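(* Let $M\subset\mathbb{R}^2$ be a bounded simply connected domain with $L=|\partial M|$, and let $\mathbb{T}_L=[0,L)$ (with periodic identification). Let $q_e:\mathbb{T}_L\to\mathbb{R}$ be a smooth, non-vanishing, positive function, and let $f(s):=q_e(s)+\varepsilon g(s)$ with $g$ a smooth real-valued function on $\partial M\cong\mathbb{T}_L$. There is $\varepsilon_*>0$, depending only on the data $(q_e,g)$, and a constant $C>0$ independent of $\varepsilon$, such that for all $0<\varepsilon<\varepsilon_*$ the following holds. There exist a unique constant $\omega_0\in\mathbb{R}$, with the same sign as $q_e$ (i.e. positive), and a unique function $q:\mathbb{T}_L\times\mathbb{R}^+\to\mathbb{R}$, with $Q:=q^2-\omega_0^2q_e^2\in X_{2,50}$ and $q=\sqrt{\omega_0^2q_e^2+Q}$, such that the pair $(\omega_0,q)$ solves the Prandtl equations on $\mathbb{T}_L\times\mathbb{R}^+$: $$\partial_sQ-q\,\partial_\psi^2Q=0,\qquad Q=q^2-\omega_0^2q_e^2,$$ $$Q(s,0)=f^2(s)-\omega_0^2q_e^2(s),\qquad Q(s,\infty)=0.$$ Moreover $\|Q\|_{X_{2,50}}\le C\varepsilon$, and $$\omega_0^2=\frac{\int_0^Lq_e(s)f^2(s)\,ds}{\int_0^Lq_e^3(s)\,ds}+\omega_{\rm Err}\qquad\text{where}\qquad|\omega_{\rm Err}|\le C\varepsilon^2.$$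
   Context: Functions on $\partial M$ are identified with $L$-periodic functions of the arc-length parameter $s$. Functions on $\mathbb{T}_L\times\mathbb{R}^+$ have variables $(s,\psi)$ and are $L$-periodic in $s$. With $\langle\psi\rangle=1+\psi$ and $\|\cdot\|_{L^2}$ the norm of $L^2(\mathbb{T}_L\times\mathbb{R}_+)$, the space $X_{k,m}$ is defined by the norm $$\|h\|_{X_{k,m}}^2=\sum_{k'=0}^k\sum_{m'=0}^m\Big\{\|\langle\psi\rangle^{m'}\partial_s^{k'}h\|_{L^2}^2+\|\langle\psi\rangle^{m'}\partial_s^{k'+1}h\|_{L^2}^2+\|\langle\psi\rangle^{m'}\partial_\psi\partial_s^{k'}h\|_{L^2}^2+\|\langle\psi\rangle^{m'}\partial_\psi^2\partial_s^{k'}h\|_{L^2}^2\Big\}.$$ $Q(s,\infty)=0$ means $Q(s,\psi)\to0$ as $\psi\to\infty$. *)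

theory Defs
  imports "HOL-Analysis.Analysis"
begin

text \<open>Length of \<open>\<gamma>\<close> on \<open>{a..b}\<close>: supremum of the lengths of inscribed polygons.\<close>

definition curve_length :: "(real \<Rightarrow> 'a::metric_space) \<Rightarrow> real \<Rightarrow> real \<Rightarrow> ereal" where
  "curve_length \<gamma> a b =
     (SUP xs \<in> {xs. sorted xs \<and> set xs \<subseteq> {a..b}}.
        ereal (\<Sum>i<length xs - 1. dist (\<gamma> (xs ! i)) (\<gamma> (xs ! Suc i))))"

definition L_periodic :: "real \<Rightarrow> (real \<Rightarrow> 'a) \<Rightarrow> bool" where
  "L_periodic L f \<longleftrightarrow> (\<forall>s. f (s + L) = f s)"

text \<open>\<open>\<Gamma>\<close> is a closed Jordan curve of total length \<open>L\<close>, and \<open>\<gamma>\<close> is its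
  \<open>L\<close>-periodic arc-length parametrization.\<close>

definition arc_length_param ::
  "(real \<Rightarrow> 'a::metric_space) \<Rightarrow> real \<Rightarrow> 'a set \<Rightarrow> bool" where
  "arc_length_param \<gamma> L \<Gamma> \<longleftrightarrow>
     L > 0 \<and> L_periodic L \<gamma> \<and> inj_on \<gamma> {0..<L} \<and> \<gamma> ` {0..<L} = \<Gamma> \<and>
     (\<forall>a b. a \<le> b \<longrightarrow> curve_length \<gamma> a b = ereal (b - a))"

definition smooth :: "(real \<Rightarrow> real) \<Rightarrow> bool" where
  "smooth f \<longleftrightarrow> (\<forall>n. (deriv ^^ n) f differentiable_on UNIV)"

text \<open>Functions of \<open>(s, \<psi>)\<close> are functions on \<open>real \<times> real\<close>.\<close>

definition d_s :: "(real \<times> real \<Rightarrow> real) \<Rightarrow> real \<times> real \<Rightarrow> real" where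
  "d_s h = (\<lambda>(s, \<psi>). deriv (\<lambda>t. h (t, \<psi>)) s)"

definition d_psi :: "(real \<times> real \<Rightarrow> real) \<Rightarrow> real \<times> real \<Rightarrow> real" where
  "d_psi h = (\<lambda>(s, \<psi>). deriv (\<lambda>t. h (s, t)) \<psi>)"

abbreviation partial_deriv ::
  "nat \<Rightarrow> nat \<Rightarrow> (real \<times> real \<Rightarrow> real) \<Rightarrow> real \<times> real \<Rightarrow> real" where
  "partial_deriv a b h \<equiv> (d_s ^^ a) ((d_psi ^^ b) h)"

text \<open>This is \<open>C\<^sup>\<infinity>\<close>: as all these functions are (Frechet) differentiable, mixed
  partial derivatives commute, so every iterated partial derivative is one of them.\<close>

definition smooth2 :: "(real \<times> real \<Rightarrow> real) \<Rightarrow> bool" where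
  "smooth2 h \<longleftrightarrow> (\<forall>a b. partial_deriv a b h differentiable_on UNIV)"

text \<open>Fundamental domain of the open half-cylinder.\<close>

definition cylinder :: "real \<Rightarrow> (real \<times> real) set" where
  "cylinder L = {0..<L} \<times> {0<..}"

text \<open>\<open>C\<^sub>c\<^sup>\<infinity>\<close> of the open half-cylinder; the support stays away from \<open>\<psi> = 0\<close>.\<close>

definition test_function :: "real \<Rightarrow> (real \<times> real \<Rightarrow> real) \<Rightarrow> bool" where
  "test_function L \<phi> \<longleftrightarrow>
     smooth2 \<phi> \<and> (\<forall>\<psi>. L_periodic L (\<lambda>s. \<phi> (s, \<psi>))) \<and>
     (\<exists>c d. 0 < c \<and> c < d \<and> (\<forall>s \<psi>. \<psi> \<notin> {c..d} \<longrightarrow> \<phi> (s, \<psi>) = 0))"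

definition locally_integrable :: "real \<Rightarrow> (real \<times> real \<Rightarrow> real) \<Rightarrow> bool" where
  "locally_integrable L h \<longleftrightarrow>
     (\<forall>c d. 0 < c \<and> c < d \<longrightarrow> set_integrable lborel ({0..<L} \<times> {c..d}) h)"

text \<open>Only the values of \<open>h\<close> and \<open>g\<close> on the fundamental domain matter. Since the test
  functions are periodic, a jump of \<open>h\<close> across \<open>s = 0 \<sim> L\<close> is seen by this definition.\<close>

definition has_weak_partial ::
  "real \<Rightarrow> nat \<Rightarrow> nat \<Rightarrow> (real \<times> real \<Rightarrow> real) \<Rightarrow> (real \<times> real \<Rightarrow> real) \<Rightarrow> bool" where
  "has_weak_partial L a b h g \<longleftrightarrow>
     locally_integrable L h \<and> locally_integrable L g \<and>
     (\<forall>\<phi>. test_function L \<phi> \<longrightarrow>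
        set_lebesgue_integral lborel (cylinder L) (\<lambda>x. h x * partial_deriv a b \<phi> x) =
        (-1) ^ (a + b) * set_lebesgue_integral lborel (cylinder L) (\<lambda>x. g x * \<phi> x))"

text \<open>The weak derivative \<open>\<partial>\<^sub>s\<^sup>a \<partial>\<^sub>\<psi>\<^sup>b h\<close>, determined up to null sets when it exists.\<close>

definition weak_partial ::
  "real \<Rightarrow> nat \<Rightarrow> nat \<Rightarrow> (real \<times> real \<Rightarrow> real) \<Rightarrow> real \<times> real \<Rightarrow> real" where
  "weak_partial L a b h = (SOME g. has_weak_partial L a b h g)"

definition weighted_square :: "nat \<Rightarrow> (real \<times> real \<Rightarrow> real) \<Rightarrow> real \<times> real \<Rightarrow> real" where
  "weighted_square m g = (\<lambda>(s, \<psi>). ((1 + \<psi>) ^ m * g (s, \<psi>))\<^sup>2)"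

definition weighted_L2_sq :: "real \<Rightarrow> nat \<Rightarrow> (real \<times> real \<Rightarrow> real) \<Rightarrow> real" where
  "weighted_L2_sq L m g = set_lebesgue_integral lborel (cylinder L) (weighted_square m g)"

definition X_space :: "real \<Rightarrow> nat \<Rightarrow> nat \<Rightarrow> (real \<times> real \<Rightarrow> real) set" where
  "X_space L k m =
     {h. \<forall>k'\<le>k. \<forall>m'\<le>m. \<forall>(a, b) \<in> {(k', 0), (k' + 1, 0), (k', 1), (k', 2)}.
           (\<exists>g. has_weak_partial L a b h g) \<and>
           set_integrable lborel (cylinder L) (weighted_square m' (weak_partial L a b h))}"

definition X_norm :: "real \<Rightarrow> nat \<Rightarrow> nat \<Rightarrow> (real \<times> real \<Rightarrow> real) \<Rightarrow> real" where
  "X_norm L k m h =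
     sqrt (\<Sum>k'\<le>k. \<Sum>m'\<le>m.
        weighted_L2_sq L m' (weak_partial L k' 0 h) +
        weighted_L2_sq L m' (weak_partial L (k' + 1) 0 h) +
        weighted_L2_sq L m' (weak_partial L k' 1 h) +
        weighted_L2_sq L m' (weak_partial L k' 2 h))"

text \<open>\<open>Q = q\<^sup>2 - \<omega>\<^sub>0\<^sup>2 q\<^sub>e\<^sup>2\<close>\<close>

definition Q_of :: "(real \<Rightarrow> real) \<Rightarrow> real \<Rightarrow> (real \<times> real \<Rightarrow> real) \<Rightarrow> real \<times> real \<Rightarrow> real" where
  "Q_of q_e \<omega>\<^sub>0 q = (\<lambda>(s, \<psi>). (q (s, \<psi>))\<^sup>2 - \<omega>\<^sub>0\<^sup>2 * (q_e s)\<^sup>2)"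

text \<open>The pointwise conditions refer to the continuous representative of \<open>Q\<close> on the closed
  half-cylinder, whence the continuity of \<open>q\<close>. The equation holds almost everywhere, with the
  derivatives of \<open>Q\<close> that exist because \<open>Q\<close> lies in the space \<open>X\<close>. The equation for \<open>q\<close> in
  terms of \<open>Q\<close> says that \<open>q\<close> is the nonnegative root.\<close>

definition prandtl_solution ::
  "real \<Rightarrow> (real \<Rightarrow> real) \<Rightarrow> (real \<Rightarrow> real) \<Rightarrow> real \<Rightarrow> (real \<times> real \<Rightarrow> real) \<Rightarrow> bool" where
  "prandtl_solution L q_e f \<omega>\<^sub>0 q \<longleftrightarrow>
     (let Q = Q_of q_e \<omega>\<^sub>0 q in
       \<omega>\<^sub>0 > 0 \<and>
       (\<forall>\<psi>\<ge>0. L_periodic L (\<lambda>s. q (s, \<psi>))) \<and>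
       continuous_on (UNIV \<times> {0..}) q \<and>
       Q \<in> X_space L 2 50 \<and>
       (\<forall>s. \<forall>\<psi>\<ge>0. q (s, \<psi>) = sqrt (\<omega>\<^sub>0\<^sup>2 * (q_e s)\<^sup>2 + Q (s, \<psi>))) \<and>
       (AE x in lborel. x \<in> cylinder L \<longrightarrow>
          weak_partial L 1 0 Q x - q x * weak_partial L 0 2 Q x = 0) \<and>
       (\<forall>s. Q (s, 0) = (f s)\<^sup>2 - \<omega>\<^sub>0\<^sup>2 * (q_e s)\<^sup>2) \<and>
       (\<forall>s. ((\<lambda>\<psi>. Q (s, \<psi>)) \<longlongrightarrow> 0) at_top))"

end

(* Existence. In the angle whose speed is (2 pi / T) q_e, T the integral of q_e, the equation
   linearised about the Euler trace becomes, mode by mode, a constant coefficient ODE in psi with an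
   explicit decaying solution. The n = 0 mode has no free boundary value, and this fixes omega_0; the
   linear part of that solvability condition is the Batchelor-Wood formula. With rho = q / q_e - 1, the
   modes of rho and of rho times the second psi-derivative of Q solve a fixed point equation, which is
   a contraction on exponentially decaying modes.

   Uniqueness. The weak derivatives of an arbitrary solution are tested with products of trigonometric
   functions and bumps; this yields that Q is C^1 in s and satisfies second difference inequalities in
   psi. Hence Q is a viscosity solution, and barriers show first that q does not vanish and then that
   Q and omega are close to the trivial ones. At a positive maximum of the difference of two solutions,
   divided by 2 - exp(-delta psi), the decay of the second derivative of the constructed solution
   makes the zeroth order term absorbable, which is a contradiction. *)
theory Submission
  imports Defs
begin

section \<open>Smooth functions and test functions\<close>

text \<open>The uniqueness class shapes the proof: a competing solution is neither small nor known
  to have q > 0, and its second \<psi>-derivative is known only almost everywhere. It is therefore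
  handled through second differences Q(s, p + r) - 2 Q(s, p) + Q(s, p - r), which are its averages
  against a tent. Periodicity in s replaces initial data: every extremum has a past, and only
  contact from the past is used.

  In the construction, q = q_e (1 + \<rho>) turns the relation between q and Q into 2 \<rho> +
  \<rho>^2 = (\<omega>^2 - 1) + Q / q_e^2, and the equation into Q_n'' = i lam_n Q_n - N_n with N =
  \<rho> Q''. With \<rho> and N as unknowns no derivative is lost: solving for Q_n gains a factor
  1/(1 + |n|), which the multiplier i lam_n in Q'' spends again. The error in \<omega>^2 is
  quadratic because the correction in the solvability condition is linear in N, a product of two
  quantities of size \<epsilon>.\<close>

definition diff_upto :: "nat \<Rightarrow> (real \<Rightarrow> real) \<Rightarrow> bool" where
  "diff_upto n f \<longleftrightarrow> (\<forall>k\<le>n. (deriv ^^ k) f differentiable_on UNIV)"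

text \<open>\<open>smooth\<close> speaks of all orders at once, which leaves nothing to induct on.
  With the order bounded by \<open>n\<close>, the rules for sums, products, inverses and affine
  substitutions follow by induction on \<open>n\<close> and transfer through this
  equivalence.\<close>

lemma smooth_diff_upto: "smooth f \<longleftrightarrow> (\<forall>n. diff_upto n f)"
  by (auto simp: smooth_def diff_upto_def)

lemma diff_upto_0: "diff_upto 0 f \<longleftrightarrow> f differentiable_on UNIV"
  by (simp add: diff_upto_def)

lemma diff_upto_Suc: "diff_upto (Suc n) f \<longleftrightarrow> f differentiable_on UNIV \<and> diff_upto n (deriv f)"
proof -
  have "(\<forall>k\<le>Suc n. (deriv ^^ k) f differentiable_on UNIV) \<longleftrightarrow>
     f differentiable_on UNIV \<and> (\<forall>k\<le>n. (deriv ^^ (Suc k)) f differentiable_on UNIV)" by (metis (no_types, lifting) Suc_le_mono funpow_0 le0 old.nat.exhaust)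
  then show ?thesis
    by (simp add: diff_upto_def funpow_swap1)
qed

lemma diff_upto_mono: "diff_upto n f \<Longrightarrow> m \<le> n \<Longrightarrow> diff_upto m f"
  by (simp add: diff_upto_def)

lemma differentiable_on_UNIV_real:
  fixes f :: "real \<Rightarrow> real"
  shows "f differentiable_on UNIV \<longleftrightarrow> (\<forall>x. (f has_real_derivative deriv f x) (at x))"
  by (metis DERIV_deriv_iff_real_differentiable UNIV_I differentiable_on_def)

lemma diff_upto_SucI:
  assumes "\<And>x. (f has_real_derivative f' x) (at x)" "diff_upto n f'"
  shows "diff_upto (Suc n) f"
proof -
  have "deriv f = f'" using assms(1) by (intro ext DERIV_imp_deriv) auto
  then show ?thesis using assms unfolding diff_upto_Suc
    by (metis differentiable_on_UNIV_real)
qed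

lemma diff_upto_0I: "(\<And>x. (f has_real_derivative f' x) (at x)) \<Longrightarrow> diff_upto 0 f"
  unfolding diff_upto_0 differentiable_on_UNIV_real
  by (metis DERIV_imp_deriv)

lemma smoothI:
  assumes "\<And>x. (f has_real_derivative f' x) (at x)" "smooth f'"
  shows "smooth f"
  unfolding smooth_diff_upto
proof
  fix n show "diff_upto n f"
    by (cases n) (use assms in \<open>auto intro!: diff_upto_SucI diff_upto_0I simp: smooth_diff_upto\<close>)
qed

lemma smooth_has_deriv: "smooth f \<Longrightarrow> (f has_real_derivative deriv f x) (at x)"
  unfolding smooth_def using differentiable_on_UNIV_real[of f] by (metis funpow_0)

lemma smooth_deriv: "smooth f \<Longrightarrow> smooth (deriv f)"
  unfolding smooth_def by (metis funpow_swap1 funpow.simps(2) o_apply)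

lemma smooth_continuous: "smooth f \<Longrightarrow> continuous_on A f"
  by (meson DERIV_isCont continuous_at_imp_continuous_on smooth_has_deriv)

lemma diff_upto_has_deriv: "diff_upto n f \<Longrightarrow> (f has_real_derivative deriv f x) (at x)"
  using differentiable_on_UNIV_real[of f] by (metis diff_upto_0 diff_upto_mono le0)

lemma diff_upto_const: "diff_upto n (\<lambda>x. c)"
  by (induction n arbitrary: c) (auto intro!: diff_upto_0I[of _ "\<lambda>x. 0"] diff_upto_SucI[of _ "\<lambda>x. 0"])

lemma diff_upto_SucD: "diff_upto (Suc n) f \<Longrightarrow> diff_upto n f" "diff_upto (Suc n) f \<Longrightarrow> diff_upto n (deriv f)"
  by (erule diff_upto_mono, simp) (simp add: diff_upto_Suc)

lemma diff_upto_add: "diff_upto n f \<Longrightarrow> diff_upto n g \<Longrightarrow> diff_upto n (\<lambda>x. f x + g x)"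
proof (induction n arbitrary: f g)
  case 0
  then show ?case
    by (intro diff_upto_0I[of _ "\<lambda>x. deriv f x + deriv g x"] DERIV_add diff_upto_has_deriv)
next
  case (Suc n)
  show ?case
    by (rule diff_upto_SucI[of _ "\<lambda>x. deriv f x + deriv g x"])
       (use Suc.prems in \<open>auto intro!: DERIV_add Suc.IH intro: diff_upto_has_deriv diff_upto_SucD\<close>)
qed

lemma diff_upto_mult: "diff_upto n f \<Longrightarrow> diff_upto n g \<Longrightarrow> diff_upto n (\<lambda>x. f x * g x)"
proof (induction n arbitrary: f g)
  case 0
  show ?case
    by (rule diff_upto_0I, rule DERIV_mult) (use 0 diff_upto_has_deriv in blast)+
next
  case (Suc n)
  have "diff_upto n (\<lambda>x. deriv f x * g x + deriv g x * f x)"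
    using Suc.prems by (intro diff_upto_add Suc.IH) (auto dest: diff_upto_SucD)
  then show ?case
    by (rule diff_upto_SucI[rotated]) (rule DERIV_mult; use Suc.prems diff_upto_has_deriv in blast)
qed

lemma smooth_const: "smooth (\<lambda>x. c)"
  by (simp add: smooth_diff_upto diff_upto_const)

lemma smooth_add: "smooth f \<Longrightarrow> smooth g \<Longrightarrow> smooth (\<lambda>x. f x + g x)"
  by (simp add: smooth_diff_upto diff_upto_add)

lemma smooth_mult: "smooth f \<Longrightarrow> smooth g \<Longrightarrow> smooth (\<lambda>x. f x * g x)"
  by (simp add: smooth_diff_upto diff_upto_mult)

lemma smooth_diff: "smooth f \<Longrightarrow> smooth g \<Longrightarrow> smooth (\<lambda>x. f x - g x)"
  using smooth_add[OF _ smooth_mult[OF smooth_const[of "-1"]], of f g] by simp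

lemma affine_deriv:
  assumes "(f has_real_derivative f') (at (a * x + b))"
  shows "((\<lambda>x. f (a * x + b)) has_real_derivative a * f') (at x)"
proof -
  have "((\<lambda>x. a * x + b) has_real_derivative a) (at x)"
    by (auto intro!: derivative_eq_intros)
  from DERIV_chain2[OF assms this] show ?thesis by (simp add: mult.commute)
qed

lemma diff_upto_affine: "diff_upto n f \<Longrightarrow> diff_upto n (\<lambda>x. f (a * x + b))"
proof (induction n arbitrary: f)
  case 0
  show ?case
    by (rule diff_upto_0I[of _ "\<lambda>x. a * deriv f (a * x + b)"])
       (rule affine_deriv, rule diff_upto_has_deriv[OF 0])
next
  case (Suc n)
  show ?case
    by (rule diff_upto_SucI[of _ "\<lambda>x. a * deriv f (a * x + b)"])
       (use Suc in \<open>auto intro!: affine_deriv diff_upto_mult[OF diff_upto_const] intro: diff_upto_has_deriv diff_upto_SucD\<close>)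
qed

lemma smooth_affine: "smooth f \<Longrightarrow> smooth (\<lambda>x. f (a * x + b))"
  by (simp add: smooth_diff_upto diff_upto_affine)

lemma diff_upto_inverse:
  assumes "\<And>x. f x \<noteq> 0"
  shows "diff_upto n f \<Longrightarrow> diff_upto n (\<lambda>x. inverse (f x))"
proof (induction n)
  case 0
  show ?case
    by (rule diff_upto_0I, rule DERIV_inverse'[where D = "deriv f x" for x])
      (use 0 diff_upto_has_deriv assms in blast)+
next
  case (Suc n)
  then have *: "diff_upto n (\<lambda>x. inverse (f x))" "diff_upto n (deriv f)"
    by (auto dest: diff_upto_SucD)
  have "diff_upto n (\<lambda>x. - (inverse (f x) * deriv f x * inverse (f x)))"
    using diff_upto_mult[OF diff_upto_const[of _ "-1"] diff_upto_mult[OF diff_upto_mult[OF *] *(1)]] by simp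
  then show ?case
    by (rule diff_upto_SucI[rotated], intro DERIV_inverse') (use Suc.prems diff_upto_has_deriv assms in blast)+
qed

lemma smooth_inverse: "smooth f \<Longrightarrow> (\<And>x. f x \<noteq> 0) \<Longrightarrow> smooth (\<lambda>x. inverse (f x))"
  by (simp add: smooth_diff_upto diff_upto_inverse)

lemma diff_upto_cos_sin: "diff_upto n (\<lambda>x. cos x) \<and> diff_upto n (\<lambda>x. sin x)"
proof (induction n)
  case 0
  show ?case by (auto intro!: diff_upto_0I derivative_eq_intros)
next
  case (Suc n)
  have "diff_upto n (\<lambda>x. - sin x)"
    using diff_upto_mult[OF diff_upto_const[of _ "-1"], of n sin] Suc by simp
  then show ?case
    using Suc diff_upto_SucI[OF DERIV_cos, of n] diff_upto_SucI[OF DERIV_sin, of n] by auto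
qed

lemma smooth_cos_affine: "smooth (\<lambda>x. cos (a * x + b))"
  and smooth_sin_affine: "smooth (\<lambda>x. sin (a * x + b))"
  using smooth_affine[of cos a b] smooth_affine[of sin a b] diff_upto_cos_sin
  by (auto simp: smooth_diff_upto)

section \<open>Flat functions and a smooth step\<close>

definition flat_exp :: "nat \<Rightarrow> real \<Rightarrow> real" where
  "flat_exp k x = (if x \<le> 0 then 0 else (1 / x) ^ k * exp (- (1 / x)))"

lemma flat_exp_quotient_tendsto: "((\<lambda>h. flat_exp k h / h) \<longlongrightarrow> 0) (at 0)"
proof -
  have "((\<lambda>y::real. y ^ Suc k / exp y) \<longlongrightarrow> 0) at_top"
    by (rule tendsto_power_div_exp_0)
  then have "((\<lambda>h::real. inverse h ^ Suc k / exp (inverse h)) \<longlongrightarrow> 0) (at_right 0)"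
    by (rule filterlim_compose) (rule filterlim_inverse_at_top_right)
  then have "((\<lambda>h. flat_exp k h / h) \<longlongrightarrow> 0) (at_right 0)"
    by (rule Lim_transform_eventually)
       (auto simp: eventually_at_right_field flat_exp_def exp_minus field_simps intro!: exI[of _ 1])
  moreover have "((\<lambda>h. flat_exp k h / h) \<longlongrightarrow> 0) (at_left 0)"
    by (rule Lim_transform_eventually[of "\<lambda>_. 0"])
       (auto simp: eventually_at_left_field flat_exp_def intro!: exI[of _ "-1"])
  ultimately show ?thesis
    by (simp add: filterlim_at_split)
qed

lemma flat_exp_deriv:
  "(flat_exp k has_real_derivative flat_exp (k + 2) x - real k * flat_exp (k + 1) x) (at x)"
proof -
  consider "x < 0" | "x = 0" | "x > 0" by linarith
  then show ?thesis
  proof cases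
    case 1
    have "((\<lambda>x. 0) has_real_derivative 0) (at x)" by simp
    then have "(flat_exp k has_real_derivative 0) (at x)"
      by (rule has_field_derivative_transform_within_open[of _ _ _ "{..<0}"]) (use 1 in \<open>auto simp: flat_exp_def\<close>)
    then show ?thesis using 1 by (simp add: flat_exp_def)
  next
    case 2
    show ?thesis using flat_exp_quotient_tendsto[of k] by (simp add: DERIV_def 2 flat_exp_def)
  next
    case 3
    have "((\<lambda>x. (1 / x) ^ k * exp (- (1 / x))) has_real_derivative
       (1 / x) ^ (k+2) * exp (- (1 / x)) - real k * ((1 / x) ^ (k+1) * exp (- (1 / x)))) (at x)"
    proof -
      have "((\<lambda>x. (1 / x) ^ k) has_real_derivative - real k * (1 / x) ^ (k+1)) (at x)"
      proof (cases k)
        case (Suc m)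
        have "((\<lambda>x. 1 / x) has_real_derivative - ((1 / x) ^ 2)) (at x)" using 3 by (auto intro!: derivative_eq_intros simp: power2_eq_square)
        from DERIV_power[OF this, of k] show ?thesis by (rule DERIV_cong) (use 3 in \<open>simp add: Suc power2_eq_square field_simps\<close>)
      qed simp
      moreover have "((\<lambda>x. exp (- (1 / x))) has_real_derivative (1 / x) ^ 2 * exp (- (1 / x))) (at x)"
        using 3 by (auto intro!: derivative_eq_intros simp: power2_eq_square)
      ultimately show ?thesis by (auto dest: DERIV_mult simp: algebra_simps power2_eq_square)
    qed
    then have "(flat_exp k has_real_derivative (1 / x) ^ (k+2) * exp (- (1 / x)) - real k * ((1 / x) ^ (k+1) * exp (- (1 / x)))) (at x)"
      by (rule has_field_derivative_transform_within_open[of _ _ _ "{0<..}"]) (use 3 in \<open>auto simp: flat_exp_def\<close>)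
    then show ?thesis using 3 by (simp add: flat_exp_def)
  qed
qed

text \<open>The functions x^(-k) exp(-1/x), extended by 0, are closed under differentiation up to
  linear combinations, so the induction on the order runs for all \<open>k\<close>
  simultaneously.\<close>

lemma diff_upto_flat_exp: "diff_upto n (flat_exp k)"
proof (induction n arbitrary: k)
  case 0
  show ?case by (rule diff_upto_0I, rule flat_exp_deriv)
next
  case (Suc n)
  have "diff_upto n (\<lambda>x. flat_exp (k + 2) x + (- real k) * flat_exp (k + 1) x)"
    by (intro diff_upto_add diff_upto_mult diff_upto_const Suc)
  then show ?case
    by (intro diff_upto_SucI[of _ "\<lambda>x. flat_exp (k + 2) x - real k * flat_exp (k + 1) x"] flat_exp_deriv) simp
qed

lemma smooth_flat_exp: "smooth (flat_exp k)"
  by (simp add: smooth_diff_upto diff_upto_flat_exp)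

lemma smooth_antiderivative:
  assumes "smooth f"
  obtains F where "smooth F" "\<And>x. (F has_real_derivative f x) (at x)"
proof -
  define F where "F x = (LBINT t=0..ereal x. f t)" for x
  have d: "(F has_real_derivative f x) (at x)" for x
  proof -
    let ?a = "- \<bar>x\<bar> - 1" and ?b = "\<bar>x\<bar> + 1"
    have "((\<lambda>u. LBINT t=ereal 0..ereal u. f t) has_vector_derivative f x) (at x within {?a..?b})"
      by (rule interval_integral_FTC2) (use smooth_continuous[OF assms] in auto)
    then have "((\<lambda>u. LBINT t=ereal 0..ereal u. f t) has_vector_derivative f x) (at x)" by (subst (asm) at_within_interior) auto
    then show ?thesis by (simp add: F_def[abs_def] has_real_derivative_iff_has_vector_derivative zero_ereal_def)
  qed
  show thesis
    by (rule that[of F]) (use d assms in \<open>auto intro: smoothI\<close>)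
qed

lemma DERIV_isconst_end':
  fixes F :: "real \<Rightarrow> real"
  assumes "a \<le> b" "\<And>x. a \<le> x \<Longrightarrow> x \<le> b \<Longrightarrow> (F has_real_derivative 0) (at x)"
  shows "F a = F b"
proof (cases "a = b")
  case False
  then show ?thesis
    using assms by (intro DERIV_isconst_end[symmetric]) (auto intro!: continuous_at_imp_continuous_on DERIV_isCont)
qed simp

text \<open>The normalised primitive of the bump exp(-1/x) exp(-1/(1 - x)) on (0, 1).\<close>

lemma smooth_step_exists:
  obtains st :: "real \<Rightarrow> real" where
    "smooth st" "\<And>x. x \<le> 0 \<Longrightarrow> st x = 0" "\<And>x. x \<ge> 1 \<Longrightarrow> st x = 1"
    "\<And>x. 0 \<le> deriv st x" "\<And>x. 0 \<le> st x" "\<And>x. st x \<le> 1"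
proof -
  define e where "e x = flat_exp 0 x * flat_exp 0 ((-1) * x + 1)" for x
  have e: "smooth e"
    unfolding e_def by (intro smooth_mult smooth_flat_exp smooth_affine)
  have e0: "e x \<ge> 0" for x by (auto simp: e_def flat_exp_def)
  have epos: "e x > 0" if "0 < x" "x < 1" for x using that by (auto simp: e_def flat_exp_def)
  have ez: "e x = 0" if "x \<le> 0 \<or> x \<ge> 1" for x using that by (auto simp: e_def flat_exp_def)
  obtain F where F: "smooth F" "\<And>x. (F has_real_derivative e x) (at x)"
    using smooth_antiderivative[OF e] by blast
  have mono: "F x \<le> F y" if "x \<le> y" for x y
    by (rule DERIV_nonneg_imp_nondecreasing[OF that]) (use F e0 in blast)
  have pos: "F 0 < F 1"
  proof (rule DERIV_pos_imp_increasing_open[of 0 1 F])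
    show "continuous_on {0..1} F" using smooth_continuous[OF F(1)] .
  qed (use F epos in \<open>auto intro!: exI[of _ "e x" for x]\<close>)
  have c0: "F x = F 0" if "x \<le> 0" for x
    by (rule DERIV_isconst_end'[OF that]) (use F ez in \<open>metis\<close>)
  have c1: "F x = F 1" if "1 \<le> x" for x
    by (rule DERIV_isconst_end'[OF that, symmetric]) (use F ez in \<open>metis\<close>)
  define st where "st x = (F x - F 0) * inverse (F 1 - F 0)" for x
  have dst: "(st has_real_derivative e x * inverse (F 1 - F 0)) (at x)" for x
    unfolding st_def using F(2)[of x] by (auto intro!: derivative_eq_intros)
  show thesis
  proof (rule that[of st])
    show "smooth st" unfolding st_def by (intro smooth_mult smooth_diff F smooth_const)
    show "x \<le> 0 \<Longrightarrow> st x = 0" for x using c0[of x] by (simp add: st_def)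
    show "x \<ge> 1 \<Longrightarrow> st x = 1" for x using c1[of x] pos by (simp add: st_def)
    show "0 \<le> deriv st x" for x using DERIV_imp_deriv[OF dst, of x] e0[of x] pos by simp
    show "0 \<le> st x" for x using mono[of 0 x] c0[of x] pos by (cases "x \<le> 0") (auto simp: st_def)
    show "st x \<le> 1" for x using mono[of x 1] c1[of x] pos by (cases "x \<le> 1") (auto simp: st_def field_simps)
  qed
qed

definition bump :: "(real \<Rightarrow> real) \<Rightarrow> bool" where
  "bump b \<longleftrightarrow> smooth b \<and> (\<exists>c d. 0 < c \<and> c < d \<and> (\<forall>x. x \<notin> {c..d} \<longrightarrow> b x = 0))"

lemma smooth_funpow_deriv: "smooth f \<Longrightarrow> smooth ((deriv ^^ n) f)"
  by (induction n) (auto intro: smooth_deriv)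

lemma d_psi_funpow_product:
  assumes "smooth \<beta>"
  shows "(d_psi ^^ n) (\<lambda>(s, y). \<alpha> s * \<beta> y) = (\<lambda>(s, y). \<alpha> s * (deriv ^^ n) \<beta> y)"
  using assms
proof (induction n arbitrary: \<beta>)
  case (Suc n)
  have "d_psi (\<lambda>(s, y). \<alpha> s * \<beta> y) = (\<lambda>(s, y). \<alpha> s * deriv \<beta> y)"
    unfolding d_psi_def by (auto intro!: ext DERIV_imp_deriv DERIV_cmult smooth_has_deriv Suc.prems)
  then show ?case
    using Suc.IH[OF smooth_deriv[OF Suc.prems]] by (simp add: funpow_swap1)
qed simp

lemma d_s_funpow_product:
  assumes "smooth \<alpha>"
  shows "(d_s ^^ n) (\<lambda>(s, y). \<alpha> s * \<beta> y) = (\<lambda>(s, y). (deriv ^^ n) \<alpha> s * \<beta> y)"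
  using assms
proof (induction n arbitrary: \<alpha>)
  case (Suc n)
  have "d_s (\<lambda>(s, y). \<alpha> s * \<beta> y) = (\<lambda>(s, y). deriv \<alpha> s * \<beta> y)"
    unfolding d_s_def by (auto intro!: ext DERIV_imp_deriv DERIV_cmult_right smooth_has_deriv Suc.prems)
  then show ?case
    using Suc.IH[OF smooth_deriv[OF Suc.prems]] by (simp add: funpow_swap1)
qed simp

lemma partial_deriv_product:
  assumes "smooth \<alpha>" "smooth \<beta>"
  shows "partial_deriv a b (\<lambda>(s, y). \<alpha> s * \<beta> y) = (\<lambda>(s, y). (deriv ^^ a) \<alpha> s * (deriv ^^ b) \<beta> y)"
  by (simp add: d_psi_funpow_product[OF assms(2)] d_s_funpow_product[OF assms(1)])

lemma smooth_differentiable: "smooth f \<Longrightarrow> f differentiable (at x)"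
  using smooth_has_deriv real_differentiable_def by blast

lemma smooth2_product:
  assumes "smooth \<alpha>" "smooth \<beta>"
  shows "smooth2 (\<lambda>(s, y). \<alpha> s * \<beta> y)"
  unfolding smooth2_def
proof (intro allI)
  fix a b
  have "(\<lambda>x. (deriv ^^ a) \<alpha> (fst x) * (deriv ^^ b) \<beta> (snd x)) differentiable (at x)" for x
    using assms by (intro differentiable_mult differentiable_compose[of "(deriv ^^ a) \<alpha>" fst]
          differentiable_compose[of "(deriv ^^ b) \<beta>" snd] smooth_differentiable smooth_funpow_deriv)
       (auto intro!: bounded_linear_imp_differentiable bounded_linear_fst bounded_linear_snd)
  then show "partial_deriv a b (\<lambda>(s, y). \<alpha> s * \<beta> y) differentiable_on UNIV"
    unfolding partial_deriv_product[OF assms] by (simp add: differentiable_on_def case_prod_unfold)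
qed

lemma test_function_product:
  assumes "smooth \<alpha>" "L_periodic L \<alpha>" "bump \<beta>"
  shows "test_function L (\<lambda>(s, y). \<alpha> s * \<beta> y)"
  using assms smooth2_product[of \<alpha> \<beta>] unfolding test_function_def bump_def L_periodic_def by (auto; metis)

section \<open>Trigonometric test functions\<close>

lemma continuous_on_interval_bounded:
  fixes f :: "real \<Rightarrow> 'a::real_normed_vector"
  assumes "continuous_on {a..b} f"
  obtains B where "B \<ge> 0" "\<And>x. x \<in> {a..b} \<Longrightarrow> norm (f x) \<le> B"
proof -
  have "bounded (f ` {a..b})"
    by (intro compact_imp_bounded compact_continuous_image assms) simp
  then obtain B where B: "B > 0" "\<And>y. y \<in> f ` {a..b} \<Longrightarrow> norm y \<le> B"
    by (auto simp: bounded_pos)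
  then show ?thesis using that[of B] by auto
qed

section \<open>Completeness of the exponentials in an angle on the circle\<close>

locale circle_angle =
  fixes L :: real and \<theta> :: "real \<Rightarrow> real"
  assumes L: "L > 0" and \<theta>: "continuous_on {0..L} \<theta>" "\<And>s t. 0 \<le> s \<Longrightarrow> s < t \<Longrightarrow> t \<le> L \<Longrightarrow> \<theta> s < \<theta> t" "\<theta> L = \<theta> 0 + 2 * pi"
begin

lemma angle_diff: "0 \<le> s \<Longrightarrow> s < t \<Longrightarrow> t \<le> L \<Longrightarrow> (s, t) \<noteq> (0, L) \<Longrightarrow> sin ((\<theta> t - \<theta> s) / 2) > 0"
  using \<theta>(2)[of s t] \<theta>(2)[of 0 s] \<theta>(2)[of t L] \<theta>(3) by (intro sin_gt_zero) (cases "s = 0"; cases "t = L"; auto)+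

text \<open>The map s \<mapsto> cis (\<theta> s) goes from a compact space to a Hausdorff space,
  hence is a quotient map onto its image; its only nontrivial fibre is {0, L}, on which
  \<open>g\<close> is constant.\<close>

lemma factor_through_circle:
  fixes g :: "real \<Rightarrow> real"
  assumes g: "continuous_on {0..L} g" "g 0 = g L"
  obtains F where "continuous_on ((\<lambda>s. cis (\<theta> s)) ` {0..L}) F" "\<And>s. s \<in> {0..L} \<Longrightarrow> F (cis (\<theta> s)) = g s"
proof -
  let ?f = "\<lambda>s. cis (\<theta> s)" and ?X = "top_of_set {0..L}" and ?Y = "top_of_set ((\<lambda>s. cis (\<theta> s)) ` {0..L})"
  have "quotient_map ?X ?Y ?f"
    by (rule T1_Spaces.continuous_imp_quotient_map)
       (use \<theta>(1) in \<open>auto simp: compact_space_subtopology Hausdorff_space_subtopology intro!: continuous_intros\<close>)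
  moreover have "continuous_map ?X euclideanreal g" using g(1) by simp
  moreover have lt: "g s = g t" if "cis (\<theta> s) = cis (\<theta> t)" "0 \<le> s" "s < t" "t \<le> L" for s t
  proof (rule ccontr)
    assume "g s \<noteq> g t"
    then have "sin ((\<theta> t - \<theta> s) / 2) > 0" using that g(2) by (intro angle_diff) auto
    moreover have "cis (\<theta> t - \<theta> s) = 1" using that(1) by (simp add: cis_divide[symmetric])
    then have "cos (\<theta> t - \<theta> s) = 1" by (simp add: complex_eq_iff)
    moreover have "cos x = 1 - 2 * (sin (x / 2))\<^sup>2" for x :: real using cos_double_sin[of "x / 2"] by simp
    ultimately have "sin ((\<theta> t - \<theta> s) / 2) > 0" "(sin ((\<theta> t - \<theta> s) / 2))\<^sup>2 = 0" by (metis, smt (verit))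
    then show False by simp
  qed
  have "g s = g t" if "s \<in> topspace ?X" "t \<in> topspace ?X" "cis (\<theta> s) = cis (\<theta> t)" for s t
    using lt[of s t] lt[of t s] that by (cases s t rule: linorder_cases) auto
  ultimately obtain F where "continuous_map ?Y euclideanreal F" "\<And>s. s \<in> topspace ?X \<Longrightarrow> F (cis (\<theta> s)) = g s"
    by (rule quotient_map_lift_exists) auto
  then show thesis using that[of F] by simp
qed

text \<open>Stone-Weierstrass on the circle; the end values of \<open>u\<close> may differ. It is
  applied to the arc-length angle, for the trigonometric tests, and to the Euler angle with weight
  \<open>q_e\<close>, for Fourier inversion.\<close>

lemma cis_orthogonal_imp_zero:
  fixes u :: "real \<Rightarrow> complex" and q :: "real \<Rightarrow> real"
  assumes u: "continuous_on {0..L} u" and q: "continuous_on {0..L} q" "\<And>s. s \<in> {0..L} \<Longrightarrow> q s > 0"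
    and orth: "\<And>n::int. integral {0..L} (\<lambda>s. u s * cis (n * \<theta> s) * q s) = 0"
    and s: "s \<in> {0..L}"
  shows "u s = 0"
proof -
  define S where "S = (\<lambda>s. cis (\<theta> s)) ` {0..L}"
  define W where "W u \<longleftrightarrow> continuous_on {0..L} u \<and> (\<forall>n::int. integral {0..L} (\<lambda>s. u s * cis (n * \<theta> s) * q s) = 0)" for u
  \<comment> \<open>\<open>R\<close> consists of the multipliers that preserve the class
    \<open>W\<close> of functions orthogonal to all exponentials. Closure under sums and products is
    then immediate, and \<open>Re\<close> and \<open>Im\<close> belong to it because multiplication
    by \<open>cis\<close> shifts the frequency.\<close>
  define R where "R = {F :: complex \<Rightarrow> real. continuous_on S F \<and> (\<forall>u. W u \<longrightarrow> W (\<lambda>s. u s * F (cis (\<theta> s))))}"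
  have W_lin: "W (\<lambda>s. a * u s + b * v s)" if "W u" "W v" for u v a b
  proof -
    have i: "(\<lambda>s. w s * cis (of_int n * \<theta> s) * q s) integrable_on {0..L}" if "W w" for w n
      using that unfolding W_def by (intro integrable_continuous_real continuous_intros q \<theta>) auto
    have "integral {0..L} (\<lambda>s. a * (u s * cis (of_int n * \<theta> s) * q s) + b * (v s * cis (of_int n * \<theta> s) * q s)) = 0" for n
      using that i[OF that(1), of n] i[OF that(2), of n] by (subst integral_add) (auto simp: W_def integrable_on_mult_right)
    then show ?thesis using that by (auto simp: W_def algebra_simps intro!: continuous_intros)
  qed
  have W_cis: "W (\<lambda>s. u s * cis (k * \<theta> s))" if "W u" for u and k :: int
  proof -
    have "u s * cis (k * \<theta> s) * cis (n * \<theta> s) = u s * cis (of_int (k + n) * \<theta> s)" for s and n :: int by (simp add: cis_mult ring_distribs mult.assoc)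
    then show ?thesis using that unfolding W_def by (simp only: continuous_intros \<theta>) simp
  qed
  have W_F: "W (\<lambda>s. u s * F (cis (\<theta> s)))" if "W u" and F: "\<And>s. of_real (F (cis (\<theta> s))) = a * cis (\<theta> s) + b * cis (- \<theta> s)" for u a b and F :: "complex \<Rightarrow> real"
    using W_lin[OF W_cis[OF that(1), of 1] W_cis[OF that(1), of "-1"], of a b] by (simp add: F algebra_simps)
  interpret function_ring_on R S
  proof unfold_locales
    show "compact S" unfolding S_def by (intro compact_continuous_image continuous_intros \<theta>) simp
    show "(\<lambda>x. F x + G x) \<in> R" if "F \<in> R" "G \<in> R" for F G using that W_lin[of "\<lambda>s. u s * F (cis (\<theta> s))" "\<lambda>s. u s * G (cis (\<theta> s))" 1 1 for u :: "real \<Rightarrow> complex"]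
      by (auto simp: R_def ring_distribs intro!: continuous_intros)
    show "(\<lambda>x. F x * G x) \<in> R" if "F \<in> R" "G \<in> R" for F G
    proof -
      have "W (\<lambda>s. u s * F (cis (\<theta> s)) * G (cis (\<theta> s)))" if "W u" for u using that \<open>F \<in> R\<close> \<open>G \<in> R\<close> by (simp add: R_def)
      then show ?thesis using that by (auto simp: R_def mult.assoc intro!: continuous_intros)
    qed
    show "(\<lambda>_. c) \<in> R" for c using W_lin[of _ _ c 0] by (auto simp: R_def mult.commute)
    have "Re \<in> R" using W_F[of _ Re "1/2" "1/2"] by (auto simp: R_def complex_eq_iff intro!: continuous_intros)
    moreover have "Im \<in> R" using W_F[of _ Im "- \<i>/2" "\<i>/2"] by (auto simp: R_def complex_eq_iff intro!: continuous_intros)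
    ultimately show "\<exists>F\<in>R. F x \<noteq> F y" if "x \<noteq> y" for x y using that complex_eq_iff by blast
  qed (auto simp: R_def)
  have orth': "integral {0..L} (\<lambda>s. u s * g s * q s) = 0" if g: "continuous_on {0..L} g" "g 0 = g L" for g :: "real \<Rightarrow> real"
  proof -
    obtain F where F: "continuous_on S F" "\<And>s. s \<in> {0..L} \<Longrightarrow> F (cis (\<theta> s)) = g s" using factor_through_circle[OF g] unfolding S_def by blast
    have "continuous_on {0..L} (\<lambda>s. u s * q s)" by (intro continuous_intros u q)
    then obtain B where B: "B \<ge> 0" "\<And>s. s \<in> {0..L} \<Longrightarrow> norm (u s * q s) \<le> B" using continuous_on_interval_bounded by blast
    have le: "norm (integral {0..L} (\<lambda>s. u s * g s * q s)) \<le> 0 + e" if e: "e > 0" for e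
    proof -
      define d where "d = e / (B * L + 1)"
      have d: "d > 0" "d * (B * L) \<le> e" using e B(1) L mult_nonneg_nonneg[of B L] by (auto simp: d_def field_simps add_pos_nonneg)
      obtain G where G: "G \<in> R" "\<And>x. x \<in> S \<Longrightarrow> \<bar>F x - G x\<bar> < d" using Stone_Weierstrass_basic[OF F(1) d(1)] by blast
      have "W (\<lambda>s. u s * G (cis (\<theta> s)))" using G(1) u orth by (simp add: R_def W_def)
      then have z: "integral {0..L} (\<lambda>s. u s * G (cis (\<theta> s)) * q s) = 0" and c: "continuous_on {0..L} (\<lambda>s. u s * G (cis (\<theta> s)))"
        unfolding W_def by (auto dest: spec[of _ 0])
      have i: "(\<lambda>s. u s * g s * q s) integrable_on {0..L}" "(\<lambda>s. u s * G (cis (\<theta> s)) * q s) integrable_on {0..L}"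
        by (intro integrable_continuous_real continuous_intros u g q c)+
      have "norm (integral {0..L} (\<lambda>s. u s * g s * q s - u s * G (cis (\<theta> s)) * q s)) \<le> integral {0..L} (\<lambda>s. B * d)"
      proof (rule integral_norm_bound_integral[OF integrable_diff[OF i]])
        fix s assume s: "s \<in> {0..L}"
        have "u s * g s * q s - u s * G (cis (\<theta> s)) * q s = (u s * q s) * of_real (F (cis (\<theta> s)) - G (cis (\<theta> s)))" by (simp add: F(2)[OF s] algebra_simps)
        also have "norm \<dots> \<le> B * d" unfolding norm_mult norm_of_real using B s G(2)[of "cis (\<theta> s)"] by (intro mult_mono) (auto simp: S_def less_imp_le norm_mult)
        finally show "norm (u s * g s * q s - u s * G (cis (\<theta> s)) * q s) \<le> B * d" .
      qed (rule integrable_const_ivl)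
      then show ?thesis using d(2) L unfolding integral_diff[OF i] z by (simp add: mult_ac)
    qed
    show ?thesis using field_le_epsilon[OF le] by simp
  qed
  have z: "v s = 0" if v: "continuous_on {0..L} v" and \<Lambda>: "bounded_linear \<Lambda>" "\<And>s. v s = \<Lambda> (u s)" for v and \<Lambda> :: "complex \<Rightarrow> real"
  proof -
    \<comment> \<open>The sine factor vanishes at both ends and is positive between them. So
      \<open>g\<close> descends to the circle even if \<open>v 0\<close> and \<open>v L\<close>
      differ, and v g q is nonnegative.\<close>
    define g where "g s = v s * sin ((\<theta> s - \<theta> 0) / 2)" for s
    have g: "continuous_on {0..L} g" "g 0 = g L" unfolding g_def using \<theta>(3) by (auto intro!: continuous_intros v \<theta>)
    have c: "continuous_on {0..L} (\<lambda>s. v s * g s * q s)" by (intro continuous_intros v g q)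
    have pos: "sin ((\<theta> s - \<theta> 0) / 2) > 0" if "0 < s" "s < L" for s using that by (intro angle_diff) auto
    have "integral {0..L} (\<lambda>s. \<Lambda> (u s * g s * q s)) = \<Lambda> (integral {0..L} (\<lambda>s. u s * g s * q s))"
      using integral_linear[OF _ \<Lambda>(1), of "\<lambda>s. u s * g s * q s" "{0..L}"] by (simp add: o_def integrable_continuous_real continuous_intros u g q)
    moreover have "\<Lambda> (u s * g s * q s) = v s * g s * q s" for s
      using linear_scale[OF bounded_linear.linear[OF \<Lambda>(1)], of "g s * q s" "u s"] by (simp add: \<Lambda>(2) scaleR_conv_of_real mult_ac)
    ultimately have "integral {0..L} (\<lambda>s. v s * g s * q s) = 0" using orth'[OF g] \<Lambda>(1) by (simp add: linear_simps)
    moreover have nonneg: "0 \<le> v s * g s * q s" if "s \<in> {0..L}" for s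
    proof (cases "s = 0 \<or> s = L")
      case False
      then have "v s * g s * q s = (v s)\<^sup>2 * (sin ((\<theta> s - \<theta> 0) / 2) * q s)" by (simp add: g_def power2_eq_square)
      then show ?thesis using False that pos[of s] q(2)[of s] by (simp add: less_imp_le)
    qed (use g(2) in \<open>auto simp: g_def\<close>)
    ultimately have *: "v s * g s * q s = 0" if "s \<in> {0..L}" for s using integral_eq_0_iff[OF c] L that by auto
    have "v s = 0" if "0 < s" "s < L" for s using *[of s] pos[OF that] q(2)[of s] that by (auto simp: g_def)
    \<comment> \<open>The ends, where the sine factor vanishes, follow by continuity.\<close>
    then show "v s = 0" using continuous_constant_on_closure[of "{0<..<L}" v 0 s] L v s by simp
  qed
  have "Re (u s) = 0" by (rule z[of "\<lambda>s. Re (u s)" Re]) (auto intro!: continuous_intros u bounded_linear_Re)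
  moreover have "Im (u s) = 0" by (rule z[of "\<lambda>s. Im (u s)" Im]) (auto intro!: continuous_intros u bounded_linear_Im)
  ultimately show ?thesis by (simp add: complex_eq_iff)
qed

end

section \<open>Trigonometric tests in arc length and primitives on the circle\<close>

definition trig :: "real \<Rightarrow> (real \<Rightarrow> real) set" where
  "trig L = (\<Union>n::nat. {\<lambda>s. cos (2 * pi * n / L * s), \<lambda>s. sin (2 * pi * n / L * s)})"

lemma trig_cos: "(\<lambda>s. cos (2 * pi * real n / L * s)) \<in> trig L"
  and trig_sin: "(\<lambda>s. sin (2 * pi * real n / L * s)) \<in> trig L"
  unfolding trig_def by blast+

lemma trig_one: "(\<lambda>s. 1) \<in> trig L"
  using trig_cos[of 0 L] by simp

lemma trig_cases:
  assumes "\<alpha> \<in> trig L"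
  obtains n where "\<alpha> = (\<lambda>s. cos (2 * pi * real n / L * s))" | n where "\<alpha> = (\<lambda>s. sin (2 * pi * real n / L * s))"
  using assms unfolding trig_def by blast

lemma trig_smooth: "\<alpha> \<in> trig L \<Longrightarrow> smooth \<alpha>"
  using smooth_cos_affine[of "2 * pi * real n / L" 0 for n] smooth_sin_affine[of "2 * pi * real n / L" 0 for n]
  by (elim trig_cases) simp_all

lemma trig_periodic:
  assumes "\<alpha> \<in> trig L" "L > 0"
  shows "L_periodic L \<alpha>"
proof -
  have e: "2 * pi * real n / L * (s + L) = 2 * pi * real n / L * s + 2 * pi * of_int (int n)" for n s
    using assms(2) by (simp add: field_simps)
  have "cos (2 * pi * real n / L * (s + L)) = cos (2 * pi * real n / L * s)"
    "sin (2 * pi * real n / L * (s + L)) = sin (2 * pi * real n / L * s)" for n s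
    unfolding e cos_add sin_add cos_int_2pin sin_int_2pin by (rule trans[OF _ refl], simp)+
  then show ?thesis
    using assms(1) by (elim trig_cases) (simp_all add: L_periodic_def)
qed

lemma trig_le_1: "\<alpha> \<in> trig L \<Longrightarrow> \<bar>\<alpha> s\<bar> \<le> 1"
  by (elim trig_cases) (auto simp: abs_cos_le_one abs_sin_le_one)

lemma deriv_cos_scale: "deriv (\<lambda>s. cos (k * s)) = (\<lambda>s. - k * sin (k * s))"
  and deriv_sin_scale: "deriv (\<lambda>s. sin (k * s)) = (\<lambda>s. k * cos (k * s))" for k :: real
  by (intro ext DERIV_imp_deriv; auto intro!: derivative_eq_intros)+

lemma integral_trig_deriv:
  assumes "\<alpha> \<in> trig L" "a \<le> b"
  shows "(deriv \<alpha> has_integral \<alpha> b - \<alpha> a) {a..b}"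
  by (rule fundamental_theorem_of_calculus[OF assms(2)])
     (use smooth_has_deriv[OF trig_smooth[OF assms(1)]] in
       \<open>auto simp flip: has_real_derivative_iff_has_vector_derivative intro: has_field_derivative_at_within\<close>)

lemma trig_deriv_integral_0:
  assumes "L > 0" "\<alpha> \<in> trig L"
  shows "integral {0..L} (deriv \<alpha>) = 0"
proof -
  have "\<alpha> L = \<alpha> 0" using trig_periodic[OF assms(2,1)] unfolding L_periodic_def by (metis add_0)
  then show ?thesis using integral_trig_deriv[OF assms(2), of 0 L] assms(1) by (auto dest: integral_unique)
qed

text \<open>Testing against derivatives of trigonometric functions thus sees everything except the
  mean. The zero function occurs as the sine with \<open>n = 0\<close>.\<close>

lemma trig_trichotomy:
  assumes "\<gamma> \<in> trig L" "L > 0"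
  shows "\<gamma> = (\<lambda>s. 1) \<or> \<gamma> = (\<lambda>s. 0) \<or> (\<exists>\<alpha>\<in>trig L. \<exists>k\<noteq>0. deriv \<alpha> = (\<lambda>s. k * \<gamma> s))"
  using assms(1)
proof (cases rule: trig_cases)
  case (1 n)
  show ?thesis
  proof (cases "n = 0")
    case False
    have "deriv (\<lambda>s. sin (2 * pi * real n / L * s)) = (\<lambda>s. 2 * pi * real n / L * \<gamma> s)" unfolding 1 deriv_sin_scale ..
    moreover have "2 * pi * real n / L \<noteq> 0" using False assms(2) by simp
    ultimately show ?thesis using trig_sin[of n L] by blast
  qed (simp add: 1)
next
  case (2 n)
  show ?thesis
  proof (cases "n = 0")
    case False
    have "deriv (\<lambda>s. cos (2 * pi * real n / L * s)) = (\<lambda>s. - (2 * pi * real n / L) * \<gamma> s)" unfolding 2 deriv_cos_scale ..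
    moreover have "- (2 * pi * real n / L) \<noteq> 0" using False assms(2) by simp
    ultimately show ?thesis using trig_cos[of n L] by blast
  qed (simp add: 2)
qed

text \<open>Subtracting the mean makes \<open>D\<close> orthogonal to the constants as well, hence,
  by \<open>trig_trichotomy\<close>, to every exponential; completeness then leaves only the
  mean.\<close>

lemma trig_deriv_orthogonal_imp_const:
  fixes D :: "real \<Rightarrow> real"
  assumes L: "L > 0" and D: "continuous_on {0..L} D"
    and orth: "\<And>\<alpha>. \<alpha> \<in> trig L \<Longrightarrow> integral {0..L} (\<lambda>s. D s * deriv \<alpha> s) = 0"
    and s: "s \<in> {0..L}"
  shows "D s = D 0"
proof -
  define m where "m = integral {0..L} D / L"
  have z: "((\<lambda>s. (D s - m) * \<gamma> s) has_integral 0) {0..L}" if \<gamma>: "\<gamma> \<in> trig L" for \<gamma>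
  proof -
    have c: "continuous_on {0..L} \<beta>" if "\<beta> = \<gamma> \<or> \<beta> = deriv \<alpha> \<and> \<alpha> \<in> trig L" for \<alpha> \<beta> using that \<gamma> by (auto intro: smooth_continuous smooth_deriv trig_smooth)
    have i: "integral {0..L} (\<lambda>s. (D s - m) * \<beta> s) = integral {0..L} (\<lambda>s. D s * \<beta> s) - m * integral {0..L} \<beta>" if "continuous_on {0..L} \<beta>" for \<beta>
      unfolding left_diff_distrib integral_mult_right[symmetric]
      by (intro integral_diff integrable_continuous_real continuous_on_mult D that continuous_on_const)
    have "integral {0..L} (\<lambda>s. (D s - m) * \<gamma> s) = 0" using trig_trichotomy[OF \<gamma> L]
    proof (elim disjE bexE exE conjE)
      assume "\<gamma> = (\<lambda>s. 1)"
      then show ?thesis using i[of \<gamma>] L by (simp add: m_def)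
    next
      fix \<alpha> and k :: real assume \<alpha>: "\<alpha> \<in> trig L" "k \<noteq> 0" "deriv \<alpha> = (\<lambda>s. k * \<gamma> s)"
      have "integral {0..L} (\<lambda>s. k * ((D s - m) * \<gamma> s)) = integral {0..L} (\<lambda>s. (D s - m) * deriv \<alpha> s)" unfolding \<alpha>(3) by (simp only: mult.left_commute)
      then have "k * integral {0..L} (\<lambda>s. (D s - m) * \<gamma> s) = 0" using i[OF c[of "deriv \<alpha>" \<alpha>]] \<alpha>(1) orth[OF \<alpha>(1)] trig_deriv_integral_0[OF L \<alpha>(1)] by simp
      then show ?thesis using \<alpha>(2) by simp
    qed simp
    moreover have "(\<lambda>s. (D s - m) * \<gamma> s) integrable_on {0..L}"
      by (intro integrable_continuous_real continuous_on_mult continuous_on_diff D c continuous_on_const) simp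
    ultimately show ?thesis by (metis integrable_integral)
  qed
  define u where "u s = complex_of_real (D s - m)" for s
  have uz: "u s = 0" if s: "s \<in> {0..L}" for s
  proof (rule circle_angle.cis_orthogonal_imp_zero[OF _ _ _ _ _ s, where q = "\<lambda>_. 1" and \<theta> = "\<lambda>s. 2 * pi / L * s"])
    show "circle_angle L (\<lambda>s. 2 * pi / L * s)" using L by unfold_locales (auto intro!: continuous_intros simp: field_simps)
    show "continuous_on {0..L} u" unfolding u_def by (intro continuous_intros D)
    show "integral {0..L} (\<lambda>s. u s * cis (of_int n * (2 * pi / L * s)) * complex_of_real 1) = 0" for n
    proof -
      obtain \<sigma> :: real and k where nk: "real_of_int n = \<sigma> * real k" "\<sigma> = 1 \<or> \<sigma> = -1"
      proof (cases "n \<ge> 0")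
        case True
        then show ?thesis using that[of 1 "nat n"] by simp
      next
        case False
        then show ?thesis using that[of "-1" "nat (- n)"] by simp
      qed
      have "u s * cis (of_int n * (2 * pi / L * s)) * complex_of_real 1 =
          complex_of_real ((D s - m) * cos (2 * pi * real k / L * s)) +
          \<i> * (\<sigma> * complex_of_real ((D s - m) * sin (2 * pi * real k / L * s)))" for s
      proof -
        have "cis (of_int n * (2 * pi / L * s)) = cos (2 * pi * real k / L * s) + \<i> * (\<sigma> * sin (2 * pi * real k / L * s))"
          using nk by (auto simp: complex_eq_iff mult.commute mult.left_commute)
        then show ?thesis by (simp add: u_def algebra_simps)
      qed
      moreover have "((\<lambda>s. complex_of_real ((D s - m) * cos (2 * pi * real k / L * s)) +
          \<i> * (\<sigma> * complex_of_real ((D s - m) * sin (2 * pi * real k / L * s)))) has_integral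
          complex_of_real 0 + \<i> * (\<sigma> * complex_of_real 0)) {0..L}" by (intro has_integral_add has_integral_mult_right has_integral_of_real z trig_sin trig_cos)
      ultimately show ?thesis by (simp only: integral_unique of_real_0 mult_zero_right add_0_right)
    qed
  qed (use L in \<open>auto intro!: continuous_intros simp: field_simps\<close>)
  show ?thesis using uz[OF s] uz[of 0] L by (simp add: u_def del: of_real_diff)
qed

text \<open>\<open>P\<close> is the primitive, vanishing at \<open>0\<close>, of the distribution \<open>T\<close>.\<close>

definition trig_primitive :: "real \<Rightarrow> (real \<Rightarrow> real) \<Rightarrow> ((real \<Rightarrow> real) \<Rightarrow> real) \<Rightarrow> bool" where
  "trig_primitive L P T \<longleftrightarrow> continuous_on {0..L} P \<and> P 0 = 0 \<and>
     (\<forall>\<alpha>\<in>trig L. integral {0..L} (\<lambda>s. P s * deriv \<alpha> s) = \<alpha> L * P L - T \<alpha>)"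

text \<open>The test \<alpha> = 1 forces P L = T 1, so two primitives of the same distribution have
  equal boundary terms. Their difference is orthogonal to all derivatives, hence constant, and both
  vanish at 0.\<close>

lemma trig_primitive_unique:
  assumes L: "L > 0" and P: "trig_primitive L P T" and P': "trig_primitive L P' T'" and T: "\<And>\<alpha>. \<alpha> \<in> trig L \<Longrightarrow> T \<alpha> = T' \<alpha>" and s: "s \<in> {0..L}"
  shows "P s = P' s"
proof -
  have PL: "P L = T (\<lambda>s. 1)" if "trig_primitive L P T" for P T
    using that trig_one unfolding trig_primitive_def by fastforce
  have "P s - P' s = P 0 - P' 0"
  proof (rule trig_deriv_orthogonal_imp_const[OF L _ _ s, where D = "\<lambda>s. P s - P' s"])
    show "continuous_on {0..L} (\<lambda>s. P s - P' s)" using P P' by (intro continuous_on_diff) (auto simp: trig_primitive_def)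
    fix \<alpha> assume \<alpha>: "\<alpha> \<in> trig L"
    have "continuous_on {0..L} (deriv \<alpha>)" using \<alpha> by (intro smooth_continuous smooth_deriv trig_smooth)
    then have "integral {0..L} (\<lambda>s. (P s - P' s) * deriv \<alpha> s) = integral {0..L} (\<lambda>s. P s * deriv \<alpha> s) - integral {0..L} (\<lambda>s. P' s * deriv \<alpha> s)"
      unfolding left_diff_distrib using P P' by (intro integral_diff integrable_continuous_real continuous_on_mult) (auto simp: trig_primitive_def)
    then show "integral {0..L} (\<lambda>s. (P s - P' s) * deriv \<alpha> s) = 0" using P P' \<alpha> T[OF \<alpha>] T[OF trig_one] PL[OF P] PL[OF P'] by (simp add: trig_primitive_def)
  qed
  then show ?thesis using P P' by (simp add: trig_primitive_def)
qed

lemma trig_primitive_weak: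
  assumes L: "L > 0" and D: "continuous_on {0..L} D" "D 0 = D L"
    and weak: "\<And>\<alpha>. \<alpha> \<in> trig L \<Longrightarrow> integral {0..L} (\<lambda>s. D s * deriv \<alpha> s) = - T \<alpha>"
  shows "trig_primitive L (\<lambda>s. D s - D 0) T"
  unfolding trig_primitive_def
proof (intro conjI ballI)
  fix \<alpha> assume \<alpha>: "\<alpha> \<in> trig L"
  have c: "continuous_on {0..L} (deriv \<alpha>)" using \<alpha> by (intro smooth_continuous smooth_deriv trig_smooth)
  have "integral {0..L} (\<lambda>s. (D s - D 0) * deriv \<alpha> s) = integral {0..L} (\<lambda>s. D s * deriv \<alpha> s) - D 0 * integral {0..L} (deriv \<alpha>)"
    unfolding left_diff_distrib integral_mult_right[symmetric] by (intro integral_diff integrable_continuous_real continuous_on_mult D c continuous_on_const)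
  then show "integral {0..L} (\<lambda>s. (D s - D 0) * deriv \<alpha> s) = \<alpha> L * (D L - D 0) - T \<alpha>"
    by (simp add: weak[OF \<alpha>] trig_deriv_integral_0[OF L \<alpha>] D(2))
qed (use D in \<open>auto intro!: continuous_intros\<close>)

lemma trig_primitive_continuous:
  assumes L: "L > 0" and u: "continuous_on {0..L} u"
  shows "trig_primitive L (\<lambda>s. integral {0..s} u) (\<lambda>\<alpha>. integral {0..L} (\<lambda>s. u s * \<alpha> s))"
proof -
  define P where "P s = integral {0..s} u" for s
  have dP: "(P has_real_derivative u s) (at s within {0..L})" if "s \<in> {0..L}" for s
    unfolding P_def by (rule integral_has_real_derivative[OF u that])
  have Pc: "continuous_on {0..L} P"
    using dP by (meson DERIV_continuous continuous_on_eq_continuous_within)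
  have "integral {0..L} (\<lambda>s. P s * deriv \<alpha> s) = \<alpha> L * P L - integral {0..L} (\<lambda>s. u s * \<alpha> s)" if \<alpha>: "\<alpha> \<in> trig L" for \<alpha>
  proof -
    have \<alpha>c: "continuous_on A (deriv \<alpha>)" "continuous_on A \<alpha>" for A using \<alpha> by (auto intro: smooth_continuous smooth_deriv trig_smooth)
    have "((\<lambda>s. u s * \<alpha> s + P s * deriv \<alpha> s) has_integral P L * \<alpha> L - P 0 * \<alpha> 0) {0..L}"
    proof (rule fundamental_theorem_of_calculus)
      fix s assume s: "s \<in> {0..L}"
      have "(\<alpha> has_real_derivative deriv \<alpha> s) (at s within {0..L})" using smooth_has_deriv[OF trig_smooth[OF \<alpha>]] by (rule has_field_derivative_at_within)
      from DERIV_mult[OF dP[OF s] this]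
      show "((\<lambda>s. P s * \<alpha> s) has_vector_derivative u s * \<alpha> s + P s * deriv \<alpha> s) (at s within {0..L})"
        by (simp add: has_real_derivative_iff_has_vector_derivative[symmetric] algebra_simps)
    qed (use L in simp)
    moreover have "integral {0..L} (\<lambda>s. u s * \<alpha> s + P s * deriv \<alpha> s) = integral {0..L} (\<lambda>s. u s * \<alpha> s) + integral {0..L} (\<lambda>s. P s * deriv \<alpha> s)"
      by (intro integral_add integrable_continuous_real continuous_on_mult u Pc \<alpha>c)
    ultimately have "integral {0..L} (\<lambda>s. u s * \<alpha> s) + integral {0..L} (\<lambda>s. P s * deriv \<alpha> s) = P L * \<alpha> L - P 0 * \<alpha> 0" by (metis integral_unique)
    moreover have "P 0 = 0" by (simp add: P_def)
    ultimately show ?thesis by (simp add: mult.commute[of "P L"])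
  qed
  then show ?thesis using Pc by (simp add: trig_primitive_def P_def[abs_def])
qed

section \<open>Primitives in \<open>s\<close> of integrable functions of two variables\<close>

lemma AE_fst_neq: "AE x in lborel. fst (x::real\<times>real) \<noteq> a"
proof -
  have "{a} \<times> UNIV \<in> null_sets (lborel \<Otimes>\<^sub>M (lborel :: real measure))"
    by (rule lborel.times_in_null_sets1) auto
  from this[unfolded lborel_prod] show ?thesis
    by (rule AE_I') auto
qed

lemma AE_snd_neq: "AE x in lborel. snd (x::real\<times>real) \<noteq> a"
proof -
  have "UNIV \<times> {a} \<in> null_sets ((lborel :: real measure) \<Otimes>\<^sub>M lborel)"
    by (rule lborel.times_in_null_sets2) auto
  from this[unfolded lborel_prod] show ?thesis
    by (rule AE_I') auto
qed

lemma measurable_fst_real2 [measurable]: "fst \<in> borel_measurable (borel :: (real \<times> real) measure)"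
  and measurable_snd_real2 [measurable]: "snd \<in> borel_measurable (borel :: (real \<times> real) measure)"
  by (auto intro!: borel_measurable_continuous_onI continuous_intros)

lemma integrable_pair_product:
  fixes h :: "'a::euclidean_space \<Rightarrow> real" and G :: "'b::euclidean_space \<Rightarrow> real"
  assumes [measurable]: "integrable lborel h" "integrable lborel G"
  shows "integrable (lborel \<Otimes>\<^sub>M lborel) (\<lambda>(s, x). h s * G x)"
  by (rule lborel_pair.Fubini_integrable) (use assms in \<open>auto simp: abs_mult\<close>)

lemma tendsto_indicator_atMost:
  fixes a :: real
  assumes "x \<longlonglongrightarrow> a" "y \<noteq> a"
  shows "(\<lambda>n. indicator {..x n} y :: real) \<longlonglongrightarrow> indicator {..a} y"
proof (cases "y < a")
  case True
  then have "\<forall>\<^sub>F n in sequentially. y < x n" using assms(1) order_tendstoD(1) by blast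
  then show ?thesis using True
    by (intro tendsto_eventually) (auto elim!: eventually_mono)
next
  case False
  then have "\<forall>\<^sub>F n in sequentially. x n < y" using assms order_tendstoD(2)[OF assms(1), of y] by auto
  then show ?thesis using False assms(2)
    by (intro tendsto_eventually) (auto elim!: eventually_mono)
qed

text \<open>Writing the primitive as an integral over the plane avoids slices of \<open>G\<close>,
  which are integrable only for almost every \<open>s\<close>. Continuity holds because vertical
  lines are null sets; the integration by parts is Fubini on the region where the first coordinate
  of \<open>x\<close> is at most \<open>s\<close>.\<close>

lemma trig_primitive_integrable:
  fixes G :: "real \<times> real \<Rightarrow> real"
  assumes L: "L > 0" and G: "integrable lborel G" and supp: "\<And>x. fst x \<notin> {0..<L} \<Longrightarrow> G x = 0"
  shows "trig_primitive L (\<lambda>s. \<integral>x. G x * indicator {..s} (fst x) \<partial>lborel) (\<lambda>\<alpha>. \<integral>x. G x * \<alpha> (fst x) \<partial>lborel)"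
    and "continuous_on A (\<lambda>s. \<integral>x. G x * indicator {..s} (fst x) \<partial>lborel)"
proof -
  note [measurable] = borel_measurable_integrable[OF G]
  define I where "I s = (\<integral>x. G x * indicator {..s} (fst x) \<partial>lborel)" for s
  have Icont: "continuous_on A I" for A
  proof (rule continuous_on_sequentiallyI)
    fix x and a :: real
    assume x: "x \<longlonglongrightarrow> a"
    show "(\<lambda>n. I (x n)) \<longlonglongrightarrow> I a" unfolding I_def
    proof (rule integral_dominated_convergence[where w = "\<lambda>x. \<bar>G x\<bar>"])
      show "AE y in lborel. (\<lambda>n. G y * indicator {..x n} (fst y)) \<longlonglongrightarrow> G y * indicator {..a} (fst y)"
        using AE_fst_neq[of a] by eventually_elim (intro tendsto_mult_left tendsto_indicator_atMost x)
      show "AE y in lborel. norm (G y * indicator {..x n} (fst y)) \<le> \<bar>G y\<bar>" for n by (intro AE_I2) (simp add: abs_mult indicator_def)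
      show "(\<lambda>y. G y * indicator {..a} (fst y)) \<in> borel_measurable lborel"
        "\<And>n. (\<lambda>y. G y * indicator {..x n} (fst y)) \<in> borel_measurable lborel" by measurable
    qed (use G in simp)
  qed
  have I0: "I 0 = 0"
  proof -
    have "I 0 = (\<integral>x. 0 \<partial>(lborel :: (real\<times>real) measure))" unfolding I_def by (rule integral_cong_AE)
        (use AE_fst_neq[of 0] in \<open>auto elim!: eventually_mono simp: indicator_def supp\<close>)
    then show ?thesis by simp
  qed
  have "G x * indicator {..L} (fst x) = G x" for x
    using supp[of x] by (auto simp: indicator_def)
  then have IL: "I L = (\<integral>x. G x \<partial>lborel)" by (simp only: I_def)
  show "continuous_on A (\<lambda>s. \<integral>x. G x * indicator {..s} (fst x) \<partial>lborel)"
    using Icont by (simp add: I_def[abs_def])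
  have "integral {0..L} (\<lambda>s. I s * deriv \<alpha> s) = \<alpha> L * I L - (\<integral>x. G x * \<alpha> (fst x) \<partial>lborel)" if \<alpha>: "\<alpha> \<in> trig L" for \<alpha>
  proof -
    have d\<alpha>: "continuous_on A (deriv \<alpha>)" for A using \<alpha> by (intro smooth_continuous smooth_deriv trig_smooth)
    have [measurable]: "deriv \<alpha> \<in> borel_measurable borel" "\<alpha> \<in> borel_measurable borel"
      using d\<alpha> smooth_continuous[OF trig_smooth[OF \<alpha>]] by (auto intro: borel_measurable_continuous_onI)
    have hint: "integrable lborel (\<lambda>s. indicator {0..L} s * deriv \<alpha> s)" using borel_integrable_atLeastAtMost'[OF d\<alpha>, of 0 L] by (simp add: set_integrable_def)
    define f where "f s x = indicator {0..L} s * deriv \<alpha> s * G x * indicator {..s} (fst x)" for s :: real and x :: "real \<times> real"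
    have fint: "integrable (lborel \<Otimes>\<^sub>M lborel) (case_prod f)"
    proof (rule Bochner_Integration.integrable_bound[OF integrable_pair_product[OF hint G]])
      define S where "S = {y :: real \<times> real \<times> real. fst (snd y) \<le> fst y}"
      have "closed S" unfolding S_def by (intro closed_Collect_le continuous_intros)
      then have S: "S \<in> sets (lborel \<Otimes>\<^sub>M lborel)" by (subst lborel_prod) simp
      have "case_prod f = (\<lambda>y. (case y of (s, x) \<Rightarrow> (indicator {0..L} s * deriv \<alpha> s) * G x) * indicator S y)" by (auto simp: f_def S_def indicator_def)
      then show "case_prod f \<in> borel_measurable (lborel \<Otimes>\<^sub>M lborel)" using borel_measurable_integrable[OF integrable_pair_product[OF hint G]] S by simp
    qed (auto simp: f_def indicator_def abs_mult intro!: AE_I2)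
    have "integral {0..L} (\<lambda>s. I s * deriv \<alpha> s) = (LINT s:{0..L}|lborel. I s * deriv \<alpha> s)"
      by (intro set_borel_integral_eq_integral(2)[symmetric] borel_integrable_atLeastAtMost' continuous_intros Icont d\<alpha>)
    also have "\<dots> = (\<integral>s. (\<integral>x. f s x \<partial>lborel) \<partial>lborel)"
      unfolding set_lebesgue_integral_def I_def f_def integral_mult_left_zero[symmetric] integral_scaleR_right[symmetric] by (simp add: mult_ac)
    also have "\<dots> = (\<integral>x. (\<integral>s. f s x \<partial>lborel) \<partial>lborel)" by (rule lborel_pair.Fubini_integral[OF fint, symmetric])
    also have "\<dots> = (\<integral>x. G x * (\<alpha> L - \<alpha> (fst x)) \<partial>lborel)"
    proof (rule Bochner_Integration.integral_cong[OF refl])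
      fix x :: "real \<times> real"
      show "(\<integral>s. f s x \<partial>lborel) = G x * (\<alpha> L - \<alpha> (fst x))"
      proof (cases "fst x \<in> {0..<L}")
        case False
        then show ?thesis by (simp add: f_def supp)
      next
        case True
        have "(\<integral>s. f s x \<partial>lborel) = G x * (LINT s:{fst x..L}|lborel. deriv \<alpha> s)" unfolding set_lebesgue_integral_def integral_mult_right_zero[symmetric]
          by (rule Bochner_Integration.integral_cong) (use True in \<open>auto simp: f_def indicator_def\<close>)
        also have "(LINT s:{fst x..L}|lborel. deriv \<alpha> s) = integral {fst x..L} (deriv \<alpha>)"
          by (intro set_borel_integral_eq_integral(2) borel_integrable_atLeastAtMost' d\<alpha>)
        also have "\<dots> = \<alpha> L - \<alpha> (fst x)" using integral_trig_deriv[OF \<alpha>, of "fst x" L] True by (auto intro: integral_unique)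
        finally show ?thesis .
      qed
    qed
    also have "\<dots> = (\<integral>x. \<alpha> L * G x - G x * \<alpha> (fst x) \<partial>lborel)" by (simp add: algebra_simps)
    also have "\<dots> = (\<integral>x. \<alpha> L * G x \<partial>lborel) - (\<integral>x. G x * \<alpha> (fst x) \<partial>lborel)"
    proof (rule Bochner_Integration.integral_diff)
      show "integrable lborel (\<lambda>x. G x * \<alpha> (fst x))" by (rule Bochner_Integration.integrable_bound[OF G])
           (use trig_le_1[OF \<alpha>] in \<open>auto simp: abs_mult intro!: AE_I2 mult_left_le\<close>)
    qed (use G in simp)
    finally show ?thesis by (simp add: IL)
  qed
  then show "trig_primitive L (\<lambda>s. \<integral>x. G x * indicator {..s} (fst x) \<partial>lborel) (\<lambda>\<alpha>. \<integral>x. G x * \<alpha> (fst x) \<partial>lborel)"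
    using Icont I0 by (simp add: trig_primitive_def I_def)
qed

lemma weak_deriv_trig_imp_primitive:
  fixes D :: "real \<Rightarrow> real" and G :: "real \<times> real \<Rightarrow> real"
  assumes L: "L > 0" and D: "continuous_on {0..L} D" "D 0 = D L"
    and G: "integrable lborel G" and supp: "\<And>x. fst x \<notin> {0..<L} \<Longrightarrow> G x = 0"
    and weak: "\<And>\<alpha>. \<alpha> \<in> trig L \<Longrightarrow> integral {0..L} (\<lambda>s. D s * deriv \<alpha> s) = - (\<integral>x. G x * \<alpha> (fst x) \<partial>lborel)"
    and s: "s \<in> {0..L}"
  shows "D s - D 0 = (\<integral>x. G x * indicator {..s} (fst x) \<partial>lborel)"
  using trig_primitive_unique[OF L trig_primitive_weak[OF L D, where T = "\<lambda>\<alpha>. \<integral>x. G x * \<alpha> (fst x) \<partial>lborel"] trig_primitive_integrable(1)[OF L G supp] refl s] weak by simp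

section \<open>Weak derivatives on the half-cylinder\<close>

lemma Times_in_borel: "A \<in> sets borel \<Longrightarrow> B \<in> sets borel \<Longrightarrow> A \<times> B \<in> sets (borel :: (real \<times> real) measure)"
  unfolding borel_prod[symmetric] by (rule pair_measureI)

lemma cylinder_measurable [measurable]: "cylinder L \<in> sets borel"
  unfolding cylinder_def by (intro Times_in_borel) auto

lemma cylinder_exhaustion:
  assumes "x \<in> cylinder L"
  shows "\<exists>N. \<forall>n\<ge>N. 1 / real (n + 2) < snd x \<and> snd x \<le> real (n + 2)"
proof -
  have p: "snd x > 0" using assms by (cases x) (simp add: cylinder_def)
  obtain N1 where N1: "snd x \<le> real N1" using real_arch_simple by blast
  obtain N2 where N2: "inverse (real (Suc N2)) < snd x" using reals_Archimedean[OF p] by blast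
  have "1 / real (n + 2) \<le> inverse (real (Suc N2))" if "n \<ge> N1 + N2" for n
    using that unfolding inverse_eq_divide by (intro divide_left_mono) auto
  then show ?thesis using N1 N2 by (intro exI[of _ "N1 + N2"]) fastforce
qed

abbreviation cyl_integral :: "real \<Rightarrow> (real \<times> real \<Rightarrow> real) \<Rightarrow> real" where
  "cyl_integral L F \<equiv> set_lebesgue_integral lborel (cylinder L) F"

abbreviation cyl_ext :: "real \<Rightarrow> (real \<times> real \<Rightarrow> real) \<Rightarrow> real \<times> real \<Rightarrow> real" where
  "cyl_ext L g x \<equiv> indicator (cylinder L) x * g x"

abbreviation cyl_cont :: "real \<Rightarrow> (real \<times> real \<Rightarrow> real) \<Rightarrow> bool" where
  "cyl_cont L g \<equiv> continuous_on ({0..L} \<times> {0<..}) g"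

section \<open>Integrals over the half-cylinder and integration by parts\<close>

lemma cylinder_box_integral:
  fixes F :: "real \<times> real \<Rightarrow> real"
  assumes L: "L > 0" and c: "0 < c" and F: "continuous_on ({0..L} \<times> {c..d}) F"
    and supp: "\<And>s y. y \<notin> {c..d} \<Longrightarrow> F (s, y) = 0"
  shows "set_integrable lborel (cylinder L) F"
    and "cyl_integral L F = integral (cbox (0, c) (L, d)) F"
proof -
  let ?B = "cbox (0, c) (L, d) :: (real \<times> real) set"
  have B: "?B = {0..L} \<times> {c..d}" by (auto simp: cbox_Pair_eq)
  have intB: "set_integrable lborel ?B F"
    unfolding set_integrable_def by (rule borel_integrable_compact) (use F in \<open>auto simp: B intro: compact_Times\<close>)
  have eq: "indicator (cylinder L) x *\<^sub>R F x = indicator (cylinder L) x *\<^sub>R (indicator ?B x *\<^sub>R F x)" for x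
    by (cases x) (use supp c in \<open>auto simp: cylinder_def B indicator_def\<close>)
  have "integrable lborel (\<lambda>x. indicator (cylinder L) x *\<^sub>R (indicator ?B x *\<^sub>R F x))"
    by (rule integrable_mult_indicator) (use intB in \<open>simp_all add: set_integrable_def\<close>)
  then show i: "set_integrable lborel (cylinder L) F"
    unfolding set_integrable_def by (simp only: eq)
  have "cyl_integral L F = set_lebesgue_integral lborel ?B F"
    unfolding set_lebesgue_integral_def
  proof (rule integral_cong_AE)
    show "AE x in lborel. indicat_real (cylinder L) x *\<^sub>R F x = indicat_real ?B x *\<^sub>R F x" using AE_fst_neq[of L]
    proof eventually_elim
      case (elim x)
      then show ?case by (cases x) (use supp c in \<open>auto simp: cylinder_def B indicator_def\<close>)
    qed
  qed (use i intB in \<open>auto simp: set_integrable_def\<close>)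
  also have "\<dots> = integral ?B F"
    by (rule set_borel_integral_eq_integral(2)[OF intB])
  finally show "cyl_integral L F = integral ?B F" .
qed

text \<open>\<open>smooth2\<close> takes the \<psi>-derivatives first, so its closure under
  \<open>d_s\<close> would require commuting mixed derivatives. This class involves s-derivatives
  only and is closed under \<open>d_s\<close> without that; every iterated \<psi>-derivative of a
  test function belongs to it.\<close>

definition s_test :: "real \<Rightarrow> real \<Rightarrow> real \<Rightarrow> (real \<times> real \<Rightarrow> real) \<Rightarrow> bool" where
  "s_test L c d \<xi> \<longleftrightarrow> (\<forall>a. (d_s ^^ a) \<xi> differentiable_on UNIV) \<and> (\<forall>y. L_periodic L (\<lambda>s. \<xi> (s, y))) \<and>
     (\<forall>s y. y \<notin> {c..d} \<longrightarrow> \<xi> (s, y) = 0)"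

lemma s_test_continuous: "s_test L c d \<xi> \<Longrightarrow> continuous_on A \<xi>"
  by (metis continuous_on_subset differentiable_imp_continuous_on funpow_0 s_test_def subset_UNIV)

lemma differentiable_partial_s:
  fixes \<xi> :: "real \<times> real \<Rightarrow> real"
  assumes "\<xi> differentiable_on UNIV"
  shows "((\<lambda>t. \<xi> (t, y)) has_real_derivative d_s \<xi> (s, y)) (at s)"
proof -
  have "\<xi> differentiable (at (s, y))" using assms by (simp add: differentiable_on_def)
  then have "(\<lambda>t. \<xi> (t, y)) differentiable (at s)"
    by (intro differentiable_compose[of \<xi> "\<lambda>t. (t, y)"]) (auto simp: differentiable_def intro!: exI derivative_eq_intros)
  then show ?thesis by (simp add: d_s_def DERIV_deriv_iff_real_differentiable)
qed

lemma differentiable_partial_psi: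
  fixes \<xi> :: "real \<times> real \<Rightarrow> real"
  assumes "\<xi> differentiable_on UNIV"
  shows "((\<lambda>t. \<xi> (s, t)) has_real_derivative d_psi \<xi> (s, y)) (at y)"
proof -
  have "\<xi> differentiable (at (s, y))" using assms by (simp add: differentiable_on_def)
  then have "(\<lambda>t. \<xi> (s, t)) differentiable (at y)"
    by (intro differentiable_compose[of \<xi> "\<lambda>t. (s, t)"]) (auto simp: differentiable_def intro!: exI derivative_eq_intros)
  then show ?thesis by (simp add: d_psi_def DERIV_deriv_iff_real_differentiable)
qed

lemma s_test_d_s:
  assumes "s_test L c d \<xi>"
  shows "s_test L c d (d_s \<xi>)"
  unfolding s_test_def
proof (intro conjI allI impI)
  show "(d_s ^^ a) (d_s \<xi>) differentiable_on UNIV" for a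
    using assms unfolding s_test_def by (metis funpow_swap1 funpow.simps(2) o_apply)
  show "L_periodic L (\<lambda>s. d_s \<xi> (s, y))" for y
  proof -
    have "(\<lambda>t. \<xi> (t, y)) = (\<lambda>t. \<xi> (1 * t + L, y))" using assms by (auto simp: s_test_def L_periodic_def)
    moreover have "((\<lambda>t. \<xi> (1 * t + L, y)) has_real_derivative 1 * d_s \<xi> (1 * s + L, y)) (at s)" for s
      by (rule affine_deriv, rule differentiable_partial_s) (use assms in \<open>auto simp: s_test_def dest: spec[of _ 0]\<close>)
    ultimately have "d_s \<xi> (s, y) = d_s \<xi> (s + L, y)" for s by (auto simp: d_s_def intro!: DERIV_imp_deriv)
    then show ?thesis by (simp add: L_periodic_def)
  qed
  show "d_s \<xi> (s, y) = 0" if "y \<notin> {c..d}" for s y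
    using assms that by (simp add: d_s_def s_test_def)
qed

lemma test_function_smooth: "test_function L \<phi> \<Longrightarrow> partial_deriv a b \<phi> differentiable_on UNIV"
  by (simp add: test_function_def smooth2_def)

lemma test_function_smooth1: "test_function L \<phi> \<Longrightarrow> \<phi> differentiable_on UNIV"
  using test_function_smooth[of L \<phi> 0 0] by simp

lemma test_function_d_psi:
  assumes "test_function L \<phi>"
  shows "test_function L (d_psi \<phi>)"
proof -
  obtain c d where cd: "0 < c" "c < d" "\<And>s y. y \<notin> {c..d} \<Longrightarrow> \<phi> (s, y) = 0"
    using assms unfolding test_function_def by blast
  have "d_psi \<phi> (s, y) = 0" if "y \<notin> {c..d}" for s y
  proof -
    have "((\<lambda>t. \<phi> (s, t)) has_real_derivative 0) (at y)" by (rule has_field_derivative_transform_within_open[of "\<lambda>_. 0" _ _ "- {c..d}"])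
         (use that cd in \<open>auto simp: open_Compl\<close>)
    then show ?thesis by (simp add: d_psi_def DERIV_imp_deriv)
  qed
  moreover have "smooth2 (d_psi \<phi>)"
    using assms unfolding smooth2_def test_function_def by (metis funpow_swap1 funpow.simps(2) o_apply)
  moreover have "L_periodic L (\<lambda>s. d_psi \<phi> (s, y))" for y
    using assms by (auto simp: test_function_def L_periodic_def d_psi_def)
  ultimately show ?thesis using cd unfolding test_function_def by blast
qed

lemma test_function_funpow_d_psi: "test_function L \<phi> \<Longrightarrow> test_function L ((d_psi ^^ b) \<phi>)"
  by (induction b) (auto intro: test_function_d_psi)

lemma test_function_s_test:
  assumes "test_function L \<phi>"
  obtains c d where "0 < c" "c < d" "s_test L c d \<phi>"
proof -
  obtain c d where cd: "0 < c" "c < d" "\<forall>s y. y \<notin> {c..d} \<longrightarrow> \<phi> (s, y) = 0"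
    using assms unfolding test_function_def by blast
  moreover have "(d_s ^^ a) \<phi> differentiable_on UNIV" for a
    using test_function_smooth[OF assms, of a 0] by simp
  ultimately show ?thesis using that[of c d] assms unfolding s_test_def test_function_def by blast
qed

lemma s_test_funpow: "s_test L c d \<xi> \<Longrightarrow> s_test L c d ((d_s ^^ a) \<xi>)"
  by (induction a) (auto intro: s_test_d_s)

lemma cyl_integrable_continuous_mult:
  assumes L: "L > 0" and h: "cyl_cont L h" and \<xi>: "s_test L c d \<xi>" "0 < c"
  shows "set_integrable lborel (cylinder L) (\<lambda>x. h x * \<xi> x)"
proof (rule cylinder_box_integral(1)[OF L \<xi>(2)])
  show "continuous_on ({0..L} \<times> {c..d}) (\<lambda>x. h x * \<xi> x)"
    by (intro continuous_on_mult s_test_continuous[OF \<xi>(1)] continuous_on_subset[OF h]) (use \<xi>(2) in auto)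
qed (use \<xi> in \<open>simp add: s_test_def\<close>)

lemma cyl_integral_fubini:
  assumes L: "L > 0" and c: "0 < c" and F: "continuous_on ({0..L} \<times> {c..d}) F1" "continuous_on ({0..L} \<times> {c..d}) F2"
    and supp: "\<And>s y. y \<notin> {c..d} \<Longrightarrow> F1 (s, y) = 0" "\<And>s y. y \<notin> {c..d} \<Longrightarrow> F2 (s, y) = (0 :: real)"
  shows "cyl_integral L F1 + cyl_integral L F2 = integral {0..L} (\<lambda>s. integral {c..d} (\<lambda>y. F1 (s, y) + F2 (s, y)))" (is "?l = ?i")
    and "cyl_integral L F1 + cyl_integral L F2 = integral {c..d} (\<lambda>y. integral {0..L} (\<lambda>s. F1 (s, y) + F2 (s, y)))"
proof -
  have c: "continuous_on (cbox (0, c) (L, d)) (\<lambda>x. F1 x + F2 x)" using F by (auto simp: cbox_Pair_eq intro: continuous_on_add)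
  have "?l = cyl_integral L (\<lambda>x. F1 x + F2 x)"
    by (rule set_integral_add(2)[symmetric]; rule cylinder_box_integral(1)[OF L assms(2)]) (use F supp in auto)
  also have "\<dots> = integral (cbox (0, c) (L, d)) (\<lambda>x. F1 x + F2 x)"
    by (rule cylinder_box_integral(2)[OF L assms(2)]) (use F supp in \<open>auto intro: continuous_on_add\<close>)
  also have "\<dots> = ?i" using integral_prod_continuous[OF c] by simp
  finally show "?l = ?i" .
  also have "\<dots> = integral {c..d} (\<lambda>y. integral {0..L} (\<lambda>s. F1 (s, y) + F2 (s, y)))"
    using integral_swap_continuous[of 0 c L d "\<lambda>s y. F1 (s, y) + F2 (s, y)"] c by (simp add: case_prod_unfold)
  finally show "?l = integral {c..d} (\<lambda>y. integral {0..L} (\<lambda>s. F1 (s, y) + F2 (s, y)))" .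
qed

lemma cyl_ibp_s:
  assumes L: "L > 0" and h: "cyl_cont L h" and h': "cyl_cont L h'"
    and der: "\<And>s y. s \<in> {0..L} \<Longrightarrow> y > 0 \<Longrightarrow> ((\<lambda>t. h (t, y)) has_real_derivative h' (s, y)) (at s within {0..L})"
    and per: "\<And>y. y > 0 \<Longrightarrow> h (0, y) = h (L, y)"
    and \<xi>: "s_test L c d \<xi>" "0 < c"
  shows "cyl_integral L (\<lambda>x. h x * d_s \<xi> x) = - cyl_integral L (\<lambda>x. h' x * \<xi> x)"
proof -
  have \<xi>': "s_test L c d (d_s \<xi>)" by (rule s_test_d_s[OF \<xi>(1)])
  have sub: "{0..L} \<times> {c..d} \<subseteq> {0..L} \<times> {0<..}" using \<xi>(2) by auto
  have "integral {0..L} (\<lambda>s. h (s, y) * d_s \<xi> (s, y) + h' (s, y) * \<xi> (s, y)) = 0" if "y \<in> {c..d}" for y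
  proof -
    have y: "y > 0" using that \<xi>(2) by auto
    have "((\<lambda>s. h (s, y) * d_s \<xi> (s, y) + h' (s, y) * \<xi> (s, y)) has_integral h (L, y) * \<xi> (L, y) - h (0, y) * \<xi> (0, y)) {0..L}"
    proof (rule fundamental_theorem_of_calculus)
      fix s assume s: "s \<in> {0..L}"
      have "((\<lambda>t. \<xi> (t, y)) has_real_derivative d_s \<xi> (s, y)) (at s within {0..L})" by (rule has_field_derivative_at_within, rule differentiable_partial_s)
           (use \<xi>(1) in \<open>auto simp: s_test_def dest: spec[of _ 0]\<close>)
      from DERIV_mult[OF der[OF s y] this]
      show "((\<lambda>s. h (s, y) * \<xi> (s, y)) has_vector_derivative h (s, y) * d_s \<xi> (s, y) + h' (s, y) * \<xi> (s, y)) (at s within {0..L})"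
        by (simp add: has_real_derivative_iff_has_vector_derivative[symmetric] algebra_simps)
    qed (use L in simp)
    moreover have "\<xi> (L, y) = \<xi> (0, y)" using \<xi>(1) unfolding s_test_def L_periodic_def by (metis add_0)
    ultimately show ?thesis using per[OF y] by (auto dest: integral_unique)
  qed
  then have "integral {c..d} (\<lambda>y. integral {0..L} (\<lambda>s. h (s, y) * d_s \<xi> (s, y) + h' (s, y) * \<xi> (s, y))) = integral {c..d} (\<lambda>y. 0)"
    by (intro Henstock_Kurzweil_Integration.integral_cong)
  moreover have "cyl_integral L (\<lambda>x. h x * d_s \<xi> x) + cyl_integral L (\<lambda>x. h' x * \<xi> x) =
      integral {c..d} (\<lambda>y. integral {0..L} (\<lambda>s. h (s, y) * d_s \<xi> (s, y) + h' (s, y) * \<xi> (s, y)))" by (rule cyl_integral_fubini(2)[OF L \<xi>(2)])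
       (use \<xi> \<xi>' in \<open>auto simp: s_test_def intro!: continuous_on_mult s_test_continuous[OF \<xi>(1)] s_test_continuous[OF \<xi>'] continuous_on_subset[OF h sub] continuous_on_subset[OF h' sub]\<close>)
  ultimately show ?thesis by simp
qed

lemma cyl_ibp_psi:
  assumes L: "L > 0" and h: "cyl_cont L h" and h': "cyl_cont L h'"
    and der: "\<And>s y. s \<in> {0..L} \<Longrightarrow> y > 0 \<Longrightarrow> ((\<lambda>t. h (s, t)) has_real_derivative h' (s, y)) (at y)"
    and \<phi>: "test_function L \<phi>"
  shows "cyl_integral L (\<lambda>x. h x * d_psi \<phi> x) = - cyl_integral L (\<lambda>x. h' x * \<phi> x)"
proof -
  obtain c0 d0 where cd0: "0 < c0" "c0 < d0" "\<And>s y. y \<notin> {c0..d0} \<Longrightarrow> \<phi> (s, y) = 0"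
    using \<phi> unfolding test_function_def by blast
  obtain c1 d1 where cd1: "0 < c1" "c1 < d1" "\<And>s y. y \<notin> {c1..d1} \<Longrightarrow> d_psi \<phi> (s, y) = 0"
    using test_function_d_psi[OF \<phi>] unfolding test_function_def by blast
  \<comment> \<open>The interval is enlarged strictly so that \<open>\<phi>\<close> vanishes at its
    two ends too; the support condition speaks only of points outside the closed interval.\<close>
  define c d where "c = min c0 c1 / 2" and "d = max d0 d1 + 1"
  have c: "0 < c" "c < c0" "c < c1" "d0 < d" "d1 < d" "c < d" using cd0 cd1 by (auto simp: c_def d_def min_def max_def)
  have \<phi>0: "\<phi> (s, y) = 0" "d_psi \<phi> (s, y) = 0" if "y \<notin> {c<..<d}" for s y
    using cd0(3)[of y s] cd1(3)[of y s] c that by auto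
  have sub: "{0..L} \<times> {c..d} \<subseteq> {0..L} \<times> {0<..}" using c by auto
  have \<phi>c: "continuous_on A \<phi>" "continuous_on A (d_psi \<phi>)" for A
    using test_function_smooth1[OF \<phi>] test_function_smooth1[OF test_function_d_psi[OF \<phi>]]
    by (meson continuous_on_subset differentiable_imp_continuous_on subset_UNIV)+
  have "integral {c..d} (\<lambda>y. h (s, y) * d_psi \<phi> (s, y) + h' (s, y) * \<phi> (s, y)) = 0" if s: "s \<in> {0..L}" for s
  proof -
    have "((\<lambda>y. h (s, y) * d_psi \<phi> (s, y) + h' (s, y) * \<phi> (s, y)) has_integral h (s, d) * \<phi> (s, d) - h (s, c) * \<phi> (s, c)) {c..d}"
    proof (rule fundamental_theorem_of_calculus)
      fix y assume y: "y \<in> {c..d}"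
      from has_field_derivative_at_within[OF DERIV_mult[OF der[OF s, of y] differentiable_partial_psi[OF test_function_smooth1[OF \<phi>]]]]
      show "((\<lambda>y. h (s, y) * \<phi> (s, y)) has_vector_derivative h (s, y) * d_psi \<phi> (s, y) + h' (s, y) * \<phi> (s, y)) (at y within {c..d})"
        using y c by (simp add: has_real_derivative_iff_has_vector_derivative[symmetric] algebra_simps)
    qed (use c in simp)
    then show ?thesis using \<phi>0 by (auto dest: integral_unique)
  qed
  then have "integral {0..L} (\<lambda>s. integral {c..d} (\<lambda>y. h (s, y) * d_psi \<phi> (s, y) + h' (s, y) * \<phi> (s, y))) = integral {0..L} (\<lambda>s. 0)"
    by (intro Henstock_Kurzweil_Integration.integral_cong)
  moreover have "cyl_integral L (\<lambda>x. h x * d_psi \<phi> x) + cyl_integral L (\<lambda>x. h' x * \<phi> x) =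
      integral {0..L} (\<lambda>s. integral {c..d} (\<lambda>y. h (s, y) * d_psi \<phi> (s, y) + h' (s, y) * \<phi> (s, y)))" by (rule cyl_integral_fubini(1)[OF L c(1)])
       (use \<phi>0 in \<open>auto intro!: continuous_on_mult \<phi>c continuous_on_subset[OF h sub] continuous_on_subset[OF h' sub]\<close>)
  ultimately show ?thesis by simp
qed

lemma locally_integrable_continuous:
  assumes "cyl_cont L h"
  shows "locally_integrable L h"
  unfolding locally_integrable_def
proof (intro allI impI)
  fix c d :: real assume cd: "0 < c \<and> c < d"
  have "set_integrable lborel ({0..L} \<times> {c..d}) h"
    unfolding set_integrable_def by (rule borel_integrable_compact) (use cd in \<open>auto intro!: compact_Times continuous_on_subset[OF assms]\<close>)
  then show "set_integrable lborel ({0..<L} \<times> {c..d}) h"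
    by (rule set_integrable_subset) (auto intro!: Times_in_borel)
qed

lemma cyl_ibp_s_funpow:
  assumes L: "L > 0" and \<xi>: "s_test L c d \<xi>" "0 < c"
  shows "(\<And>i. i \<le> a \<Longrightarrow> cyl_cont L (h i)) \<Longrightarrow>
    (\<And>i s y. i < a \<Longrightarrow> s \<in> {0..L} \<Longrightarrow> y > 0 \<Longrightarrow> ((\<lambda>t. h i (t, y)) has_real_derivative h (Suc i) (s, y)) (at s within {0..L})) \<Longrightarrow>
    (\<And>i y. i < a \<Longrightarrow> y > 0 \<Longrightarrow> h i (0, y) = h i (L, y)) \<Longrightarrow>
    cyl_integral L (\<lambda>x. h 0 x * (d_s ^^ a) \<xi> x) =
      (- 1) ^ a * cyl_integral L (\<lambda>x. h a x * \<xi> x)"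
proof (induction a arbitrary: h)
  case (Suc a)
  have "cyl_integral L (\<lambda>x. h 0 x * d_s ((d_s ^^ a) \<xi>) x) =
    - cyl_integral L (\<lambda>x. h (Suc 0) x * (d_s ^^ a) \<xi> x)" by (rule cyl_ibp_s[OF L _ _ _ _ s_test_funpow[OF \<xi>(1)] \<xi>(2)]) (use Suc.prems in auto)
  also have "cyl_integral L (\<lambda>x. h (Suc 0) x * (d_s ^^ a) \<xi> x) =
    (- 1) ^ a * cyl_integral L (\<lambda>x. h (Suc a) x * \<xi> x)" by (rule Suc.IH[of "\<lambda>i. h (Suc i)"]) (use Suc.prems in auto)
  finally show ?case by simp
qed simp

lemma cyl_ibp_psi_funpow:
  assumes L: "L > 0" and \<phi>: "test_function L \<phi>"
  shows "(\<And>i. i \<le> b \<Longrightarrow> cyl_cont L (h i)) \<Longrightarrow>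
    (\<And>i s y. i < b \<Longrightarrow> s \<in> {0..L} \<Longrightarrow> y > 0 \<Longrightarrow> ((\<lambda>t. h i (s, t)) has_real_derivative h (Suc i) (s, y)) (at y)) \<Longrightarrow>
    cyl_integral L (\<lambda>x. h 0 x * (d_psi ^^ b) \<phi> x) =
      (- 1) ^ b * cyl_integral L (\<lambda>x. h b x * \<phi> x)"
proof (induction b arbitrary: h)
  case (Suc b)
  have "cyl_integral L (\<lambda>x. h 0 x * d_psi ((d_psi ^^ b) \<phi>) x) =
    - cyl_integral L (\<lambda>x. h (Suc 0) x * (d_psi ^^ b) \<phi> x)" by (rule cyl_ibp_psi[OF L _ _ _ test_function_funpow_d_psi[OF \<phi>]]) (use Suc.prems in auto)
  also have "cyl_integral L (\<lambda>x. h (Suc 0) x * (d_psi ^^ b) \<phi> x) =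
    (- 1) ^ b * cyl_integral L (\<lambda>x. h (Suc b) x * \<phi> x)" by (rule Suc.IH[of "\<lambda>i. h (Suc i)"]) (use Suc.prems in auto)
  finally show ?case by simp
qed simp

text \<open>The s-derivatives are the outer ones in \<open>partial_deriv\<close>, so they are moved
  first, from the test \<open>(d_psi ^^ b) \<phi>\<close> to the chain \<open>h\<close>; the chain
  \<open>k\<close> of \<psi>-derivatives starts where \<open>h\<close> ends.\<close>

lemma classical_imp_weak_partial:
  assumes L: "L > 0"
    and h: "\<And>i. i \<le> a \<Longrightarrow> cyl_cont L (h i)"
      "\<And>i s y. i < a \<Longrightarrow> s \<in> {0..L} \<Longrightarrow> y > 0 \<Longrightarrow> ((\<lambda>t. h i (t, y)) has_real_derivative h (Suc i) (s, y)) (at s within {0..L})"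
      "\<And>i y. i < a \<Longrightarrow> y > 0 \<Longrightarrow> h i (0, y) = h i (L, y)"
    and k: "k 0 = h a" "\<And>i. i \<le> b \<Longrightarrow> cyl_cont L (k i)"
      "\<And>i s y. i < b \<Longrightarrow> s \<in> {0..L} \<Longrightarrow> y > 0 \<Longrightarrow> ((\<lambda>t. k i (s, t)) has_real_derivative k (Suc i) (s, y)) (at y)"
  shows "has_weak_partial L a b (h 0) (k b)"
  unfolding has_weak_partial_def
proof (intro conjI allI impI locally_integrable_continuous)
  fix \<phi> assume \<phi>: "test_function L \<phi>"
  obtain c d where cd: "0 < c" "s_test L c d ((d_psi ^^ b) \<phi>)"
    using test_function_s_test[OF test_function_funpow_d_psi[OF \<phi>]] by metis
  show "cyl_integral L (\<lambda>x. h 0 x * partial_deriv a b \<phi> x) =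
        (-1) ^ (a + b) * cyl_integral L (\<lambda>x. k b x * \<phi> x)" using cyl_ibp_s_funpow[where h = h and a = a, OF L cd(2,1) h]
      cyl_ibp_psi_funpow[where h = k and b = b, OF L \<phi> k(2,3)] by (simp add: k(1) power_add)
qed (use h k in auto)

text \<open>Both sides of the weak identity are continuous under uniform convergence on the
  cylinder, as each test is integrable. The filter is arbitrary because series over the integers are
  later summed along finite subsets.\<close>

lemma weak_partial_uniform_limit:
  assumes L: "L > 0" and F: "F \<noteq> bot"
    and w: "\<And>n. has_weak_partial L a b (hF n) (gF n)"
    and cF: "\<And>n. cyl_cont L (hF n)" "\<And>n. cyl_cont L (gF n)"
    and c: "cyl_cont L h" "cyl_cont L g"
    and u: "uniform_limit (cylinder L) hF h F" "uniform_limit (cylinder L) gF g F"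
  shows "has_weak_partial L a b h g"
  unfolding has_weak_partial_def
proof (intro conjI allI impI locally_integrable_continuous c)
  fix \<phi> assume \<phi>: "test_function L \<phi>"
  have lim: "((\<lambda>n. cyl_integral L (\<lambda>x. kF n x * \<xi> x)) \<longlongrightarrow> cyl_integral L (\<lambda>x. k x * \<xi> x)) F"
    if kF: "\<And>n. cyl_cont L (kF n)" and k: "cyl_cont L k"
      and u: "uniform_limit (cylinder L) kF k F" and \<xi>: "s_test L c d \<xi>" "0 < c"
    for kF and k \<xi> :: "real \<times> real \<Rightarrow> real" and c d
  proof (rule tendstoI)
    fix e :: real assume e: "e > 0"
    define A where "A = cyl_integral L (\<lambda>x. \<bar>\<xi> x\<bar>)"
    have \<xi>i: "set_integrable lborel (cylinder L) (\<lambda>x. \<bar>\<xi> x\<bar>)"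
      using set_integrable_abs[OF cyl_integrable_continuous_mult[OF L continuous_on_const[of _ 1] \<xi>]] by simp
    have A0: "A \<ge> 0" unfolding A_def set_lebesgue_integral_def by (intro integral_nonneg_AE AE_I2) auto
    have "\<forall>\<^sub>F n in F. \<forall>x\<in>cylinder L. dist (kF n x) (k x) < e / (A + 1)" using u e A0 by (intro uniform_limitD) auto
    then show "\<forall>\<^sub>F n in F. dist (cyl_integral L (\<lambda>x. kF n x * \<xi> x)) (cyl_integral L (\<lambda>x. k x * \<xi> x)) < e"
    proof eventually_elim
      case (elim n)
      note i = cyl_integrable_continuous_mult[OF L kF \<xi>, of n] cyl_integrable_continuous_mult[OF L k \<xi>]
      have "\<bar>cyl_integral L (\<lambda>x. kF n x * \<xi> x) - cyl_integral L (\<lambda>x. k x * \<xi> x)\<bar>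
        = \<bar>cyl_integral L (\<lambda>x. kF n x * \<xi> x - k x * \<xi> x)\<bar>" using set_integral_diff(2)[OF i] by simp
      also have "\<dots> \<le> cyl_integral L (\<lambda>x. \<bar>kF n x * \<xi> x - k x * \<xi> x\<bar>)" using set_integral_norm_bound[OF set_integral_diff(1)[OF i]] by simp
      also have "\<dots> \<le> cyl_integral L (\<lambda>x. e / (A + 1) * \<bar>\<xi> x\<bar>)"
      proof (rule set_integral_mono)
        fix x assume "x \<in> cylinder L"
        then show "\<bar>kF n x * \<xi> x - k x * \<xi> x\<bar> \<le> e / (A + 1) * \<bar>\<xi> x\<bar>" using elim unfolding left_diff_distrib[symmetric] abs_mult dist_real_def
          by (intro mult_right_mono) (auto intro: less_imp_le)
      qed (use i \<xi>i in \<open>auto intro!: set_integrable_abs\<close>)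
      also have "\<dots> = e / (A + 1) * A" by (simp add: A_def)
      also have "\<dots> < e" using e A0 by (simp add: field_simps)
      finally show ?case by (simp add: dist_real_def)
    qed
  qed
  obtain c d where cd: "0 < c" "s_test L c d ((d_psi ^^ b) \<phi>)"
    using test_function_s_test[OF test_function_funpow_d_psi[OF \<phi>]] by metis
  obtain c' d' where cd': "0 < c'" "s_test L c' d' \<phi>"
    using test_function_s_test[OF \<phi>] by metis
  have "((\<lambda>n. cyl_integral L (\<lambda>x. hF n x * partial_deriv a b \<phi> x)) \<longlongrightarrow> (-1) ^ (a + b) * cyl_integral L (\<lambda>x. g x * \<phi> x)) F"
    using tendsto_mult_left[OF lim[OF cF(2) c(2) u(2) cd'(2,1)], of "(-1) ^ (a + b)"] w \<phi> unfolding has_weak_partial_def by simp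
  then show "cyl_integral L (\<lambda>x. h x * partial_deriv a b \<phi> x) =
        (-1) ^ (a + b) * cyl_integral L (\<lambda>x. g x * \<phi> x)" by (rule tendsto_unique[OF F lim[OF cF(1) c(1) u(1) s_test_funpow[OF cd(2)] cd(1)]])
qed

section \<open>Smoothed steps, cuts, ramps and tents\<close>

definition smooth_step :: "real \<Rightarrow> real" where
  "smooth_step = (SOME st. smooth st \<and> (\<forall>x\<le>0. st x = 0) \<and> (\<forall>x\<ge>1. st x = 1) \<and>
     (\<forall>x. 0 \<le> deriv st x) \<and> (\<forall>x. 0 \<le> st x) \<and> (\<forall>x. st x \<le> 1))"

lemma smooth_step:
  shows smooth_smooth_step: "smooth smooth_step"
    and smooth_step_0: "x \<le> 0 \<Longrightarrow> smooth_step x = 0"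
    and smooth_step_1: "x \<ge> 1 \<Longrightarrow> smooth_step x = 1"
    and smooth_step_deriv_nonneg: "0 \<le> deriv smooth_step x"
    and smooth_step_nonneg: "0 \<le> smooth_step x"
    and smooth_step_le_1: "smooth_step x \<le> 1"
proof -
  have "\<exists>st. smooth st \<and> (\<forall>x\<le>0. st x = 0) \<and> (\<forall>x\<ge>1. st x = 1) \<and>
     (\<forall>x. 0 \<le> deriv st x) \<and> (\<forall>x. 0 \<le> st x) \<and> (\<forall>x. st x \<le> 1)" using smooth_step_exists by metis
  from someI_ex[OF this, folded smooth_step_def]
  show "smooth smooth_step" "x \<le> 0 \<Longrightarrow> smooth_step x = 0" "x \<ge> 1 \<Longrightarrow> smooth_step x = 1"
    "0 \<le> deriv smooth_step x" "0 \<le> smooth_step x" "smooth_step x \<le> 1" by auto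
qed

lemma smooth_step_deriv_0: "x \<le> 0 \<or> 1 \<le> x \<Longrightarrow> deriv smooth_step x = 0"
proof (erule disjE)
  show "deriv smooth_step x = 0" if "x \<le> 0"
    by (rule DERIV_local_min[OF smooth_has_deriv[OF smooth_smooth_step], of 1])
       (use that smooth_step_0 smooth_step_nonneg in auto)
  show "deriv smooth_step x = 0" if "1 \<le> x"
    by (rule DERIV_local_max[OF smooth_has_deriv[OF smooth_smooth_step], of 1])
       (use that smooth_step_1 smooth_step_le_1 in auto)
qed

text \<open>A one-sided approximate identity: the derivative of \<open>step j c\<close>, with mass 1
  carried by the interval from \<open>c\<close> to c + 1/(j + 1).\<close>

definition step_delta :: "nat \<Rightarrow> real \<Rightarrow> real \<Rightarrow> real" where
  "step_delta j c y = real (Suc j) * deriv smooth_step (real (Suc j) * (y - c))"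

lemma step_delta_props:
  shows "0 \<le> step_delta j c y" "y \<le> c \<or> y \<ge> c + 1 / real (Suc j) \<Longrightarrow> step_delta j c y = 0" "y \<notin> {c..c+1} \<Longrightarrow> step_delta j c y = 0"
proof -
  show "0 \<le> step_delta j c y" by (simp add: step_delta_def smooth_step_deriv_nonneg)
  show 0: "step_delta j c y = 0" if "y \<le> c \<or> y \<ge> c + 1 / real (Suc j)"
  proof -
    have "real (Suc j) * (y - c) \<le> 0 \<or> 1 \<le> real (Suc j) * (y - c)" using that by (auto simp: mult_nonneg_nonpos) (simp add: field_simps)
    then show ?thesis by (simp add: step_delta_def smooth_step_deriv_0)
  qed
  have "1 / real (Suc j) \<le> 1" by simp
  moreover have "y < c \<or> c + 1 < y" if "y \<notin> {c..c+1}" using that by auto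
  ultimately show "step_delta j c y = 0" if "y \<notin> {c..c+1}" using that by (intro 0) linarith
qed

definition step :: "nat \<Rightarrow> real \<Rightarrow> real \<Rightarrow> real" where
  "step j c y = smooth_step (real (Suc j) * (y - c))"

lemma smooth_step_at: "smooth (step j c)"
  using smooth_affine[OF smooth_smooth_step, of "real (Suc j)" "- real (Suc j) * c"] by (simp add: step_def[abs_def] algebra_simps)

lemma step_deriv: "(step j c has_real_derivative step_delta j c y) (at y)"
  using affine_deriv[OF smooth_has_deriv[OF smooth_smooth_step], of "real (Suc j)" "- real (Suc j) * c" y]
  by (simp add: algebra_simps step_delta_def step_def[abs_def])

lemma step_bounds: "0 \<le> step j c y" "step j c y \<le> 1" "y \<le> c \<Longrightarrow> step j c y = 0" "y \<ge> c + 1 \<Longrightarrow> step j c y = 1"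
proof -
  show "0 \<le> step j c y" "step j c y \<le> 1" "y \<le> c \<Longrightarrow> step j c y = 0"
    by (simp_all add: step_def smooth_step_nonneg smooth_step_le_1 smooth_step_0 mult_nonneg_nonpos)
  show "step j c y = 1" if "y \<ge> c + 1"
    using mult_mono[of 1 "real (Suc j)" 1 "y - c"] that by (simp add: step_def smooth_step_1 del: of_nat_Suc)
qed

lemma step_delta_continuous: "continuous_on A (step_delta j c)"
proof -
  have "deriv (step j c) = step_delta j c" by (intro ext DERIV_imp_deriv step_deriv)
  then show ?thesis using smooth_continuous[OF smooth_deriv[OF smooth_step_at[of j c]]] by simp
qed

lemma step_delta_integral: "(step_delta j c has_integral 1) {c..c+1}"
proof -
  have "(step_delta j c has_integral step j c (c + 1) - step j c c) {c..c+1}"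
    by (rule fundamental_theorem_of_calculus)
       (simp, rule has_real_derivative_iff_has_vector_derivative[THEN iffD1], rule has_field_derivative_at_within, rule step_deriv)
  then show ?thesis by (simp add: step_bounds)
qed

lemma step_delta_limit:
  assumes L: "L > 0" and c: "c > 0" and F: "cyl_cont L F"
  shows "(\<lambda>j. cyl_integral L (\<lambda>x. F x * step_delta j c (snd x))) \<longlonglongrightarrow> integral {0..L} (\<lambda>s. F (s, c))"
proof (rule LIMSEQ_I)
  fix e :: real assume e: "e > 0"
  define K where "K = {0..L} \<times> {c..c+1}"
  have Kc: "continuous_on K F" using c by (auto simp: K_def intro: continuous_on_subset[OF F])
  have "compact K" by (auto simp: K_def intro: compact_Times)
  then have "uniformly_continuous_on K F" using Kc compact_uniformly_continuous by blast
  then obtain \<delta> where \<delta>: "\<delta> > 0" "\<And>x y. x \<in> K \<Longrightarrow> y \<in> K \<Longrightarrow> dist x y < \<delta> \<Longrightarrow> dist (F x) (F y) < e / (2 * L)"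
    unfolding uniformly_continuous_on_def using e L by (metis divide_pos_pos mult_pos_pos zero_less_numeral)
  obtain N where N: "inverse (real (Suc N)) < \<delta>" using reals_Archimedean[OF \<delta>(1)] by blast
  show "\<exists>N. \<forall>j\<ge>N. norm (cyl_integral L (\<lambda>x. F x * step_delta j c (snd x)) - integral {0..L} (\<lambda>s. F (s, c))) < e"
  proof (intro exI[of _ N] allI impI)
    fix j assume j: "N \<le> j"
    have j\<delta>: "1 / real (Suc j) < \<delta>" "1 / real (Suc j) \<le> 1"
    proof -
      have "1 / real (Suc j) \<le> 1 / real (Suc N)" using j by (intro divide_left_mono) auto
      then show "1 / real (Suc j) < \<delta>" using N by (simp add: inverse_eq_divide)
    qed simp
    have B: "cbox (0, c) (L, c+1) = K" by (auto simp: K_def cbox_Pair_eq)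
    have sd: "continuous_on A (\<lambda>x::real\<times>real. step_delta j c (snd x))" for A
      by (rule continuous_on_compose2[OF step_delta_continuous[of UNIV]]) (auto intro: continuous_intros)
    have Fc': "continuous_on K (\<lambda>x. F (fst x, c))" by (rule continuous_on_compose2[OF Kc]) (auto simp: K_def intro!: continuous_intros)
    have i1: "(\<lambda>x. F x * step_delta j c (snd x)) integrable_on K"
      unfolding B[symmetric] by (rule integrable_continuous) (unfold B, intro continuous_on_mult Kc sd)
    have i2: "(\<lambda>x. F (fst x, c) * step_delta j c (snd x)) integrable_on K"
      unfolding B[symmetric] by (rule integrable_continuous) (unfold B, intro continuous_on_mult Fc' sd)
    have i3: "(\<lambda>x. e / (2 * L) * step_delta j c (snd x)) integrable_on K"
      unfolding B[symmetric] by (rule integrable_continuous) (unfold B, intro continuous_on_mult continuous_on_const sd)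
    have s1: "integral {c..c+1} (\<lambda>y. a * step_delta j c y) = a" for a
      using has_integral_mult_right[OF step_delta_integral, of a j c] by (intro integral_unique) simp
    have "cyl_integral L (\<lambda>x. F x * step_delta j c (snd x)) = integral K (\<lambda>x. F x * step_delta j c (snd x))" unfolding B[symmetric]
    proof (rule cylinder_box_integral(2)[OF L c])
      show "continuous_on ({0..L} \<times> {c..c+1}) (\<lambda>x. F x * step_delta j c (snd x))" using continuous_on_mult[OF Kc sd] by (simp add: K_def)
      show "F (s, y) * step_delta j c (snd (s, y)) = 0" if "y \<notin> {c..c+1}" for s y using that by (simp add: step_delta_props(3))
    qed
    moreover have "integral K (\<lambda>x. F (fst x, c) * step_delta j c (snd x)) = integral {0..L} (\<lambda>s. F (s, c))"
    proof -
      have "integral K (\<lambda>x. F (fst x, c) * step_delta j c (snd x)) = integral (cbox 0 L) (\<lambda>s. integral (cbox c (c+1)) (\<lambda>y. F (s, c) * step_delta j c y))"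
        unfolding B[symmetric] by (subst integral_prod_continuous) (unfold B, auto intro!: continuous_on_mult Fc' sd)
      then show ?thesis by (simp only: cbox_interval s1)
    qed
    moreover have "norm (integral K (\<lambda>x. F x * step_delta j c (snd x) - F (fst x, c) * step_delta j c (snd x))) \<le> integral K (\<lambda>x. e / (2 * L) * step_delta j c (snd x))"
    proof (rule integral_norm_bound_integral)
      fix x assume x: "x \<in> K"
      show "norm (F x * step_delta j c (snd x) - F (fst x, c) * step_delta j c (snd x)) \<le> e / (2 * L) * step_delta j c (snd x)"
      proof (cases "snd x \<le> c + 1 / real (Suc j)")
        case True
        have "x \<in> K" "(fst x, c) \<in> K" "dist x (fst x, c) < \<delta>" using x True j\<delta> by (auto simp: K_def dist_Pair_Pair dist_real_def)
        then have "\<bar>F x - F (fst x, c)\<bar> \<le> e / (2 * L)" using \<delta>(2) unfolding dist_real_def by (meson less_imp_le)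
        then have "\<bar>F x - F (fst x, c)\<bar> * step_delta j c (snd x) \<le> e / (2 * L) * step_delta j c (snd x)" by (rule mult_right_mono) (rule step_delta_props(1))
        then show ?thesis using step_delta_props(1)[of j c "snd x"] unfolding left_diff_distrib[symmetric] by (simp only: abs_mult real_norm_def abs_of_nonneg)
      next
        case False
        then show ?thesis using step_delta_props(2)[where c = c and j = j and y = "snd x"] by simp
      qed
    qed (use i1 i2 i3 in \<open>auto intro: integrable_diff\<close>)
    moreover have "integral K (\<lambda>x. e / (2 * L) * step_delta j c (snd x)) = e / 2"
    proof -
      have "integral K (\<lambda>x. e / (2 * L) * step_delta j c (snd x)) = integral (cbox 0 L) (\<lambda>s. integral (cbox c (c+1)) (\<lambda>y. e / (2 * L) * step_delta j c y))"
        unfolding B[symmetric] by (subst integral_prod_continuous) (unfold B, intro continuous_on_mult continuous_on_const sd, simp)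
      also have "\<dots> = integral {0..L} (\<lambda>s. e / (2 * L))" by (simp only: cbox_interval s1)
      finally show ?thesis using L by simp
    qed
    ultimately show "norm (cyl_integral L (\<lambda>x. F x * step_delta j c (snd x)) - integral {0..L} (\<lambda>s. F (s, c))) < e"
      using e unfolding Henstock_Kurzweil_Integration.integral_diff[OF i1 i2] real_norm_def by linarith
  qed
qed

text \<open>A smooth approximation of the indicator of (c, d]. The limit is half-open because
  \<open>step j c\<close> vanishes at \<open>c\<close> for every \<open>j\<close>, while at each
  point beyond \<open>c\<close> it is eventually 1.\<close>

definition step_cut :: "nat \<Rightarrow> real \<Rightarrow> real \<Rightarrow> real \<Rightarrow> real" where
  "step_cut j c d y = step j c y - step j d y"

lemma step_cut_smooth: "smooth (step_cut j c d)"
  unfolding step_cut_def[abs_def] by (intro smooth_diff smooth_step_at)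

lemma step_cut_deriv: "deriv (step_cut j c d) = (\<lambda>y. step_delta j c y - step_delta j d y)"
  unfolding step_cut_def[abs_def] by (intro ext DERIV_imp_deriv DERIV_diff step_deriv)

lemma step_cut_supp: "c < d \<Longrightarrow> y \<notin> {c..d+1} \<Longrightarrow> step_cut j c d y = 0"
  by (cases "y < c") (auto simp: step_cut_def step_bounds)

lemma step_cut_bump: "0 < c \<Longrightarrow> c < d \<Longrightarrow> bump (step_cut j c d)"
  unfolding bump_def by (intro conjI step_cut_smooth exI[of _ c] exI[of _ "d+1"]) (auto simp: step_cut_supp)

lemma step_cut_bound: "\<bar>step_cut j c d y\<bar> \<le> 1"
  using step_bounds(1,2)[of j c y] step_bounds(1,2)[of j d y] unfolding step_cut_def by linarith

lemma step_limit: "(\<lambda>j. step j c y) \<longlonglongrightarrow> (if y > c then 1 else 0)"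
proof (cases "y > c")
  case True
  then obtain N where N: "inverse (real (Suc N)) < y - c" using reals_Archimedean[of "y - c"] by auto
  have "step j c y = 1" if "j \<ge> N" for j
  proof -
    have "1 \<le> real (Suc N) * (y - c)" using N by (simp add: field_simps)
    also have "\<dots> \<le> real (Suc j) * (y - c)" using that True by (intro mult_right_mono) auto
    finally show ?thesis by (simp add: step_def smooth_step_1)
  qed
  then have "\<forall>\<^sub>F j in sequentially. step j c y = 1" unfolding eventually_sequentially by blast
  then show ?thesis using True by (simp add: tendsto_eventually)
qed (simp add: step_bounds)

lemma step_cut_limit:
  assumes "c < d"
  shows "(\<lambda>j. step_cut j c d y) \<longlonglongrightarrow> indicator {c<..d} y"
  using tendsto_diff[OF step_limit[of c y] step_limit[of d y]] assms
  by (auto simp: step_cut_def indicator_def split: if_splits)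

section \<open>Weak derivatives tested with products of functions of one variable\<close>

lemma bump_limit:
  assumes L: "L > 0" and g: "locally_integrable L g" and cd: "0 < c" "c < d"
    and \<alpha>: "continuous_on UNIV \<alpha>" "\<And>s. \<bar>\<alpha> s\<bar> \<le> 1"
    and \<beta>: "\<And>j. continuous_on UNIV (\<beta> j)" "\<And>j y. \<bar>\<beta> j y\<bar> \<le> B" "\<And>j y. y \<notin> {c..d} \<Longrightarrow> \<beta> j y = 0"
      "\<And>y. (\<lambda>j. \<beta> j y) \<longlonglongrightarrow> \<beta>' y"
  shows "(\<lambda>j. cyl_integral L (\<lambda>x. g x * (\<alpha> (fst x) * \<beta> j (snd x)))) \<longlonglongrightarrow>
      (\<integral>x. cyl_ext L g x * \<beta>' (snd x) * \<alpha> (fst x) \<partial>lborel)"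
    and "integrable lborel (\<lambda>x. cyl_ext L g x * \<beta>' (snd x) * \<alpha> (fst x))"
proof -
  define S where "S = {0..<L} \<times> {c..d}"
  define k where "k x = indicator S x * g x" for x
  have gi: "integrable lborel k"
    using g cd unfolding locally_integrable_def S_def set_integrable_def k_def[abs_def] by simp
  have km [measurable]: "k \<in> borel_measurable borel" using borel_measurable_integrable[OF gi] by simp
  have [measurable]: "\<alpha> \<in> borel_measurable borel" "\<beta> j \<in> borel_measurable borel" for j
    using \<alpha> \<beta> by (auto intro: borel_measurable_continuous_onI)
  have [measurable]: "\<beta>' \<in> borel_measurable borel"
    by (rule borel_measurable_LIMSEQ_metric[of \<beta>]) (use \<beta> in auto)
  have \<beta>'0: "\<beta>' y = 0" if "y \<notin> {c..d}" for y
    using \<beta>(4)[of y] \<beta>(3)[OF that] by (simp add: LIMSEQ_const_iff)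
  have \<beta>'B: "\<bar>\<beta>' y\<bar> \<le> B" for y
    by (rule LIMSEQ_le_const2[OF tendsto_rabs[OF \<beta>(4)]]) (use \<beta>(2) in auto)
  have eq: "indicator (cylinder L) x * p (snd x) = indicator S x * p (snd x)" if "\<And>y. y \<notin> {c..d} \<Longrightarrow> p y = 0" for p :: "real \<Rightarrow> real" and x
    by (cases x) (use that cd in \<open>auto simp: S_def cylinder_def indicator_def\<close>)
  have e1: "indicator (cylinder L) x *\<^sub>R (g x * (\<alpha> (fst x) * \<beta> j (snd x))) = k x * (\<alpha> (fst x) * \<beta> j (snd x))" for x j
    using eq[of "\<beta> j" x, OF \<beta>(3)] by (simp add: k_def mult.left_commute)
  have e2: "cyl_ext L g x * \<beta>' (snd x) = k x * \<beta>' (snd x)" for x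
    using eq[of \<beta>' x, OF \<beta>'0] by (simp add: k_def mult.assoc mult.left_commute)
  have B0: "0 \<le> B" using \<beta>(2)[of 0 0] by linarith
  have Bk: "integrable lborel (\<lambda>x. B * \<bar>k x\<bar>)" using gi by simp
  have bound: "norm (k x * (\<alpha> (fst x) * b)) \<le> B * \<bar>k x\<bar>" if "\<bar>b\<bar> \<le> B" for x b
  proof -
    have "\<bar>\<alpha> (fst x)\<bar> * \<bar>b\<bar> \<le> 1 * B" by (intro mult_mono \<alpha> that) (use B0 in auto)
    from mult_left_mono[OF this, of "\<bar>k x\<bar>"] show ?thesis by (simp add: abs_mult mult_ac)
  qed
  show "integrable lborel (\<lambda>x. cyl_ext L g x * \<beta>' (snd x) * \<alpha> (fst x))"
    unfolding e2
  proof (rule Bochner_Integration.integrable_bound[OF Bk])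
    show "(\<lambda>x. k x * \<beta>' (snd x) * \<alpha> (fst x)) \<in> borel_measurable lborel" by measurable
    show "AE x in lborel. norm (k x * \<beta>' (snd x) * \<alpha> (fst x)) \<le> norm (B * \<bar>k x\<bar>)"
      using bound[OF \<beta>'B] B0 by (intro AE_I2) (simp add: mult.assoc mult.commute[of "\<beta>' _"])
  qed
  show "(\<lambda>j. cyl_integral L (\<lambda>x. g x * (\<alpha> (fst x) * \<beta> j (snd x)))) \<longlonglongrightarrow>
      (\<integral>x. cyl_ext L g x * \<beta>' (snd x) * \<alpha> (fst x) \<partial>lborel)" unfolding set_lebesgue_integral_def e1 e2
  proof (rule integral_dominated_convergence[OF _ _ Bk])
    show "AE x in lborel. (\<lambda>j. k x * (\<alpha> (fst x) * \<beta> j (snd x))) \<longlonglongrightarrow> k x * \<beta>' (snd x) * \<alpha> (fst x)"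
      by (intro AE_I2) (use tendsto_mult_left[OF \<beta>(4)[of "snd _"], of "k _ * \<alpha> (fst _)"] in \<open>simp add: mult_ac\<close>)
    show "AE x in lborel. norm (k x * (\<alpha> (fst x) * \<beta> j (snd x))) \<le> B * \<bar>k x\<bar>" for j by (intro AE_I2 bound \<beta>)
    show "(\<lambda>x. k x * \<beta>' (snd x) * \<alpha> (fst x)) \<in> borel_measurable lborel" by measurable
    show "(\<lambda>x. k x * (\<alpha> (fst x) * \<beta> j (snd x))) \<in> borel_measurable lborel" for j by measurable
  qed
qed

text \<open>The quadrants are stable under intersection and generate the Borel sets, and the sets
  over which \<open>f\<close> integrates to 0 form a Dynkin system, the whole plane being an
  increasing union of quadrants.\<close>

lemma integrals_atMost_zero_imp_AE_zero:
  fixes f :: "real \<times> real \<Rightarrow> real"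
  assumes f: "integrable lborel f" and z: "\<And>a. set_lebesgue_integral lborel {..a} f = 0"
  shows "AE x in lborel. f x = 0"
proof (rule sigma_finite_measure.density_zero[OF sigma_finite_lborel f])
  have si: "set_integrable lborel A f" if "A \<in> sets borel" for A
    using f that unfolding set_integrable_def by (intro integrable_mult_indicator) auto
  have U: "set_lebesgue_integral lborel UNIV f = 0"
  proof -
    have "(\<lambda>n. set_lebesgue_integral lborel {..(real n, real n)} f) \<longlonglongrightarrow> set_lebesgue_integral lborel (\<Union>n. {..(real n, real n)}) f"
    proof (rule set_integral_cont_up)
      show "incseq (\<lambda>n. {..(real n, real n)})" by (auto simp: incseq_def)
    qed (auto intro!: si)
    moreover have "(\<Union>n. {..(real n, real n)}) = UNIV"
    proof -
      have "\<exists>n. (a, b) \<le> (real n, real n)" for a b using real_arch_simple[of "max a b"] by auto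
      then show ?thesis by auto
    qed
    ultimately show ?thesis using z by (simp add: LIMSEQ_const_iff)
  qed
  fix A :: "(real \<times> real) set" assume "A \<in> sets lborel"
  then have AA: "A \<in> sigma_sets UNIV (range atMost)"
    by (simp add: borel_eq_atMost)
  have "Int_stable (range (atMost :: real \<times> real \<Rightarrow> _))"
  proof -
    have "{..a} \<inter> {..b} = {..(min (fst a) (fst b), min (snd a) (snd b))}" for a b :: "real \<times> real" by (cases a; cases b) auto
    then show ?thesis unfolding Int_stable_def by blast
  qed
  from this subset_Pow_Union[of "range atMost", THEN subset_trans, OF Pow_mono[OF subset_UNIV]] AA show "set_lebesgue_integral lborel A f = 0"
  proof (induction rule: sigma_sets_induct_disjoint)
    case (union A)
    have A: "A i \<in> sets borel" for i using union(2) by (auto simp: borel_eq_atMost)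
    show ?case by (subst lebesgue_integral_countable_add) (use union A in \<open>auto simp: disjoint_family_on_def intro!: si\<close>)
  next
    case (compl A)
    then have "A \<in> sets borel" by (simp add: borel_eq_atMost)
    then have "set_lebesgue_integral lborel (A \<union> (UNIV - A)) f = set_lebesgue_integral lborel A f + set_lebesgue_integral lborel (UNIV - A) f"
      by (intro set_integral_Un si) auto
    moreover have "A \<union> (UNIV - A) = UNIV" by auto
    ultimately show ?case using U compl by simp
  qed (use z in \<open>auto simp: set_lebesgue_integral_def\<close>)
qed

text \<open>If the b-th derivatives of the cut-offs are combinations of approximate point masses,
  the left side of the weak identity tends to a combination of slices of \<open>Q\<close>. A weak
  \<psi>-derivative thus becomes a statement about finite differences of Q (s, e) at fixed heights,
  tested in \<open>s\<close> alone: cuts serve for b = 1, tents for b = 2.\<close>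

lemma weak_partial_trig_limit:
  fixes k :: "real \<Rightarrow> real"
  assumes L: "L > 0" and Q: "cyl_cont L Q" and w: "has_weak_partial L a b Q g" and \<alpha>: "\<alpha> \<in> trig L"
    and cd: "0 < c" "c < d" and \<beta>: "\<And>j. smooth (\<beta> j)" "\<And>j y. \<bar>\<beta> j y\<bar> \<le> B" "\<And>j y. y \<notin> {c..d} \<Longrightarrow> \<beta> j y = 0" "\<And>y. (\<lambda>j. \<beta> j y) \<longlonglongrightarrow> \<beta>' y"
    and E: "finite E" "\<And>e. e \<in> E \<Longrightarrow> 0 < e" "\<And>j y. (deriv ^^ b) (\<beta> j) y = (\<Sum>e\<in>E. k e * step_delta j e y)"
  shows "(\<Sum>e\<in>E. k e * integral {0..L} (\<lambda>s. Q (s, e) * (deriv ^^ a) \<alpha> s)) =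
      (- 1) ^ (a + b) * (\<integral>x. cyl_ext L g x * \<beta>' (snd x) * \<alpha> (fst x) \<partial>lborel)"
    and "integrable lborel (\<lambda>x. cyl_ext L g x * \<beta>' (snd x))"
proof -
  let ?A = "(deriv ^^ a) \<alpha>"
  have \<alpha>s: "smooth \<alpha>" "smooth ?A" using \<alpha> by (auto intro: trig_smooth smooth_funpow_deriv)
  have g: "locally_integrable L g" using w by (simp add: has_weak_partial_def)
  note lim = bump_limit[OF L g cd smooth_continuous[OF \<alpha>s(1)] trig_le_1[OF \<alpha>] smooth_continuous[OF \<beta>(1)] \<beta>(2-4)]
  show "integrable lborel (\<lambda>x. cyl_ext L g x * \<beta>' (snd x))"
    using bump_limit(2)[OF L g cd continuous_on_const _ smooth_continuous[OF \<beta>(1)] \<beta>(2-4), of 1] by simp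
  define F where "F x = Q x * ?A (fst x)" for x
  have Fc: "cyl_cont L F"
    unfolding F_def by (intro continuous_on_mult Q continuous_on_compose2[OF smooth_continuous[OF \<alpha>s(2), of UNIV]] continuous_intros) auto
  have int: "set_integrable lborel (cylinder L) (\<lambda>x. F x * step_delta j e (snd x))" if "0 < e" for j e
  proof (rule cylinder_box_integral(1)[OF L that, where d = "e+1"])
    show "continuous_on ({0..L} \<times> {e..e+1}) (\<lambda>x. F x * step_delta j e (snd x))"
      using that by (intro continuous_on_mult continuous_on_subset[OF Fc] continuous_on_compose2[OF step_delta_continuous[of UNIV]] continuous_intros) auto
  qed (simp add: step_delta_props(3))
  have "(\<Sum>e\<in>E. k e * cyl_integral L (\<lambda>x. F x * step_delta j e (snd x))) = (- 1) ^ (a + b) * cyl_integral L (\<lambda>x. g x * (\<alpha> (fst x) * \<beta> j (snd x)))" for j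
  proof -
    have "bump (\<beta> j)" unfolding bump_def using \<beta>(1,3) cd by blast
    then have "test_function L (\<lambda>(s, \<psi>). \<alpha> s * \<beta> j \<psi>)" by (intro test_function_product \<alpha>s trig_periodic[OF \<alpha> L])
    then have "cyl_integral L (\<lambda>x. Q x * partial_deriv a b (\<lambda>(s, \<psi>). \<alpha> s * \<beta> j \<psi>) x) =
        (-1) ^ (a + b) * cyl_integral L (\<lambda>x. g x * (\<lambda>(s, \<psi>). \<alpha> s * \<beta> j \<psi>) x)" using w unfolding has_weak_partial_def by blast
    moreover have "Q x * partial_deriv a b (\<lambda>(s, \<psi>). \<alpha> s * \<beta> j \<psi>) x = (\<Sum>e\<in>E. k e * (F x * step_delta j e (snd x)))" for x
      unfolding partial_deriv_product[OF \<alpha>s(1) \<beta>(1)] by (cases x) (simp add: E(3) F_def sum_distrib_left mult_ac)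
    moreover have "cyl_integral L (\<lambda>x. \<Sum>e\<in>E. k e * (F x * step_delta j e (snd x))) = (\<Sum>e\<in>E. k e * cyl_integral L (\<lambda>x. F x * step_delta j e (snd x)))"
      using int[OF E(2)] unfolding set_lebesgue_integral_def set_integrable_def scaleR_sum_right
      by (subst Bochner_Integration.integral_sum) (simp_all add: mult.left_commute[of _ "k _"])
    ultimately show ?thesis by (simp add: case_prod_unfold)
  qed
  then have "(\<lambda>j. (- 1) ^ (a + b) * cyl_integral L (\<lambda>x. g x * (\<alpha> (fst x) * \<beta> j (snd x)))) \<longlonglongrightarrow> (\<Sum>e\<in>E. k e * integral {0..L} (\<lambda>s. F (s, e)))"
    using tendsto_sum[OF tendsto_mult_left[OF step_delta_limit[OF L E(2) Fc]], of E "\<lambda>e. e" k] by simp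
  from LIMSEQ_unique[OF this tendsto_mult_left[OF lim(1)]]
  show "(\<Sum>e\<in>E. k e * integral {0..L} (\<lambda>s. Q (s, e) * ?A s)) =
      (- 1) ^ (a + b) * (\<integral>x. cyl_ext L g x * \<beta>' (snd x) * \<alpha> (fst x) \<partial>lborel)" by (simp add: F_def)
qed

lemma slice_trig_integrable:
  assumes "cyl_cont L Q" "\<alpha> \<in> trig L" "e > 0"
  shows "(\<lambda>s. Q (s, e) * (deriv ^^ a) \<alpha> s) integrable_on {0..L}"
  using assms by (intro integrable_continuous_real continuous_on_mult continuous_on_compose2[OF assms(1)] continuous_intros
      smooth_continuous smooth_funpow_deriv trig_smooth) auto

lemma weak_partial_trig_step:
  assumes L: "L > 0" and Q: "cyl_cont L Q" and w: "has_weak_partial L a 1 Q g"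
    and \<alpha>: "\<alpha> \<in> trig L" and cd: "0 < c" "c < d"
  shows "integral {0..L} (\<lambda>s. (Q (s, d) - Q (s, c)) * (deriv ^^ a) \<alpha> s) =
    (- 1) ^ a * (\<integral>x. cyl_ext L g x * indicator {c<..d} (snd x) * \<alpha> (fst x) \<partial>lborel)"
    and "integrable lborel (\<lambda>x. cyl_ext L g x * indicator {c<..d} (snd x))"
proof -
  note lim = weak_partial_trig_limit[OF L Q w \<alpha>, of c "d + 1" "\<lambda>j. step_cut j c d" 1 "indicator {c<..d}" "{c, d}" "\<lambda>e. if e = c then 1 else - 1"]
  have "(\<Sum>e\<in>{c, d}. (if e = c then 1 else - 1) * integral {0..L} (\<lambda>s. Q (s, e) * (deriv ^^ a) \<alpha> s)) =
      (- 1) ^ (a + 1) * (\<integral>x. cyl_ext L g x * indicator {c<..d} (snd x) * \<alpha> (fst x) \<partial>lborel)"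
    by (rule lim(1)) (use cd in \<open>auto simp: step_cut_smooth step_cut_bound step_cut_supp step_cut_limit step_cut_deriv\<close>)
  then show "integral {0..L} (\<lambda>s. (Q (s, d) - Q (s, c)) * (deriv ^^ a) \<alpha> s) =
    (- 1) ^ a * (\<integral>x. cyl_ext L g x * indicator {c<..d} (snd x) * \<alpha> (fst x) \<partial>lborel)"
    using cd Henstock_Kurzweil_Integration.integral_diff[OF slice_trig_integrable[OF Q \<alpha>] slice_trig_integrable[OF Q \<alpha>], of d c a a]
    by (simp add: left_diff_distrib)
  show "integrable lborel (\<lambda>x. cyl_ext L g x * indicator {c<..d} (snd x))"
    by (rule lim(2)) (use cd in \<open>auto simp: step_cut_smooth step_cut_bound step_cut_supp step_cut_limit step_cut_deriv\<close>)
qed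

text \<open>A smoothed positive part of y - c. The primitive is chosen once, at c = 0, and
  translated, so that all ramps with the same \<open>j\<close> share one profile; this is what makes
  the constants cancel in \<open>ramp_tent_supp\<close>.\<close>

definition ramp :: "nat \<Rightarrow> real \<Rightarrow> real \<Rightarrow> real" where
  "ramp j c y = (SOME F. (\<forall>y. (F has_real_derivative step j 0 y) (at y)) \<and> F 0 = 0) (y - c)"

lemma ramp_deriv: "(ramp j c has_real_derivative step j c y) (at y)"
  and ramp_0: "ramp j c c = 0"
proof -
  obtain F where F: "\<And>y. (F has_real_derivative step j 0 y) (at y)"
    using smooth_antiderivative[OF smooth_step_at[of j 0]] by blast
  define R where "R = (SOME F. (\<forall>y. (F has_real_derivative step j 0 y) (at y)) \<and> F 0 = 0)"
  have "\<exists>F. (\<forall>y. (F has_real_derivative step j 0 y) (at y)) \<and> F 0 = 0"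
    by (rule exI[of _ "\<lambda>y. F y - F 0"]) (auto intro!: derivative_eq_intros F)
  from someI_ex[OF this, folded R_def] have R: "\<And>y. (R has_real_derivative step j 0 y) (at y)" "R 0 = 0" by auto
  have "ramp j c = (\<lambda>y. R (1 * y + - c))" by (simp add: ramp_def[abs_def] R_def)
  moreover have "((\<lambda>y. R (1 * y + - c)) has_real_derivative 1 * step j 0 (1 * y + - c)) (at y)" by (rule affine_deriv[OF R(1)])
  ultimately show "(ramp j c has_real_derivative step j c y) (at y)" "ramp j c c = 0" by (simp_all add: step_def R(2))
qed

lemma ramp_below: "y \<le> c \<Longrightarrow> ramp j c y = 0"
  using DERIV_isconst_end'[of y c "ramp j c"] ramp_deriv step_bounds(3) ramp_0 by metis

lemma ramp_above:
  assumes "y \<ge> c + 1 / real (Suc j)"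
  shows "ramp j c y - y = ramp j c (c + 1 / real (Suc j)) - (c + 1 / real (Suc j))"
proof -
  have "((\<lambda>y. ramp j c y - y) has_real_derivative step j c y - 1) (at y)" for y
    by (intro DERIV_diff ramp_deriv DERIV_ident)
  moreover have "step j c y = 1" if "y \<ge> c + 1 / real (Suc j)" for y
    using that by (simp add: step_def smooth_step_1 field_simps)
  ultimately show ?thesis using DERIV_isconst_end'[OF assms, of "\<lambda>y. ramp j c y - y"] by (metis diff_self)
qed

lemma ramp_close: "\<bar>ramp j c y - max 0 (y - c)\<bar> \<le> 1 / real (Suc j)"
proof -
  have mono: "ramp j c x \<le> ramp j c y" if "x \<le> y" for x y
    by (rule DERIV_nonneg_imp_nondecreasing[OF that]) (use ramp_deriv step_bounds(1) in blast)
  have mono': "x - ramp j c x \<le> y - ramp j c y" if "x \<le> y" for x y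
    by (rule DERIV_nonneg_imp_nondecreasing[OF that], rule exI[of _ "1 - step j c _"]) (auto intro!: DERIV_diff DERIV_ident ramp_deriv simp: step_bounds)
  define d where "d = c + 1 / real (Suc j)"
  have d: "c \<le> d" "1 / real (Suc j) = d - c" by (auto simp: d_def)
  consider "y \<le> c" | "c \<le> y" "y \<le> d" | "d \<le> y" using d by linarith
  then show ?thesis
    unfolding d(2) using ramp_below[of y c j] ramp_above[of c j y, folded d_def] mono[of c y] mono[of y d] mono[of c d] mono'[of c y] mono'[of y d] mono'[of c d] ramp_0[of j c] d
    by cases auto
qed

definition ramp_tent :: "nat \<Rightarrow> real \<Rightarrow> real \<Rightarrow> real \<Rightarrow> real" where
  "ramp_tent j p r y = ramp j (p + r) y - 2 * ramp j p y + ramp j (p - r) y"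

text \<open>The Peano kernel of the second difference: integrating h'' against it gives h(p + r) - 2
  h(p) + h(p - r).\<close>

definition tent :: "real \<Rightarrow> real \<Rightarrow> real \<Rightarrow> real" where
  "tent p r y = max 0 (r - \<bar>y - p\<bar>)"

lemma tent_eq: "r > 0 \<Longrightarrow> tent p r y = max 0 (y - (p + r)) - 2 * max 0 (y - p) + max 0 (y - (p - r))"
  by (auto simp: tent_def max_def abs_if)

lemma ramp_tent_deriv: "(ramp_tent j p r has_real_derivative step j (p + r) y - 2 * step j p y + step j (p - r) y) (at y)"
  unfolding ramp_tent_def[abs_def] by (intro DERIV_add DERIV_diff DERIV_cmult ramp_deriv)

lemma ramp_tent_smooth: "smooth (ramp_tent j p r)"
  by (rule smoothI[OF ramp_tent_deriv]) (intro smooth_add smooth_diff smooth_mult smooth_const smooth_step_at)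

lemma ramp_tent_deriv2: "(deriv ^^ 2) (ramp_tent j p r) = (\<lambda>y. step_delta j (p + r) y - 2 * step_delta j p y + step_delta j (p - r) y)"
proof -
  have "deriv (ramp_tent j p r) = (\<lambda>y. step j (p + r) y - 2 * step j p y + step j (p - r) y)"
    by (intro ext DERIV_imp_deriv ramp_tent_deriv)
  then show ?thesis
    by (auto simp: numeral_2_eq_2 intro!: ext DERIV_imp_deriv DERIV_add DERIV_diff DERIV_cmult step_deriv)
qed

lemma ramp_tent_close:
  assumes "r > 0" shows "\<bar>ramp_tent j p r y - tent p r y\<bar> \<le> 4 / real (Suc j)"
  using ramp_close[of j "p + r" y] ramp_close[of j p y] ramp_close[of j "p - r" y]
  unfolding tent_eq[OF assms] ramp_tent_def abs_le_iff by (simp del: of_nat_Suc; linarith)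

text \<open>To the right of its transition a ramp is y plus a constant that depends affinely on
  \<open>c\<close>, and the coefficients 1, -2, 1 annihilate affine functions of
  \<open>c\<close>.\<close>

lemma ramp_tent_supp:
  assumes "r > 0" "y \<notin> {p - r..p + r + 1}" shows "ramp_tent j p r y = 0"
proof (cases "y < p - r")
  case True
  then show ?thesis using assms(1) by (simp add: ramp_tent_def ramp_below)
next
  case False
  have *: "ramp j c (c + 1 / real (Suc j)) = ramp j 0 (0 + 1 / real (Suc j))" for c by (simp add: ramp_def)
  have "1 / real (Suc j) \<le> 1" by simp
  moreover have "p + r + 1 < y" using False assms by auto
  ultimately have "y \<ge> c + 1 / real (Suc j)" if "c \<le> p + r" for c using that by linarith
  then show ?thesis
    using ramp_above[of "p + r" j y] ramp_above[of p j y] ramp_above[of "p - r" j y] *[of "p + r"] *[of p] *[of "p - r"] assms(1)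
    unfolding ramp_tent_def by (simp del: of_nat_Suc; linarith)
qed

lemma tent_le: "r > 0 \<Longrightarrow> 0 \<le> tent p r y" "r > 0 \<Longrightarrow> tent p r y \<le> r" "\<bar>y - p\<bar> \<ge> r \<Longrightarrow> tent p r y = 0"
  by (auto simp: tent_def)

lemma ramp_tent_limit:
  assumes "r > 0" shows "(\<lambda>j. ramp_tent j p r y) \<longlonglongrightarrow> tent p r y"
proof -
  have "(\<lambda>j. 4 / real (Suc j)) \<longlonglongrightarrow> 0" by (rule lim_const_over_n[THEN LIMSEQ_Suc])
  then have "(\<lambda>j. ramp_tent j p r y - tent p r y) \<longlonglongrightarrow> 0"
    by (rule Lim_null_comparison[rotated]) (use ramp_tent_close[OF assms] in auto)
  then show ?thesis by (simp add: LIM_zero_iff)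
qed

lemma weak_partial_trig_tent:
  assumes L: "L > 0" and Q: "cyl_cont L Q" and w: "has_weak_partial L a 2 Q g"
    and \<alpha>: "\<alpha> \<in> trig L" and r: "0 < r" "r < p"
  shows "integral {0..L} (\<lambda>s. (Q (s, p + r) - 2 * Q (s, p) + Q (s, p - r)) * (deriv ^^ a) \<alpha> s) =
    (- 1) ^ a * (\<integral>x. cyl_ext L g x * tent p r (snd x) * \<alpha> (fst x) \<partial>lborel)"
    and "integrable lborel (\<lambda>x. cyl_ext L g x * tent p r (snd x))"
proof -
  have B: "\<bar>ramp_tent j p r y\<bar> \<le> 4 + r" for j y
  proof -
    have "4 / real (Suc j) \<le> 4 / 1" by (intro divide_left_mono) auto
    then show ?thesis using ramp_tent_close[OF r(1), of j p y] tent_le(1,2)[OF r(1), of p y] by linarith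
  qed
  note lim = weak_partial_trig_limit[OF L Q w \<alpha>, of "p - r" "p + r + 1" "\<lambda>j. ramp_tent j p r" "4 + r" "tent p r" "{p + r, p, p - r}" "\<lambda>e. if e = p then - 2 else 1"]
  let ?I = "\<lambda>e. integral {0..L} (\<lambda>s. Q (s, e) * (deriv ^^ a) \<alpha> s)"
  have "(\<Sum>e\<in>{p + r, p, p - r}. (if e = p then - 2 else 1) * ?I e) =
      (- 1) ^ (a + 2) * (\<integral>x. cyl_ext L g x * tent p r (snd x) * \<alpha> (fst x) \<partial>lborel)"
    by (rule lim(1)) (use r B in \<open>auto simp: ramp_tent_smooth ramp_tent_supp ramp_tent_limit ramp_tent_deriv2\<close>)
  then have "?I (p + r) - 2 * ?I p + ?I (p - r) = (- 1) ^ a * (\<integral>x. cyl_ext L g x * tent p r (snd x) * \<alpha> (fst x) \<partial>lborel)"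
    using r by simp
  moreover have "((\<lambda>s. Q (s, p + r) * (deriv ^^ a) \<alpha> s - 2 * (Q (s, p) * (deriv ^^ a) \<alpha> s) + Q (s, p - r) * (deriv ^^ a) \<alpha> s) has_integral ?I (p + r) - 2 * ?I p + ?I (p - r)) {0..L}"
    using r by (intro has_integral_add has_integral_diff has_integral_mult_right integrable_integral slice_trig_integrable[OF Q \<alpha>]) auto
  ultimately show "integral {0..L} (\<lambda>s. (Q (s, p + r) - 2 * Q (s, p) + Q (s, p - r)) * (deriv ^^ a) \<alpha> s) =
    (- 1) ^ a * (\<integral>x. cyl_ext L g x * tent p r (snd x) * \<alpha> (fst x) \<partial>lborel)" by (auto dest!: integral_unique simp: algebra_simps)
  show "integrable lborel (\<lambda>x. cyl_ext L g x * tent p r (snd x))"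
    by (rule lim(2)) (use r B in \<open>auto simp: ramp_tent_smooth ramp_tent_supp ramp_tent_limit ramp_tent_deriv2\<close>)
qed

text \<open>Products of trigonometric functions and cuts suffice as tests. For G = g1 - g2 they show
  that on each strip (c, d] the primitive of \<open>G\<close> in \<open>s\<close> vanishes, so
  \<open>G\<close> restricted to the strip has integral 0 over every quadrant. Countably many strips
  exhaust the cylinder.\<close>

lemma weak_partial_unique:
  assumes L: "L > 0" and w: "has_weak_partial L a b h g1" "has_weak_partial L a b h g2"
  shows "AE x in lborel. x \<in> cylinder L \<longrightarrow> g1 x = g2 x"
proof -
  define G where "G x = g1 x - g2 x" for x
  have li: "locally_integrable L g1" "locally_integrable L g2" using w by (auto simp: has_weak_partial_def)
  have G: "locally_integrable L G"
    using li unfolding locally_integrable_def G_def by auto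
  have rect: "integrable lborel (\<lambda>x. cyl_ext L G x * indicator {c<..d} (snd x))"
    "(\<integral>x. cyl_ext L G x * indicator {c<..d} (snd x) * indicator {..s} (fst x) \<partial>lborel) = 0"
    if cd: "0 < c" "c < d" for c d s
  proof -
    note lim = bump_limit[OF L _ cd(1), of _ "d+1" _ "\<lambda>j. step_cut j c d" 1 "indicator {c<..d}"]
    note sc = smooth_continuous[OF step_cut_smooth] step_cut_bound step_cut_supp step_cut_limit
    show I: "integrable lborel (\<lambda>x. cyl_ext L G x * indicator {c<..d} (snd x))" using cd G lim(2)[of _ "\<lambda>_. 1"] by (auto simp: sc)
    have z: "(\<integral>x. cyl_ext L G x * indicator {c<..d} (snd x) * \<alpha> (fst x) \<partial>lborel) = 0" if \<alpha>: "\<alpha> \<in> trig L" for \<alpha>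
    proof -
      have *: "(\<lambda>j. cyl_integral L (\<lambda>x. g x * (\<alpha> (fst x) * step_cut j c d (snd x)))) \<longlonglongrightarrow>
          (\<integral>x. cyl_ext L g x * indicator {c<..d} (snd x) * \<alpha> (fst x) \<partial>lborel)"
        "integrable lborel (\<lambda>x. cyl_ext L g x * indicator {c<..d} (snd x) * \<alpha> (fst x))" if "locally_integrable L g" for g
        using cd by (intro lim that sc smooth_continuous[OF trig_smooth[OF \<alpha>]] trig_le_1[OF \<alpha>]; simp)+
      have "cyl_integral L (\<lambda>x. g1 x * (\<alpha> (fst x) * step_cut j c d (snd x))) =
        cyl_integral L (\<lambda>x. g2 x * (\<alpha> (fst x) * step_cut j c d (snd x)))" for j
      proof -
        have "test_function L (\<lambda>(s, y). \<alpha> s * step_cut j c d y)" by (intro test_function_product trig_smooth[OF \<alpha>] trig_periodic[OF \<alpha> L] step_cut_bump cd)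
        from w(1)[unfolded has_weak_partial_def, THEN conjunct2, THEN conjunct2, rule_format, OF this]
             w(2)[unfolded has_weak_partial_def, THEN conjunct2, THEN conjunct2, rule_format, OF this]
        show ?thesis by (simp add: case_prod_unfold)
      qed
      then have "(\<integral>x. cyl_ext L g1 x * indicator {c<..d} (snd x) * \<alpha> (fst x) \<partial>lborel) =
        (\<integral>x. cyl_ext L g2 x * indicator {c<..d} (snd x) * \<alpha> (fst x) \<partial>lborel)" using *(1)[OF li(1)] *(1)[OF li(2)] LIMSEQ_unique by simp
      then show ?thesis using Bochner_Integration.integral_diff[OF *(2)[OF li(1)] *(2)[OF li(2)]] by (simp add: G_def algebra_simps)
    qed
    define G' where "G' = (\<lambda>x. cyl_ext L G x * indicator {c<..d} (snd x))"
    have supp: "G' x = 0" if "fst x \<notin> {0..<L}" for x using that by (cases x) (auto simp: G'_def cylinder_def)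
    have main: "(\<integral>x. G' x * indicator {..s} (fst x) \<partial>lborel) = 0" if "s \<in> {0..L}" for s
    proof -
      have "integral {0..L} (\<lambda>s. 0 * deriv \<alpha> s) = - (\<integral>x. G' x * \<alpha> (fst x) \<partial>lborel)" if "\<alpha> \<in> trig L" for \<alpha> using z[OF that] by (simp add: G'_def)
      from weak_deriv_trig_imp_primitive[where D = "\<lambda>_. 0", OF L continuous_on_const refl I[folded G'_def] supp this that]
      show ?thesis by simp
    qed
    have "(\<integral>x. G' x * indicator {..s} (fst x) \<partial>lborel) = 0" for s
    proof -
      consider "s < 0" | "s \<in> {0..L}" | "s > L" by fastforce
      then show ?thesis
      proof cases
        case 1
        then have e: "G' x * indicator {..s} (fst x) = 0" for x using supp[of x] by (auto simp: indicator_def)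
        show ?thesis by (simp only: e Bochner_Integration.integral_zero)
      next
        case 3
        then have e: "G' x * indicator {..s} (fst x) = G' x * indicator {..L} (fst x)" for x using supp[of x] by (auto simp: indicator_def)
        show ?thesis unfolding e by (rule main) (use L in simp)
      qed (use main in auto)
    qed
    then show "(\<integral>x. cyl_ext L G x * indicator {c<..d} (snd x) * indicator {..s} (fst x) \<partial>lborel) = 0" by (simp add: G'_def)
  qed
  have "AE x in lborel. cyl_ext L G x * indicator {c<..d} (snd x) = 0" if cd: "0 < c" "c < d" for c d
  proof (rule integrals_atMost_zero_imp_AE_zero[OF rect(1)[OF cd]])
    fix a :: "real \<times> real"
    obtain s t where a: "a = (s, t)" by (cases a)
    show "set_lebesgue_integral lborel {..a} (\<lambda>x. cyl_ext L G x * indicator {c<..d} (snd x)) = 0"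
    proof (cases "t \<le> c")
      case True
      then have e: "indicator {..a} x *\<^sub>R (cyl_ext L G x * indicator {c<..d} (snd x)) = 0" for x by (cases x) (auto simp: a indicator_def)
      show ?thesis by (simp only: set_lebesgue_integral_def e Bochner_Integration.integral_zero)
    next
      case False
      have e: "indicator {..a} x *\<^sub>R (cyl_ext L G x * indicator {c<..d} (snd x)) =
         cyl_ext L G x * indicator {c<..min d t} (snd x) * indicator {..s} (fst x)" for x by (cases x) (auto simp: a indicator_def)
      show ?thesis unfolding set_lebesgue_integral_def e by (rule rect(2)) (use False cd in auto)
    qed
  qed
  then have "AE x in lborel. \<forall>n. cyl_ext L G x * indicator {1 / real (n + 2)<..real (n + 2)} (snd x) = 0"
    unfolding AE_all_countable by (intro allI) (simp add: field_simps add_pos_nonneg)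
  then show ?thesis
  proof eventually_elim
    case (elim x)
    show ?case
    proof
      assume x: "x \<in> cylinder L"
      from cylinder_exhaustion[OF x] obtain n where "snd x \<in> {1 / real (n + 2)<..real (n + 2)}" by force
      then show "g1 x = g2 x" using elim[rule_format, of n] x by (simp add: G_def)
    qed
  qed
qed

section \<open>Measurability and integrability from the weights\<close>

lemma indicator_fst_measurable [measurable]:
    "A \<in> sets borel \<Longrightarrow> (\<lambda>x. indicator A (fst x) :: real) \<in> borel_measurable (borel :: (real \<times> real) measure)"
  and indicator_snd_measurable [measurable]:
    "A \<in> sets borel \<Longrightarrow> (\<lambda>x. indicator A (snd x) :: real) \<in> borel_measurable (borel :: (real \<times> real) measure)"
  by (rule measurable_compose[OF measurable_fst_real2 borel_measurable_indicator], assumption)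
     (rule measurable_compose[OF measurable_snd_real2 borel_measurable_indicator], assumption)

text \<open>\<open>g\<close> is arbitrary off the cylinder and integrable only on strips away from
  \<psi> = 0, so measurability is obtained for the extension by zero, as a limit along an
  exhaustion.\<close>

lemma cylinder_measurable_mult:
  assumes "locally_integrable L g"
  shows "(cyl_ext L g) \<in> borel_measurable lborel"
proof (rule borel_measurable_LIMSEQ_real)
  let ?S = "\<lambda>n. {0..<L} \<times> {1 / real (n + 2)..real (n + 2)}"
  show "(\<lambda>x. indicator (?S n) x * g x) \<in> borel_measurable lborel" for n
  proof -
    have "1 / real (n + 2) < real (n + 2)" by (simp add: field_simps add_pos_nonneg)
    then have "set_integrable lborel (?S n) g" using assms unfolding locally_integrable_def by simp
    then have "integrable lborel (\<lambda>x. indicator (?S n) x * g x)" by (simp add: set_integrable_def)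
    then show ?thesis by (rule borel_measurable_integrable)
  qed
  fix x :: "real \<times> real"
  show "(\<lambda>n. indicator (?S n) x * g x) \<longlonglongrightarrow> cyl_ext L g x"
  proof (cases "x \<in> cylinder L")
    case False
    have "x \<notin> ?S n" for n
    proof
      assume "x \<in> ?S n"
      then have "1 / real (n + 2) \<le> snd x" "fst x \<in> {0..<L}" by (cases x, simp)+
      moreover have "0 < 1 / real (n + 2)" by simp
      ultimately have "0 < snd x" by linarith
      then show False using False \<open>fst x \<in> {0..<L}\<close> by (cases x) (simp add: cylinder_def)
    qed
    then show ?thesis using False by simp
  next
    case True
    from cylinder_exhaustion[OF this] obtain N where "\<forall>n\<ge>N. 1 / real (n + 2) < snd x \<and> snd x \<le> real (n + 2)" by blast
    then have "x \<in> ?S n" if "n \<ge> N" for n using True that by (cases x) (force simp: cylinder_def)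
    then have "\<forall>\<^sub>F n in sequentially. indicator (?S n) x * g x = cyl_ext L g x" using True unfolding eventually_sequentially by (intro exI[of _ N]) auto
    then show ?thesis by (rule tendsto_eventually)
  qed
qed

lemma integrable_inverse_square: "integrable lborel (\<lambda>y. indicator {0..} y * (1 / (1 + y)\<^sup>2) :: real)"
proof (rule integrableI_nonneg)
  have "(\<integral>\<^sup>+ y. ennreal (1 / (1 + y)\<^sup>2) * indicator {0..} y \<partial>lborel) = ennreal (0 - (- 1 / (1 + 0)))"
  proof (rule nn_integral_FTC_atLeast[where F = "\<lambda>y. - 1 / (1 + y)"])
    show "((\<lambda>y::real. - 1 / (1 + y)) has_real_derivative 1 / (1 + y)\<^sup>2) (at y)" if "0 \<le> y" for y
      using that by (auto intro!: derivative_eq_intros simp: power2_eq_square)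
    have "filterlim (\<lambda>y::real. 1 + y) at_top at_top" by (rule filterlim_tendsto_add_at_top[OF tendsto_const filterlim_ident])
    then have "((\<lambda>y::real. (- 1) * inverse (1 + y)) \<longlongrightarrow> (- 1) * 0) at_top"
      by (intro tendsto_mult_left filterlim_compose[OF tendsto_inverse_0_at_top filterlim_ident] tendsto_inverse_0_at_top)
    then show "((\<lambda>y::real. - 1 / (1 + y)) \<longlongrightarrow> 0) at_top" by (simp add: divide_inverse)
  qed auto
  moreover have "ennreal (indicator {0..} y * (1 / (1 + y)\<^sup>2)) = ennreal (1 / (1 + y)\<^sup>2) * indicator {0..} y" for y :: real
    by (simp add: indicator_def)
  ultimately show "(\<integral>\<^sup>+ y. ennreal (indicator {0..} y * (1 / (1 + y)\<^sup>2)) \<partial>lborel) < \<infinity>" by simp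
qed auto

text \<open>Cauchy-Schwarz in the form |g| \<le> ((1 + \<psi>) g)^2 + (1 + \<psi>)^(-2); the last
  term is integrable over the half-cylinder because \<open>s\<close> ranges over a bounded
  interval.\<close>

lemma weighted_integrable_imp_integrable:
  assumes li: "locally_integrable L g" and w: "set_integrable lborel (cylinder L) (weighted_square 1 g)"
  shows "integrable lborel (cyl_ext L g)"
proof (rule Bochner_Integration.integrable_bound)
  have h: "integrable lborel (\<lambda>s. indicator {0..L} s * 1 :: real)"
    by (simp add: integrable_indicator_iff emeasure_lborel_Icc_eq)
  show "integrable lborel (\<lambda>x. indicator (cylinder L) x * weighted_square 1 g x + (\<lambda>(s, y). (indicator {0..L} s * 1) * (indicator {0..} y * (1 / (1 + y)\<^sup>2))) x)"
    by (rule Bochner_Integration.integrable_add)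
       (use w integrable_pair_product[OF h integrable_inverse_square] in \<open>simp_all add: set_integrable_def lborel_prod\<close>)
  show "AE x in lborel. norm (cyl_ext L g x) \<le>
     norm (indicator (cylinder L) x * weighted_square 1 g x + (\<lambda>(s, y). (indicator {0..L} s * 1) * (indicator {0..} y * (1 / (1 + y)\<^sup>2))) x)"
  proof (intro AE_I2)
    fix x :: "real \<times> real"
    obtain s y where x: "x = (s, y)" by (cases x)
    show "norm (cyl_ext L g x) \<le>
     norm (indicator (cylinder L) x * weighted_square 1 g x + (\<lambda>(s, y). (indicator {0..L} s * 1) * (indicator {0..} y * (1 / (1 + y)\<^sup>2))) x)"
    proof (cases "x \<in> cylinder L")
      case True
      then have y: "y > 0" "0 \<le> s" "s < L" by (auto simp: x cylinder_def)
      have "2 * (\<bar>(1 + y) * g x\<bar> * (1 / (1 + y))) \<le> \<bar>(1 + y) * g x\<bar>\<^sup>2 + (1 / (1 + y))\<^sup>2"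
        using sum_squares_bound[of "\<bar>(1 + y) * g x\<bar>" "1 / (1 + y)"] by (simp only: mult.assoc)
      moreover have "\<bar>(1 + y) * g x\<bar> * (1 / (1 + y)) = \<bar>g x\<bar>" using y by (simp only: abs_mult) (simp add: field_simps)
      ultimately have *: "2 * \<bar>g x\<bar> \<le> ((1 + y) * g x)\<^sup>2 + 1 / (1 + y)\<^sup>2" by (simp only: power2_abs power_divide power_one)
      have "\<bar>g x\<bar> \<le> 2 * \<bar>g x\<bar>" by simp
      from order_trans[OF this *] have "\<bar>g x\<bar> \<le> ((1 + y) * g x)\<^sup>2 + 1 / (1 + y)\<^sup>2" .
      then show ?thesis using True y by (simp add: x weighted_square_def)
    qed simp
  qed
qed (rule cylinder_measurable_mult[OF li])

section \<open>Second differences as averages of the second derivative\<close>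

lemma has_integral_tent:
  assumes "r > 0"
  shows "(tent p r has_integral r\<^sup>2) {p - r..p + r}"
proof -
  have "((\<lambda>y. y - (p - r)) has_integral ((\<lambda>y. (y - (p - r))\<^sup>2 / 2) p - (\<lambda>y. (y - (p - r))\<^sup>2 / 2) (p - r))) {p - r..p}"
    by (rule fundamental_theorem_of_calculus)
       (use assms in \<open>auto intro!: derivative_eq_intros simp flip: has_real_derivative_iff_has_vector_derivative\<close>)
  then have "(tent p r has_integral r\<^sup>2 / 2) {p - r..p}"
    by (rule has_integral_eq[rotated, THEN subst[where P = "\<lambda>I. (_ has_integral I) _", rotated]]) (auto simp: tent_def)
  moreover have "((\<lambda>y. p + r - y) has_integral ((\<lambda>y. - (p + r - y)\<^sup>2 / 2) (p + r) - (\<lambda>y. - (p + r - y)\<^sup>2 / 2) p)) {p..p + r}"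
    by (rule fundamental_theorem_of_calculus)
       (use assms in \<open>auto intro!: derivative_eq_intros simp: field_simps simp flip: has_real_derivative_iff_has_vector_derivative\<close>)
  then have "(tent p r has_integral r\<^sup>2 / 2) {p..p + r}"
    by (rule has_integral_eq[rotated, THEN subst[where P = "\<lambda>I. (_ has_integral I) _", rotated]]) (auto simp: tent_def)
  ultimately have "(tent p r has_integral r\<^sup>2 / 2 + r\<^sup>2 / 2) {p - r..p + r}"
    by (rule has_integral_combine[of "p - r" p "p + r", rotated 2]) (use assms in auto)
  then show ?thesis by simp
qed

lemma tent_continuous: "continuous_on A (tent p r)"
  unfolding tent_def[abs_def] by (intro continuous_intros)

lemma integral_tent_box:
  assumes r: "r > 0" and s: "s1 \<le> s2"
  shows "integrable lborel (\<lambda>x::real\<times>real. tent p r (snd x) * indicator {s1<..s2} (fst x))"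
    and "(\<integral>x. tent p r (snd x) * indicator {s1<..s2} (fst x) \<partial>(lborel :: (real \<times> real) measure)) = r\<^sup>2 * (s2 - s1)"
proof -
  have h: "integrable lborel (indicator {s1<..s2} :: real \<Rightarrow> real)" using s by simp
  have "tent p r y = indicator {p - r..p + r} y * tent p r y" for y
    using r by (auto simp: tent_def indicator_def)
  then have e: "tent p r = (\<lambda>y. indicator {p - r..p + r} y * tent p r y)" by blast
  have "set_integrable lborel {p - r..p + r} (tent p r)"
    by (rule borel_integrable_atLeastAtMost'[OF tent_continuous])
  then have t: "integrable lborel (tent p r)" "(\<integral>y. tent p r y \<partial>lborel) = r\<^sup>2"
    using set_borel_integral_eq_integral(2)[of "{p - r..p + r}" "tent p r"] integral_unique[OF has_integral_tent[OF r, of p]]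
    by (simp_all add: set_integrable_def set_lebesgue_integral_def flip: e)
  have i: "integrable (lborel \<Otimes>\<^sub>M lborel) (\<lambda>(s, y). indicator {s1<..s2} s * tent p r y)"
    by (rule integrable_pair_product[OF h t(1)])
  then show "integrable lborel (\<lambda>x::real\<times>real. tent p r (snd x) * indicator {s1<..s2} (fst x))"
    by (simp add: lborel_prod case_prod_unfold mult.commute)
  have "(\<integral>x. (case x of (s, y) \<Rightarrow> indicator {s1<..s2} s * tent p r y) \<partial>(lborel \<Otimes>\<^sub>M lborel)) =
     (\<integral>s. (\<integral>y. indicator {s1<..s2} s * tent p r y \<partial>lborel) \<partial>lborel)" using lborel_pair.integral_fst[OF i] by simp
  also have "\<dots> = r\<^sup>2 * (s2 - s1)" using s t by simp
  finally show "(\<integral>x. tent p r (snd x) * indicator {s1<..s2} (fst x) \<partial>(lborel :: (real \<times> real) measure)) = r\<^sup>2 * (s2 - s1)"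
    by (simp add: lborel_prod case_prod_unfold mult.commute)
qed

definition second_diff :: "(real \<times> real \<Rightarrow> real) \<Rightarrow> real \<Rightarrow> real \<Rightarrow> real \<Rightarrow> real" where
  "second_diff Q s p r = Q (s, p + r) - 2 * Q (s, p) + Q (s, p - r)"

text \<open>\<open>H\<close> is the second \<psi>-derivative of \<open>Q\<close> in the sense of
  distributions, tested with tents times indicators of s-intervals: exactly the averages that
  control a second difference. The condition r < p keeps the tent inside \<psi> > 0.\<close>

definition distributional_psi2 :: "real \<Rightarrow> (real \<times> real \<Rightarrow> real) \<Rightarrow> (real \<times> real \<Rightarrow> real) \<Rightarrow> bool" where
  "distributional_psi2 L Q H \<longleftrightarrow> continuous_on (UNIV \<times> {0..}) Q \<and> integrable lborel H \<and>
     (\<forall>s1 s2 p r. 0 \<le> s1 \<longrightarrow> s1 \<le> s2 \<longrightarrow> s2 \<le> L \<longrightarrow> 0 < r \<longrightarrow> r < p \<longrightarrow>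
       integral {s1..s2} (\<lambda>s. second_diff Q s p r) = (\<integral>x. H x * tent p r (snd x) * indicator {s1<..s2} (fst x) \<partial>lborel))"

lemma second_diff_continuous:
  assumes Q: "continuous_on (UNIV \<times> {0..}) Q" and r: "0 < r" "r \<le> p"
  shows "continuous_on A (\<lambda>s. second_diff Q s p r)"
  unfolding second_diff_def
  by (intro continuous_intros continuous_on_compose2[OF Q]) (use r in auto)

lemma tent_mult_integrable:
  assumes H: "integrable lborel H" and r: "r > 0"
  shows "integrable lborel (\<lambda>x::real\<times>real. H x * tent p r (snd x) * indicator {s1<..s2} (fst x))"
proof (rule Bochner_Integration.integrable_bound)
  show "integrable lborel (\<lambda>x. r * \<bar>H x\<bar>)" using H by simp
  have [measurable]: "tent p r \<in> borel_measurable borel" by (rule borel_measurable_continuous_onI[OF tent_continuous])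
  have [measurable]: "H \<in> borel_measurable borel" using borel_measurable_integrable[OF H] by simp
  show "(\<lambda>x::real\<times>real. H x * tent p r (snd x) * indicator {s1<..s2} (fst x)) \<in> borel_measurable lborel" by measurable
  show "AE x in lborel. norm (H x * tent p r (snd x) * indicator {s1<..s2} (fst x)) \<le> norm (r * \<bar>H x\<bar>)"
  proof (intro AE_I2)
    fix x :: "real \<times> real"
    have "\<bar>H x\<bar> * \<bar>tent p r (snd x)\<bar> \<le> \<bar>H x\<bar> * r" using tent_le(1,2)[OF r, of p "snd x"] by (intro mult_left_mono) auto
    then show "norm (H x * tent p r (snd x) * indicator {s1<..s2} (fst x)) \<le> norm (r * \<bar>H x\<bar>)" using r by (auto simp: abs_mult indicator_def mult.commute)
  qed
qed

text \<open>Averaging over an interval (s1, s0] uses the bound on \<open>H\<close> only in the past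
  of \<open>s0\<close>; continuity of the second difference in \<open>s\<close> leads from the
  average to \<open>s0\<close>. The factor r^2 is the mass of the tent.\<close>

lemma second_diff_le_of_AE_le:
  assumes Q: "distributional_psi2 L Q H" and s0: "0 < s0" "s0 \<le> L" and r: "0 < r" "r < p" and \<delta>: "0 < \<delta>"
    and ae: "AE x in lborel. s0 - \<delta> < fst x \<longrightarrow> fst x < s0 \<longrightarrow> p - r < snd x \<longrightarrow> snd x < p + r \<longrightarrow> H x \<le> b"
  shows "second_diff Q s0 p r \<le> b * r\<^sup>2"
proof (rule ccontr)
  assume "\<not> second_diff Q s0 p r \<le> b * r\<^sup>2"
  then have gt: "second_diff Q s0 p r > b * r\<^sup>2" by simp
  have Qc: "continuous_on (UNIV \<times> {0..}) Q" and Hi: "integrable lborel H"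
    using Q by (auto simp: distributional_psi2_def)
  have c: "continuous_on UNIV (\<lambda>s. second_diff Q s p r)"
    by (rule second_diff_continuous[OF Qc]) (use r in auto)
  define \<eta> where "\<eta> = (second_diff Q s0 p r - b * r\<^sup>2) / 2"
  have \<eta>: "\<eta> > 0" using gt by (simp add: \<eta>_def)
  obtain \<delta>' where \<delta>': "\<delta>' > 0" "\<And>s. \<bar>s - s0\<bar> < \<delta>' \<Longrightarrow> \<bar>second_diff Q s p r - second_diff Q s0 p r\<bar> < \<eta>"
    using c \<eta> unfolding continuous_on_iff dist_real_def by (metis UNIV_I)
  define s1 where "s1 = max (s0 / 2) (s0 - min \<delta> \<delta>' / 2)"
  have s1: "0 \<le> s1" "s1 < s0" "s0 - \<delta> < s1" "s0 - \<delta>' < s1" using s0 \<delta> \<delta>'(1) by (auto simp: s1_def)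
  have "(b * r\<^sup>2 + \<eta>) * (s0 - s1) = integral {s1..s0} (\<lambda>s. b * r\<^sup>2 + \<eta>)" using s1 by simp
  also have "\<dots> \<le> integral {s1..s0} (\<lambda>s. second_diff Q s p r)"
  proof (intro integral_le integrable_continuous_real continuous_on_const continuous_on_subset[OF c])
    fix s assume "s \<in> {s1..s0}"
    then have "\<bar>s - s0\<bar> < \<delta>'" using s1 by auto
    from \<delta>'(2)[OF this] show "b * r\<^sup>2 + \<eta> \<le> second_diff Q s p r" by (simp add: \<eta>_def field_simps abs_if split: if_splits)
  qed auto
  also have "\<dots> = (\<integral>x. H x * tent p r (snd x) * indicator {s1<..s0} (fst x) \<partial>lborel)"
    using Q s1 s0 r unfolding distributional_psi2_def by simp
  also have "\<dots> \<le> (\<integral>x. b * (tent p r (snd x) * indicator {s1<..s0} (fst x)) \<partial>lborel)"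
  proof (rule integral_mono_AE)
    show "integrable lborel (\<lambda>x. b * (tent p r (snd x) * indicator {s1<..s0} (fst x)))" using integral_tent_box(1)[OF r(1), of s1 s0 p] s1 by simp
    show "AE x in lborel. H x * tent p r (snd x) * indicator {s1<..s0} (fst x) \<le> b * (tent p r (snd x) * indicator {s1<..s0} (fst x))"
      using ae AE_fst_neq[of s0]
    proof eventually_elim
      case (elim x)
      show ?case
      proof (cases "s1 < fst x \<and> fst x \<le> s0 \<and> p - r < snd x \<and> snd x < p + r")
        case True
        then have "H x \<le> b" using elim s1 by auto
        then show ?thesis using True tent_le(1)[OF r(1), of p "snd x"] by (simp add: mult_right_mono)
      next
        case False
        then have "tent p r (snd x) = 0 \<or> indicator {s1<..s0} (fst x) = (0::real)" using r by (auto simp: tent_def indicator_def)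
        then show ?thesis by auto
      qed
    qed
  qed (rule tent_mult_integrable[OF Hi r(1)])
  also have "\<dots> = b * r\<^sup>2 * (s0 - s1)"
    using integral_tent_box(2)[OF r(1), of s1 s0 p] s1 by simp
  finally have "(b * r\<^sup>2 + \<eta>) * (s0 - s1) \<le> b * r\<^sup>2 * (s0 - s1)" .
  then have "\<eta> * (s0 - s1) \<le> 0" by (simp add: algebra_simps)
  then show False using \<eta> s1 by (simp add: mult_le_0_iff)
qed

lemma distributional_psi2_linear:
  assumes "distributional_psi2 L Q1 H1" "distributional_psi2 L Q2 H2"
  shows "distributional_psi2 L (\<lambda>x. a * Q1 x + b * Q2 x) (\<lambda>x. a * H1 x + b * H2 x)"
  unfolding distributional_psi2_def
proof (intro conjI allI impI)
  have Q: "continuous_on (UNIV \<times> {0..}) Q1" "continuous_on (UNIV \<times> {0..}) Q2" "integrable lborel H1" "integrable lborel H2"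
    using assms by (auto simp: distributional_psi2_def)
  show "continuous_on (UNIV \<times> {0..}) (\<lambda>x. a * Q1 x + b * Q2 x)" by (intro continuous_intros Q)
  show "integrable lborel (\<lambda>x. a * H1 x + b * H2 x)" using Q by simp
  fix s1 s2 p r :: real assume h: "0 \<le> s1" "s1 \<le> s2" "s2 \<le> L" "0 < r" "r < p"
  have "integral {s1..s2} (\<lambda>s. a * second_diff Q1 s p r + b * second_diff Q2 s p r) =
      a * integral {s1..s2} (\<lambda>s. second_diff Q1 s p r) + b * integral {s1..s2} (\<lambda>s. second_diff Q2 s p r)"
    using h by (subst Henstock_Kurzweil_Integration.integral_add)
      (auto intro!: integrable_continuous_real continuous_intros second_diff_continuous Q)
  also have "\<dots> = a * (\<integral>x. H1 x * tent p r (snd x) * indicator {s1<..s2} (fst x) \<partial>lborel) + b * (\<integral>x. H2 x * tent p r (snd x) * indicator {s1<..s2} (fst x) \<partial>lborel)"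
    using assms h by (simp add: distributional_psi2_def)
  also have "\<dots> = (\<integral>x. a * (H1 x * tent p r (snd x) * indicator {s1<..s2} (fst x)) + b * (H2 x * tent p r (snd x) * indicator {s1<..s2} (fst x)) \<partial>lborel)"
    using tent_mult_integrable[OF Q(3) h(4), of p s1 s2] tent_mult_integrable[OF Q(4) h(4), of p s1 s2] by simp
  finally show "integral {s1..s2} (\<lambda>s. second_diff (\<lambda>x. a * Q1 x + b * Q2 x) s p r) =
     (\<integral>x. (a * H1 x + b * H2 x) * tent p r (snd x) * indicator {s1<..s2} (fst x) \<partial>lborel)" by (simp add: second_diff_def algebra_simps)
qed

text \<open>Weakly D'' = G, so D' is \<open>J\<close> plus a constant, and periodicity of
  \<open>D\<close> makes that constant minus the mean of \<open>J\<close>. The test with 1 shows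
  that \<open>G\<close> has total integral 0, hence J L = 0 and \<open>J\<close> is itself
  periodic.\<close>

lemma weak_mixed_partial_imp_primitive:
  fixes D :: "real \<Rightarrow> real" and G :: "real \<times> real \<Rightarrow> real"
  assumes L: "L > 0" and D: "continuous_on {0..L} D" "D 0 = D L"
    and G: "integrable lborel G" and supp: "\<And>x. fst x \<notin> {0..<L} \<Longrightarrow> G x = 0"
    and weak: "\<And>\<alpha>. \<alpha> \<in> trig L \<Longrightarrow> integral {0..L} (\<lambda>s. D s * (deriv ^^ 2) \<alpha> s) = (\<integral>x. G x * \<alpha> (fst x) \<partial>lborel)"
    and s: "s \<in> {0..L}"
  defines "J \<equiv> \<lambda>s. \<integral>x. G x * indicator {..s} (fst x) \<partial>lborel"
  shows "D s - D 0 = integral {0..s} (\<lambda>s. J s - integral {0..L} J / L)"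
proof -
  have Jc: "continuous_on A J" for A
    unfolding J_def by (rule trig_primitive_integrable(2)[OF L G supp])
  have d1: "deriv (\<lambda>s::real. 1::real) = (\<lambda>s. 0)" "deriv (\<lambda>s::real. 0::real) = (\<lambda>s. 0)"
    by (auto intro!: ext DERIV_imp_deriv)
  have primG: "trig_primitive L J (\<lambda>\<alpha>. \<integral>x. G x * \<alpha> (fst x) \<partial>lborel)"
    unfolding J_def by (rule trig_primitive_integrable(1)[OF L G supp])
  have G0: "(\<integral>x. G x \<partial>lborel) = 0" using weak[OF trig_one] by (simp add: numeral_2_eq_2 d1)
  have JL: "J L = 0" using primG trig_one[of L] G0 by (fastforce simp: trig_primitive_def d1)
  have T: "- integral {0..L} (\<lambda>s. D s * deriv \<gamma> s) = integral {0..L} (\<lambda>s. (J s - integral {0..L} J / L) * \<gamma> s)" if \<gamma>: "\<gamma> \<in> trig L" for \<gamma>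
  proof -
    from trig_trichotomy[OF \<gamma> L] consider "\<gamma> = (\<lambda>s. 1)" | "\<gamma> = (\<lambda>s. 0)" | \<alpha> k where "\<alpha> \<in> trig L" "k \<noteq> 0" "deriv \<alpha> = (\<lambda>s. k * \<gamma> s)" by blast
    then show ?thesis
    proof cases
      case 1
      have "integral {0..L} (\<lambda>s. J s - integral {0..L} J / L) = integral {0..L} J - integral {0..L} (\<lambda>s. integral {0..L} J / L)"
        by (intro Henstock_Kurzweil_Integration.integral_diff integrable_continuous_real Jc continuous_on_const)
      then show ?thesis using L by (simp add: 1 d1)
    next
      case 2
      then show ?thesis by (simp add: d1)
    next
      case (3 \<alpha> k)
      have dd: "(deriv ^^ 2) \<alpha> = (\<lambda>s. k * deriv \<gamma> s)"
        unfolding numeral_2_eq_2 by (simp add: 3(3)) (intro ext DERIV_imp_deriv DERIV_cmult smooth_has_deriv[OF trig_smooth[OF \<gamma>]])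
      have \<gamma>c: "continuous_on A \<gamma>" for A using \<gamma> by (auto intro: smooth_continuous trig_smooth)
      have "k * integral {0..L} (\<lambda>s. D s * deriv \<gamma> s) = (\<integral>x. G x * \<alpha> (fst x) \<partial>lborel)"
        using weak[OF 3(1)] unfolding dd by (simp only: mult.left_commute[of _ k] Henstock_Kurzweil_Integration.integral_mult_right)
      also have "\<dots> = - integral {0..L} (\<lambda>s. J s * deriv \<alpha> s)" using primG[unfolded trig_primitive_def] 3(1) trig_one G0 JL by simp
      also have "\<dots> = - (k * integral {0..L} (\<lambda>s. J s * \<gamma> s))"
        unfolding 3(3) by (simp only: mult.left_commute[of _ k] Henstock_Kurzweil_Integration.integral_mult_right)
      finally have "k * integral {0..L} (\<lambda>s. D s * deriv \<gamma> s) = k * (- integral {0..L} (\<lambda>s. J s * \<gamma> s))" by (simp only: mult_minus_right)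
      then have 1: "integral {0..L} (\<lambda>s. D s * deriv \<gamma> s) = - integral {0..L} (\<lambda>s. J s * \<gamma> s)" using 3(2) mult_left_cancel by blast
      have "integral {0..L} (\<lambda>s. k * \<gamma> s) = 0" using trig_deriv_integral_0[OF L 3(1)] by (simp only: 3(3))
      then have z: "integral {0..L} \<gamma> = 0" using 3(2) by simp
      have "integral {0..L} (\<lambda>s. (J s - integral {0..L} J / L) * \<gamma> s) = integral {0..L} (\<lambda>s. J s * \<gamma> s) - integral {0..L} (\<lambda>s. integral {0..L} J / L * \<gamma> s)"
        unfolding left_diff_distrib
        by (intro Henstock_Kurzweil_Integration.integral_diff integrable_continuous_real continuous_on_mult Jc \<gamma>c continuous_on_const)
      also have "\<dots> = integral {0..L} (\<lambda>s. J s * \<gamma> s)" by (simp only: Henstock_Kurzweil_Integration.integral_mult_right z mult_zero_right diff_zero)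
      finally show ?thesis using 1 by simp
    qed
  qed
  show ?thesis
    by (rule trig_primitive_unique[OF L trig_primitive_weak[OF L D] trig_primitive_continuous[OF L] T s])
       (simp, intro continuous_intros Jc)
qed

section \<open>Mass on far strips and on thin strips\<close>

lemma integral_snd_tail_tendsto_0:
  fixes G :: "real \<times> real \<Rightarrow> real"
  assumes G: "integrable lborel G"
  shows "((\<lambda>c. \<integral>x. \<bar>G x\<bar> * indicator {c<..} (snd x) \<partial>lborel) \<longlongrightarrow> 0) at_top"
proof -
  have [measurable]: "G \<in> borel_measurable borel" using borel_measurable_integrable[OF G] by simp
  have "((\<lambda>c. \<integral>x. \<bar>G x\<bar> * indicator {c<..} (snd x) \<partial>lborel) \<longlongrightarrow> (\<integral>x. 0 \<partial>(lborel :: (real\<times>real) measure))) at_top"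
  proof (rule integral_dominated_convergence_at_top[where w = "\<lambda>x. \<bar>G x\<bar>"])
    show "AE x in lborel. ((\<lambda>c. \<bar>G x\<bar> * indicator {c<..} (snd x)) \<longlongrightarrow> 0) at_top"
    proof (intro AE_I2)
      fix x :: "real \<times> real"
      have "\<forall>\<^sub>F c in at_top. \<bar>G x\<bar> * indicator {c<..} (snd x) = 0" using eventually_ge_at_top[of "snd x"] by eventually_elim auto
      then show "((\<lambda>c. \<bar>G x\<bar> * indicator {c<..} (snd x)) \<longlongrightarrow> 0) at_top" by (rule tendsto_eventually)
    qed
    show "\<forall>\<^sub>F c in at_top. AE x in lborel. norm (\<bar>G x\<bar> * indicator {c<..} (snd x)) \<le> \<bar>G x\<bar>" by (intro always_eventually allI AE_I2) (simp add: indicator_def)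
    show "(\<lambda>x. \<bar>G x\<bar> * indicator {c<..} (snd x)) \<in> borel_measurable lborel" for c by measurable
  qed (use G in auto)
  then show ?thesis by simp
qed

lemma integral_snd_strip_tendsto_0:
  fixes G :: "real \<times> real \<Rightarrow> real"
  assumes G: "integrable lborel G"
  shows "((\<lambda>r. \<integral>x. \<bar>G x\<bar> * indicator {p - r<..<p + r} (snd x) \<partial>lborel) \<longlongrightarrow> 0) (at_right 0)"
proof (rule tendsto_at_right_sequentially[of 0 1])
  have [measurable]: "G \<in> borel_measurable borel" using borel_measurable_integrable[OF G] by simp
  fix S :: "nat \<Rightarrow> real" assume S: "\<And>n. 0 < S n" "S \<longlonglongrightarrow> 0"
  have "(\<lambda>n. \<integral>x. \<bar>G x\<bar> * indicator {p - S n<..<p + S n} (snd x) \<partial>lborel) \<longlonglongrightarrow> (\<integral>x. 0 \<partial>(lborel :: (real\<times>real) measure))"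
  proof (rule integral_dominated_convergence[where w = "\<lambda>x. \<bar>G x\<bar>"])
    show "AE x in lborel. (\<lambda>n. \<bar>G x\<bar> * indicator {p - S n<..<p + S n} (snd x)) \<longlonglongrightarrow> 0" using AE_snd_neq[of p]
    proof eventually_elim
      case (elim x)
      then have "\<forall>\<^sub>F n in sequentially. S n < \<bar>snd x - p\<bar>" using S(2) by (intro order_tendstoD(2)) auto
      then have "\<forall>\<^sub>F n in sequentially. \<bar>G x\<bar> * indicator {p - S n<..<p + S n} (snd x) = 0" by eventually_elim (auto simp: indicator_def)
      then show ?case by (rule tendsto_eventually)
    qed
    show "AE x in lborel. norm (\<bar>G x\<bar> * indicator {p - S n<..<p + S n} (snd x)) \<le> \<bar>G x\<bar>" for n by (intro AE_I2) (simp add: indicator_def)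
    show "(\<lambda>x. \<bar>G x\<bar> * indicator {p - S n<..<p + S n} (snd x)) \<in> borel_measurable lborel" for n by measurable
  qed (use G in auto)
  then show "(\<lambda>n. \<integral>x. \<bar>G x\<bar> * indicator {p - S n<..<p + S n} (snd x) \<partial>lborel) \<longlonglongrightarrow> 0" by simp
qed simp

lemma tent_integral_bound:
  fixes G :: "real \<times> real \<Rightarrow> real"
  assumes G: "integrable lborel G" and r: "r > 0"
  shows "\<bar>\<integral>x. G x * tent p r (snd x) * indicator A (fst x) \<partial>lborel\<bar> \<le> r * (\<integral>x. \<bar>G x\<bar> * indicator {p - r<..<p + r} (snd x) \<partial>lborel)"
proof -
  have Gm: "G \<in> borel_measurable borel" using borel_measurable_integrable[OF G] by simp
  have i: "integrable lborel (\<lambda>x. r * (\<bar>G x\<bar> * indicator {p - r<..<p + r} (snd x)))"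
  proof (rule integrable_mult_right, rule Bochner_Integration.integrable_bound[OF integrable_abs[OF G]])
    show "(\<lambda>x. \<bar>G x\<bar> * indicator {p - r<..<p + r} (snd x)) \<in> borel_measurable lborel"
      using borel_measurable_times[OF borel_measurable_abs[OF Gm] indicator_snd_measurable[OF borel_open[OF open_greaterThanLessThan[of "p - r" "p + r"]]]] by simp
  qed (auto simp: indicator_def)
  show ?thesis
  proof (cases "integrable lborel (\<lambda>x. G x * tent p r (snd x) * indicator A (fst x))")
    case True
    have "\<bar>\<integral>x. G x * tent p r (snd x) * indicator A (fst x) \<partial>lborel\<bar> \<le> (\<integral>x. \<bar>G x * tent p r (snd x) * indicator A (fst x)\<bar> \<partial>lborel)"
      by (rule integral_abs_bound)
    also have "\<dots> \<le> (\<integral>x. r * (\<bar>G x\<bar> * indicator {p - r<..<p + r} (snd x)) \<partial>lborel)"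
    proof (rule integral_mono[OF integrable_abs[OF True] i])
      fix x :: "real \<times> real"
      show "\<bar>G x * tent p r (snd x) * indicator A (fst x)\<bar> \<le> r * (\<bar>G x\<bar> * indicator {p - r<..<p + r} (snd x))"
      proof (cases "snd x \<in> {p - r<..<p + r}")
        case True
        have "\<bar>G x\<bar> * \<bar>tent p r (snd x)\<bar> \<le> \<bar>G x\<bar> * r" using tent_le(1,2)[OF r, of p "snd x"] by (intro mult_left_mono) auto
        then show ?thesis using True r by (auto simp: abs_mult indicator_def mult.commute)
      next
        case False
        then have "tent p r (snd x) = 0" by (intro tent_le(3)) auto
        then show ?thesis using r by simp
      qed
    qed
    finally show ?thesis by simp
  next
    \<comment> \<open>\<open>A\<close> is an arbitrary set; if the integrand is not integrable, its
      integral is 0 by convention.\<close>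
    case False
    have "0 \<le> (\<integral>x. \<bar>G x\<bar> * indicator {p - r<..<p + r} (snd x) \<partial>lborel)" by (intro integral_nonneg_AE AE_I2) auto
    then show ?thesis using False r by (simp add: not_integrable_integral_eq)
  qed
qed

section \<open>Regularity of solutions\<close>

text \<open>What survives of membership in the weighted space: a continuous s-derivative
  \<open>V\<close>, a second \<psi>-derivative \<open>H\<close> known in distribution and almost
  everywhere, and decay uniform in \<open>s\<close>. \<open>second_diff_small\<close> is the form in
  which differentiability in \<psi> is kept: it excludes corners of \<open>Q\<close> at a fixed
  \<open>s\<close>.\<close>

locale regular_solution =
  fixes L :: real and Q q V H :: "real \<times> real \<Rightarrow> real"
  assumes L_pos: "L > 0"
    and Q_cont: "continuous_on (UNIV \<times> {0..}) Q"
    and Q_per: "\<psi> \<ge> 0 \<Longrightarrow> Q (s + L, \<psi>) = Q (s, \<psi>)"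
    and q_cont: "continuous_on (UNIV \<times> {0..}) q"
    and q_per: "\<psi> \<ge> 0 \<Longrightarrow> q (s + L, \<psi>) = q (s, \<psi>)"
    and q_nonneg: "\<psi> \<ge> 0 \<Longrightarrow> 0 \<le> q (s, \<psi>)"
    and V_cont: "continuous_on UNIV V"
    and V_deriv: "s \<in> {0..L} \<Longrightarrow> \<psi> > 0 \<Longrightarrow> ((\<lambda>t. Q (t, \<psi>)) has_real_derivative V (s, \<psi>)) (at s within {0..L})"
    and psi2: "distributional_psi2 L Q H"
    and equation: "AE x in lborel. x \<in> cylinder L \<longrightarrow> V x = q x * H x"
    and second_diff_small: "p > 0 \<Longrightarrow> ((\<lambda>r. second_diff Q s p r / r) \<longlongrightarrow> 0) (at_right 0)"
    and decay: "\<eta> > 0 \<Longrightarrow> \<exists>A0. \<forall>A\<ge>A0. \<forall>s. \<bar>Q (s, A)\<bar> \<le> \<eta>"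

text \<open>The representative is taken in (0, L] so that points slightly in its past stay in
  [0, L], where the s-derivative of a solution is available.\<close>

lemma periodic_reduce:
  fixes s L :: real
  assumes "L > 0"
  obtains k :: int where "s - of_int k * L \<in> {0<..L}"
proof -
  define k where "k = \<lceil>s / L\<rceil> - 1"
  have "real_of_int k < s / L" "s / L \<le> real_of_int k + 1"
    using ceiling_correct[of "s / L"] by (simp_all add: k_def)
  then have "s - of_int k * L \<in> {0<..L}" using assms by (auto simp: field_simps)
  then show ?thesis by (rule that)
qed

lemma periodic_int:
  assumes "\<And>s. f (s + L) = f s"
  shows "f (s + of_int k * L) = f (s :: real)"
proof -
  have n: "f (s + real n * L) = f s" for n s
  proof (induction n)
    case (Suc n)
    have "s + real (Suc n) * L = (s + real n * L) + L" by (simp add: algebra_simps)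
    then show ?case using Suc assms[of "s + real n * L"] by (simp only:)
  qed simp
  show ?thesis
  proof (cases "k \<ge> 0")
    case True
    then show ?thesis using n[of s "nat k"] by simp
  next
    case False
    then show ?thesis using n[of "s + of_int k * L" "nat (- k)"] by (simp add: algebra_simps)
  qed
qed

lemma integrable_indicator_fst:
  fixes G :: "real \<times> real \<Rightarrow> real"
  assumes G: "integrable lborel G" and A: "A \<in> sets borel"
  shows "integrable lborel (\<lambda>x. G x * indicator A (fst x))"
proof (rule Bochner_Integration.integrable_bound[OF G])
  show "(\<lambda>x. G x * indicator A (fst x)) \<in> borel_measurable lborel"
    using borel_measurable_times[OF borel_measurable_integrable[OF G]] indicator_fst_measurable[OF A] by simp
qed (auto simp: indicator_def)

lemma integrable_indicator_snd:
  fixes G :: "real \<times> real \<Rightarrow> real"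
  assumes G: "integrable lborel G" and A: "A \<in> sets borel"
  shows "integrable lborel (\<lambda>x. G x * indicator A (snd x))"
proof (rule Bochner_Integration.integrable_bound[OF G])
  show "(\<lambda>x. G x * indicator A (snd x)) \<in> borel_measurable lborel"
    using borel_measurable_times[OF borel_measurable_integrable[OF G]] indicator_snd_measurable[OF A] by simp
qed (auto simp: indicator_def)

lemma weak_second_diff:
  assumes L: "L > 0" and Q: "continuous_on (UNIV \<times> {0..}) Q" and w: "has_weak_partial L 0 2 Q g"
    and G: "integrable lborel (cyl_ext L g)"
  shows "distributional_psi2 L Q (cyl_ext L g)"
  unfolding distributional_psi2_def
proof (intro conjI allI impI Q G)
  fix s1 s2 p r :: real assume s: "0 \<le> s1" "s1 \<le> s2" "s2 \<le> L" and r: "0 < r" "r < p"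
  define G where "G x = cyl_ext L g x * tent p r (snd x)" for x
  define \<Delta> where "\<Delta> s = second_diff Q s p r" for s
  define J where "J s = (\<integral>x. G x * indicator {..s} (fst x) \<partial>lborel)" for s
  have Q': "cyl_cont L Q" by (rule continuous_on_subset[OF Q]) auto
  have \<Delta>c: "continuous_on A \<Delta>" for A
    unfolding \<Delta>_def by (rule second_diff_continuous[OF Q]) (use r in auto)
  have Gi: "integrable lborel G"
    unfolding G_def by (rule weak_partial_trig_tent(2)[OF L Q' w trig_one r])
  have supp: "G x = 0" if "fst x \<notin> {0..<L}" for x
    using that by (cases x) (auto simp: G_def cylinder_def)
  have wk: "integral {0..L} (\<lambda>s. \<Delta> s * \<alpha> s) = (\<integral>x. G x * \<alpha> (fst x) \<partial>lborel)" if "\<alpha> \<in> trig L" for \<alpha>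
    using weak_partial_trig_tent(1)[OF L Q' w that r] by (simp add: \<Delta>_def second_diff_def G_def)
  have main: "J s = integral {0..s} \<Delta>" if "s \<in> {0..L}" for s
    unfolding J_def
    by (rule trig_primitive_unique[OF L trig_primitive_integrable(1)[OF L Gi supp] trig_primitive_continuous[OF L \<Delta>c] _ that]) (simp_all add: wk)
  have Gm: "integrable lborel (\<lambda>x. G x * indicator {..s} (fst x))" for s
    by (rule integrable_indicator_fst[OF Gi]) simp
  have "integral {s1..s2} \<Delta> = integral {0..s2} \<Delta> - integral {0..s1} \<Delta>"
    using Henstock_Kurzweil_Integration.integral_combine[of 0 s1 s2 \<Delta>] s \<Delta>c integrable_continuous_real by fastforce
  also have "\<dots> = J s2 - J s1" using main[of s1] main[of s2] s by simp
  also have "\<dots> = (\<integral>x. G x * indicator {..s2} (fst x) - G x * indicator {..s1} (fst x) \<partial>lborel)"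
    unfolding J_def using Gm[of s1] Gm[of s2] by simp
  also have "(\<lambda>x. G x * indicator {..s2} (fst x) - G x * indicator {..s1} (fst x)) = (\<lambda>x. G x * indicator {s1<..s2} (fst x))"
    using s by (auto simp: indicator_def)
  finally show "integral {s1..s2} (\<lambda>s. second_diff Q s p r) = (\<integral>x. cyl_ext L g x * tent p r (snd x) * indicator {s1<..s2} (fst x) \<partial>lborel)"
    by (simp add: \<Delta>_def[abs_def] G_def)
qed

text \<open>The derivative of order (1, 2) bounds the oscillation of the second difference in
  \<open>s\<close>, and \<open>H\<close> bounds its mean; both bounds are r times a mass on the
  strip |\<psi> - p| < r, and these masses tend to 0 with r.\<close>

lemma weak_second_diff_small:
  assumes L: "L > 0" and Q: "continuous_on (UNIV \<times> {0..}) Q" and per: "\<And>s y. y \<ge> 0 \<Longrightarrow> Q (s + L, y) = Q (s, y)"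
    and H: "distributional_psi2 L Q H" and w: "has_weak_partial L 1 2 Q k"
    and K: "integrable lborel (cyl_ext L k)" and p: "p > 0"
  shows "((\<lambda>r. second_diff Q s p r / r) \<longlongrightarrow> 0) (at_right 0)"
proof -
  define K where "K x = cyl_ext L k x" for x
  have Ki: "integrable lborel K" using K by (simp add: K_def[abs_def])
  have Hi: "integrable lborel H" using H by (simp add: distributional_psi2_def)
  define \<kappa> where "\<kappa> r = (\<integral>x. \<bar>K x\<bar> * indicator {p - r<..<p + r} (snd x) \<partial>lborel)" for r
  define \<eta> where "\<eta> r = (\<integral>x. \<bar>H x\<bar> * indicator {p - r<..<p + r} (snd x) \<partial>lborel)" for r
  have Q': "cyl_cont L Q" by (rule continuous_on_subset[OF Q]) auto
  obtain k' :: int where k': "s - of_int k' * L \<in> {0<..L}" by (rule periodic_reduce[OF L])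
  define s' where "s' = s - of_int k' * L"
  have Qs: "Q (s, y) = Q (s', y)" if "y \<ge> 0" for y
    using periodic_int[of "\<lambda>s. Q (s, y)" L s' k'] per[OF that] by (simp add: s'_def)
  have bound: "\<bar>second_diff Q s p r\<bar> \<le> r * (\<eta> r / L + 2 * \<kappa> r)" if r: "0 < r" "r < p" for r
  proof -
    have sc: "continuous_on A (\<lambda>s. second_diff Q s p r)" for A by (rule second_diff_continuous[OF Q]) (use r in auto)
    define G where "G x = K x * tent p r (snd x)" for x
    have Gi: "integrable lborel G" unfolding G_def K_def by (rule weak_partial_trig_tent(2)[OF L Q' w trig_one r])
    have supp: "G x = 0" if "fst x \<notin> {0..<L}" for x using that by (cases x) (auto simp: G_def K_def cylinder_def)
    have d: "\<bar>second_diff Q t p r - second_diff Q 0 p r\<bar> \<le> r * \<kappa> r" if t: "t \<in> {0..L}" for t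
    proof -
      have "second_diff Q t p r - second_diff Q 0 p r = (\<integral>x. G x * indicator {..t} (fst x) \<partial>lborel)"
      proof (rule weak_deriv_trig_imp_primitive[OF L sc _ Gi supp _ t])
        show "second_diff Q 0 p r = second_diff Q L p r" using per[of "p+r" 0] per[of p 0] per[of "p-r" 0] r by (simp add: second_diff_def)
        show "integral {0..L} (\<lambda>s. second_diff Q s p r * deriv \<alpha> s) = - (\<integral>x. G x * \<alpha> (fst x) \<partial>lborel)" if "\<alpha> \<in> trig L" for \<alpha>
          using weak_partial_trig_tent(1)[OF L Q' w that r] by (simp add: second_diff_def G_def K_def)
      qed
      then show ?thesis using tent_integral_bound[OF Ki r(1), of p "{..t}"] by (simp add: G_def \<kappa>_def)
    qed
    have tot: "\<bar>integral {0..L} (\<lambda>s. second_diff Q s p r)\<bar> \<le> r * \<eta> r"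
    proof -
      have "integral {0..L} (\<lambda>s. second_diff Q s p r) = (\<integral>x. H x * tent p r (snd x) * indicator {0<..L} (fst x) \<partial>lborel)"
        using H L r by (simp add: distributional_psi2_def)
      then show ?thesis using tent_integral_bound[OF Hi r(1), of p "{0<..L}"] by (simp add: \<eta>_def)
    qed
    have "norm (integral {0..L} (\<lambda>s. second_diff Q s p r - second_diff Q 0 p r)) \<le> integral {0..L} (\<lambda>s. r * \<kappa> r)"
      by (rule integral_norm_bound_integral) (auto intro!: integrable_continuous_real continuous_intros sc d)
    moreover have "integral {0..L} (\<lambda>s. r * \<kappa> r) = L * (r * \<kappa> r)" using L by simp
    moreover have "integral {0..L} (\<lambda>s. second_diff Q s p r - second_diff Q 0 p r) = integral {0..L} (\<lambda>s. second_diff Q s p r) - L * second_diff Q 0 p r"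
      by (subst Henstock_Kurzweil_Integration.integral_diff) (use L in \<open>auto intro!: integrable_continuous_real sc\<close>)
    ultimately have "\<bar>L * second_diff Q 0 p r\<bar> \<le> r * \<eta> r + L * (r * \<kappa> r)" using tot unfolding real_norm_def by linarith
    then have "\<bar>second_diff Q 0 p r\<bar> \<le> (r * \<eta> r + L * (r * \<kappa> r)) / L" using L by (simp add: abs_mult field_simps)
    also have "\<dots> = r * (\<eta> r / L + \<kappa> r)" using L by (simp add: field_simps)
    finally have "\<bar>second_diff Q s' p r\<bar> \<le> r * (\<eta> r / L + \<kappa> r) + r * \<kappa> r" using d[of s'] k' unfolding s'_def by (auto simp: abs_le_iff)
    moreover have "second_diff Q s p r = second_diff Q s' p r" using r by (simp add: second_diff_def Qs)
    ultimately show ?thesis by (simp add: algebra_simps)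
  qed
  have "((\<lambda>r. \<eta> r / L + 2 * \<kappa> r) \<longlongrightarrow> 0 / L + 2 * 0) (at_right 0)"
    unfolding \<eta>_def \<kappa>_def by (intro tendsto_add tendsto_divide tendsto_mult tendsto_const integral_snd_strip_tendsto_0 Hi Ki) (use L in auto)
  then have lim: "((\<lambda>r. \<eta> r / L + 2 * \<kappa> r) \<longlongrightarrow> 0) (at_right 0)" by simp
  show ?thesis
  proof (rule Lim_null_comparison[OF _ lim])
    show "\<forall>\<^sub>F r in at_right 0. norm (second_diff Q s p r / r) \<le> \<eta> r / L + 2 * \<kappa> r" unfolding eventually_at_right_field
    proof (intro exI[of _ p] conjI p allI impI)
      fix r :: real assume r: "0 < r" "r < p"
      have "\<bar>second_diff Q s p r\<bar> / r \<le> r * (\<eta> r / L + 2 * \<kappa> r) / r" using bound[OF r] r by (intro divide_right_mono) auto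
      then show "norm (second_diff Q s p r / r) \<le> \<eta> r / L + 2 * \<kappa> r" using r by simp
    qed
  qed
qed

lemma tendsto_indicator_greaterThan:
  fixes a :: real
  assumes "x \<longlonglongrightarrow> a" "y \<noteq> a"
  shows "(\<lambda>n. indicator {x n<..} y :: real) \<longlonglongrightarrow> indicator {a<..} y"
proof -
  have "indicator {c<..} y = (1 - indicator {..c} y :: real)" for c y :: real by (simp add: indicator_def)
  then show ?thesis using tendsto_diff[OF tendsto_const tendsto_indicator_atMost[OF assms], of 1] by simp
qed

text \<open>Since the derivative of order (2, 1) is integrable, integrating it once in
  \<open>s\<close> and from infinity in \<psi> gives a continuous candidate for the s-derivative. It
  is bounded by twice the mass above the given height, which also makes the decay of
  \<open>Q\<close> uniform in \<open>s\<close>.\<close>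

lemma mixed_partial_imp_C1:
  assumes L: "L > 0" and Q: "continuous_on (UNIV \<times> {0..}) Q" and per: "\<And>s \<psi>. \<psi> \<ge> 0 \<Longrightarrow> Q (s + L, \<psi>) = Q (s, \<psi>)"
    and w: "has_weak_partial L 2 1 Q g" and G: "integrable lborel (cyl_ext L g)"
    and lim: "\<And>s. ((\<lambda>\<psi>. Q (s, \<psi>)) \<longlongrightarrow> 0) at_top"
  obtains V where "continuous_on UNIV V"
    "\<And>s \<psi>. s \<in> {0..L} \<Longrightarrow> \<psi> > 0 \<Longrightarrow> ((\<lambda>t. Q (t, \<psi>)) has_real_derivative V (s, \<psi>)) (at s within {0..L})"
    "\<And>\<eta>. \<eta> > 0 \<Longrightarrow> \<exists>A0. \<forall>A\<ge>A0. \<forall>s. \<bar>Q (s, A)\<bar> \<le> \<eta>"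
proof -
  define G where "G x = cyl_ext L g x" for x
  have Gi: "integrable lborel G" using G by (simp add: G_def[abs_def])
  have Gm [measurable]: "G \<in> borel_measurable borel" using borel_measurable_integrable[OF Gi] by simp
  have Q': "cyl_cont L Q" by (rule continuous_on_subset[OF Q]) auto
  \<comment> \<open>The integral of \<open>K (s, c)\<close> is the integral of \<open>G\<close> over
    the quadrant left of \<open>s\<close> and above \<open>c\<close>: minus the s-derivative of
    \<open>Q\<close> at height \<open>c\<close>, up to a function of \<open>c\<close> alone.\<close>
  define K where "K y x = G x * indicator {..fst y} (fst x) * indicator {snd y<..} (snd x)" for x y :: "real \<times> real"
  have Ki: "integrable lborel (K y)" for y
    unfolding K_def[abs_def] by (intro integrable_indicator_snd integrable_indicator_fst Gi) simp_all
  define I where "I y = (\<integral>x. K y x \<partial>lborel)" for y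
  define tail where "tail c = (\<integral>x. \<bar>G x\<bar> * indicator {c<..} (snd x) \<partial>lborel)" for c :: real
  have tail0: "(tail \<longlongrightarrow> 0) at_top" unfolding tail_def by (rule integral_snd_tail_tendsto_0[OF Gi])
  have Ibound: "\<bar>I (s, c)\<bar> \<le> tail c" for s c
  proof -
    have i: "integrable lborel (\<lambda>x. \<bar>G x\<bar> * indicator {c<..} (snd x))" by (intro integrable_indicator_snd Gi integrable_abs) simp
    have "\<bar>I (s, c)\<bar> \<le> (\<integral>x. \<bar>K (s, c) x\<bar> \<partial>lborel)" unfolding I_def by (rule integral_abs_bound)
    also have "\<dots> \<le> tail c" unfolding tail_def by (rule integral_mono[OF integrable_abs[OF Ki] i]) (auto simp: K_def indicator_def)
    finally show ?thesis .
  qed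
  have Ic: "continuous_on UNIV I"
  proof (rule continuous_on_sequentiallyI)
    fix y :: "nat \<Rightarrow> real \<times> real" and a assume y: "y \<longlonglongrightarrow> a"
    show "(\<lambda>n. I (y n)) \<longlonglongrightarrow> I a" unfolding I_def
    proof (rule integral_dominated_convergence[where w = "\<lambda>x. \<bar>G x\<bar>"])
      show "AE x in lborel. (\<lambda>n. K (y n) x) \<longlonglongrightarrow> K a x" using AE_fst_neq[of "fst a"] AE_snd_neq[of "snd a"] unfolding K_def
        by eventually_elim (intro tendsto_mult tendsto_const tendsto_indicator_atMost tendsto_indicator_greaterThan tendsto_fst tendsto_snd y)
      show "AE x in lborel. norm (K (y n) x) \<le> \<bar>G x\<bar>" for n by (intro AE_I2) (simp add: K_def abs_mult indicator_def)
      show "K a \<in> borel_measurable lborel" "\<And>n. K (y n) \<in> borel_measurable lborel" by (intro borel_measurable_integrable Ki)+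
    qed (use Gi in simp)
  qed
  have Ic': "continuous_on A (\<lambda>\<sigma>. I (\<sigma>, c))" for A c
    by (rule continuous_on_compose2[OF Ic]) (auto intro!: continuous_intros)
  \<comment> \<open>With this choice \<open>V = m - I\<close> has mean zero over a period at each
    height, as the s-derivative of a periodic function must.\<close>
  define m where "m c = integral {0..L} (\<lambda>\<sigma>. I (\<sigma>, c)) / L" for c
  have mc: "continuous_on UNIV m"
  proof -
    have "continuous_on (UNIV \<times> cbox 0 L) (\<lambda>(c, \<sigma>). I (\<sigma>, c))"
      unfolding case_prod_unfold by (rule continuous_on_compose2[OF Ic]) (auto intro!: continuous_intros)
    from integral_continuous_on_param[OF this] have "continuous_on UNIV (\<lambda>c. integral {0..L} (\<lambda>\<sigma>. I (\<sigma>, c)))" by (simp add: cbox_interval)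
    then show ?thesis unfolding m_def by (intro continuous_on_divide continuous_on_const) (use L in auto)
  qed
  define V where "V y = m (snd y) - I y" for y
  have Vc: "continuous_on UNIV V"
    unfolding V_def by (intro continuous_on_diff Ic continuous_on_compose2[OF mc]) (auto intro!: continuous_intros)
  have Vc': "continuous_on A (\<lambda>\<sigma>. V (\<sigma>, c))" for A c
    by (rule continuous_on_compose2[OF Vc]) (auto intro!: continuous_intros)
  have mb: "\<bar>m c\<bar> \<le> tail c" for c
  proof -
    have "norm (integral {0..L} (\<lambda>\<sigma>. I (\<sigma>, c))) \<le> integral {0..L} (\<lambda>\<sigma>. tail c)"
      by (rule integral_norm_bound_integral) (auto intro!: integrable_continuous_real Ic' simp: Ibound)
    then show ?thesis using L by (simp add: m_def abs_mult field_simps)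
  qed
  have Vb: "\<bar>V (s, c)\<bar> \<le> 2 * tail c" for s c
    using Ibound[of s c] mb[of c] unfolding V_def by auto
  have diff: "Q (s, d) - Q (s, c) - (Q (0, d) - Q (0, c)) = integral {0..s} (\<lambda>\<sigma>. V (\<sigma>, d) - V (\<sigma>, c))"
    if s: "s \<in> {0..L}" and cd: "0 < c" "c < d" for s c d
  proof -
    define Gc where "Gc x = cyl_ext L g x * indicator {c<..d} (snd x)" for x
    have Gci: "integrable lborel Gc" unfolding Gc_def by (rule weak_partial_trig_step(2)[OF L Q' w trig_one cd])
    have supp: "Gc x = 0" if "fst x \<notin> {0..<L}" for x using that by (cases x) (auto simp: Gc_def cylinder_def)
    have J: "(\<integral>x. Gc x * indicator {..s} (fst x) \<partial>lborel) = I (s, c) - I (s, d)" for s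
    proof -
      have "I (s, c) - I (s, d) = (\<integral>x. K (s, c) x - K (s, d) x \<partial>lborel)" unfolding I_def by (rule Bochner_Integration.integral_diff[OF Ki Ki, symmetric])
      also have "(\<lambda>x. K (s, c) x - K (s, d) x) = (\<lambda>x. Gc x * indicator {..s} (fst x))" using cd by (auto simp: K_def Gc_def G_def indicator_def)
      finally show ?thesis by simp
    qed
    have "(\<lambda>s. Q (s, d) - Q (s, c)) s - (\<lambda>s. Q (s, d) - Q (s, c)) 0 =
      integral {0..s} (\<lambda>s. (\<integral>x. Gc x * indicator {..s} (fst x) \<partial>lborel) - integral {0..L} (\<lambda>s. \<integral>x. Gc x * indicator {..s} (fst x) \<partial>lborel) / L)"
    proof (rule weak_mixed_partial_imp_primitive[OF L _ _ Gci supp _ s])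
      show "continuous_on {0..L} (\<lambda>s. Q (s, d) - Q (s, c))" using cd by (intro continuous_intros continuous_on_compose2[OF Q]) auto
      show "Q (0, d) - Q (0, c) = Q (L, d) - Q (L, c)" using per[of d 0] per[of c 0] cd by simp
      show "integral {0..L} (\<lambda>s. (Q (s, d) - Q (s, c)) * (deriv ^^ 2) \<alpha> s) = (\<integral>x. Gc x * \<alpha> (fst x) \<partial>lborel)" if "\<alpha> \<in> trig L" for \<alpha>
        using weak_partial_trig_step(1)[OF L Q' w that cd] by (simp add: Gc_def)
    qed
    also have "\<dots> = integral {0..s} (\<lambda>\<sigma>. V (\<sigma>, d) - V (\<sigma>, c))"
    proof -
      have "integral {0..L} (\<lambda>s. I (s, c) - I (s, d)) = integral {0..L} (\<lambda>s. I (s, c)) - integral {0..L} (\<lambda>s. I (s, d))"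
        by (intro Henstock_Kurzweil_Integration.integral_diff integrable_continuous_real Ic')
      then have e: "I (s, c) - I (s, d) - integral {0..L} (\<lambda>s. I (s, c) - I (s, d)) / L = V (s, d) - V (s, c)" for s
        by (simp add: V_def m_def diff_divide_distrib)
      show ?thesis unfolding J e ..
    qed
    finally show ?thesis by simp
  qed
  have main: "Q (s, c) - Q (0, c) = integral {0..s} (\<lambda>\<sigma>. V (\<sigma>, c))" if s: "s \<in> {0..L}" and c: "0 < c" for s c
  proof -
    \<comment> \<open>Letting d tend to infinity removes the upper slice from \<open>diff\<close>:
      \<open>Q\<close> tends to 0 there, and the integral of \<open>V\<close> at height d is at most
      a multiple of the tail mass.\<close>
    have "((\<lambda>d. Q (s, d) - Q (s, c) - (Q (0, d) - Q (0, c)) + integral {0..s} (\<lambda>\<sigma>. V (\<sigma>, c))) \<longlongrightarrow>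
       0 - Q (s, c) - (0 - Q (0, c)) + integral {0..s} (\<lambda>\<sigma>. V (\<sigma>, c))) at_top" by (intro tendsto_intros lim)
    moreover have "((\<lambda>d. Q (s, d) - Q (s, c) - (Q (0, d) - Q (0, c)) + integral {0..s} (\<lambda>\<sigma>. V (\<sigma>, c))) \<longlongrightarrow> 0) at_top"
    proof (rule Lim_null_comparison)
      show "((\<lambda>d. s * (2 * tail d)) \<longlongrightarrow> 0) at_top" using tendsto_mult_left[OF tendsto_mult_left[OF tail0, of 2], of s] by simp
      show "\<forall>\<^sub>F d in at_top. norm (Q (s, d) - Q (s, c) - (Q (0, d) - Q (0, c)) + integral {0..s} (\<lambda>\<sigma>. V (\<sigma>, c))) \<le> s * (2 * tail d)"
        using eventually_gt_at_top[of c]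
      proof eventually_elim
        case (elim d)
        have "Q (s, d) - Q (s, c) - (Q (0, d) - Q (0, c)) + integral {0..s} (\<lambda>\<sigma>. V (\<sigma>, c)) = integral {0..s} (\<lambda>\<sigma>. V (\<sigma>, d))"
          using diff[OF s c elim] by (simp add: Henstock_Kurzweil_Integration.integral_diff integrable_continuous_real Vc')
        moreover have "norm (integral {0..s} (\<lambda>\<sigma>. V (\<sigma>, d))) \<le> integral {0..s} (\<lambda>\<sigma>. 2 * tail d)"
          by (rule integral_norm_bound_integral) (use Vb in \<open>auto intro!: integrable_continuous_real Vc'\<close>)
        ultimately show ?case using s by simp
      qed
    qed
    ultimately have "0 - Q (s, c) - (0 - Q (0, c)) + integral {0..s} (\<lambda>\<sigma>. V (\<sigma>, c)) = 0" by (rule tendsto_unique[rotated]) simp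
    then show ?thesis by simp
  qed
  show thesis
  proof (rule that[OF Vc])
    fix s \<psi> :: real assume s: "s \<in> {0..L}" and \<psi>: "\<psi> > 0"
    have "((\<lambda>t. integral {0..t} (\<lambda>\<sigma>. V (\<sigma>, \<psi>)) + Q (0, \<psi>)) has_real_derivative V (s, \<psi>) + 0) (at s within {0..L})"
      by (intro DERIV_add DERIV_const integral_has_real_derivative Vc' s)
    then show "((\<lambda>t. Q (t, \<psi>)) has_real_derivative V (s, \<psi>)) (at s within {0..L})" unfolding add_0_right
    proof (rule has_field_derivative_transform_within[where d = 1])
      show "integral {0..t} (\<lambda>\<sigma>. V (\<sigma>, \<psi>)) + Q (0, \<psi>) = Q (t, \<psi>)" if "t \<in> {0..L}" for t using main[OF that \<psi>] by linarith
    qed (use s in auto)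
  next
    fix \<eta> :: real assume \<eta>: "\<eta> > 0"
    have "((\<lambda>A. \<bar>Q (0, A)\<bar> + L * (2 * tail A)) \<longlongrightarrow> \<bar>0\<bar> + L * (2 * 0)) at_top" by (intro tendsto_intros lim tail0)
    then have "\<forall>\<^sub>F A in at_top. \<bar>Q (0, A)\<bar> + L * (2 * tail A) < \<eta>" using \<eta> by (intro order_tendstoD(2)) auto
    then obtain A0 where A0: "\<And>A. A \<ge> A0 \<Longrightarrow> \<bar>Q (0, A)\<bar> + L * (2 * tail A) < \<eta>" by (auto simp: eventually_at_top_linorder)
    show "\<exists>A0. \<forall>A\<ge>A0. \<forall>s. \<bar>Q (s, A)\<bar> \<le> \<eta>"
    proof (intro exI[of _ "max A0 1"] allI impI)
      fix A s :: real assume A: "max A0 1 \<le> A"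
      obtain k where k: "s - of_int k * L \<in> {0<..L}" by (rule periodic_reduce[OF L])
      define s' where "s' = s - of_int k * L"
      have "Q (s, A) = Q (s', A)" using periodic_int[of "\<lambda>s. Q (s, A)" L s' k] per[of A] A by (simp add: s'_def)
      moreover have s': "s' \<in> {0..L}" using k by (auto simp: s'_def)
      moreover have "norm (integral {0..s'} (\<lambda>\<sigma>. V (\<sigma>, A))) \<le> integral {0..s'} (\<lambda>\<sigma>. 2 * tail A)"
        by (rule integral_norm_bound_integral) (use Vb in \<open>auto intro!: integrable_continuous_real Vc'\<close>)
      moreover have "s' * (2 * tail A) \<le> L * (2 * tail A)" using s' Vb[of 0 A] by (intro mult_right_mono) auto
      ultimately show "\<bar>Q (s, A)\<bar> \<le> \<eta>" using main[OF s', of A] A0[of A] A s' by auto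
    qed
  qed
qed

text \<open>The derivative of order (2, 1) gives the C^1 regularity in \<open>s\<close>, order (1,
  2) the smallness of second differences, and order (0, 2) is \<open>H\<close>. Order (1, 0) is
  identified with \<open>V\<close> by uniqueness of weak derivatives, which brings the equation into
  the form V = q H.\<close>

theorem prandtl_solution_regular:
  assumes L: "L > 0" and qe: "continuous_on UNIV q_e" "\<And>s. q_e (s + L) = q_e s" and sol: "prandtl_solution L q_e f \<omega> q"
  obtains V where "regular_solution L (Q_of q_e \<omega> q) q V (cyl_ext L (weak_partial L 0 2 (Q_of q_e \<omega> q)))"
proof -
  define Q where "Q = Q_of q_e \<omega> q"
  have S: "\<And>s y. y \<ge> 0 \<Longrightarrow> q (s + L, y) = q (s, y)" "continuous_on (UNIV \<times> {0..}) q" "Q \<in> X_space L 2 50"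
    "\<And>s y. y \<ge> 0 \<Longrightarrow> q (s, y) = sqrt (\<omega>\<^sup>2 * (q_e s)\<^sup>2 + Q (s, y))"
    "AE x in lborel. x \<in> cylinder L \<longrightarrow> weak_partial L 1 0 Q x - q x * weak_partial L 0 2 Q x = 0"
    "\<And>s. ((\<lambda>y. Q (s, y)) \<longlongrightarrow> 0) at_top" using sol unfolding prandtl_solution_def Let_def Q_def L_periodic_def by auto
  have Qc: "continuous_on (UNIV \<times> {0..}) Q"
    unfolding Q_def Q_of_def case_prod_unfold by (intro continuous_intros continuous_on_compose2[OF qe(1)] continuous_on_compose2[OF S(2)]) auto
  have per: "Q (s + L, y) = Q (s, y)" if "y \<ge> 0" for s y
    using S(1)[OF that] qe(2) by (simp add: Q_def Q_of_def)
  have W: "has_weak_partial L a b Q (weak_partial L a b Q)" "set_integrable lborel (cylinder L) (weighted_square 1 (weak_partial L a b Q))"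
    if "k \<le> 2" "(a, b) \<in> {(k, 0), (k + 1, 0), (k, 1), (k, 2)}" for a b k
  proof -
    have "(\<exists>g. has_weak_partial L a b Q g) \<and> set_integrable lborel (cylinder L) (weighted_square 1 (weak_partial L a b Q))"
      using S(3)[unfolded X_space_def mem_Collect_eq, rule_format, OF that(1), of 1, OF _ that(2)] by simp
    then show "has_weak_partial L a b Q (weak_partial L a b Q)" "set_integrable lborel (cylinder L) (weighted_square 1 (weak_partial L a b Q))"
      using someI_ex[of "has_weak_partial L a b Q"] unfolding weak_partial_def by auto
  qed
  have Wi: "integrable lborel (cyl_ext L (weak_partial L a b Q))"
    if "k \<le> 2" "(a, b) \<in> {(k, 0), (k + 1, 0), (k, 1), (k, 2)}" for a b k
    using W[OF that] by (intro weighted_integrable_imp_integrable) (auto simp: has_weak_partial_def)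
  obtain V where V: "continuous_on UNIV V"
    "\<And>s y. s \<in> {0..L} \<Longrightarrow> y > 0 \<Longrightarrow> ((\<lambda>t. Q (t, y)) has_real_derivative V (s, y)) (at s within {0..L})"
    "\<And>\<eta>. \<eta> > 0 \<Longrightarrow> \<exists>A0. \<forall>A\<ge>A0. \<forall>s. \<bar>Q (s, A)\<bar> \<le> \<eta>" using mixed_partial_imp_C1[OF L Qc per W(1)[of 2 2 1] Wi[of 2 2 1] S(6)] by auto
  have psi2: "distributional_psi2 L Q (cyl_ext L (weak_partial L 0 2 Q))"
    by (rule weak_second_diff[OF L Qc W(1)[of 0] Wi[of 0]]) auto
  have Q': "cyl_cont L Q" by (rule continuous_on_subset[OF Qc]) auto
  have "has_weak_partial L 1 0 Q V"
    using classical_imp_weak_partial[where h = "\<lambda>i. if i = 0 then Q else V" and k = "\<lambda>_. V" and a = 1 and b = 0, OF L]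
      Q' continuous_on_subset[OF V(1), of "{0..L} \<times> {0<..}"] V(2) per[of _ 0] by auto
  from weak_partial_unique[OF L this W(1)[of 0 1 0]]
  have "AE x in lborel. x \<in> cylinder L \<longrightarrow> V x = weak_partial L 1 0 Q x" by simp
  then have eq: "AE x in lborel. x \<in> cylinder L \<longrightarrow> V x = q x * (cyl_ext L (weak_partial L 0 2 Q) x)"
    using S(5) by eventually_elim auto
  have "regular_solution L Q q V (cyl_ext L (weak_partial L 0 2 Q))"
  proof unfold_locales
    show "((\<lambda>r. second_diff Q s p r / r) \<longlongrightarrow> 0) (at_right 0)" if "p > 0" for s p by (rule weak_second_diff_small[OF L Qc per psi2 W(1)[of 1] Wi[of 1] that]) auto
    show "0 \<le> q (s, y)" if "y \<ge> 0" for s y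
    proof -
      have "(q (s, y))\<^sup>2 = \<omega>\<^sup>2 * (q_e s)\<^sup>2 + Q (s, y)" by (simp add: Q_def Q_of_def)
      then have "0 \<le> \<omega>\<^sup>2 * (q_e s)\<^sup>2 + Q (s, y)" by (metis zero_le_power2)
      then show ?thesis using S(4)[OF that, of s] by simp
    qed
  qed (use L Qc per S V psi2 eq in auto)
  then show thesis using that by (simp add: Q_def)
qed

section \<open>Viscosity inequalities and uniqueness\<close>

lemma deriv_le_of_contact:
  fixes h B :: "real \<Rightarrow> real"
  assumes s0: "0 < s0" "s0 \<le> L" and h: "(h has_real_derivative v) (at s0 within {0..L})" and B: "(B has_real_derivative b) (at s0)"
    and contact: "\<delta> > 0" "\<And>t. s0 - \<delta> < t \<Longrightarrow> t < s0 \<Longrightarrow> h s0 - B s0 \<le> h t - B t"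
  shows "v \<le> b"
proof -
  let ?F = "at s0 within {max 0 (s0 - \<delta>)<..<s0}"
  have nt: "?F \<noteq> bot"
    using s0 contact(1) islimpt_greaterThanLessThan2[of "max 0 (s0 - \<delta>)" s0] by (simp add: trivial_limit_within)
  have l1: "((\<lambda>t. (h t - h s0) / (t - s0)) \<longlongrightarrow> v) ?F"
    using h unfolding has_field_derivative_iff by (rule tendsto_within_subset) (use s0 in auto)
  have l2: "((\<lambda>t. (B t - B s0) / (t - s0)) \<longlongrightarrow> b) ?F"
    using B unfolding has_field_derivative_iff by (rule tendsto_within_subset) simp
  show ?thesis
  proof (rule tendsto_le[OF nt l2 l1])
    show "\<forall>\<^sub>F t in ?F. (h t - h s0) / (t - s0) \<le> (B t - B s0) / (t - s0)" unfolding eventually_at_filter using contact(2)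
      by (intro always_eventually allI impI divide_right_mono_neg) (auto simp: algebra_simps)
  qed
qed

text \<open>L'Hopital is applied once only: \<phi>' is known to be differentiable just at
  \<open>p\<close>, so the remaining limit is read off from the definition of that
  derivative.\<close>

lemma second_difference_quotient_tendsto:
  fixes \<phi> \<phi>' :: "real \<Rightarrow> real"
  assumes d: "d > 0" and \<phi>: "\<And>y. \<bar>y - p\<bar> < d \<Longrightarrow> (\<phi> has_real_derivative \<phi>' y) (at y)"
    and \<phi>': "(\<phi>' has_real_derivative \<beta>) (at p)"
  shows "((\<lambda>r. (\<phi> (p + r) - 2 * \<phi> p + \<phi> (p - r)) / r\<^sup>2) \<longlongrightarrow> \<beta>) (at_right 0)"
proof (rule lhopital_right_0[where f' = "\<lambda>r. \<phi>' (p + r) - \<phi>' (p - r)" and g' = "\<lambda>r. 2 * r"])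
  have c: "isCont \<phi> p" using DERIV_isCont[OF \<phi>] d by simp
  have p1: "((\<lambda>r. p + r) \<longlongrightarrow> p) (at_right 0)" "((\<lambda>r. p - r) \<longlongrightarrow> p) (at_right 0)"
    by (rule tendsto_eq_intros refl | simp)+
  have "((\<lambda>r. \<phi> (p + r) - 2 * \<phi> p + \<phi> (p - r)) \<longlongrightarrow> \<phi> p - 2 * \<phi> p + \<phi> p) (at_right 0)"
    by (intro tendsto_intros isCont_tendsto_compose[OF c] p1)
  then show "((\<lambda>r. \<phi> (p + r) - 2 * \<phi> p + \<phi> (p - r)) \<longlongrightarrow> 0) (at_right 0)" by simp
  show "((\<lambda>r::real. r\<^sup>2) \<longlongrightarrow> 0) (at_right 0)" by (rule tendsto_eq_intros refl | simp)+
  show "\<forall>\<^sub>F r in at_right 0. (r::real)\<^sup>2 \<noteq> 0" "\<forall>\<^sub>F r in at_right 0. 2 * (r::real) \<noteq> 0"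
    by (auto simp: eventually_at_right_field intro!: exI[of _ 1])
  show "\<forall>\<^sub>F r in at_right 0. ((\<lambda>r. \<phi> (p + r) - 2 * \<phi> p + \<phi> (p - r)) has_real_derivative \<phi>' (p + r) - \<phi>' (p - r)) (at r)"
    unfolding eventually_at_right_field
  proof (intro exI[of _ d] conjI d allI impI)
    fix r :: real assume r: "0 < r" "r < d"
    have "((\<lambda>r. \<phi> (1 * r + p)) has_real_derivative 1 * \<phi>' (1 * r + p)) (at r)" by (rule affine_deriv, rule \<phi>) (use r in auto)
    moreover have "((\<lambda>r. \<phi> ((-1) * r + p)) has_real_derivative (-1) * \<phi>' ((-1) * r + p)) (at r)" by (rule affine_deriv, rule \<phi>) (use r in auto)
    ultimately show "((\<lambda>r. \<phi> (p + r) - 2 * \<phi> p + \<phi> (p - r)) has_real_derivative \<phi>' (p + r) - \<phi>' (p - r)) (at r)"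
      by (auto intro!: derivative_eq_intros simp: add.commute)
  qed
  show "\<forall>\<^sub>F r in at_right 0. ((\<lambda>r::real. r\<^sup>2) has_real_derivative 2 * r) (at r)"
    by (auto intro!: always_eventually derivative_eq_intros)
  have q: "((\<lambda>r. (\<phi>' (p + r) - \<phi>' p) / r) \<longlongrightarrow> \<beta>) (at 0)" using \<phi>' by (simp add: DERIV_def)
  then have q1: "((\<lambda>r. (\<phi>' (p + r) - \<phi>' p) / r) \<longlongrightarrow> \<beta>) (at_right 0)" by (rule tendsto_within_subset) simp
  have "((\<lambda>r. (\<phi>' (p + - r) - \<phi>' p) / - r) \<longlongrightarrow> \<beta>) (at_right 0)"
    using q by (subst (asm) filterlim_at_split) (simp add: filterlim_at_left_to_right)
  from tendsto_divide[OF tendsto_add[OF q1 this] tendsto_const[of 2]]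
  have "((\<lambda>r. ((\<phi>' (p + r) - \<phi>' p) / r + (\<phi>' (p + - r) - \<phi>' p) / - r) / 2) \<longlongrightarrow> \<beta>) (at_right 0)" by simp
  then show "((\<lambda>r. (\<phi>' (p + r) - \<phi>' (p - r)) / (2 * r)) \<longlongrightarrow> \<beta>) (at_right 0)"
    by (rule Lim_transform_eventually)
       (auto simp: eventually_at_right_field field_simps intro!: exI[of _ 1])
qed

context regular_solution
begin

lemma distributional_psi2_sign: "distributional_psi2 L (\<lambda>x. \<sigma> * Q x) (\<lambda>x. \<sigma> * H x)"
  using distributional_psi2_linear[OF psi2 psi2, of \<sigma> 0] by simp

text \<open>If the inequality failed, then \<sigma> V < q b near the point for some b < \<beta>, so
  q (\<sigma> H - b) < 0 almost everywhere nearby, and q \<ge> 0 gives \<sigma> H < b without any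
  positive lower bound on \<open>q\<close>. Averaging over the past bounds the second difference by
  b r^2, against the contact.\<close>

lemma viscosity_space:
  assumes \<sigma>: "\<sigma> = 1 \<or> \<sigma> = (- 1 :: real)" and s0: "0 < s0" "s0 \<le> L" and p: "p > 0"
    and contact: "r0 > 0" "\<And>r. 0 < r \<Longrightarrow> r < r0 \<Longrightarrow> \<phi> (p + r) - 2 * \<phi> p + \<phi> (p - r) \<le> \<sigma> * second_diff Q s0 p r"
    and lim: "((\<lambda>r. (\<phi> (p + r) - 2 * \<phi> p + \<phi> (p - r)) / r\<^sup>2) \<longlongrightarrow> \<beta>) (at_right 0)"
  shows "q (s0, p) * \<beta> \<le> \<sigma> * V (s0, p)"
proof (rule ccontr)
  assume "\<not> q (s0, p) * \<beta> \<le> \<sigma> * V (s0, p)"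
  then have lt: "\<sigma> * V (s0, p) < q (s0, p) * \<beta>" by simp
  \<comment> \<open>At a zero of \<open>q\<close> any b < \<beta> will do; otherwise b is the
    midpoint between \<sigma> V / q and \<beta>.\<close>
  obtain b where b: "b < \<beta>" "\<sigma> * V (s0, p) < q (s0, p) * b"
  proof (cases "q (s0, p) = 0")
    case True
    then show ?thesis using lt that[of "\<beta> - 1"] by simp
  next
    case False
    then have q: "q (s0, p) > 0" using q_nonneg[of p s0] p by auto
    define v where "v = \<sigma> * V (s0, p) / q (s0, p)"
    have v: "v < \<beta>" "\<sigma> * V (s0, p) = q (s0, p) * v" using lt q by (auto simp: v_def field_simps)
    show ?thesis by (rule that[of "(v + \<beta>) / 2"]) (use v q in \<open>auto simp: field_simps\<close>)
  qed
  define F where "F x = \<sigma> * V x - q x * b" for x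
  have Fc: "continuous_on (UNIV \<times> {0..}) F"
    unfolding F_def by (intro continuous_intros continuous_on_subset[OF V_cont] q_cont) auto
  have "F (s0, p) < 0" "(s0, p) \<in> UNIV \<times> {0..}" using b p by (auto simp: F_def)
  then obtain \<delta>1 where \<delta>1: "\<delta>1 > 0" "\<And>x. x \<in> UNIV \<times> {0..} \<Longrightarrow> dist x (s0, p) < \<delta>1 \<Longrightarrow> dist (F x) (F (s0, p)) < - F (s0, p)"
    using Fc unfolding continuous_on_iff by (metis neg_0_less_iff_less)
  define \<delta> where "\<delta> = min (\<delta>1 / 2) (min p s0)"
  have \<delta>: "0 < \<delta>" "\<delta> \<le> \<delta>1 / 2" "\<delta> \<le> p" "\<delta> \<le> s0" using \<delta>1(1) p s0 by (auto simp: \<delta>_def)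
  have Fneg: "F (s, y) < 0" if "\<bar>s - s0\<bar> < \<delta>" "\<bar>y - p\<bar> < \<delta>" for s y
  proof -
    have "dist (s, y) (s0, p) \<le> \<bar>s - s0\<bar> + \<bar>y - p\<bar>" unfolding dist_Pair_Pair dist_real_def using sqrt_sum_squares_le_sum_abs[of "\<bar>s - s0\<bar>" "\<bar>y - p\<bar>"] by simp
    then have "dist (s, y) (s0, p) < \<delta>1" using that \<delta> by linarith
    moreover have "(s, y) \<in> UNIV \<times> {0..}" using that \<delta> by auto
    ultimately have "dist (F (s, y)) (F (s0, p)) < - F (s0, p)" using \<delta>1(2) by blast
    then show ?thesis by (simp add: dist_real_def abs_if split: if_splits)
  qed
  have le: "\<sigma> * second_diff Q s0 p r \<le> b * r\<^sup>2" if r: "0 < r" "r < \<delta>" for r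
  proof -
    have "second_diff (\<lambda>x. \<sigma> * Q x) s0 p r \<le> b * r\<^sup>2"
    proof (rule second_diff_le_of_AE_le[OF distributional_psi2_sign s0 r(1) _ \<delta>(1)])
      show "AE x in lborel. s0 - \<delta> < fst x \<longrightarrow> fst x < s0 \<longrightarrow> p - r < snd x \<longrightarrow> snd x < p + r \<longrightarrow> \<sigma> * H x \<le> b" using equation
      proof eventually_elim
        case (elim x)
        show ?case
        proof (intro impI)
          assume x: "s0 - \<delta> < fst x" "fst x < s0" "p - r < snd x" "snd x < p + r"
          then have "x \<in> cylinder L" using \<delta> r s0 by (cases x) (auto simp: cylinder_def)
          then have "V x = q x * H x" using elim by blast
          moreover have "F x < 0" using Fneg[of "fst x" "snd x"] x r by (cases x) auto
          ultimately have "q x * (\<sigma> * H x - b) < 0" by (simp add: F_def algebra_simps)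
          moreover have "0 \<le> q x" using q_nonneg[of "snd x" "fst x"] x r \<delta> by simp
          ultimately have "\<sigma> * H x - b < 0" by (metis mult_nonneg_nonneg not_less)
          then show "\<sigma> * H x \<le> b" by simp
        qed
      qed
    qed (use r \<delta> in auto)
    then show ?thesis by (simp add: second_diff_def algebra_simps)
  qed
  have "\<forall>\<^sub>F r in at_right 0. (\<phi> (p + r) - 2 * \<phi> p + \<phi> (p - r)) / r\<^sup>2 \<le> b"
    unfolding eventually_at_right_field
  proof (intro exI[of _ "min r0 \<delta>"] conjI allI impI)
    fix r :: real assume r: "0 < r" "r < min r0 \<delta>"
    have "\<phi> (p + r) - 2 * \<phi> p + \<phi> (p - r) \<le> b * r\<^sup>2" using contact(2)[of r] le[of r] r by auto
    then show "(\<phi> (p + r) - 2 * \<phi> p + \<phi> (p - r)) / r\<^sup>2 \<le> b" using r by (simp add: divide_le_eq)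
  qed (use contact(1) \<delta>(1) in auto)
  then have "\<beta> \<le> b" using tendsto_upperbound[OF lim] by simp
  then show False using b by simp
qed

lemma viscosity_time:
  assumes s0: "0 < s0" "s0 \<le> L" and p: "p > 0"
    and contact: "\<delta> > 0" "\<And>t. s0 - \<delta> < t \<Longrightarrow> t < s0 \<Longrightarrow> \<sigma> * Q (s0, p) - B s0 \<le> \<sigma> * Q (t, p) - B t"
    and B: "(B has_real_derivative b) (at s0)"
  shows "\<sigma> * V (s0, p) \<le> b"
proof (rule deriv_le_of_contact[OF s0 _ B contact(1)])
  show "((\<lambda>t. \<sigma> * Q (t, p)) has_real_derivative \<sigma> * V (s0, p)) (at s0 within {0..L})"
    using V_deriv[of s0 p] s0 p by (intro DERIV_cmult) auto
qed (rule contact(2))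

lemma Q_shift: "y \<ge> 0 \<Longrightarrow> Q (s - of_int k * L, y) = Q (s, y)"
  using periodic_int[of "\<lambda>s. Q (s, y)" L "s - of_int k * L" k] Q_per by simp

lemma q_shift: "y \<ge> 0 \<Longrightarrow> q (s - of_int k * L, y) = q (s, y)"
  using periodic_int[of "\<lambda>s. q (s, y)" L "s - of_int k * L" k] q_per by simp

text \<open>\<open>Q\<close> solves the equation in the viscosity sense, also where it degenerates (\<open>q = 0\<close>); only
  contact from the past is required.\<close>

lemma viscosity:
  assumes \<sigma>: "\<sigma> = 1 \<or> \<sigma> = (- 1 :: real)" and p: "p > 0"
    and time: "\<delta> > 0" "\<And>t. s0 - \<delta> < t \<Longrightarrow> t < s0 \<Longrightarrow> \<sigma> * Q (s0, p) - B s0 \<le> \<sigma> * Q (t, p) - B t"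
      "(B has_real_derivative b) (at s0)"
    and space: "r0 > 0" "\<And>r. 0 < r \<Longrightarrow> r < r0 \<Longrightarrow> \<phi> (p + r) - 2 * \<phi> p + \<phi> (p - r) \<le> \<sigma> * second_diff Q s0 p r"
      "((\<lambda>r. (\<phi> (p + r) - 2 * \<phi> p + \<phi> (p - r)) / r\<^sup>2) \<longlongrightarrow> \<beta>) (at_right 0)"
  shows "q (s0, p) * \<beta> \<le> b"
proof -
  obtain k where k: "s0 - of_int k * L \<in> {0<..L}" by (rule periodic_reduce[OF L_pos])
  define s1 where "s1 = s0 - of_int k * L"
  have s1: "0 < s1" "s1 \<le> L" using k by (auto simp: s1_def)
  have "q (s1, p) * \<beta> \<le> \<sigma> * V (s1, p)"
  proof (rule viscosity_space[OF \<sigma> s1 p _ _ space(3)])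
    show "0 < min r0 p" using space(1) p by simp
    fix r :: real assume r: "0 < r" "r < min r0 p"
    have "second_diff Q s1 p r = second_diff Q s0 p r" using r p by (simp add: second_diff_def s1_def Q_shift)
    then show "\<phi> (p + r) - 2 * \<phi> p + \<phi> (p - r) \<le> \<sigma> * second_diff Q s1 p r" using space(2)[of r] r by simp
  qed
  also have "\<dots> \<le> b"
  proof (rule viscosity_time[OF s1 p time(1), where B = "\<lambda>t. B (1 * t + of_int k * L)"])
    have "((\<lambda>t. B (1 * t + of_int k * L)) has_real_derivative 1 * b) (at s1)" by (rule affine_deriv) (use time(3) in \<open>simp add: s1_def\<close>)
    then show "((\<lambda>t. B (1 * t + of_int k * L)) has_real_derivative b) (at s1)" by simp
    fix t assume t: "s1 - \<delta> < t" "t < s1"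
    have "Q (t + of_int k * L, p) = Q (t, p)" "Q (s1, p) = Q (s0, p)" using Q_shift[of p "t + of_int k * L" k] Q_shift[of p s0 k] p by (simp_all add: s1_def)
    then show "\<sigma> * Q (s1, p) - B (1 * s1 + of_int k * L) \<le> \<sigma> * Q (t, p) - B (1 * t + of_int k * L)" using time(2)[of "t + of_int k * L"] t by (simp add: s1_def)
  qed
  finally show ?thesis using q_shift[of p s0 k] p by (simp add: s1_def)
qed

section \<open>Maxima over a period and the maximum principle\<close>

lemma Q_attains_max:
  fixes B \<Phi> :: "real \<Rightarrow> real" and Q2 :: "real \<times> real \<Rightarrow> real"
  assumes A: "A \<ge> 0" and B: "continuous_on {0..A} B" "continuous_on {0..A} \<Phi>" "\<And>\<psi>. \<psi> \<in> {0..A} \<Longrightarrow> \<Phi> \<psi> > 0"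
    and Q2: "continuous_on (UNIV \<times> {0..}) Q2" "\<And>s \<psi>. \<psi> \<ge> 0 \<Longrightarrow> Q2 (s + L, \<psi>) = Q2 (s, \<psi>)"
  obtains s0 \<psi>0 where "0 < s0" "s0 \<le> L" "\<psi>0 \<in> {0..A}"
    "\<And>s \<psi>. \<psi> \<in> {0..A} \<Longrightarrow> (Q2 (s, \<psi>) - B \<psi>) / \<Phi> \<psi> \<le> (Q2 (s0, \<psi>0) - B \<psi>0) / \<Phi> \<psi>0"
proof -
  let ?K = "{0..L} \<times> {0..A}" and ?F = "\<lambda>x. (Q2 x - B (snd x)) / \<Phi> (snd x)"
  have c1: "continuous_on ?K Q2" by (rule continuous_on_subset[OF Q2(1)]) auto
  have c2: "continuous_on ?K (\<lambda>x. B (snd x))"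
    by (rule continuous_on_compose2[OF B(1)]) (auto intro: continuous_intros)
  have c3: "continuous_on ?K (\<lambda>x. \<Phi> (snd x))"
    by (rule continuous_on_compose2[OF B(2)]) (auto intro: continuous_intros)
  have "continuous_on ?K ?F"
    by (intro continuous_on_divide continuous_on_diff c1 c2 c3) (use B(3) in \<open>auto simp: less_imp_neq[symmetric]\<close>)
  moreover have "compact ?K" by (intro compact_Times) auto
  moreover have "?K \<noteq> {}" using A L_pos by auto
  ultimately obtain x where x: "x \<in> ?K" "\<And>y. y \<in> ?K \<Longrightarrow> ?F y \<le> ?F x"
    using continuous_attains_sup[of ?K ?F] by blast
  obtain a b where ab: "x = (a, b)" by (cases x)
  have shift: "Q2 (s - of_int k * L, \<psi>) = Q2 (s, \<psi>)" if "\<psi> \<ge> 0" for s k \<psi>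
    using periodic_int[of "\<lambda>s. Q2 (s, \<psi>)" L "s - of_int k * L" k] Q2(2)[OF that] by simp
  obtain k where k: "a - of_int k * L \<in> {0<..L}" by (rule periodic_reduce[OF L_pos])
  show thesis
  proof (rule that[of "a - of_int k * L" b])
    show "0 < a - of_int k * L" "a - of_int k * L \<le> L" "b \<in> {0..A}" using k x ab by auto
    fix s \<psi> assume \<psi>: "\<psi> \<in> {0..A}"
    obtain k' where k': "s - of_int k' * L \<in> {0<..L}" by (rule periodic_reduce[OF L_pos])
    have "?F (s - of_int k' * L, \<psi>) \<le> ?F x" using k' \<psi> by (intro x(2)) auto
    then show "(Q2 (s, \<psi>) - B \<psi>) / \<Phi> \<psi> \<le> (Q2 (a - of_int k * L, b) - B b) / \<Phi> b" using \<psi> x ab by (simp add: shift)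
  qed
qed

text \<open>The comparison function k + \<mu> \<psi> + \<epsilon> \<psi> (A - \<psi>) dominates
  \<sigma> Q at height A because \<mu> A = |k| + 1, and its strict concavity makes an interior
  contact contradict the equation. Positivity of \<open>q\<close> is asked only above the level
  \<open>k\<close>, so that the principle can be used before q > 0 is known.\<close>

lemma maximum_principle:
  assumes \<sigma>: "\<sigma> = 1 \<or> \<sigma> = (- 1 :: real)" and bdry: "\<And>s. \<sigma> * Q (s, 0) \<le> k"
    and nondeg: "\<And>s \<psi>. \<psi> > 0 \<Longrightarrow> \<sigma> * Q (s, \<psi>) > k \<Longrightarrow> q (s, \<psi>) > 0"
    and \<psi>: "\<psi> \<ge> 0"
  shows "\<sigma> * Q (s, \<psi>) \<le> k"
proof (rule ccontr)
  assume "\<not> \<sigma> * Q (s, \<psi>) \<le> k"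
  define \<theta> where "\<theta> = \<sigma> * Q (s, \<psi>) - k"
  have \<theta>: "\<theta> > 0" using \<open>\<not> _\<close> by (simp add: \<theta>_def)
  have \<psi>0: "\<psi> > 0" using \<psi> \<theta> bdry[of s] by (cases "\<psi> = 0") (auto simp: \<theta>_def)
  obtain A0 where A0: "\<And>A s. A \<ge> A0 \<Longrightarrow> \<bar>Q (s, A)\<bar> \<le> 1" using decay[of 1] by auto
  \<comment> \<open>Large enough that |Q| \<le> 1 at height A and that the linear term takes less
    than \<theta>/2 of the excess \<theta> at \<psi>; the concave term takes \<theta>/4.\<close>
  define A where "A = max A0 (max (\<psi> + 1) (2 * (\<bar>k\<bar> + 1) * \<psi> / \<theta> + 1))"
  have A: "A \<ge> A0" "A > \<psi>" "A > 0" "2 * (\<bar>k\<bar> + 1) * \<psi> / \<theta> < A" using \<psi>0 by (auto simp: A_def)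
  define \<mu> where "\<mu> = (\<bar>k\<bar> + 1) / A"
  have \<mu>: "\<mu> > 0" "\<mu> * A = \<bar>k\<bar> + 1" using A by (auto simp: \<mu>_def)
  have \<mu>\<psi>: "\<mu> * \<psi> < \<theta> / 2" using A \<theta> by (simp add: \<mu>_def field_simps)
  define \<epsilon> where "\<epsilon> = \<theta> / (4 * (\<psi> * (A - \<psi>)))"
  have \<epsilon>: "\<epsilon> > 0" "\<epsilon> * (\<psi> * (A - \<psi>)) = \<theta> / 4" using \<theta> \<psi>0 A by (auto simp: \<epsilon>_def)
  define B where "B y = k + \<mu> * y + \<epsilon> * (y * (A - y))" for y
  obtain s0 y0 where m: "0 < s0" "s0 \<le> L" "y0 \<in> {0..A}"
    "\<And>s y. y \<in> {0..A} \<Longrightarrow> (\<sigma> * Q (s, y) - B y) / 1 \<le> (\<sigma> * Q (s0, y0) - B y0) / 1"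
  proof (rule Q_attains_max[of A B "\<lambda>_. 1" "\<lambda>x. \<sigma> * Q x"])
    show "continuous_on {0..A} B" unfolding B_def by (intro continuous_intros)
    show "continuous_on (UNIV \<times> {0..}) (\<lambda>x. \<sigma> * Q x)" by (intro continuous_intros Q_cont)
  qed (use A Q_per in auto)
  have "\<sigma> * Q (s, \<psi>) - B \<psi> > 0" using \<mu>\<psi> \<epsilon> \<theta> unfolding B_def \<theta>_def[symmetric] by (simp add: \<theta>_def)
  then have pos: "\<sigma> * Q (s0, y0) > B y0" using m(4)[of \<psi> s] A \<psi>0 by simp
  have "y0 \<noteq> 0" using pos bdry[of s0] by (auto simp: B_def)
  moreover have "y0 \<noteq> A"
  proof
    assume "y0 = A"
    then have "\<sigma> * Q (s0, A) > k + (\<bar>k\<bar> + 1)" using pos \<mu>(2) by (simp add: B_def)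
    moreover have "\<sigma> * Q (s0, A) \<le> 1" using A0[OF A(1), of s0] \<sigma> by auto
    ultimately show False by (auto simp: abs_if split: if_splits)
  qed
  ultimately have y0: "0 < y0" "y0 < A" using m(3) by auto
  \<comment> \<open>At the interior maximum, -\<sigma> Q is touched from below in \<psi> by a
    translate of -B, whose second derivative is 2 \<epsilon>, and by a constant in
    \<open>s\<close>.\<close>
  have "q (s0, y0) * (2 * \<epsilon>) \<le> 0"
  proof (rule viscosity[where \<sigma> = "- \<sigma>" and B = "\<lambda>_. 0" and \<delta> = 1 and ?r0.0 = "min y0 (A - y0)" and \<phi> = "\<lambda>y. - B y"])
    show "- \<sigma> * Q (s0, y0) - 0 \<le> - \<sigma> * Q (t, y0) - 0" for t using m(4)[of y0 t] m(3) by simp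
    show "- B (y0 + r) - 2 * - B y0 + - B (y0 - r) \<le> - \<sigma> * second_diff Q s0 y0 r" if "0 < r" "r < min y0 (A - y0)" for r
      using m(4)[of "y0 + r" s0] m(4)[of "y0 - r" s0] that unfolding second_diff_def by (simp add: algebra_simps)
    show "((\<lambda>r. (- B (y0 + r) - 2 * - B y0 + - B (y0 - r)) / r\<^sup>2) \<longlongrightarrow> 2 * \<epsilon>) (at_right 0)"
    proof (rule second_difference_quotient_tendsto[of 1 y0 "\<lambda>y. - B y" "\<lambda>y. - (\<mu> + \<epsilon> * (A - 2 * y))"])
      show "((\<lambda>y. - B y) has_real_derivative - (\<mu> + \<epsilon> * (A - 2 * y))) (at y)" for y unfolding B_def by (auto intro!: derivative_eq_intros simp: algebra_simps)
    qed (auto intro!: derivative_eq_intros)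
  qed (use \<sigma> y0 in auto)
  moreover have "q (s0, y0) > 0"
  proof (rule nondeg[OF y0(1)])
    have "B y0 \<ge> k" using y0 \<mu> \<epsilon> by (simp add: B_def)
    then show "k < \<sigma> * Q (s0, y0)" using pos by simp
  qed
  ultimately show False using \<epsilon>(1) by (simp add: mult_le_0_iff)
qed

end

section \<open>A priori bounds for data close to the Euler trace\<close>

locale perturbed_solution = regular_solution +
  fixes q_e f :: "real \<Rightarrow> real" and \<omega> a M e :: real
  assumes qe_bounds: "\<And>s. a \<le> q_e s" "\<And>s. q_e s \<le> M" and a_pos: "a > 0" and a_attained: "\<exists>s. q_e s = a"
    and f_close: "\<And>s. \<bar>(f s)\<^sup>2 - (q_e s)\<^sup>2\<bar> \<le> e * (q_e s)\<^sup>2" and e_small: "0 \<le> e" "4 * e * M\<^sup>2 \<le> a\<^sup>2"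
    and omega_pos: "\<omega> > 0"
    and q_sq: "\<And>s \<psi>. \<psi> \<ge> 0 \<Longrightarrow> (q (s, \<psi>))\<^sup>2 = \<omega>\<^sup>2 * (q_e s)\<^sup>2 + Q (s, \<psi>)"
    and Q_bdry: "\<And>s. Q (s, 0) = (f s)\<^sup>2 - \<omega>\<^sup>2 * (q_e s)\<^sup>2"
begin

lemma qe_sq_bounds: "a\<^sup>2 \<le> (q_e s)\<^sup>2" "(q_e s)\<^sup>2 \<le> M\<^sup>2" "0 < (q_e s)\<^sup>2"
  using qe_bounds[of s] a_pos by (auto intro!: power_mono)

text \<open>By the maximum principle \<sigma> Q would stay below a negative level at all heights,
  which contradicts its decay to 0.\<close>

lemma Q_not_negative:
  assumes \<sigma>: "\<sigma> = 1 \<or> \<sigma> = (- 1 :: real)" and k: "k < 0" and bdry: "\<And>s. \<sigma> * Q (s, 0) \<le> k"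
    and nondeg: "\<And>s y. y > 0 \<Longrightarrow> \<sigma> * Q (s, y) > k \<Longrightarrow> q (s, y) > 0"
  shows False
proof -
  obtain A0 where A0: "\<And>A s. A \<ge> A0 \<Longrightarrow> \<bar>Q (s, A)\<bar> \<le> - k / 2" using decay[of "- k / 2"] k by auto
  have "\<bar>Q (0, max A0 0)\<bar> \<le> - k / 2" using A0 by simp
  moreover have "\<sigma> * Q (0, max A0 0) \<le> k" by (rule maximum_principle[OF \<sigma> bdry nondeg]) auto
  ultimately show False using \<sigma> k by auto
qed

lemma omega_upper: "\<omega>\<^sup>2 \<le> 1 + e"
proof (rule ccontr)
  assume "\<not> \<omega>\<^sup>2 \<le> 1 + e"
  then have w: "1 + e - \<omega>\<^sup>2 < 0" by simp
  define k where "k = max ((1 + e - \<omega>\<^sup>2) * a\<^sup>2) (- (\<omega>\<^sup>2 * a\<^sup>2))"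
  show False
  proof (rule Q_not_negative[of 1 k])
    show "k < 0" using w omega_pos a_pos by (simp add: k_def mult_neg_pos)
    show "1 * Q (s, 0) \<le> k" for s
    proof -
      have "Q (s, 0) \<le> (1 + e - \<omega>\<^sup>2) * (q_e s)\<^sup>2" using f_close[of s] by (simp add: Q_bdry abs_le_iff algebra_simps)
      also have "\<dots> \<le> (1 + e - \<omega>\<^sup>2) * a\<^sup>2" using w qe_sq_bounds(1)[of s] by (intro mult_left_mono_neg) auto
      finally show ?thesis by (simp add: k_def)
    qed
    show "q (s, y) > 0" if "y > 0" "1 * Q (s, y) > k" for s y
    proof -
      have "- (\<omega>\<^sup>2 * (q_e s)\<^sup>2) \<le> - (\<omega>\<^sup>2 * a\<^sup>2)" using qe_sq_bounds(1)[of s] by (simp add: mult_left_mono)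
      then have "(q (s, y))\<^sup>2 > 0" using that q_sq[of y s] by (simp add: k_def)
      then show ?thesis using q_nonneg[of y s] that by (simp add: order_less_le)
    qed
  qed simp
qed

text \<open>\<open>Q\<close> plus a constant, hence with the same derivatives, and a lower bound for
  q^2: \<open>R \<le> q\<^sup>2\<close>, with equality where q_e attains its minimum. Positivity of
  \<open>R\<close> therefore gives that of \<open>q\<close>.\<close>

definition R :: "real \<times> real \<Rightarrow> real" where "R x = Q x + \<omega>\<^sup>2 * a\<^sup>2"

lemma R_boundary: "R (s, 0) \<ge> a\<^sup>2 / 2"
proof -
  have "(f s)\<^sup>2 \<ge> (1 - e) * (q_e s)\<^sup>2" using f_close[of s] by (simp add: abs_le_iff algebra_simps)
  moreover have "\<omega>\<^sup>2 * ((q_e s)\<^sup>2 - a\<^sup>2) \<le> (1 + e) * ((q_e s)\<^sup>2 - a\<^sup>2)"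
    using omega_upper qe_sq_bounds(1)[of s] by (intro mult_right_mono) auto
  moreover have "e * (q_e s)\<^sup>2 \<le> e * M\<^sup>2" using qe_sq_bounds(2) e_small by (intro mult_left_mono) auto
  moreover have "0 \<le> e * a\<^sup>2" "4 * (e * M\<^sup>2) \<le> a\<^sup>2" using e_small by simp_all
  moreover have "A / 2 \<le> F - W * q + W * A"
    if "(1 - e) * q \<le> F" "W * (q - A) \<le> (1 + e) * (q - A)" "e * q \<le> m" "0 \<le> e * A" "4 * m \<le> A" for F W q A m :: real
  proof -
    have "q - e * q \<le> F" "W * q - W * A \<le> q - A + e * q - e * A" using that(1,2) by (simp_all add: algebra_simps)
    then show ?thesis using that(3-5) by linarith
  qed
  ultimately show ?thesis unfolding R_def Q_bdry by blast
qed

lemma R_le_q_sq: "y \<ge> 0 \<Longrightarrow> R (s, y) \<le> (q (s, y))\<^sup>2"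
  using q_sq[of y s] mult_left_mono[OF qe_sq_bounds(1)[of s], of "\<omega>\<^sup>2"] by (simp add: R_def)

lemma R_cont: "continuous_on (UNIV \<times> {0..}) R"
  unfolding R_def by (intro continuous_intros Q_cont)

lemma R_per: "y \<ge> 0 \<Longrightarrow> R (s - of_int k * L, y) = R (s, y)"
  by (simp add: R_def Q_shift)

text \<open>At a minimum of \<open>q_e\<close> the bound is \<open>q\<^sup>2 \<ge> 0\<close>; from there it propagates forwards in \<open>s\<close>.\<close>

lemma R_nonneg:
  assumes "\<psi> \<ge> 0"
  shows "R (s, \<psi>) \<ge> 0"
proof (rule ccontr)
  assume neg: "\<not> R (s, \<psi>) \<ge> 0"
  obtain s1 where s1: "q_e s1 = a" using a_attained by blast
  obtain k where k: "s - s1 - of_int k * L \<in> {0<..L}" by (rule periodic_reduce[OF L_pos])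
  define t where "t = s - of_int k * L"
  have t: "s1 < t" "t \<le> s1 + L" "R (t, \<psi>) < 0" using k neg R_per[OF assms, of s k] by (auto simp: t_def)
  \<comment> \<open>The tilt \<epsilon> (s - s1) turns a negative minimum into a contact with slope
    -\<epsilon> in \<open>s\<close>. Over one period it costs at most half of -R (t, \<psi>), so the
    minimum stays negative.\<close>
  define \<epsilon> where "\<epsilon> = - R (t, \<psi>) / (2 * L)"
  have \<epsilon>: "\<epsilon> > 0" "\<epsilon> * (t - s1) < - R (t, \<psi>)"
  proof -
    show "\<epsilon> > 0" using t L_pos by (simp add: \<epsilon>_def divide_neg_pos)
    then have "\<epsilon> * (t - s1) \<le> \<epsilon> * L" using t by (intro mult_left_mono) auto
    also have "\<dots> < - R (t, \<psi>)" using t L_pos by (simp add: \<epsilon>_def)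
    finally show "\<epsilon> * (t - s1) < - R (t, \<psi>)" .
  qed
  have wa: "\<omega>\<^sup>2 * a\<^sup>2 > 0" using omega_pos a_pos by simp
  obtain A0 where A0: "\<And>A s. A \<ge> A0 \<Longrightarrow> \<bar>Q (s, A)\<bar> \<le> \<omega>\<^sup>2 * a\<^sup>2" using decay[OF wa] by auto
  define A where "A = max A0 (\<psi> + 1)"
  have A: "A > \<psi>" "A > 0" "A \<ge> A0" using assms by (auto simp: A_def)
  let ?K = "{s1..s1 + L} \<times> {0..A}" and ?F = "\<lambda>x. R x + \<epsilon> * (fst x - s1)"
  have "continuous_on ?K R" by (rule continuous_on_subset[OF R_cont]) auto
  then have "continuous_on ?K ?F" by (intro continuous_intros)
  moreover have "compact ?K" by (intro compact_Times) auto
  moreover have "?K \<noteq> {}" using A L_pos by auto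
  ultimately obtain x where x: "x \<in> ?K" "\<And>y. y \<in> ?K \<Longrightarrow> ?F x \<le> ?F y"
    using continuous_attains_inf[of ?K ?F] by blast
  obtain s0 y0 where x0: "x = (s0, y0)" by (cases x)
  have "?F (t, \<psi>) < 0" using \<epsilon> by simp
  moreover have "(t, \<psi>) \<in> ?K" using t A assms by auto
  ultimately have neg0: "R (s0, y0) + \<epsilon> * (s0 - s1) < 0" using x(2)[of "(t, \<psi>)"] x0 by simp
  have s0: "s1 \<le> s0" "s0 \<le> s1 + L" "0 \<le> y0" "y0 \<le> A" using x(1) x0 by auto
  have "0 \<le> \<epsilon> * (s0 - s1)" using s0 \<epsilon> by simp
  then have Rneg: "R (s0, y0) < 0" using neg0 by linarith
  have "s0 \<noteq> s1"
  proof
    assume "s0 = s1"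
    then have "R (s0, y0) = (q (s0, y0))\<^sup>2" using q_sq[OF s0(3), of s0] s1 by (simp add: R_def)
    then show False using Rneg by (metis not_less zero_le_power2)
  qed
  moreover have "y0 \<noteq> 0"
  proof
    assume "y0 = 0"
    then have "R (s0, 0) < 0" using Rneg by simp
    moreover have "0 \<le> a\<^sup>2 / 2" by simp
    ultimately show False using R_boundary[of s0] by linarith
  qed
  moreover have "y0 \<noteq> A" using A0[OF A(3), of s0] Rneg by (auto simp: R_def abs_le_iff)
  ultimately have in0: "s1 < s0" "0 < y0" "y0 < A" using s0 by auto
  have "q (s0, y0) * 0 \<le> - \<epsilon>"
  proof (rule viscosity[where \<sigma> = 1 and B = "\<lambda>t. - \<epsilon> * t" and \<delta> = "s0 - s1" and ?r0.0 = "min y0 (A - y0)" and \<phi> = "\<lambda>_. 0"])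
    show "1 * Q (s0, y0) - - \<epsilon> * s0 \<le> 1 * Q (t, y0) - - \<epsilon> * t" if "s0 - (s0 - s1) < t" "t < s0" for t
      using x(2)[of "(t, y0)"] that s0 by (simp add: x0 R_def algebra_simps)
    show "0 - 2 * 0 + 0 \<le> 1 * second_diff Q s0 y0 r" if "0 < r" "r < min y0 (A - y0)" for r
      using x(2)[of "(s0, y0 + r)"] x(2)[of "(s0, y0 - r)"] that s0 by (simp add: x0 R_def second_diff_def)
    show "((\<lambda>t. - \<epsilon> * t) has_real_derivative - \<epsilon>) (at s0)" by (auto intro!: derivative_eq_intros)
  qed (use in0 in auto)
  then show False using \<epsilon> by simp
qed

text \<open>The barrier \<open>C\<close> is a strict subsolution of \<open>R\<^sub>s = \<surd>R R\<^sub>\<psi>\<^sub>\<psi>\<close> moving to the right with speed \<open>c\<close>. It meets zero with a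
  positive slope, so it cannot touch \<open>R\<close> at a zero of \<open>R\<close>, where the second differences of \<open>R\<close> are \<open>o(r)\<close>.\<close>

lemma R_pos:
  assumes "\<psi> \<ge> 0"
  shows "R (s, \<psi>) > 0"
proof (rule ccontr)
  assume not: "\<not> R (s, \<psi>) > 0"
  define Y where "Y = \<psi> + 1"
  have Y: "Y \<ge> 1" "\<psi> < Y" using assms by (auto simp: Y_def)
  \<comment> \<open>Normalised so that C Y = a^2 / 4, below the lower bound a^2 / 2 of
    \<open>R\<close> on the boundary.\<close>
  define \<beta> where "\<beta> = a\<^sup>2 / (4 * (Y + Y * sqrt Y))"
  have den: "Y + Y * sqrt Y > 0" using Y by (intro add_pos_nonneg) auto
  have \<beta>: "\<beta> > 0" using den a_pos by (simp add: \<beta>_def)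
  \<comment> \<open>The linear part gives the positive slope at 0. The part y^(3/2) has second
    derivative of order y^(-1/2), which compensates the degenerating coefficient of order
    y^(1/2).\<close>
  define C where "C y = \<beta> * (y + y * sqrt y)" for y
  have CY: "C Y < a\<^sup>2 / 2"
  proof -
    have "a\<^sup>2 / (4 * D) * D = a\<^sup>2 / 4" if "D > 0" for D using that by simp
    from this[OF den] have "C Y = a\<^sup>2 / 4" by (simp only: C_def \<beta>_def)
    moreover have "a\<^sup>2 > 0" using a_pos by simp
    ultimately show ?thesis by linarith
  qed
  have Cmono: "C y \<le> C Y" if "0 \<le> y" "y \<le> Y" for y
    unfolding C_def using that \<beta> by (intro mult_left_mono add_mono mult_mono) auto
  have Clin: "\<beta> * y \<le> C y" if "0 \<le> y" for y using that \<beta> by (simp add: C_def mult_left_mono)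
  \<comment> \<open>The subsolution condition c C' < sqrt(\<beta> y) C'' reads c (1 + 3/2 sqrt y) <
    3/4 sqrt \<beta>; this speed makes the left side at most sqrt \<beta> / 2 for all y \<le>
    Y.\<close>
  define c where "c = sqrt \<beta> / (2 * (1 + 3/2 * sqrt Y))"
  have c: "c > 0" using \<beta> Y by (auto simp: c_def intro!: divide_pos_pos add_pos_nonneg)
  \<comment> \<open>The front leaves the boundary at time \<open>si\<close> and reaches Y = \<psi> +
    1, beyond \<psi>, at time \<open>s\<close>.\<close>
  define si where "si = s - Y / c"
  have si: "si < s" "c * (s - si) = Y" using c Y by (auto simp: si_def)
  let ?K = "({si..s} \<times> {0..Y}) \<times> {0..Y}"
  \<comment> \<open>The last coordinate \<theta> is a distance by which the barrier is held back,
    and \<open>S\<close> collects the points where the barrier so retarded is not below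
    \<open>R\<close>. With the largest such \<theta> the barrier lies below \<open>R\<close>
    wherever its argument is positive, and touches it.\<close>
  define S where "S = ?K \<inter> {z. snd z \<le> c * (fst (fst z) - si) - snd (fst z)} \<inter> {z \<in> ?K. R (fst z) \<le> C (c * (fst (fst z) - si) - snd (fst z) - snd z)}"
  have cR: "continuous_on ?K (\<lambda>z. R (fst z))"
    by (rule continuous_on_compose2[OF R_cont]) (auto intro: continuous_intros)
  have cC: "continuous_on UNIV C" unfolding C_def by (intro continuous_intros)
  have cC': "continuous_on ?K (\<lambda>z. C (c * (fst (fst z) - si) - snd (fst z) - snd z))"
    by (rule continuous_on_compose2[OF cC]) (auto intro!: continuous_intros)
  have "closed {z \<in> ?K. R (fst z) \<le> C (c * (fst (fst z) - si) - snd (fst z) - snd z)}"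
    by (rule continuous_on_closed_Collect_le[OF cR cC']) (intro closed_Times closed_atLeastAtMost)
  moreover have "closed {z :: (real \<times> real) \<times> real. snd z \<le> c * (fst (fst z) - si) - snd (fst z)}"
    by (intro closed_Collect_le continuous_intros)
  moreover have "compact ?K" by (intro compact_Times compact_Icc)
  ultimately have cS: "compact S" unfolding S_def by (intro compact_Int_closed)
  have mem: "((s, \<psi>), 0) \<in> S"
  proof -
    have "R (s, \<psi>) \<le> C (Y - \<psi>)"
    proof -
      have "0 \<le> \<beta> * (Y - \<psi>)" using Y \<beta> by simp
      then show ?thesis using not Clin[of "Y - \<psi>"] Y by linarith
    qed
    then show ?thesis using si Y assms by (auto simp: S_def)
  qed
  have "S \<noteq> {}" "continuous_on S snd" using mem by (auto intro: continuous_intros)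
  from continuous_attains_sup[OF cS this]
  obtain z where z: "z \<in> S" "\<And>w. w \<in> S \<Longrightarrow> snd w \<le> snd z" by blast
  have le_Y: "c * (t - si) \<le> Y" if "t \<le> s" for t
    using mult_left_mono[of "t - si" "s - si" c] c si that by simp
  obtain s0 y0 \<theta> where z0: "z = ((s0, y0), \<theta>)" by (cases z) auto
  have in0: "si \<le> s0" "s0 \<le> s" "0 \<le> y0" "y0 \<le> Y" "0 \<le> \<theta>" "\<theta> \<le> Y" "\<theta> \<le> c * (s0 - si) - y0" "R (s0, y0) \<le> C (c * (s0 - si) - y0 - \<theta>)"
    using z(1) by (auto simp: z0 S_def)
  have ge: "C (c * (t - si) - y - \<theta>) \<le> R (t, y)" if t: "si \<le> t" "t \<le> s" "0 \<le> y" and gt: "\<theta> < c * (t - si) - y" for t y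
  proof (rule ccontr)
    assume "\<not> C (c * (t - si) - y - \<theta>) \<le> R (t, y)"
    then have lt: "R (t, y) < C (c * (t - si) - y - \<theta>)" by simp
    have "c * (t - si) \<le> Y" using t le_Y by blast
    then have yY: "y \<le> Y" "c * (t - si) - y \<le> Y" using gt in0 t by auto
    have "continuous_on UNIV (\<lambda>\<eta>. C (c * (t - si) - y - \<eta>))" by (rule continuous_on_compose2[OF cC]) (auto intro!: continuous_intros)
    then have "isCont (\<lambda>\<eta>. C (c * (t - si) - y - \<eta>)) \<theta>" by (simp add: continuous_on_eq_continuous_at)
    then have "((\<lambda>\<eta>. C (c * (t - si) - y - \<eta>)) \<longlongrightarrow> C (c * (t - si) - y - \<theta>)) (at_right \<theta>)" unfolding isCont_def by (rule tendsto_within_subset) simp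
    then have "\<forall>\<^sub>F \<eta> in at_right \<theta>. R (t, y) < C (c * (t - si) - y - \<eta>)" using lt by (rule order_tendstoD)
    moreover have "\<forall>\<^sub>F \<eta> in at_right \<theta>. \<eta> < c * (t - si) - y" unfolding eventually_at_right_field using gt by blast
    moreover have "\<forall>\<^sub>F \<eta> in at_right \<theta>. \<theta> < \<eta>" by (rule eventually_at_right_less)
    ultimately have "\<forall>\<^sub>F \<eta> in at_right \<theta>. ((t, y), \<eta>) \<in> S \<and> \<theta> < \<eta>"
    proof eventually_elim
      case (elim \<eta>)
      then show ?case using t yY in0 by (auto simp: S_def)
    qed
    then obtain \<eta> where "((t, y), \<eta>) \<in> S" "\<theta> < \<eta>" using eventually_happens' trivial_limit_at_right_real by blast
    then show False using z(2)[of "((t, y), \<eta>)"] by (simp add: z0)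
  qed
  have y0: "y0 > 0"
  proof (rule ccontr)
    assume "\<not> y0 > 0"
    then have "y0 = 0" using in0 by simp
    have "c * (s0 - si) \<le> Y" using in0 le_Y by blast
    then have "R (s0, 0) \<le> C Y" using in0 Cmono[of "c * (s0 - si) - \<theta>"] \<open>y0 = 0\<close> by simp
    then show False using R_boundary[of s0] CY by simp
  qed
  show False
  proof (cases "\<theta> < c * (s0 - si) - y0")
    \<comment> \<open>Contact at the tip of the front, where R = 0: the slope \<beta> on the left
      and R \<ge> 0 on the right make the second difference at least \<beta> r, against
      \<open>second_diff_small\<close>.\<close>
    case False
    then have \<theta>: "\<theta> = c * (s0 - si) - y0" using in0 by simp
    then have R0: "R (s0, y0) = 0" using in0 R_nonneg[of y0 s0] by (simp add: C_def)
    have "\<forall>\<^sub>F r in at_right 0. \<beta> \<le> second_diff Q s0 y0 r / r" unfolding eventually_at_right_field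
    proof (intro exI[of _ y0] conjI y0 allI impI)
      fix r :: real assume r: "0 < r" "r < y0"
      have "C r \<le> R (s0, y0 - r)" using ge[of s0 "y0 - r"] in0 r \<theta> by simp
      then have "\<beta> * r \<le> R (s0, y0 - r)" using Clin[of r] r by simp
      moreover have "0 \<le> R (s0, y0 + r)" using R_nonneg[of "y0 + r" s0] r y0 by simp
      ultimately have "\<beta> * r \<le> second_diff Q s0 y0 r" using R0 by (simp add: second_diff_def R_def)
      then show "\<beta> \<le> second_diff Q s0 y0 r / r" using r by (simp add: le_divide_eq)
    qed
    then have "\<beta> \<le> 0" using tendsto_lowerbound[OF second_diff_small[OF y0]] by simp
    then show False using \<beta> by simp
  next
    \<comment> \<open>Contact behind the front, where R = C y > 0. Since q \<ge> sqrt R \<ge>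
      sqrt(\<beta> y), the viscosity inequality contradicts the choice of the speed
      \<open>c\<close>.\<close>
    case True
    define y where "y = c * (s0 - si) - y0 - \<theta>"
    have y: "y > 0" using True by (simp add: y_def)
    have R0: "R (s0, y0) = C y" using ge[of s0 y0] in0 True by (simp add: y_def)
    have y_le: "y \<le> Y"
    proof -
      have "c * (s0 - si) \<le> Y" using in0 le_Y by blast
      then show ?thesis using in0 by (simp add: y_def)
    qed
    have s0si: "si < s0" using y in0 by (cases "si = s0") (auto simp: y_def)
    let ?\<phi> = "\<lambda>p. C ((-1) * p + (c * (s0 - si) - \<theta>))" and ?B = "\<lambda>t. C (c * t + (- c * si - y0 - \<theta>))"
    define C' where "C' u = \<beta> * (1 + 3/2 * sqrt u)" for u
    have dC: "(C has_real_derivative C' u) (at u)" if "u > 0" for u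
    proof -
      have "((\<lambda>u. u * sqrt u) has_real_derivative 3/2 * sqrt u) (at u)"
      proof -
        have "u * (inverse (sqrt u) / 2) = sqrt u / 2" using that real_sqrt_mult_self[of u] by (simp add: field_simps)
        then have "u * (inverse (sqrt u) / 2) + sqrt u = 3/2 * sqrt u" by simp
        then show ?thesis using that by (auto intro!: derivative_eq_intros simp: mult.commute)
      qed
      then show ?thesis unfolding C_def C'_def by (rule DERIV_cmult[OF DERIV_add[OF DERIV_ident]])
    qed
    have dC': "(C' has_real_derivative \<beta> * (3/4 / sqrt u)) (at u)" if "u > 0" for u
      unfolding C'_def using that by (auto intro!: derivative_eq_intros simp: field_simps)
    have "q (s0, y0) * (\<beta> * (3/4 / sqrt y)) \<le> c * C' y"
    proof (rule viscosity[where \<sigma> = 1 and B = "?B" and \<delta> = "min (s0 - si) (y / c)" and ?r0.0 = "min y0 y"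
          and \<phi> = "?\<phi>"])
      show "0 < min (s0 - si) (y / c)" using s0si y c by simp
      show "1 * Q (s0, y0) - ?B s0 \<le> 1 * Q (t, y0) - ?B t"
        if "s0 - min (s0 - si) (y / c) < t" "t < s0" for t
      proof -
        have tt: "si \<le> t" "s0 - t < y / c" using that by auto
        then have "c * (s0 - t) < y" using c by (simp add: less_divide_eq mult.commute)
        then have "\<theta> < c * (t - si) - y0" by (simp add: y_def algebra_simps)
        then have "C (c * (t - si) - y0 - \<theta>) \<le> R (t, y0)" using tt that in0 by (intro ge) auto
        then show ?thesis using R0 by (simp add: R_def y_def algebra_simps)
      qed
      show "((?B) has_real_derivative c * C' y) (at s0)" by (rule affine_deriv) (use dC[OF y] in \<open>simp add: y_def algebra_simps\<close>)
      show "0 < min y0 y" using y0 y by simp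
      show "?\<phi> (y0 + r) - 2 * ?\<phi> y0 + ?\<phi> (y0 - r)
         \<le> 1 * second_diff Q s0 y0 r" if "0 < r" "r < min y0 y" for r
      proof -
        have "C (c * (s0 - si) - (y0 + r) - \<theta>) \<le> R (s0, y0 + r)" "C (c * (s0 - si) - (y0 - r) - \<theta>) \<le> R (s0, y0 - r)"
          using that in0 by (intro ge; auto simp: y_def)+
        then show ?thesis using R0 by (simp add: R_def second_diff_def y_def algebra_simps)
      qed
      show "((\<lambda>r. (?\<phi> (y0 + r) - 2 * ?\<phi> y0 + ?\<phi> (y0 - r)) / r\<^sup>2)
         \<longlongrightarrow> \<beta> * (3/4 / sqrt y)) (at_right 0)"
      proof (rule second_difference_quotient_tendsto[of y y0 "?\<phi>" "\<lambda>p. (-1) * C' ((-1) * p + (c * (s0 - si) - \<theta>))", OF y])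
        fix p assume "\<bar>p - y0\<bar> < y"
        then show "((?\<phi>) has_real_derivative (-1) * C' ((-1) * p + (c * (s0 - si) - \<theta>))) (at p)" by (intro affine_deriv dC) (auto simp: y_def)
      next
        have "((\<lambda>p. C' ((-1) * p + (c * (s0 - si) - \<theta>))) has_real_derivative (-1) * (\<beta> * (3/4 / sqrt y))) (at y0)"
          by (rule affine_deriv) (use dC'[OF y] in \<open>simp add: y_def algebra_simps\<close>)
        from DERIV_cmult[OF this, of "-1"]
        show "((\<lambda>p. (-1) * C' ((-1) * p + (c * (s0 - si) - \<theta>))) has_real_derivative \<beta> * (3/4 / sqrt y)) (at y0)" by simp
      qed
    qed (use y0 in auto)
    moreover have "sqrt (\<beta> * y) \<le> q (s0, y0)"
    proof -
      have "\<beta> * y \<le> (q (s0, y0))\<^sup>2" using Clin[of y] y R0 R_le_q_sq[of y0 s0] y0 by simp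
      then have "sqrt (\<beta> * y) \<le> sqrt ((q (s0, y0))\<^sup>2)" by (rule real_sqrt_le_mono)
      then show ?thesis using q_nonneg[of y0 s0] y0 by simp
    qed
    moreover have "0 \<le> \<beta> * (3/4 / sqrt y)" using \<beta> y by simp
    ultimately have "sqrt (\<beta> * y) * (\<beta> * (3/4 / sqrt y)) \<le> c * C' y" using mult_right_mono order_trans by blast
    then have "\<beta> * (3/4 * sqrt \<beta>) \<le> \<beta> * (c * (1 + 3/2 * sqrt y))" using y \<beta> by (simp add: real_sqrt_mult C'_def mult_ac)
    then have "3/4 * sqrt \<beta> \<le> c * (1 + 3/2 * sqrt y)" using \<beta> by (simp only: mult_le_cancel_left_pos)
    also have "\<dots> \<le> c * (1 + 3/2 * sqrt Y)" using c y_le by (intro mult_left_mono) auto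
    also have "\<dots> = sqrt \<beta> / 2"
    proof -
      have "1 + 3/2 * sqrt Y > 0" using Y by (intro add_pos_nonneg) auto
      moreover have "b / (2 * d) * d = b / 2" if "d > 0" for b d :: real using that by simp
      ultimately show ?thesis unfolding c_def by blast
    qed
    finally show False using \<beta> by simp
  qed
qed

lemma q_pos: "y \<ge> 0 \<Longrightarrow> q (s, y) > 0"
  using R_pos[of y s] R_le_q_sq[of y s] q_nonneg[of y s] by (cases "q (s, y) = 0") auto

lemma Q_lower: "y \<ge> 0 \<Longrightarrow> - Q (s, y) \<le> 2 * e * M\<^sup>2"
proof -
  assume y: "y \<ge> 0"
  have "(-1) * Q (s, y) \<le> 2 * e * M\<^sup>2"
  proof (rule maximum_principle[OF _ _ _ y])
    fix s
    have "(f s)\<^sup>2 \<ge> (1 - e) * (q_e s)\<^sup>2" using f_close[of s] by (simp add: abs_le_iff algebra_simps)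
    moreover have "\<omega>\<^sup>2 * (q_e s)\<^sup>2 \<le> (1 + e) * (q_e s)\<^sup>2" using omega_upper by (intro mult_right_mono) auto
    moreover have "e * (q_e s)\<^sup>2 \<le> e * M\<^sup>2" using qe_sq_bounds(2) e_small by (intro mult_left_mono) auto
    ultimately show "(-1) * Q (s, 0) \<le> 2 * e * M\<^sup>2" unfolding Q_bdry by (simp add: algebra_simps)
  qed (use q_pos in auto)
  then show ?thesis by simp
qed

text \<open>The counterpart of \<open>omega_upper\<close> for -Q. Here the required nondegeneracy is
  \<open>q_pos\<close>, whose proof rests on the upper bound for \<omega>.\<close>

lemma omega_lower: "\<omega>\<^sup>2 \<ge> 1 - e"
proof (rule ccontr)
  assume "\<not> \<omega>\<^sup>2 \<ge> 1 - e"
  then have w: "\<omega>\<^sup>2 - (1 - e) < 0" by simp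
  show False
  proof (rule Q_not_negative[of "- 1" "(\<omega>\<^sup>2 - (1 - e)) * a\<^sup>2"])
    show "(\<omega>\<^sup>2 - (1 - e)) * a\<^sup>2 < 0" using w a_pos by (intro mult_neg_pos) auto
    fix s
    have "- 1 * Q (s, 0) \<le> (\<omega>\<^sup>2 - (1 - e)) * (q_e s)\<^sup>2" using f_close[of s] by (simp add: Q_bdry abs_le_iff algebra_simps)
    also have "\<dots> \<le> (\<omega>\<^sup>2 - (1 - e)) * a\<^sup>2" using w qe_sq_bounds(1)[of s] by (intro mult_left_mono_neg) auto
    finally show "- 1 * Q (s, 0) \<le> (\<omega>\<^sup>2 - (1 - e)) * a\<^sup>2" .
  qed (use q_pos in auto)
qed

lemma q_lower: "y \<ge> 0 \<Longrightarrow> q (s, y) \<ge> a / 2"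
proof -
  assume y: "y \<ge> 0"
  have "(1 - e) * (q_e s)\<^sup>2 \<le> \<omega>\<^sup>2 * (q_e s)\<^sup>2" using omega_lower by (intro mult_right_mono) auto
  moreover have "e * (q_e s)\<^sup>2 \<le> e * M\<^sup>2" using qe_sq_bounds(2) e_small by (intro mult_left_mono) auto
  \<comment> \<open>One e M^2 comes from the bound on \<omega>, two from \<open>Q_lower\<close>; the
    condition 4 e M^2 \<le> a^2 then leaves a^2 / 4.\<close>
  ultimately have "a\<^sup>2 - 3 * (e * M\<^sup>2) \<le> (q (s, y))\<^sup>2"
    using Q_lower[OF y, of s] q_sq[OF y, of s] qe_sq_bounds(1)[of s] by (simp add: algebra_simps)
  then have "(a / 2)\<^sup>2 \<le> (q (s, y))\<^sup>2" using e_small by (simp add: power_divide)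
  then show ?thesis using q_nonneg[OF y, of s] a_pos by (simp add: power2_le_iff_abs_le)
qed

end

text \<open>For z = \<sigma> (Q1 - Q2) and D = \<sigma> (\<omega>1^2 - \<omega>2^2) the boundary
  value is -D q_e^2 \<le> -D a^2, and half of this bound persists inside. If D > 0 this contradicts
  decay; once D = 0 it says z \<le> 0. The equations subtract to z_s = q1 z'' + \<sigma> (q1 - q2)
  H2, which is why the exponential bound is asked of the second solution.\<close>

lemma perturbed_solutions_compare:
  fixes \<delta> \<kappa> :: real
  assumes S1: "perturbed_solution L Q1 q1 V1 H1 q_e f \<omega>1 a M e" and S2: "perturbed_solution L Q2 q2 V2 H2 q_e f \<omega>2 a M e"
    and \<delta>: "\<delta> > 0" and H2: "AE x in lborel. x \<in> cylinder L \<longrightarrow> \<bar>H2 x\<bar> \<le> \<kappa> * exp (- (\<delta> * snd x))"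
    and \<kappa>: "0 \<le> \<kappa>" "2 * \<kappa> * (2 + 12 * M\<^sup>2 / a\<^sup>2) < \<delta>\<^sup>2 * a\<^sup>2"
    and \<sigma>: "\<sigma> = 1 \<or> \<sigma> = (- 1 :: real)" and D: "0 \<le> \<sigma> * (\<omega>1\<^sup>2 - \<omega>2\<^sup>2)" and \<psi>1: "\<psi>1 > 0"
  shows "\<sigma> * (Q1 (s1, \<psi>1) - Q2 (s1, \<psi>1)) \<le> - (\<sigma> * (\<omega>1\<^sup>2 - \<omega>2\<^sup>2)) * a\<^sup>2 / 2"
proof (rule ccontr)
  interpret S1: perturbed_solution L Q1 q1 V1 H1 q_e f \<omega>1 a M e by (rule S1)
  interpret S2: perturbed_solution L Q2 q2 V2 H2 q_e f \<omega>2 a M e by (rule S2)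
  note a = S1.a_pos
  define D where "D = \<sigma> * (\<omega>1\<^sup>2 - \<omega>2\<^sup>2)"
  let ?c = "2 + 12 * M\<^sup>2 / a\<^sup>2" and ?d = "D * a\<^sup>2"
  have D0: "D \<ge> 0" using D by (simp add: D_def)
  define z where "z x = \<sigma> * Q1 x + (- \<sigma>) * Q2 x" for x
  assume "\<not> \<sigma> * (Q1 (s1, \<psi>1) - Q2 (s1, \<psi>1)) \<le> - (\<sigma> * (\<omega>1\<^sup>2 - \<omega>2\<^sup>2)) * a\<^sup>2 / 2"
  moreover have "z (s1, \<psi>1) = \<sigma> * (Q1 (s1, \<psi>1) - Q2 (s1, \<psi>1))" by (simp add: z_def algebra_simps)
  ultimately have gt: "z (s1, \<psi>1) > - D * a\<^sup>2 / 2" unfolding D_def by linarith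
  define \<theta> where "\<theta> = z (s1, \<psi>1) + ?d / 2"
  have \<theta>: "\<theta> > 0" using gt by (simp add: \<theta>_def)
  have zc: "continuous_on (UNIV \<times> {0..}) z"
    unfolding z_def by (intro continuous_intros S1.Q_cont S2.Q_cont)
  have zper: "z (s + L, \<psi>) = z (s, \<psi>)" if "\<psi> \<ge> 0" for s \<psi>
    using S1.Q_per[OF that] S2.Q_per[OF that] by (simp add: z_def)
  have zpsi2: "distributional_psi2 L (\<lambda>x. (- 1) * z x + 0 * z x) (\<lambda>x. (- 1) * (\<sigma> * H1 x + (- \<sigma>) * H2 x) + 0 * (\<sigma> * H1 x + (- \<sigma>) * H2 x))"
    unfolding z_def by (intro distributional_psi2_linear S1.psi2 S2.psi2)
  obtain A1 where A1: "\<And>A s. A \<ge> A1 \<Longrightarrow> \<bar>Q1 (s, A)\<bar> \<le> \<theta> / 16" using S1.decay[of "\<theta> / 16"] \<theta> by auto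
  obtain A2 where A2: "\<And>A s. A \<ge> A2 \<Longrightarrow> \<bar>Q2 (s, A)\<bar> \<le> \<theta> / 16" using S2.decay[of "\<theta> / 16"] \<theta> by auto
  define A where "A = max (max A1 A2) (max (\<psi>1 + 1) (2 * (?d) * \<psi>1 / \<theta> + 1))"
  have A: "A \<ge> A1" "A \<ge> A2" "A > \<psi>1" "A > 0" "2 * (?d) * \<psi>1 / \<theta> < A" using \<psi>1 by (auto simp: A_def)
  have zA: "z (s, A) \<le> \<theta> / 8" for s
    using A1[OF A(1), of s] A2[OF A(2), of s] \<sigma> unfolding z_def abs_le_iff by auto
  \<comment> \<open>The line \<mu> y - D a^2 joins the boundary bound to the value 0 at height
    \<open>A\<close>, which is so large that the line has risen by less than \<theta>/2 at
    \<psi>1.\<close>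
  define \<mu> where "\<mu> = ?d / A"
  have \<mu>: "\<mu> \<ge> 0" "\<mu> * A = ?d" "\<mu> * \<psi>1 < \<theta> / 2"
  proof -
    show "\<mu> \<ge> 0" "\<mu> * A = ?d" using A D0 by (auto simp: \<mu>_def)
    show "\<mu> * \<psi>1 < \<theta> / 2" using A \<theta> by (simp add: \<mu>_def field_simps)
  qed
  \<comment> \<open>Bounded between 1 and 2, with second derivative -\<delta>^2 exp(-\<delta> y): it
    decays at the rate of the bound on \<open>H2\<close> and so can absorb the zeroth order term at
    every height.\<close>
  define \<Phi> where "\<Phi> y = 2 - exp (- (\<delta> * y))" for y
  have \<Phi>: "1 \<le> \<Phi> y" "\<Phi> y \<le> 2" if "y \<ge> 0" for y using that \<delta> by (auto simp: \<Phi>_def)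
  obtain s0 y0 where m: "0 < s0" "s0 \<le> L" "y0 \<in> {0..A}"
    "\<And>s y. y \<in> {0..A} \<Longrightarrow> (z (s, y) - (\<mu> * y - ?d)) / \<Phi> y \<le> (z (s0, y0) - (\<mu> * y0 - ?d)) / \<Phi> y0"
  proof (rule S1.Q_attains_max[of A "\<lambda>y. \<mu> * y - ?d" \<Phi> z])
    show "\<Phi> y > 0" if "y \<in> {0..A}" for y using \<Phi>(1)[of y] that by simp
    show "continuous_on {0..A} \<Phi>" unfolding \<Phi>_def by (intro continuous_intros)
  qed (use A zc zper in \<open>auto intro!: continuous_intros\<close>)
  define \<Lambda> where "\<Lambda> = (z (s0, y0) - (\<mu> * y0 - ?d)) / \<Phi> y0"
  let ?\<beta> = "\<lambda>y. \<Lambda> * (\<delta>\<^sup>2 * exp (- (\<delta> * y)))"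
  define B where "B y = \<mu> * y - ?d + \<Lambda> * \<Phi> y" for y
  have zB: "z (s, y) \<le> B y" if "y \<in> {0..A}" for s y
    using m(4)[OF that, of s] \<Phi>(1)[of y] that unfolding \<Lambda>_def[symmetric] B_def by (simp add: divide_le_eq)
  have zB0: "z (s0, y0) = B y0" using \<Phi>(1)[of y0] m(3) by (simp add: B_def \<Lambda>_def)
  have "z (s1, \<psi>1) \<le> B \<psi>1" using zB[of \<psi>1 s1] A \<psi>1 by simp
  moreover have "\<theta> / 2 + d / 2 < p" if "\<theta> = x + d / 2" "x \<le> m - d + p" "m < \<theta> / 2" for x m d p
    using that by linarith
  ultimately have "\<theta> / 2 + ?d / 2 < \<Lambda> * \<Phi> \<psi>1" using \<mu>(3) \<theta>_def unfolding B_def by blast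
  moreover have "0 \<le> ?d" using D0 by simp
  moreover have "\<Lambda> * \<Phi> \<psi>1 \<le> \<Lambda> * 2" if "\<Lambda> \<ge> 0" using \<Phi>(2)[of \<psi>1] that \<psi>1 by (intro mult_left_mono) auto
  moreover have "\<Lambda> * \<Phi> \<psi>1 \<le> 0" if "\<Lambda> \<le> 0" using \<Phi>(1)[of \<psi>1] that \<psi>1 by (intro mult_nonpos_nonneg) auto
  ultimately have \<Lambda>: "\<theta> / 4 + ?d / 4 < \<Lambda>" "\<Lambda> > 0" using \<theta> by (cases "\<Lambda> \<ge> 0"; force)+
  have "y0 \<noteq> 0"
  proof
    assume "y0 = 0"
    have "z (s0, 0) = - (D * (q_e s0)\<^sup>2)" unfolding z_def S1.Q_bdry S2.Q_bdry D_def by (simp add: algebra_simps)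
    moreover have "?d \<le> D * (q_e s0)\<^sup>2" using S1.qe_sq_bounds(1)[of s0] D0 by (intro mult_left_mono) auto
    ultimately show False using zB0 \<Lambda>(2) \<open>y0 = 0\<close> by (simp add: B_def \<Phi>_def)
  qed
  moreover have "y0 \<noteq> A"
  proof
    assume "y0 = A"
    then have "z (s0, A) = \<Lambda> * \<Phi> A" using zB0 \<mu> by (simp add: B_def)
    moreover have "\<Lambda> * 1 \<le> \<Lambda> * \<Phi> A" using \<Phi>(1)[of A] A \<Lambda> by (intro mult_left_mono) auto
    moreover have "0 \<le> ?d" using D0 by simp
    ultimately show False using zA[of s0] \<Lambda>(1) \<theta> by linarith
  qed
  ultimately have y0: "0 < y0" "y0 < A" using m(3) by auto
  define v where "v x = \<sigma> * V1 x - \<sigma> * V2 x" for x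
  have "((\<lambda>t. - z (t, y0)) has_real_derivative - v (s0, y0)) (at s0 within {0..L})"
    unfolding z_def v_def using S1.V_deriv[of s0 y0] S2.V_deriv[of s0 y0] m y0 by (auto intro!: derivative_eq_intros)
  then have "- v (s0, y0) \<le> 0"
    by (rule deriv_le_of_contact[OF m(1,2) _ DERIV_const[of 0] m(1)]) (use zB[of y0] zB0 m(3) in simp)
  then have v0: "v (s0, y0) \<ge> 0" by simp
  \<comment> \<open>A continuous lower bound for \<sigma> (H1 - H2), which is itself known only
    almost everywhere: V1 = q1 H1 and V2 = q2 H2 give q1 \<sigma> (H1 - H2) = v - \<sigma> (q1 - q2)
    H2.\<close>
  define E where "E x = (v x - \<bar>q1 x - q2 x\<bar> * (\<kappa> * exp (- (\<delta> * snd x)))) / q1 x" for x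
  have q1p: "q1 x > 0" if "snd x \<ge> 0" for x using S1.q_pos[of "snd x" "fst x"] that by simp
  have Ec: "continuous_on (UNIV \<times> {0..}) E"
    unfolding E_def v_def by (intro continuous_intros continuous_on_subset[OF S1.V_cont] continuous_on_subset[OF S2.V_cont] S1.q_cont S2.q_cont)
       (use q1p in \<open>auto simp: less_imp_neq[symmetric]\<close>)
  have E0: "E (s0, y0) > - (?\<beta> y0)"
  proof -
    let ?q1 = "q1 (s0, y0)" and ?q2 = "q2 (s0, y0)" and ?x = "exp (- (\<delta> * y0))"
    have ql: "?q1 \<ge> a / 2" "?q2 \<ge> a / 2" using S1.q_lower[of y0 s0] S2.q_lower[of y0 s0] y0 by auto
    have p: "(?q1 + ?q2) * ?q1 \<ge> (a / 2 + a / 2) * (a / 2)" using ql a by (intro mult_mono add_mono) auto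
    have p0: "?q1 > 0" "?q1 + ?q2 > 0" using ql a by auto
    have "\<sigma> * (?q1\<^sup>2 - ?q2\<^sup>2) = z (s0, y0) + D * (q_e s0)\<^sup>2" using S1.q_sq[of y0 s0] S2.q_sq[of y0 s0] y0 by (simp add: z_def D_def algebra_simps)
    then have "\<bar>?q1\<^sup>2 - ?q2\<^sup>2\<bar> = \<bar>z (s0, y0) + D * (q_e s0)\<^sup>2\<bar>" using \<sigma> by (auto simp: abs_minus_commute)
    \<comment> \<open>The term \<Lambda> \<Phi> contributes 2 \<Lambda>; the three others are each
      at most D M^2, and D a^2 \<le> 4 \<Lambda> turns them into 12 \<Lambda> M^2 / a^2.\<close>
    also have "\<dots> \<le> \<Lambda> * ?c"
    proof -
      have d1: "?d \<le> 4 * \<Lambda>" using \<Lambda> \<theta> by simp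
      have d2: "0 \<le> D * (q_e s0)\<^sup>2" "D * (q_e s0)\<^sup>2 \<le> D * M\<^sup>2" "?d \<le> D * M\<^sup>2" "0 \<le> ?d" using D0 S1.qe_sq_bounds[of s0] by (auto intro!: mult_left_mono)
      have d3: "\<mu> * y0 \<le> ?d" using \<mu> y0 mult_left_mono[of y0 A \<mu>] by simp
      have d4: "0 \<le> \<mu> * y0" using \<mu> y0 by simp
      have d5: "\<Lambda> * \<Phi> y0 \<le> \<Lambda> * 2" "0 \<le> \<Lambda> * \<Phi> y0" using \<Phi>[of y0] y0 \<Lambda> by (auto intro!: mult_left_mono)
      have "D * M\<^sup>2 = (?d) * (M\<^sup>2 / a\<^sup>2)" using a by simp
      also have "\<dots> \<le> (4 * \<Lambda>) * (M\<^sup>2 / a\<^sup>2)" using d1 by (intro mult_right_mono) auto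
      also have "\<dots> = \<Lambda> * (12 * M\<^sup>2 / a\<^sup>2) / 3" by simp
      finally have d6': "D * M\<^sup>2 \<le> \<Lambda> * (12 * M\<^sup>2 / a\<^sup>2) / 3" .
      have "3 * x \<le> y" if "x \<le> y / 3" for x y :: real using that by simp
      from this[OF d6'] have d6: "3 * (D * M\<^sup>2) \<le> \<Lambda> * (12 * M\<^sup>2 / a\<^sup>2)" .
      have "\<Lambda> * ?c = \<Lambda> * 2 + \<Lambda> * (12 * M\<^sup>2 / a\<^sup>2)" by (simp add: ring_distribs)
      then show ?thesis unfolding zB0 B_def using d2 d3 d4 d5 d6 by (intro abs_leI) linarith+
    qed
    finally have "\<bar>?q1 - ?q2\<bar> * (?q1 + ?q2) \<le> \<Lambda> * ?c" using p0(2) by (simp add: power2_eq_square square_diff_square_factored abs_mult mult.commute)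
    then have "\<bar>?q1 - ?q2\<bar> * (?q1 + ?q2) * \<kappa> \<le> \<Lambda> * ?c * \<kappa>" using \<kappa>(1) by (rule mult_right_mono)
    also have "\<dots> = \<Lambda> * (\<kappa> * ?c)" by simp
    also have "\<dots> < \<Lambda> * (\<delta>\<^sup>2 * (a\<^sup>2 / 2))"
    proof (rule mult_strict_left_mono[OF _ \<Lambda>(2)])
      have "k * c < d * (b / 2)" if "2 * k * c < d * b" for k c d b :: real using that by simp
      from this[OF \<kappa>(2)] show "\<kappa> * ?c < \<delta>\<^sup>2 * (a\<^sup>2 / 2)" .
    qed
    also have "\<dots> = (\<Lambda> * \<delta>\<^sup>2) * ((a / 2 + a / 2) * (a / 2))" by (simp add: power2_eq_square)
    also have "\<dots> \<le> (\<Lambda> * \<delta>\<^sup>2) * ((?q1 + ?q2) * ?q1)" using p \<Lambda>(2) by (intro mult_left_mono) auto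
    finally have "(\<bar>?q1 - ?q2\<bar> * \<kappa>) * (?q1 + ?q2) < (\<Lambda> * \<delta>\<^sup>2 * ?q1) * (?q1 + ?q2)" by (simp only: mult_ac)
    then have "\<bar>?q1 - ?q2\<bar> * \<kappa> < \<Lambda> * \<delta>\<^sup>2 * ?q1" using p0(2) by (simp only: mult_less_cancel_right_pos)
    then have "\<bar>?q1 - ?q2\<bar> * \<kappa> * ?x < \<Lambda> * \<delta>\<^sup>2 * ?q1 * ?x" by (intro mult_strict_right_mono) auto
    then have "- (?\<beta> y0) * ?q1 < v (s0, y0) - \<bar>?q1 - ?q2\<bar> * (\<kappa> * ?x)"
    proof -
      have "- (l * (d * x)) * q < v - u * (k * x)" if "u * k * x < l * d * q * x" "0 \<le> v" for l d x q v u k :: real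
        using that by (simp only: mult_ac mult_minus_left mult_minus_right)
      from this[OF \<open>\<bar>?q1 - ?q2\<bar> * \<kappa> * ?x < \<Lambda> * \<delta>\<^sup>2 * ?q1 * ?x\<close> v0] show ?thesis .
    qed
    then show ?thesis unfolding E_def using p0(1) by (simp add: less_divide_eq)
  qed
  obtain b where b: "- (?\<beta> y0) < b" "b < E (s0, y0)" using dense[OF E0] by blast
  have "(s0, y0) \<in> UNIV \<times> {0..}" using y0 by simp
  then obtain \<eta>1 where \<eta>1: "\<eta>1 > 0" "\<And>x. x \<in> UNIV \<times> {0..} \<Longrightarrow> dist x (s0, y0) < \<eta>1 \<Longrightarrow> dist (E x) (E (s0, y0)) < E (s0, y0) - b"
    using Ec b(2) unfolding continuous_on_iff by (metis diff_gt_0_iff_gt)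
  define \<eta> where "\<eta> = min (\<eta>1 / 2) (min y0 s0)"
  have \<eta>: "0 < \<eta>" "\<eta> \<le> \<eta>1 / 2" "\<eta> \<le> y0" "\<eta> \<le> s0" using \<eta>1(1) y0 m(1) by (auto simp: \<eta>_def)
  have Eb: "E (s, y) > b" if "\<bar>s - s0\<bar> < \<eta>" "\<bar>y - y0\<bar> < \<eta>" for s y
  proof -
    have "dist (s, y) (s0, y0) \<le> \<bar>s - s0\<bar> + \<bar>y - y0\<bar>" unfolding dist_Pair_Pair dist_real_def using sqrt_sum_squares_le_sum_abs[of "\<bar>s - s0\<bar>" "\<bar>y - y0\<bar>"] by simp
    then have "dist (s, y) (s0, y0) < \<eta>1" using that \<eta> by linarith
    moreover have "(s, y) \<in> UNIV \<times> {0..}" using that \<eta> by auto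
    ultimately have "dist (E (s, y)) (E (s0, y0)) < E (s0, y0) - b" using \<eta>1(2) by blast
    then show ?thesis by (simp add: dist_real_def abs_if split: if_splits)
  qed
  have ge: "b * r\<^sup>2 \<le> second_diff z s0 y0 r" if r: "0 < r" "r < \<eta>" for r
  proof -
    have "second_diff (\<lambda>x. (- 1) * z x + 0 * z x) s0 y0 r \<le> (- b) * r\<^sup>2"
    proof (rule second_diff_le_of_AE_le[OF zpsi2 m(1,2) r(1) _ \<eta>(1)])
      show "AE x in lborel. s0 - \<eta> < fst x \<longrightarrow> fst x < s0 \<longrightarrow> y0 - r < snd x \<longrightarrow> snd x < y0 + r \<longrightarrow>
          - 1 * (\<sigma> * H1 x + - \<sigma> * H2 x) + 0 * (\<sigma> * H1 x + - \<sigma> * H2 x) \<le> - b" using S1.equation S2.equation H2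
      proof eventually_elim
        case (elim x)
        show ?case
        proof (intro impI)
          assume x: "s0 - \<eta> < fst x" "fst x < s0" "y0 - r < snd x" "snd x < y0 + r"
          then have "x \<in> cylinder L" using \<eta> r m(2) by (cases x) (auto simp: cylinder_def)
          then have e: "V1 x = q1 x * H1 x" "V2 x = q2 x * H2 x" "\<bar>H2 x\<bar> \<le> \<kappa> * exp (- (\<delta> * snd x))" using elim by auto
          have q: "q1 x > 0" using q1p[of x] x r \<eta> by simp
          have "E x > b" using Eb[of "fst x" "snd x"] x r by (cases x) auto
          then have "b * q1 x < v x - \<bar>q1 x - q2 x\<bar> * (\<kappa> * exp (- (\<delta> * snd x)))" using q by (simp add: E_def less_divide_eq)
          also have "\<dots> \<le> v x - \<bar>q1 x - q2 x\<bar> * \<bar>H2 x\<bar>" using e(3) by (simp add: mult_left_mono)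
          also have "\<dots> \<le> v x - \<sigma> * ((q1 x - q2 x) * H2 x)"
            using abs_ge_self[of "(q1 x - q2 x) * H2 x"] abs_ge_minus_self[of "(q1 x - q2 x) * H2 x"] \<sigma> unfolding abs_mult[symmetric] by auto
          also have "\<dots> = q1 x * (\<sigma> * H1 x - \<sigma> * H2 x)" by (simp add: v_def e(1,2) algebra_simps)
          finally have "b < \<sigma> * H1 x - \<sigma> * H2 x" using q by (simp add: mult.commute[of b])
          then show "- 1 * (\<sigma> * H1 x + - \<sigma> * H2 x) + 0 * (\<sigma> * H1 x + - \<sigma> * H2 x) \<le> - b" by simp
        qed
      qed
    qed (use r \<eta> in auto)
    then show ?thesis by (simp add: second_diff_def algebra_simps)
  qed
  have lim: "((\<lambda>r. (B (y0 + r) - 2 * B y0 + B (y0 - r)) / r\<^sup>2) \<longlongrightarrow> - (?\<beta> y0)) (at_right 0)"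
  proof (rule second_difference_quotient_tendsto[of 1 y0 B "\<lambda>y. \<mu> + \<Lambda> * (\<delta> * exp (- (\<delta> * y)))"])
    show "(B has_real_derivative \<mu> + \<Lambda> * (\<delta> * exp (- (\<delta> * y)))) (at y)" for y unfolding B_def \<Phi>_def by (auto intro!: derivative_eq_intros)
    show "((\<lambda>y. \<mu> + \<Lambda> * (\<delta> * exp (- (\<delta> * y)))) has_real_derivative - (?\<beta> y0)) (at y0)" by (auto intro!: derivative_eq_intros simp: power2_eq_square)
  qed simp
  have "\<forall>\<^sub>F r in at_right 0. b \<le> (B (y0 + r) - 2 * B y0 + B (y0 - r)) / r\<^sup>2"
    unfolding eventually_at_right_field
  proof (intro exI[of _ "min \<eta> (A - y0)"] conjI allI impI)
    fix r :: real assume r: "0 < r" "r < min \<eta> (A - y0)"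
    have "z (s0, y0 + r) \<le> B (y0 + r)" "z (s0, y0 - r) \<le> B (y0 - r)" using r y0 \<eta> by (auto intro!: zB)
    then have "b * r\<^sup>2 \<le> B (y0 + r) - 2 * B y0 + B (y0 - r)" using ge[of r] r zB0 by (simp add: second_diff_def)
    then show "b \<le> (B (y0 + r) - 2 * B y0 + B (y0 - r)) / r\<^sup>2" using r by (simp add: le_divide_eq)
  qed (use y0 \<eta>(1) in auto)
  then have "b \<le> - (?\<beta> y0)" using tendsto_lowerbound[OF lim] by simp
  then show False using b by simp
qed

theorem perturbed_solutions_unique:
  fixes \<delta> \<kappa> :: real
  assumes S1: "perturbed_solution L Q1 q1 V1 H1 q_e f \<omega>1 a M e" and S2: "perturbed_solution L Q2 q2 V2 H2 q_e f \<omega>2 a M e"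
    and \<delta>: "\<delta> > 0" and H2: "AE x in lborel. x \<in> cylinder L \<longrightarrow> \<bar>H2 x\<bar> \<le> \<kappa> * exp (- (\<delta> * snd x))"
    and \<kappa>: "0 \<le> \<kappa>" "2 * \<kappa> * (2 + 12 * M\<^sup>2 / a\<^sup>2) < \<delta>\<^sup>2 * a\<^sup>2"
  shows "\<omega>1 = \<omega>2" and "y \<ge> 0 \<Longrightarrow> q1 (s, y) = q2 (s, y)"
proof -
  interpret S1: perturbed_solution L Q1 q1 V1 H1 q_e f \<omega>1 a M e by (rule S1)
  interpret S2: perturbed_solution L Q2 q2 V2 H2 q_e f \<omega>2 a M e by (rule S2)
  note cmp = perturbed_solutions_compare[OF S1 S2 \<delta> H2 \<kappa>]
  have le0: "\<sigma> * (\<omega>1\<^sup>2 - \<omega>2\<^sup>2) \<le> 0" if \<sigma>: "\<sigma> = 1 \<or> \<sigma> = (- 1 :: real)" for \<sigma>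
  proof (rule ccontr)
    assume "\<not> \<sigma> * (\<omega>1\<^sup>2 - \<omega>2\<^sup>2) \<le> 0"
    then have D: "\<sigma> * (\<omega>1\<^sup>2 - \<omega>2\<^sup>2) > 0" by simp
    define \<theta> where "\<theta> = \<sigma> * (\<omega>1\<^sup>2 - \<omega>2\<^sup>2) * a\<^sup>2"
    have \<theta>: "\<theta> > 0" using D S1.a_pos by (simp add: \<theta>_def)
    obtain A1 where A1: "\<And>A s. A \<ge> A1 \<Longrightarrow> \<bar>Q1 (s, A)\<bar> \<le> \<theta> / 8" using S1.decay[of "\<theta> / 8"] \<theta> by auto
    obtain A2 where A2: "\<And>A s. A \<ge> A2 \<Longrightarrow> \<bar>Q2 (s, A)\<bar> \<le> \<theta> / 8" using S2.decay[of "\<theta> / 8"] \<theta> by auto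
    define A where "A = max 1 (max A1 A2)"
    have "\<sigma> * (Q1 (0, A) - Q2 (0, A)) \<le> - \<theta> / 2" using cmp[OF \<sigma>, of A 0] D by (simp add: A_def \<theta>_def)
    moreover have "\<bar>Q1 (0, A)\<bar> \<le> \<theta> / 8" "\<bar>Q2 (0, A)\<bar> \<le> \<theta> / 8" using A1 A2 by (auto simp: A_def)
    ultimately show False using \<sigma> \<theta> unfolding abs_le_iff by auto
  qed
  have w2: "\<omega>1\<^sup>2 = \<omega>2\<^sup>2" using le0[of 1] le0[of "-1"] by simp
  then show w: "\<omega>1 = \<omega>2" using S1.omega_pos S2.omega_pos by (metis less_imp_le power2_eq_imp_eq)
  assume y: "y \<ge> 0"
  have "Q1 (s, y) = Q2 (s, y)"
  proof (cases "y = 0")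
    case True
    then show ?thesis using S1.Q_bdry[of s] S2.Q_bdry[of s] w by simp
  next
    case False
    then show ?thesis using cmp[of 1 y s] cmp[of "-1" y s] w2 y by simp
  qed
  then have "(q1 (s, y))\<^sup>2 = (q2 (s, y))\<^sup>2" using S1.q_sq[OF y, of s] S2.q_sq[OF y, of s] w by simp
  then show "q1 (s, y) = q2 (s, y)" using S1.q_nonneg[OF y, of s] S2.q_nonneg[OF y, of s] by (metis power2_eq_imp_eq)
qed

section \<open>Decaying solutions of the mode equations\<close>

definition decays :: "real \<Rightarrow> real \<Rightarrow> (real \<Rightarrow> complex) \<Rightarrow> bool" where
  "decays \<gamma> K f \<longleftrightarrow> continuous_on {0..} f \<and> (\<forall>y\<ge>0. norm (f y) \<le> K * exp (- (\<gamma> * y)))"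

lemma decays_bound: "decays \<gamma> K f \<Longrightarrow> y \<ge> 0 \<Longrightarrow> norm (f y) \<le> K * exp (- (\<gamma> * y))"
  and decays_cont: "decays \<gamma> K f \<Longrightarrow> continuous_on {0..} f"
  by (auto simp: decays_def)

lemma decays_diff: "decays \<gamma> K f \<Longrightarrow> decays \<gamma> K' g \<Longrightarrow> decays \<gamma> (K + K') (\<lambda>y. f y - g y)"
  unfolding decays_def by (auto intro!: continuous_intros norm_triangle_le_diff simp: ring_distribs add_mono)

lemma decays_mono: "decays \<gamma> K f \<Longrightarrow> K \<le> K' \<Longrightarrow> decays \<gamma> K' f"
  unfolding decays_def using mult_right_mono[of K K' "exp (- (\<gamma> * _))"] order_trans by fastforce

lemma tail_integrable:
  assumes "decays \<gamma> K f" "\<gamma> > 0" "c \<ge> 0"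
  shows "f integrable_on {c..}"
proof (rule measurable_bounded_by_integrable_imp_integrable)
  have "continuous_on {c..} f" using decays_cont[OF assms(1)] by (rule continuous_on_subset) (use assms in auto)
  then show "f \<in> borel_measurable (lebesgue_on {c..})"
    by (rule continuous_imp_measurable_on_sets_lebesgue) simp
  show "(\<lambda>y. K * exp (- \<gamma> * y)) integrable_on {c..}"
    using integrable_on_exp_minus_to_infinity[OF assms(2)] by (rule integrable_on_mult_right)
  show "norm (f y) \<le> K * exp (- \<gamma> * y)" if "y \<in> {c..}" for y
    using decays_bound[OF assms(1), of y] that assms by simp
qed simp

lemma tail_bound:
  assumes "decays \<gamma> K f" "\<gamma> > 0" "c \<ge> 0"
  shows "norm (integral {c..} f) \<le> K / \<gamma> * exp (- (\<gamma> * c))"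
proof -
  have i: "((\<lambda>y. K * exp (- \<gamma> * y)) has_integral K * (exp (- \<gamma> * c) / \<gamma>)) {c..}"
    using has_integral_exp_minus_to_infinity[OF assms(2)] by (rule has_integral_mult_right)
  have "norm (integral {c..} f) \<le> integral {c..} (\<lambda>y. K * exp (- \<gamma> * y))"
    by (rule integral_norm_bound_integral[OF tail_integrable[OF assms]])
       (use i decays_bound[OF assms(1)] assms in \<open>auto simp: integrable_on_def\<close>)
  also have "\<dots> = K * (exp (- \<gamma> * c) / \<gamma>)" using i by (rule integral_unique)
  finally show ?thesis by simp
qed

lemma at_within_Ici: "at x within {0..x + 1} = at x within {0..}" for x :: real
  by (intro at_within_nhd[of x "{..<x + 1}"]) auto

lemma primitive_deriv:
  fixes f :: "real \<Rightarrow> complex"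
  assumes "continuous_on {0..} f" "y \<ge> 0"
  shows "((\<lambda>u. integral {0..u} f) has_vector_derivative f y) (at y within {0..})"
  using integral_has_vector_derivative[OF continuous_on_subset[OF assms(1)], of 0 "y + 1" y] assms(2)
  by (auto simp: at_within_Ici)

lemma tail_deriv:
  assumes "decays \<gamma> K f" "\<gamma> > 0" "y \<ge> 0"
  shows "((\<lambda>u. integral {u..} f) has_vector_derivative - f y) (at y within {0..})"
proof -
  have split: "integral {0..} f - integral {0..u} f = integral {u..} f" if "u \<ge> 0" for u
  proof -
    have "f integrable_on {u..}" "f integrable_on {0..u}" using tail_integrable[OF assms(1,2)] that
      by (auto intro!: integrable_continuous_interval continuous_on_subset[OF decays_cont[OF assms(1)]])
    moreover have "negligible ({0..u} \<inter> {u..})" by (rule negligible_subset[of "{u}"]) auto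
    moreover have "{0..u} \<union> {u..} = {0..}" using that by auto
    ultimately show ?thesis using integral_Un[of f "{0..u}" "{u..}"] by simp
  qed
  have "((\<lambda>u. integral {0..} f - integral {0..u} f) has_vector_derivative 0 - f y) (at y within {0..})"
    by (intro derivative_intros primitive_deriv decays_cont[OF assms(1)] assms(3))
  then show ?thesis
    using split assms(3) by (auto intro: has_vector_derivative_transform[where f = "\<lambda>u. integral {0..} f - integral {0..u} f"])
qed

text \<open>Inverses of \<open>\<mu> - d/d\<psi>\<close> (decaying at infinity) and of \<open>\<mu> + d/d\<psi>\<close> (vanishing at \<open>0\<close>).\<close>

definition backward :: "complex \<Rightarrow> (real \<Rightarrow> complex) \<Rightarrow> real \<Rightarrow> complex" where
  "backward \<mu> N \<psi> = exp (\<mu> * of_real \<psi>) * integral {\<psi>..} (\<lambda>y. exp (- (\<mu> * of_real y)) * N y)"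

definition forward :: "complex \<Rightarrow> (real \<Rightarrow> complex) \<Rightarrow> real \<Rightarrow> complex" where
  "forward \<mu> v \<psi> = exp (- (\<mu> * of_real \<psi>)) * integral {0..\<psi>} (\<lambda>y. exp (\<mu> * of_real y) * v y)"

lemma decays_exp_mult:
  assumes "decays \<gamma> K N"
  shows "decays (Re \<mu> + \<gamma>) K (\<lambda>y. exp (- (\<mu> * of_real y)) * N y)"
  unfolding decays_def
proof (intro conjI allI impI)
  show "continuous_on {0..} (\<lambda>y. exp (- (\<mu> * of_real y)) * N y)"
    by (intro continuous_intros decays_cont[OF assms])
  fix y :: real assume "0 \<le> y"
  then have "exp (- (Re \<mu> * y)) * norm (N y) \<le> exp (- (Re \<mu> * y)) * (K * exp (- (\<gamma> * y)))"
    using decays_bound[OF assms, of y] by (intro mult_left_mono) auto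
  also have "\<dots> = K * exp (- (Re \<mu> * y) + - (\<gamma> * y))" by (simp only: exp_add mult_ac)
  also have "- (Re \<mu> * y) + - (\<gamma> * y) = - ((Re \<mu> + \<gamma>) * y)" by (simp add: ring_distribs)
  finally show "norm (exp (- (\<mu> * of_real y)) * N y) \<le> K * exp (- ((Re \<mu> + \<gamma>) * y))"
    by (simp add: norm_mult)
qed

lemma exp_deriv_within:
  "((\<lambda>u. exp (c * of_real u)) has_vector_derivative c * exp (c * of_real y)) (at y within S)" for c :: complex
proof -
  have "((\<lambda>z. exp (c * z)) has_field_derivative c * exp (c * of_real y)) (at (of_real y))"
    by (auto intro!: derivative_eq_intros)
  from has_vector_derivative_real_field[OF this] show ?thesis .
qed

context
  fixes \<mu> :: complex and \<gamma> K :: real and N :: "real \<Rightarrow> complex"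
  assumes \<gamma>: "\<gamma> > 0" and N: "decays \<gamma> K N"
begin

lemma backward_deriv:
  assumes "\<psi> \<ge> 0" "Re \<mu> \<ge> 0"
  shows "(backward \<mu> N has_vector_derivative \<mu> * backward \<mu> N \<psi> - N \<psi>) (at \<psi> within {0..})"
proof -
  let ?I = "\<lambda>\<psi>. integral {\<psi>..} (\<lambda>y. exp (- (\<mu> * of_real y)) * N y)"
  have "(?I has_vector_derivative - (exp (- (\<mu> * of_real \<psi>)) * N \<psi>)) (at \<psi> within {0..})"
    by (rule tail_deriv[OF decays_exp_mult[OF N]]) (use assms \<gamma> in auto)
  from has_vector_derivative_mult[OF exp_deriv_within[of \<mu>] this]
  have "((\<lambda>\<psi>. exp (\<mu> * of_real \<psi>) * ?I \<psi>) has_vector_derivative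
     exp (\<mu> * of_real \<psi>) * - (exp (- (\<mu> * of_real \<psi>)) * N \<psi>) + \<mu> * exp (\<mu> * of_real \<psi>) * ?I \<psi>) (at \<psi> within {0..})" .
  moreover have "exp z * - (exp (- z) * w) + m * exp z * i = m * (exp z * i) - w" for z w m i :: complex
    by (simp add: exp_minus)
  ultimately show ?thesis unfolding backward_def by (simp only:)
qed

lemma decays_backward:
  assumes "Re \<mu> \<ge> 0"
  shows "decays \<gamma> (K / (Re \<mu> + \<gamma>)) (backward \<mu> N)"
  unfolding decays_def
proof (intro conjI allI impI)
  show "continuous_on {0..} (backward \<mu> N)"
    unfolding continuous_on_eq_continuous_within using has_vector_derivative_continuous[OF backward_deriv] assms by auto
  fix y :: real assume y: "0 \<le> y"
  have "exp (Re \<mu> * y) * norm (integral {y..} (\<lambda>y. exp (- (\<mu> * of_real y)) * N y))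
      \<le> exp (Re \<mu> * y) * (K / (Re \<mu> + \<gamma>) * exp (- ((Re \<mu> + \<gamma>) * y)))" using assms \<gamma> y by (intro mult_left_mono tail_bound[OF decays_exp_mult[OF N]]) auto
  also have "\<dots> = K / (Re \<mu> + \<gamma>) * exp (Re \<mu> * y + - ((Re \<mu> + \<gamma>) * y))" by (simp only: exp_add mult_ac)
  also have "Re \<mu> * y + - ((Re \<mu> + \<gamma>) * y) = - (\<gamma> * y)" by (simp add: algebra_simps)
  finally show "norm (backward \<mu> N y) \<le> K / (Re \<mu> + \<gamma>) * exp (- (\<gamma> * y))"
    by (simp add: backward_def norm_mult)
qed

lemma forward_deriv:
  assumes "\<psi> \<ge> 0"
  shows "(forward \<mu> N has_vector_derivative N \<psi> - \<mu> * forward \<mu> N \<psi>) (at \<psi> within {0..})"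
proof -
  let ?I = "\<lambda>\<psi>. integral {0..\<psi>} (\<lambda>y. exp (\<mu> * of_real y) * N y)"
  have "(?I has_vector_derivative exp (\<mu> * of_real \<psi>) * N \<psi>) (at \<psi> within {0..})"
    by (intro primitive_deriv continuous_intros decays_cont[OF N] assms)
  from has_vector_derivative_mult[OF exp_deriv_within[of "- \<mu>"] this]
  have "((\<lambda>\<psi>. exp (- \<mu> * of_real \<psi>) * ?I \<psi>) has_vector_derivative
     exp (- \<mu> * of_real \<psi>) * (exp (\<mu> * of_real \<psi>) * N \<psi>) + - \<mu> * exp (- \<mu> * of_real \<psi>) * ?I \<psi>) (at \<psi> within {0..})" .
  moreover have "exp (- \<mu> * z) * (exp (\<mu> * z) * w) + - m * exp (- \<mu> * z) * i = w - m * (exp (- (\<mu> * z)) * i)" for z w m i :: complex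
    by (simp add: exp_minus)
  moreover have "(\<lambda>\<psi>. exp (- \<mu> * of_real \<psi>) * ?I \<psi>) = forward \<mu> N" by (simp add: forward_def fun_eq_iff)
  ultimately show ?thesis by (simp only: forward_def)
qed

lemma decays_forward:
  assumes "Re \<mu> > \<gamma>"
  shows "decays \<gamma> (K / (Re \<mu> - \<gamma>)) (forward \<mu> N)"
  unfolding decays_def
proof (intro conjI allI impI)
  show "continuous_on {0..} (forward \<mu> N)"
    unfolding continuous_on_eq_continuous_within using has_vector_derivative_continuous[OF forward_deriv] assms by auto
  fix y :: real assume y: "0 \<le> y"
  let ?r = "Re \<mu> - \<gamma>"
  have K: "K \<ge> 0" using decays_bound[OF N, of 0] norm_ge_zero[of "N 0"] by (simp del: norm_ge_zero)
  have i: "((\<lambda>t. K * exp (?r * t)) has_integral (K * (exp (?r * y) / ?r) - K * (exp (?r * 0) / ?r))) {0..y}"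
    using y assms by (intro fundamental_theorem_of_calculus)
      (auto intro!: derivative_eq_intros simp: has_real_derivative_iff_has_vector_derivative[symmetric])
  have "norm (integral {0..y} (\<lambda>y. exp (\<mu> * of_real y) * N y)) \<le> integral {0..y} (\<lambda>t. K * exp (?r * t))"
  proof (rule integral_norm_bound_integral)
    show "(\<lambda>y. exp (\<mu> * of_real y) * N y) integrable_on {0..y}"
      by (intro integrable_continuous_interval continuous_intros continuous_on_subset[OF decays_cont[OF N]]) auto
    show "(\<lambda>t. K * exp (?r * t)) integrable_on {0..y}" using i by blast
    fix t assume t: "t \<in> {0..y}"
    then have "exp (Re \<mu> * t) * norm (N t) \<le> exp (Re \<mu> * t) * (K * exp (- (\<gamma> * t)))" by (intro mult_left_mono decays_bound[OF N]) auto
    also have "\<dots> = K * exp (Re \<mu> * t + - (\<gamma> * t))" by (simp only: exp_add mult_ac)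
    also have "Re \<mu> * t + - (\<gamma> * t) = ?r * t" by (simp add: algebra_simps)
    finally show "norm (exp (\<mu> * of_real t) * N t) \<le> K * exp (?r * t)" by (simp add: norm_mult)
  qed
  also have "\<dots> = K * (exp (?r * y) / ?r) - K * (exp (?r * 0) / ?r)" using i by (rule integral_unique)
  also have "\<dots> \<le> K / ?r * exp (?r * y)" using K assms by simp
  finally have "exp (- (Re \<mu> * y)) * norm (integral {0..y} (\<lambda>y. exp (\<mu> * of_real y) * N y)) \<le> exp (- (Re \<mu> * y)) * (K / ?r * exp (?r * y))"
    by (intro mult_left_mono) auto
  also have "\<dots> = K / ?r * exp (- (Re \<mu> * y) + ?r * y)" by (simp only: exp_add mult_ac)
  also have "- (Re \<mu> * y) + ?r * y = - (\<gamma> * y)" by (simp add: algebra_simps)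
  finally show "norm (forward \<mu> N y) \<le> K / ?r * exp (- (\<gamma> * y))" by (simp add: forward_def norm_mult)
qed

end

lemma backward_diff:
  assumes "\<gamma> > 0" "decays \<gamma> K N" "decays \<gamma> K' N'" "Re \<mu> \<ge> 0" "\<psi> \<ge> 0"
  shows "backward \<mu> (\<lambda>y. N y - N' y) \<psi> = backward \<mu> N \<psi> - backward \<mu> N' \<psi>"
  using integral_diff[OF tail_integrable[OF decays_exp_mult[OF assms(2), of \<mu>] _ assms(5)] tail_integrable[OF decays_exp_mult[OF assms(3), of \<mu>] _ assms(5)]] assms
  by (simp add: backward_def ring_distribs)

lemma forward_diff:
  assumes "decays \<gamma> K N" "decays \<gamma> K' N'"
  shows "forward \<mu> (\<lambda>y. N y - N' y) \<psi> = forward \<mu> N \<psi> - forward \<mu> N' \<psi>"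
proof -
  have "(\<lambda>y. exp (\<mu> * of_real y) * N y) integrable_on {0..\<psi>}" "(\<lambda>y. exp (\<mu> * of_real y) * N' y) integrable_on {0..\<psi>}"
    by (intro integrable_continuous_interval continuous_intros continuous_on_subset[OF decays_cont[OF assms(1)]]
       continuous_on_subset[OF decays_cont[OF assms(2)]]; auto)+
  from integral_diff[OF this] show ?thesis by (simp add: forward_def ring_distribs)
qed

lemma backward_cnj: "backward (cnj \<mu>) (\<lambda>y. cnj (N y)) \<psi> = cnj (backward \<mu> N \<psi>)"
  by (simp add: backward_def integral_cnj exp_cnj)

lemma forward_cnj: "forward (cnj \<mu>) (\<lambda>y. cnj (N y)) \<psi> = cnj (forward \<mu> N \<psi>)"
  by (simp add: forward_def integral_cnj exp_cnj)

lemma backward_cong: "(\<And>y. y \<ge> 0 \<Longrightarrow> N y = N' y) \<Longrightarrow> \<psi> \<ge> 0 \<Longrightarrow> backward \<mu> N \<psi> = backward \<mu> N' \<psi>"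
  unfolding backward_def by (intro arg_cong2[of _ _ _ _ "(*)"] refl integral_cong) auto

lemma forward_cong: "(\<And>y. y \<ge> 0 \<Longrightarrow> N y = N' y) \<Longrightarrow> forward \<mu> N \<psi> = forward \<mu> N' \<psi>"
  unfolding forward_def by (intro arg_cong2[of _ _ _ _ "(*)"] refl integral_cong) auto

text \<open>The decaying solution of \<open>Q'' = \<mu>\<^sup>2 Q - N\<close>. For \<open>\<mu> \<noteq> 0\<close> it has boundary value \<open>b\<close>; for \<open>\<mu> = 0\<close> decay
  leaves no freedom and \<open>b\<close> is ignored.\<close>

definition mode :: "complex \<Rightarrow> complex \<Rightarrow> (real \<Rightarrow> complex) \<Rightarrow> real \<Rightarrow> complex" where
  "mode \<mu> b N y = (if \<mu> = 0 then - backward 0 (backward 0 N) y else b * exp (- (\<mu> * of_real y)) + forward \<mu> (backward \<mu> N) y)"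

lemma mode_deriv:
  assumes "\<gamma> > 0" "decays \<gamma> K N" "Re \<mu> \<ge> 0" "y \<ge> 0"
  shows "(mode \<mu> b N has_vector_derivative backward \<mu> N y - \<mu> * mode \<mu> b N y) (at y within {0..})"
proof (cases "\<mu> = 0")
  case True
  have "((\<lambda>y. - backward 0 (backward 0 N) y) has_vector_derivative - (0 * backward 0 (backward 0 N) y - backward 0 N y)) (at y within {0..})"
    by (intro has_vector_derivative_minus backward_deriv[OF assms(1) decays_backward[OF assms(1,2)]] assms(4)) auto
  moreover have "mode \<mu> b N = (\<lambda>y. - backward 0 (backward 0 N) y)" using True by (simp add: mode_def fun_eq_iff)
  ultimately show ?thesis using True by simp
next
  case False
  have "((\<lambda>y. b * exp (- \<mu> * of_real y) + forward \<mu> (backward \<mu> N) y) has_vector_derivative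
      b * (- \<mu> * exp (- \<mu> * of_real y)) + (backward \<mu> N y - \<mu> * forward \<mu> (backward \<mu> N) y)) (at y within {0..})"
    by (intro has_vector_derivative_add has_vector_derivative_mult_right exp_deriv_within
        forward_deriv[OF assms(1) decays_backward[OF assms(1,2,3)] assms(4)])
  moreover have "b * (- \<mu> * exp (- \<mu> * of_real y)) + (backward \<mu> N y - \<mu> * forward \<mu> (backward \<mu> N) y)
      = backward \<mu> N y - \<mu> * mode \<mu> b N y" using False by (simp add: mode_def algebra_simps)
  moreover have "(\<lambda>y. b * exp (- \<mu> * of_real y) + forward \<mu> (backward \<mu> N) y) = mode \<mu> b N"
    using False by (simp add: mode_def fun_eq_iff)
  ultimately show ?thesis by (simp only:)
qed

lemma mode_deriv2:
  assumes "\<gamma> > 0" "decays \<gamma> K N" "Re \<mu> \<ge> 0" "y \<ge> 0"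
  shows "((\<lambda>y. backward \<mu> N y - \<mu> * mode \<mu> b N y) has_vector_derivative \<mu>\<^sup>2 * mode \<mu> b N y - N y) (at y within {0..})"
proof -
  have "((\<lambda>y. backward \<mu> N y - \<mu> * mode \<mu> b N y) has_vector_derivative
      (\<mu> * backward \<mu> N y - N y) - \<mu> * (backward \<mu> N y - \<mu> * mode \<mu> b N y)) (at y within {0..})"
    by (intro has_vector_derivative_diff has_vector_derivative_mult_right mode_deriv[OF assms] backward_deriv[OF assms(1,2,4,3)])
  then show ?thesis by (simp add: algebra_simps power2_eq_square)
qed

lemma mode_cont:
  assumes "\<gamma> > 0" "decays \<gamma> K N" "Re \<mu> \<ge> 0"
  shows "continuous_on {0..} (mode \<mu> b N)"
  unfolding continuous_on_eq_continuous_within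
  using has_vector_derivative_continuous[OF mode_deriv[OF assms]] by auto

lemma decays_mode_0:
  assumes "\<gamma> > 0" "decays \<gamma> K N"
  shows "decays \<gamma> (K / \<gamma>\<^sup>2) (mode 0 b N)"
  using decays_backward[OF assms(1) decays_backward[OF assms, of 0], of 0] mode_cont[OF assms, of 0]
  by (simp add: decays_def mode_def power2_eq_square)

text \<open>The two inversions together gain 1 / ((Re \<mu>)^2 - \<gamma>^2), and 2 \<gamma> \<le>
  Re \<mu> bounds this by 4 / (3 (Re \<mu>)^2). In the application \<mu>^2 is linear in the
  frequency, so this is one full power of it.\<close>

lemma decays_mode:
  assumes "\<gamma> > 0" "decays \<gamma> K N" "2 * \<gamma> \<le> Re \<mu>"
  shows "decays \<gamma> (norm b + 4 / 3 * K / (Re \<mu>)\<^sup>2) (mode \<mu> b N)"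
  unfolding decays_def
proof (intro conjI allI impI)
  have \<mu>: "\<mu> \<noteq> 0" "Re \<mu> > 0" "\<gamma> < Re \<mu>" using assms by auto
  show "continuous_on {0..} (mode \<mu> b N)" using mode_cont[OF assms(1,2)] \<mu> by simp
  fix y :: real assume y: "0 \<le> y"
  have K: "K \<ge> 0" using decays_bound[OF assms(2), of 0] norm_ge_zero[of "N 0"] by (simp del: norm_ge_zero)
  have "K / (Re \<mu> + \<gamma>) / (Re \<mu> - \<gamma>) \<le> 4 / 3 * K / (Re \<mu>)\<^sup>2"
  proof -
    have "(2 * \<gamma>) * (2 * \<gamma>) \<le> Re \<mu> * Re \<mu>" using assms \<mu> by (intro mult_mono) auto
    then have "3 / 4 * (Re \<mu>)\<^sup>2 \<le> (Re \<mu> + \<gamma>) * (Re \<mu> - \<gamma>)" by (simp add: power2_eq_square algebra_simps)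
    then have "K / ((Re \<mu> + \<gamma>) * (Re \<mu> - \<gamma>)) \<le> K / (3 / 4 * (Re \<mu>)\<^sup>2)" using K \<mu> assms(1) by (intro divide_left_mono) (auto intro!: mult_pos_pos)
    then show ?thesis by simp
  qed
  then have f: "norm (forward \<mu> (backward \<mu> N) y) \<le> 4 / 3 * K / (Re \<mu>)\<^sup>2 * exp (- (\<gamma> * y))"
    using decays_bound[OF decays_forward[OF assms(1) decays_backward[OF assms(1,2)] \<mu>(3)] y] \<mu> by (meson less_imp_le mult_right_mono exp_ge_zero order_trans)
  have "\<gamma> * y \<le> Re \<mu> * y" using y \<mu> by (intro mult_right_mono) auto
  then have "norm b * exp (- (Re \<mu> * y)) \<le> norm b * exp (- (\<gamma> * y))" by (intro mult_left_mono) auto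
  then show "norm (mode \<mu> b N y) \<le> (norm b + 4 / 3 * K / (Re \<mu>)\<^sup>2) * exp (- (\<gamma> * y))"
    using f \<mu> by (simp add: mode_def ring_distribs norm_mult norm_triangle_le add_mono)
qed

lemma mode_boundary: "\<mu> \<noteq> 0 \<Longrightarrow> mode \<mu> b N 0 = b" "mode 0 b N 0 = - backward 0 (backward 0 N) 0"
  by (simp_all add: mode_def forward_def)

lemma mode_diff:
  assumes "\<gamma> > 0" "decays \<gamma> K N" "decays \<gamma> K' N'" "Re \<mu> \<ge> 0" "\<psi> \<ge> 0"
  shows "mode \<mu> (b - b') (\<lambda>y. N y - N' y) \<psi> = mode \<mu> b N \<psi> - mode \<mu> b' N' \<psi>"
proof -
  note d = decays_backward[OF assms(1,2,4)] decays_backward[OF assms(1,3,4)]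
  have e: "backward \<mu> (\<lambda>y. N y - N' y) y = backward \<mu> N y - backward \<mu> N' y" if "y \<ge> 0" for y
    using backward_diff[OF assms(1,2,3,4) that] .
  have "backward \<mu> (backward \<mu> (\<lambda>y. N y - N' y)) \<psi> = backward \<mu> (backward \<mu> N) \<psi> - backward \<mu> (backward \<mu> N') \<psi>"
    using backward_cong[OF e assms(5)] backward_diff[OF assms(1) d assms(4,5)] by simp
  moreover have "forward \<mu> (backward \<mu> (\<lambda>y. N y - N' y)) \<psi> = forward \<mu> (backward \<mu> N) \<psi> - forward \<mu> (backward \<mu> N') \<psi>"
    using forward_cong[OF e] forward_diff[OF d] by simp
  ultimately show ?thesis by (auto simp: mode_def algebra_simps)
qed

lemma mode_cnj:
  assumes "\<And>y. y \<ge> 0 \<Longrightarrow> N' y = cnj (N y)" "\<psi> \<ge> 0"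
  shows "mode (cnj \<mu>) (cnj b) N' \<psi> = cnj (mode \<mu> b N \<psi>)"
proof -
  have e: "backward (cnj \<mu>) N' y = cnj (backward \<mu> N y)" if "y \<ge> 0" for y \<mu>
    using backward_cong[OF assms(1) that] by (simp add: backward_cnj)
  have "backward (cnj \<mu>) (backward (cnj \<mu>) N') \<psi> = cnj (backward \<mu> (backward \<mu> N) \<psi>)"
    using backward_cong[OF e assms(2)] by (simp add: backward_cnj)
  moreover have "forward (cnj \<mu>) (backward (cnj \<mu>) N') \<psi> = cnj (forward \<mu> (backward \<mu> N) \<psi>)"
    using forward_cong[OF e] by (simp add: forward_cnj)
  ultimately show ?thesis by (auto simp: mode_def exp_cnj)
qed

section \<open>The fixed point\<close>

definition bracket :: "int \<Rightarrow> real" where "bracket n = 1 + \<bar>real_of_int n\<bar>"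

lemma bracket_ge_1: "bracket n \<ge> 1"
  and bracket_pos: "bracket n > 0"
  and bracket_minus: "bracket (- n) = bracket n"
  and bracket_0: "bracket 0 = 1"
  and bracket_add: "bracket (m + n) \<le> bracket m + bracket n"
  by (auto simp: bracket_def)

lemma bracket_power_pos: "bracket n ^ k > 0"
  using bracket_pos by simp

lemma bracket_inverse_mono: "k \<le> l \<Longrightarrow> 1 / bracket n ^ l \<le> 1 / bracket n ^ k"
  using bracket_ge_1[of n] by (intro divide_left_mono power_increasing mult_pos_pos bracket_power_pos) auto

lemma bracket_summable:
  assumes "k \<ge> 2"
  shows "(\<lambda>n. 1 / bracket n ^ k) summable_on UNIV"
proof -
  have nat: "(\<lambda>n::nat. 1 / bracket (int n) ^ 2) summable_on UNIV"
  proof (rule norm_summable_imp_summable_on)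
    have "summable (\<lambda>n. inverse (real (n + 1) ^ 2))" using inverse_power_summable[of 2, where 'a = real] by (subst summable_iff_shift) simp
    then show "summable (\<lambda>n. norm (1 / bracket (int n) ^ 2))" by (simp add: bracket_def divide_inverse add.commute)
  qed
  have "(\<lambda>n. 1 / bracket n ^ 2) summable_on range int"
    using nat by (subst summable_on_reindex) (auto simp: o_def)
  moreover have "(\<lambda>n. 1 / bracket n ^ 2) summable_on range (\<lambda>n. - int n)"
    using nat by (subst summable_on_reindex) (auto simp: o_def bracket_minus inj_on_def)
  ultimately have "(\<lambda>n. 1 / bracket n ^ 2) summable_on (range int \<union> range (\<lambda>n. - int n))"
    by (rule summable_on_union)
  moreover have "range int \<union> range (\<lambda>n. - int n) = UNIV"
  proof (intro set_eqI iffI UNIV_I)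
    fix n :: int
    show "n \<in> range int \<union> range (\<lambda>n. - int n)" by (cases n rule: int_cases2) auto
  qed
  ultimately have "(\<lambda>n. 1 / bracket n ^ 2) summable_on UNIV" by simp
  then show ?thesis
    by (rule summable_on_comparison_test) (use bracket_inverse_mono[OF assms] bracket_pos in \<open>auto intro!: less_imp_le\<close>)
qed

definition bracket_sum :: real where "bracket_sum = (\<Sum>\<^sub>\<infinity>n. 1 / bracket n ^ 4)"

lemma bracket_sum_nonneg: "bracket_sum \<ge> 0"
  unfolding bracket_sum_def using bracket_power_pos by (intro infsum_nonneg) (simp add: less_imp_le)

text \<open>The larger of the two brackets is at least half of \<open>bracket n\<close>, whence 16 =
  2^4. Summed over \<open>m\<close>, this makes decay of order 4 stable under convolution.\<close>

lemma bracket_conv_le: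
  "1 / bracket m ^ 4 * (1 / bracket (n - m) ^ 4) \<le> 16 / bracket n ^ 4 * (1 / bracket m ^ 4 + 1 / bracket (n - m) ^ 4)"
proof -
  define x y z where "x = bracket m" "y = bracket (n - m)" "z = bracket n"
  have p: "x > 0" "y > 0" "z > 0" using bracket_pos by (auto simp: x_y_z_def)
  have "z \<le> x + y" using bracket_add[of m "n - m"] by (simp add: x_y_z_def)
  then have "z \<le> 2 * max x y" by linarith
  then have "z ^ 4 \<le> (2 * max x y) ^ 4" using p by (intro power_mono) auto
  also have "\<dots> = 16 * max x y ^ 4" by (simp add: power_mult_distrib)
  also have "max x y ^ 4 \<le> x ^ 4 + y ^ 4" using p by (auto simp: max_def)
  finally have "z ^ 4 \<le> 16 * (x ^ 4 + y ^ 4)" by simp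
  then have "1 / x ^ 4 * (1 / y ^ 4) \<le> 16 / z ^ 4 * (1 / x ^ 4 + 1 / y ^ 4)"
    using p by (simp add: field_simps)
  then show ?thesis by (simp add: x_y_z_def)
qed

lemma bij_minus_shift: "bij (\<lambda>m. n - m)" for n :: int
  by (rule bij_betw_byWitness[where f' = "\<lambda>m. n - m"]) auto

lemma bracket_conv_summable: "(\<lambda>m. 1 / bracket m ^ 4 * (1 / bracket (n - m) ^ 4)) summable_on UNIV"
  and bracket_conv_sum: "(\<Sum>\<^sub>\<infinity>m. 1 / bracket m ^ 4 * (1 / bracket (n - m) ^ 4)) \<le> 32 * bracket_sum / bracket n ^ 4"
proof -
  have s1: "(\<lambda>m. 1 / bracket m ^ 4) summable_on UNIV" by (rule bracket_summable) simp
  then have s2: "(\<lambda>m. 1 / bracket (n - m) ^ 4) summable_on UNIV"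
    using summable_on_reindex_bij_betw[OF bij_minus_shift, of "\<lambda>m. 1 / bracket m ^ 4"] by simp
  have s: "(\<lambda>m. 16 / bracket n ^ 4 * (1 / bracket m ^ 4 + 1 / bracket (n - m) ^ 4)) summable_on UNIV"
    by (intro summable_on_cmult_right summable_on_add s1 s2)
  show c: "(\<lambda>m. 1 / bracket m ^ 4 * (1 / bracket (n - m) ^ 4)) summable_on UNIV"
    by (rule summable_on_comparison_test[OF s]) (use bracket_conv_le bracket_power_pos in \<open>auto simp: less_imp_le\<close>)
  have "(\<Sum>\<^sub>\<infinity>m. 1 / bracket m ^ 4 * (1 / bracket (n - m) ^ 4)) \<le> (\<Sum>\<^sub>\<infinity>m. 16 / bracket n ^ 4 * (1 / bracket m ^ 4 + 1 / bracket (n - m) ^ 4))"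
    by (rule infsum_mono[OF c s bracket_conv_le])
  also have "\<dots> = 16 / bracket n ^ 4 * (bracket_sum + (\<Sum>\<^sub>\<infinity>m. 1 / bracket (n - m) ^ 4))"
    unfolding infsum_cmult_right' bracket_sum_def by (subst infsum_add[OF s1 s2]) simp
  also have "(\<Sum>\<^sub>\<infinity>m. 1 / bracket (n - m) ^ 4) = bracket_sum"
    using infsum_reindex_bij_betw[OF bij_minus_shift, of "\<lambda>m. 1 / bracket m ^ 4"] by (simp add: bracket_sum_def)
  finally show "(\<Sum>\<^sub>\<infinity>m. 1 / bracket m ^ 4 * (1 / bracket (n - m) ^ 4)) \<le> 32 * bracket_sum / bracket n ^ 4" by simp
qed

section \<open>Decaying families of modes and their convolution\<close>

definition modes :: "nat \<Rightarrow> real \<Rightarrow> real \<Rightarrow> (int \<Rightarrow> real \<Rightarrow> complex) \<Rightarrow> bool" where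
  "modes k \<gamma> K u \<longleftrightarrow> (\<forall>n. decays \<gamma> (K / bracket n ^ k) (u n))"

lemma modes_bound: "modes k \<gamma> K u \<Longrightarrow> y \<ge> 0 \<Longrightarrow> norm (u n y) \<le> K * exp (- (\<gamma> * y)) * (1 / bracket n ^ k)"
  unfolding modes_def using decays_bound[of \<gamma> "K / bracket n ^ k" "u n" y] by simp

lemma modes_K: "modes k \<gamma> K u \<Longrightarrow> K \<ge> 0"
  using modes_bound[of k \<gamma> K u 0 0] norm_ge_zero[of "u 0 0"] by (simp add: bracket_0 del: norm_ge_zero)

lemma modes_diff: "modes k \<gamma> K u \<Longrightarrow> modes k \<gamma> K' v \<Longrightarrow> modes k \<gamma> (K + K') (\<lambda>n y. u n y - v n y)"
  unfolding modes_def using decays_diff by (fastforce simp: add_divide_distrib)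

lemma modes_add: "modes k \<gamma> K u \<Longrightarrow> modes k \<gamma> K' v \<Longrightarrow> modes k \<gamma> (K + K') (\<lambda>n y. u n y + v n y)"
  unfolding modes_def decays_def
  by (auto intro!: continuous_intros norm_triangle_le simp: add_divide_distrib ring_distribs add_mono)

lemma modes_scale: "modes k \<gamma> K u \<Longrightarrow> modes k \<gamma> (norm c * K) (\<lambda>n \<psi>. c * u n \<psi>)"
  unfolding modes_def decays_def
proof (intro allI conjI impI, goal_cases)
  case (2 n y)
  then have "norm (u n y) \<le> K / bracket n ^ k * exp (- (\<gamma> * y))" by blast
  from mult_left_mono[OF this, of "norm c"] show ?case by (simp add: norm_mult mult.assoc)
qed (auto intro!: continuous_intros)

lemma modes_mono: "modes k \<gamma> K u \<Longrightarrow> K \<le> K' \<Longrightarrow> modes k \<gamma> K' u"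
  unfolding modes_def
proof
  fix n assume a: "\<forall>n. decays \<gamma> (K / bracket n ^ k) (u n)" "K \<le> K'"
  have "K / bracket n ^ k \<le> K' / bracket n ^ k" using a(2) bracket_power_pos by (rule divide_right_mono[OF _ less_imp_le])
  with a(1) show "decays \<gamma> (K' / bracket n ^ k) (u n)" using decays_mono by blast
qed

lemma modes_order_mono:
  assumes "modes l \<gamma> K u" "k \<le> l"
  shows "modes k \<gamma> K u"
  unfolding modes_def
proof
  fix n
  have "K / bracket n ^ l \<le> K / bracket n ^ k"
    using mult_left_mono[OF bracket_inverse_mono[OF assms(2), of n] modes_K[OF assms(1)]] by simp
  then show "decays \<gamma> (K / bracket n ^ k) (u n)" using assms(1) decays_mono unfolding modes_def by blast
qed

lemma modes_abs_summable:
  assumes "modes k \<gamma> K u" "k \<ge> 2" "y \<ge> 0"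
  shows "(\<lambda>n. norm (u n y)) summable_on UNIV"
  by (rule Infinite_Sum.abs_summable_on_comparison_test'[where g = "\<lambda>n. K * exp (- (\<gamma> * y)) * (1 / bracket n ^ k)"])
     (intro summable_on_cmult_right bracket_summable assms(2), intro modes_bound[OF assms(1,3)])

definition conv :: "(int \<Rightarrow> real \<Rightarrow> complex) \<Rightarrow> (int \<Rightarrow> real \<Rightarrow> complex) \<Rightarrow> int \<Rightarrow> real \<Rightarrow> complex" where
  "conv u v n y = (\<Sum>\<^sub>\<infinity>m. u m y * v (n - m) y)"

context
  fixes u v :: "int \<Rightarrow> real \<Rightarrow> complex" and \<gamma> \<gamma>' K K' :: real
  assumes u: "modes 4 \<gamma> K u" and v: "modes 4 \<gamma>' K' v"
begin

lemma conv_term_bound: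
  assumes "y \<ge> 0"
  shows "norm (u m y * v (n - m) y) \<le> K * K' * exp (- ((\<gamma> + \<gamma>') * y)) * (1 / bracket m ^ 4 * (1 / bracket (n - m) ^ 4))"
proof -
  have "norm (u m y * v (n - m) y) \<le> (K * exp (- (\<gamma> * y)) * (1 / bracket m ^ 4)) * (K' * exp (- (\<gamma>' * y)) * (1 / bracket (n - m) ^ 4))"
    unfolding norm_mult using bracket_power_pos modes_K[OF u] by (intro mult_mono modes_bound[OF u] modes_bound[OF v] assms) (auto simp: less_imp_le)
  also have "\<dots> = K * K' * exp (- (\<gamma> * y) + - (\<gamma>' * y)) * (1 / bracket m ^ 4 * (1 / bracket (n - m) ^ 4))"
    by (simp only: exp_add mult_ac)
  also have "- (\<gamma> * y) + - (\<gamma>' * y) = - ((\<gamma> + \<gamma>') * y)" by (simp add: ring_distribs)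
  finally show ?thesis .
qed

lemma conv_abs_summable: "y \<ge> 0 \<Longrightarrow> (\<lambda>m. norm (u m y * v (n - m) y)) summable_on UNIV"
  by (rule Infinite_Sum.abs_summable_on_comparison_test'[OF summable_on_cmult_right[OF bracket_conv_summable] conv_term_bound])

text \<open>The exponential rates add. A factor of rate 0, such as the modes of q / q_e - 1, which
  tends to \<omega> - 1 at infinity, therefore preserves the rate of the other factor.\<close>

lemma modes_conv:
  assumes "0 \<le> \<gamma>" "0 \<le> \<gamma>'"
  shows "modes 4 (\<gamma> + \<gamma>') (32 * bracket_sum * (K * K')) (conv u v)"
  unfolding modes_def decays_def
proof (intro allI conjI impI)
  fix n :: int
  have KK: "K * K' \<ge> 0" using modes_K[OF u] modes_K[OF v] by simp
  let ?M = "\<lambda>m. K * K' * (1 / bracket m ^ 4 * (1 / bracket (n - m) ^ 4))"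
  have "uniform_limit {0..} (\<lambda>F y. \<Sum>m\<in>F. u m y * v (n - m) y) (conv u v n) (finite_subsets_at_top UNIV)"
    unfolding conv_def
  proof (rule Weierstrass_m_test_general)
    show "?M summable_on UNIV" by (intro summable_on_cmult_right bracket_conv_summable)
    fix m and y :: real assume "y \<in> {0..}"
    then have y: "y \<ge> 0" by simp
    have "exp (- ((\<gamma> + \<gamma>') * y)) \<le> 1" using assms y by simp
    then have "K * K' * exp (- ((\<gamma> + \<gamma>') * y)) \<le> K * K' * 1" using KK by (rule mult_left_mono)
    then show "norm (u m y * v (n - m) y) \<le> ?M m"
proof -
      have "0 \<le> 1 / bracket m ^ 4 * (1 / bracket (n - m) ^ 4)" using bracket_power_pos by (simp add: less_imp_le)
      from mult_right_mono[OF \<open>K * K' * exp (- ((\<gamma> + \<gamma>') * y)) \<le> K * K' * 1\<close> this]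
      show ?thesis using conv_term_bound[OF y, of m n] by simp
    qed
  qed
  then show "continuous_on {0..} (conv u v n)"
    using u v by (rule_tac uniform_limit_theorem) (auto intro!: always_eventually continuous_intros simp: modes_def decays_def)
  fix y :: real assume y: "0 \<le> y"
  have "norm (conv u v n y) \<le> (\<Sum>\<^sub>\<infinity>m. norm (u m y * v (n - m) y))"
    unfolding conv_def by (rule norm_infsum_bound[OF conv_abs_summable[OF y]])
  also have "\<dots> \<le> (\<Sum>\<^sub>\<infinity>m. K * K' * exp (- ((\<gamma> + \<gamma>') * y)) * (1 / bracket m ^ 4 * (1 / bracket (n - m) ^ 4)))"
    by (intro infsum_mono conv_abs_summable[OF y] summable_on_cmult_right bracket_conv_summable conv_term_bound[OF y])
  also have "\<dots> \<le> K * K' * exp (- ((\<gamma> + \<gamma>') * y)) * (32 * bracket_sum / bracket n ^ 4)"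
    unfolding infsum_cmult_right' using KK by (intro mult_left_mono bracket_conv_sum) auto
  finally show "norm (conv u v n y) \<le> 32 * bracket_sum * (K * K') / bracket n ^ 4 * exp (- ((\<gamma> + \<gamma>') * y))"
    by (simp add: mult_ac)
qed

lemma conv_cnj:
  assumes "\<And>n. u (- n) y = cnj (u n y)" "\<And>n. v (- n) y = cnj (v n y)"
  shows "conv u v (- n) y = cnj (conv u v n y)"
proof -
  have "conv u v (- n) y = (\<Sum>\<^sub>\<infinity>m. u (- m) y * v (- n - - m) y)"
    unfolding conv_def using infsum_reindex_bij_betw[OF bij_minus_shift[of 0], of "\<lambda>m. u m y * v (- n - m) y"] by simp
  also have "\<dots> = (\<Sum>\<^sub>\<infinity>m. cnj (u m y * v (n - m) y))"
    using assms(2)[of "n - _"] by (intro infsum_cong) (simp add: assms(1))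
  finally show ?thesis by (simp only: infsum_cnj conv_def)
qed

end

lemma conv_diff:
  assumes "modes 4 \<gamma> K u" "modes 4 \<gamma> K1 u'" "modes 4 \<gamma>' K' v" "modes 4 \<gamma>' K2 v'" "y \<ge> 0"
  shows "conv u v n y - conv u' v' n y = conv (\<lambda>n y. u n y - u' n y) v n y + conv u' (\<lambda>n y. v n y - v' n y) n y"
proof -
  note s = abs_summable_summable[OF conv_abs_summable[OF _ _ assms(5)]]
  note d = modes_diff[OF assms(1,2)] modes_diff[OF assms(3,4)]
  have "conv u v n y - conv u' v' n y = (\<Sum>\<^sub>\<infinity>m. u m y * v (n - m) y - u' m y * v' (n - m) y)"
    unfolding conv_def using infsum_add[OF s[OF assms(1,3)] iffD2[OF summable_on_uminus s[OF assms(2,4)]], of n n] by (simp add: infsum_uminus)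
  also have "\<dots> = (\<Sum>\<^sub>\<infinity>m. (u m y - u' m y) * v (n - m) y + u' m y * (v (n - m) y - v' (n - m) y))"
    by (intro infsum_cong) (simp add: algebra_simps)
  also have "\<dots> = conv (\<lambda>n y. u n y - u' n y) v n y + conv u' (\<lambda>n y. v n y - v' n y) n y"
    unfolding conv_def by (intro infsum_add s[OF d(1) assms(3)] s[OF assms(2) d(2)])
  finally show ?thesis .
qed

lemma infsum_convolution:
  fixes x y :: "int \<Rightarrow> complex"
  assumes "(\<lambda>n. norm (x n)) summable_on UNIV" "(\<lambda>n. norm (y n)) summable_on UNIV"
  shows "(\<Sum>\<^sub>\<infinity>n. \<Sum>\<^sub>\<infinity>m. x m * y (n - m)) = (\<Sum>\<^sub>\<infinity>n. x n) * (\<Sum>\<^sub>\<infinity>n. y n)"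
proof -
  have "(\<lambda>p. norm (x (fst p) * y (snd p))) summable_on UNIV \<times> UNIV"
    unfolding Infinite_Sum.abs_summable_on_Sigma_iff using assms
    by (auto simp: norm_mult infsum_cmult_right' infsum_cmult_left' abs_mult infsum_nonneg intro!: summable_on_cmult_right summable_on_cmult_left)
  then have s: "(\<lambda>p. x (fst p) * y (snd p)) summable_on UNIV \<times> UNIV" by (rule abs_summable_summable)
  have bij: "bij_betw (\<lambda>(m, n). (m, n - m)) (UNIV \<times> UNIV) (UNIV \<times> (UNIV :: int set))"
    by (rule bij_betw_byWitness[where f' = "\<lambda>(m, k). (m, k + m)"]) auto
  have s': "(\<lambda>(m, n). x m * y (n - m)) summable_on UNIV \<times> UNIV"
    using summable_on_reindex_bij_betw[OF bij, of "\<lambda>p. x (fst p) * y (snd p)"] s by (simp add: case_prod_beta')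
  have "(\<Sum>\<^sub>\<infinity>n. \<Sum>\<^sub>\<infinity>m. x m * y (n - m)) = (\<Sum>\<^sub>\<infinity>m. \<Sum>\<^sub>\<infinity>n. x m * y (n - m))"
    using infsum_swap_banach[OF s'] by simp
  also have "\<dots> = (\<Sum>\<^sub>\<infinity>m. x m * (\<Sum>\<^sub>\<infinity>n. y n))"
  proof (rule infsum_cong)
    fix m :: int
    have b: "bij (\<lambda>n. n - m)" by (rule bij_betw_byWitness[where f' = "\<lambda>n. n + m"]) auto
    show "(\<Sum>\<^sub>\<infinity>n. x m * y (n - m)) = x m * (\<Sum>\<^sub>\<infinity>n. y n)" using infsum_reindex_bij_betw[OF b, of y] by (simp add: infsum_cmult_right')
  qed
  finally show ?thesis by (simp add: infsum_cmult_left')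
qed

text \<open>Banach's theorem carried out by hand: functions count only on y \<ge> 0, and each index
  has its own rate and weight. The map \<iota> encodes the reality condition, so that the
  contraction estimate is required only between families satisfying it.\<close>

lemma weighted_contraction:
  fixes \<Phi> :: "('i \<Rightarrow> real \<Rightarrow> complex) \<Rightarrow> 'i \<Rightarrow> real \<Rightarrow> complex" and \<gamma> w :: "'i \<Rightarrow> real" and \<iota> :: "'i \<Rightarrow> 'i"
  defines "adm \<equiv> \<lambda>u. (\<forall>i. decays (\<gamma> i) (w i) (u i)) \<and> (\<forall>i. \<forall>y\<ge>0. u (\<iota> i) y = cnj (u i y))"
  assumes \<gamma>: "\<And>i. \<gamma> i \<ge> 0" and w: "\<And>i. w i \<ge> 0" and maps: "\<And>u. adm u \<Longrightarrow> adm (\<Phi> u)"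
    and contr: "\<And>u v c i. adm u \<Longrightarrow> adm v \<Longrightarrow> 0 \<le> c \<Longrightarrow> (\<And>i. decays (\<gamma> i) (c * w i) (\<lambda>y. u i y - v i y)) \<Longrightarrow>
        decays (\<gamma> i) (c / 2 * w i) (\<lambda>y. \<Phi> u i y - \<Phi> v i y)"
  shows "\<exists>u. adm u \<and> (\<forall>i. \<forall>y\<ge>0. \<Phi> u i y = u i y)"
proof -
  define X where "X k = (\<Phi> ^^ k) (\<lambda>_ _. 0)" for k
  have X_Suc: "X (Suc k) = \<Phi> (X k)" for k by (simp add: X_def)
  have adm0: "adm (\<lambda>_ _. 0)" using w by (auto simp: adm_def decays_def)
  have adm: "adm (X k)" for k by (induction k) (simp_all add: X_def adm0 maps)
  have step: "decays (\<gamma> i) ((1 / 2) ^ k * w i) (\<lambda>y. X (Suc k) i y - X k i y)" for k i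
  proof (induction k arbitrary: i)
    case 0
    show ?case using adm[of 1] by (simp add: X_def adm_def)
  next
    case (Suc k)
    have "decays (\<gamma> i) ((1 / 2) ^ k / 2 * w i) (\<lambda>y. \<Phi> (X (Suc k)) i y - \<Phi> (X k) i y)" by (rule contr[OF adm adm _ Suc]) simp
    then show ?case by (simp add: X_Suc)
  qed
  define d where "d i y k = X (Suc k) i y - X k i y" for i y k
  have d: "norm (d i y k) \<le> w i * exp (- (\<gamma> i * y)) * (1 / 2) ^ k" if "y \<ge> 0" for i y k
    using decays_bound[OF step that] by (simp add: d_def mult_ac)
  have sum_d: "(\<Sum>j<k. d i y j) = X k i y" for i y k
    using sum_lessThan_telescope[of "\<lambda>k. X k i y" k] by (simp add: d_def X_def)
  have geo: "summable (\<lambda>k. c * (1 / 2 :: real) ^ k)" for c by (intro summable_mult summable_geometric) simp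
  have sd: "summable (d i y)" if "y \<ge> 0" for i y
    by (rule summable_comparison_test'[OF geo d[OF that]])
  define u where "u i y = suminf (d i y)" for i y
  \<comment> \<open>The factor 2 is the sum of the geometric series of ratio 1/2.\<close>
  have rem: "norm (u i y - X k i y) \<le> w i * exp (- (\<gamma> i * y)) * (2 * (1 / 2) ^ k)" if y: "y \<ge> 0" for i y k
  proof -
    have "u i y - X k i y = (\<Sum>j. d i y (j + k))" using suminf_minus_initial_segment[OF sd[OF y], of i k] by (simp add: u_def sum_d)
    also have "norm \<dots> \<le> (\<Sum>j. w i * exp (- (\<gamma> i * y)) * (1 / 2) ^ k * (1 / 2) ^ j)"
      by (rule norm_suminf_le[OF _ geo]) (use d[OF y, of i "_ + k"] in \<open>simp add: power_add mult_ac\<close>)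
    also have "\<dots> = w i * exp (- (\<gamma> i * y)) * (1 / 2) ^ k * 2" by (subst suminf_mult) (auto simp: suminf_geometric)
    finally show ?thesis by simp
  qed
  have lim: "(\<lambda>k. X k i y) \<longlonglongrightarrow> u i y" if "y \<ge> 0" for i y
    using summable_LIMSEQ[OF sd[OF that]] by (simp add: sum_d u_def)
  have half: "(\<lambda>k. c * (2 * (1 / 2 :: real) ^ k)) \<longlonglongrightarrow> 0" for c
    by (rule tendsto_mult_right_zero tendsto_mult_right_zero LIMSEQ_power_zero)+ simp
  have cont: "continuous_on {0..} (u i)" for i
  proof (rule uniform_limit_theorem)
    show "uniform_limit {0..} (\<lambda>k. X k i) (u i) sequentially"
    proof (rule uniform_limitI)
      fix e :: real assume "e > 0"
      from order_tendstoD(2)[OF half[of "w i"] this]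
      show "\<forall>\<^sub>F k in sequentially. \<forall>y\<in>{0..}. dist (X k i y) (u i y) < e"
      proof eventually_elim
        case (elim k)
        show ?case
        proof
          fix y :: real assume y: "y \<in> {0..}"
          have "w i * exp (- (\<gamma> i * y)) * (2 * (1 / 2) ^ k) \<le> w i * 1 * (2 * (1 / 2) ^ k)" using y \<gamma> w by (intro mult_right_mono mult_left_mono) auto
          then show "dist (X k i y) (u i y) < e" using rem[of y i k] y elim by (simp add: dist_norm norm_minus_commute)
        qed
      qed
    qed
    show "\<forall>\<^sub>F k in sequentially. continuous_on {0..} (X k i)" using adm by (auto intro!: always_eventually simp: adm_def decays_def)
  qed simp
  have "adm u"
    unfolding adm_def decays_def
  proof (intro conjI allI impI cont)
    fix i and y :: real assume y: "y \<ge> 0"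
    show "norm (u i y) \<le> w i * exp (- (\<gamma> i * y))" using tendsto_norm[OF lim[OF y, of i]] adm y by (rule_tac LIMSEQ_le_const2) (auto simp: adm_def decays_def)
    have "(\<lambda>k. X k (\<iota> i) y) = (\<lambda>k. cnj (X k i y))" using adm y by (auto simp: adm_def)
    then show "u (\<iota> i) y = cnj (u i y)" using lim[OF y, of "\<iota> i"] tendsto_cnj[OF lim[OF y, of i]] LIMSEQ_unique by metis
  qed
  moreover have "\<Phi> u i y = u i y" if y: "y \<ge> 0" for i y
  proof -
    have "norm (\<Phi> u i y - u i y) \<le> (w i * exp (- (\<gamma> i * y))) * (2 * (1 / 2) ^ k)" for k
    proof -
      have "decays (\<gamma> i) ((2 * (1 / 2) ^ k) / 2 * w i) (\<lambda>y. \<Phi> u i y - \<Phi> (X k) i y)"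
      proof (rule contr[OF \<open>adm u\<close> adm])
        show "decays (\<gamma> i) (2 * (1 / 2) ^ k * w i) (\<lambda>y. u i y - X k i y)" for i
          using rem[of _ i k] adm[of k] by (auto simp: decays_def adm_def mult_ac intro!: continuous_intros cont)
      qed simp
      from decays_bound[OF this y] have "norm (\<Phi> u i y - X (Suc k) i y) \<le> w i * exp (- (\<gamma> i * y)) * (1 / 2) ^ k" by (simp add: X_Suc mult_ac)
      moreover have "norm (u i y - X (Suc k) i y) \<le> w i * exp (- (\<gamma> i * y)) * (1 / 2) ^ k" using rem[OF y, of i "Suc k"] by simp
      moreover have "norm (\<Phi> u i y - u i y) \<le> norm (\<Phi> u i y - X (Suc k) i y) + norm (u i y - X (Suc k) i y)" by (metis dist_norm dist_triangle2)
      ultimately show ?thesis by simp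
    qed
    then have "norm (\<Phi> u i y - u i y) \<le> 0" using LIMSEQ_le_const[OF half] by blast
    then show ?thesis by simp
  qed
  ultimately show ?thesis by blast
qed

lemma modes_rate_mono:
  assumes "modes k \<gamma> K u" "\<gamma>' \<le> \<gamma>"
  shows "modes k \<gamma>' K u"
  unfolding modes_def decays_def
proof (intro allI conjI impI)
  fix n show "continuous_on {0..} (u n)" using assms(1) by (simp add: modes_def decays_def)
  fix y :: real assume y: "0 \<le> y"
  have "K / bracket n ^ k * exp (- (\<gamma> * y)) \<le> K / bracket n ^ k * exp (- (\<gamma>' * y))"
    using modes_K[OF assms(1)] bracket_power_pos y assms(2) by (intro mult_left_mono) (auto simp: less_imp_le mult_right_mono)
  then show "norm (u n y) \<le> K / bracket n ^ k * exp (- (\<gamma>' * y))"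
    using assms(1) y unfolding modes_def decays_def by (meson order_trans)
qed

lemma modes_multiplier:
  assumes u: "modes 5 \<gamma> K u" and c: "\<And>n. norm (c n) \<le> C * bracket n"
  shows "modes 4 \<gamma> (C * K) (\<lambda>n \<psi>. c n * u n \<psi>)"
  unfolding modes_def decays_def
proof (intro allI conjI impI)
  fix n show "continuous_on {0..} (\<lambda>\<psi>. c n * u n \<psi>)"
    using u by (intro continuous_intros) (simp add: modes_def decays_def)
  fix y :: real assume y: "0 \<le> y"
  have "norm (c n * u n y) \<le> (C * bracket n) * (K * exp (- (\<gamma> * y)) * (1 / bracket n ^ 5))"
    unfolding norm_mult using order_trans[OF norm_ge_zero c[of n]] by (intro mult_mono c modes_bound[OF u y]) auto
  then show "norm (c n * u n y) \<le> C * K / bracket n ^ 4 * exp (- (\<gamma> * y))"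
    using bracket_pos[of n] by (simp add: eval_nat_numeral)
qed

section \<open>The linear problem and its solvability condition\<close>

locale mode_problem =
  fixes l1 \<nu>0 B :: real and \<nu> \<alpha> :: "int \<Rightarrow> complex"
  assumes l1: "l1 > 0" and \<nu>0: "\<nu> 0 = of_real \<nu>0" "\<nu>0 > 0" and B: "B \<ge> 0"
    and \<nu>_bound: "\<And>n. norm (\<nu> n) \<le> B / bracket n ^ 5" and \<alpha>_bound: "\<And>n. norm (\<alpha> n) \<le> B / bracket n ^ 4"
    and \<nu>_cnj: "\<And>n. \<nu> (- n) = cnj (\<nu> n)" and \<alpha>_cnj: "\<And>n. \<alpha> (- n) = cnj (\<alpha> n)"
begin

definition lam :: "int \<Rightarrow> real" where "lam n = l1 * real_of_int n"

text \<open>The square root of i l1 n with nonnegative real part; for n \<noteq> 0 the real part is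
  positive, so exp(-mu \<psi>) decays.\<close>

definition mu :: "int \<Rightarrow> complex" where
  "mu n = Complex (sqrt (l1 * \<bar>real_of_int n\<bar> / 2)) (sgn (real_of_int n) * sqrt (l1 * \<bar>real_of_int n\<bar> / 2))"

text \<open>Half of the smallest real part of \<open>mu n\<close> over n \<noteq> 0;
  \<open>decays_mode\<close> requires this factor of two.\<close>

definition rate :: real where "rate = sqrt (l1 / 2) / 2"

lemma rate_pos: "rate > 0"
  using l1 by (simp add: rate_def)

lemma Re_mu: "Re (mu n) = sqrt (l1 * \<bar>real_of_int n\<bar> / 2)"
  by (simp add: mu_def)

lemma Re_mu_nonneg: "Re (mu n) \<ge> 0"
  using l1 by (simp add: mu_def)

lemma Re_mu_sq: "(Re (mu n))\<^sup>2 = l1 * \<bar>real_of_int n\<bar> / 2"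
  using l1 by (simp add: mu_def)

lemma mu_sq: "(mu n)\<^sup>2 = \<i> * of_real (lam n)"
proof -
  define x where "x = sqrt (l1 * \<bar>real_of_int n\<bar> / 2)"
  have x: "x * x = l1 * \<bar>real_of_int n\<bar> / 2" unfolding x_def using l1 by (simp add: real_sqrt_mult_self)
  have "mu n = Complex x (sgn (real_of_int n) * x)" by (simp add: mu_def x_def)
  then show ?thesis
    using x by (auto simp: complex_eq_iff power2_eq_square lam_def sgn_if abs_if split: if_splits)
qed

lemma mu_eq_0: "mu n = 0 \<longleftrightarrow> n = 0"
  using l1 by (auto simp: mu_def complex_eq_iff)

lemma norm_mu: "norm (mu n) \<le> (1 + l1) * bracket n"
proof -
  have "(norm (mu n))\<^sup>2 = l1 * \<bar>real_of_int n\<bar>"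
    using arg_cong[OF mu_sq[of n], of norm] l1 by (simp add: norm_power norm_mult lam_def abs_mult)
  also have "\<dots> \<le> (1 + l1) * bracket n" using l1 by (intro mult_mono) (auto simp: bracket_def)
  also have "\<dots> \<le> ((1 + l1) * bracket n)\<^sup>2"
  proof -
    have "1 * 1 \<le> (1 + l1) * bracket n" using l1 bracket_ge_1[of n] by (intro mult_mono) auto
    then show ?thesis using power_increasing[of 1 2 "(1 + l1) * bracket n"] by simp
  qed
  finally show ?thesis using l1 bracket_pos[of n] by (simp add: power2_le_iff_abs_le)
qed

lemma mu_cnj: "mu (- n) = cnj (mu n)"
  by (simp add: mu_def complex_eq_iff)

lemma rate_le_mu:
  assumes "n \<noteq> 0"
  shows "2 * rate \<le> Re (mu n)"
proof -
  have "1 \<le> \<bar>real_of_int n\<bar>" using assms by linarith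
  then have "l1 * 1 / 2 \<le> l1 * \<bar>real_of_int n\<bar> / 2" using l1 by (intro divide_right_mono mult_left_mono) auto
  then show ?thesis by (simp add: rate_def Re_mu real_sqrt_le_mono)
qed

text \<open>The value of \<omega>^2 - 1. For n = 0 the decaying solution starts at minus the double
  tail integral of \<open>N 0\<close>, while the data ask for b 0 - (\<omega>^2 - 1) \<nu> 0;
  equating the two gives this quotient.\<close>

definition omega_shift :: "(int \<Rightarrow> complex) \<Rightarrow> (int \<Rightarrow> real \<Rightarrow> complex) \<Rightarrow> complex" where
  "omega_shift b N = (b 0 + backward 0 (backward 0 (N 0)) 0) / \<nu> 0"

text \<open>With \<open>b\<close> the modes of f^2 - q_e^2 and \<open>\<nu>\<close> those of q_e^2,
  the boundary values used here are the modes of f^2 - \<omega>^2 q_e^2.\<close>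

definition Q_mode :: "(int \<Rightarrow> complex) \<Rightarrow> (int \<Rightarrow> real \<Rightarrow> complex) \<Rightarrow> int \<Rightarrow> real \<Rightarrow> complex" where
  "Q_mode b N n = mode (mu n) (b n - omega_shift b N * \<nu> n) (N n)"

definition P_mode :: "(int \<Rightarrow> complex) \<Rightarrow> (int \<Rightarrow> real \<Rightarrow> complex) \<Rightarrow> int \<Rightarrow> real \<Rightarrow> complex" where
  "P_mode b N n y = backward (mu n) (N n) y - mu n * Q_mode b N n y"

definition H_mode :: "(int \<Rightarrow> complex) \<Rightarrow> (int \<Rightarrow> real \<Rightarrow> complex) \<Rightarrow> int \<Rightarrow> real \<Rightarrow> complex" where
  "H_mode b N n y = \<i> * of_real (lam n) * Q_mode b N n y - N n y"

text \<open>The modes of (\<omega>^2 - 1) + Q / q_e^2, with \<open>\<alpha>\<close> standing for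
  those of q_e^(-2). This function has to equal 2 \<rho> + \<rho>^2 for \<rho> = q / q_e -
  1.\<close>

definition Z_mode :: "(int \<Rightarrow> complex) \<Rightarrow> (int \<Rightarrow> real \<Rightarrow> complex) \<Rightarrow> int \<Rightarrow> real \<Rightarrow> complex" where
  "Z_mode b N n y = (if n = 0 then omega_shift b N else 0) + conv (\<lambda>n _. \<alpha> n) (Q_mode b N) n y"

text \<open>These constants bound the linear solution operators by Kb + K, the sizes of the data and
  of \<open>N\<close>. In \<open>C_Q\<close> the number 16 / (3 l1) is the product of 4/3 from
  \<open>decays_mode\<close>, 2 / l1 from (Re mu)^2 = l1 |n| / 2, and 2 from bracket n \<le> 2
  |n|.\<close>

definition C_om :: real where "C_om = (1 + 1 / rate\<^sup>2) / \<nu>0"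
definition C_Q :: real where "C_Q = 1 + C_om * B + 16 / (3 * l1) + 1 / rate\<^sup>2"
definition C_H :: real where "C_H = l1 * C_Q + 1"
definition C_P :: real where "C_P = 1 / rate + (1 + l1) * C_Q"
definition C_Z :: real where "C_Z = C_om + 32 * bracket_sum * (B * C_Q)"

lemma C_nonneg: "C_om \<ge> 0" "C_Q \<ge> 1" "C_H \<ge> 1" "C_P \<ge> 0" "C_Z \<ge> 0"
proof -
  show 1: "C_om \<ge> 0" using \<nu>0 by (simp add: C_om_def)
  then show 2: "C_Q \<ge> 1" using B l1 by (simp add: C_Q_def)
  then show "C_H \<ge> 1" "C_P \<ge> 0" "C_Z \<ge> 0" using 1 l1 rate_pos B bracket_sum_nonneg by (auto simp: C_H_def C_P_def C_Z_def)
qed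

context
  fixes b :: "int \<Rightarrow> complex" and Kb K :: real and N :: "int \<Rightarrow> real \<Rightarrow> complex"
  assumes b: "\<And>n. norm (b n) \<le> Kb / bracket n ^ 5" and N: "modes 4 rate K N"
begin

lemma N_decays: "decays rate (K / bracket n ^ 4) (N n)"
  using N by (simp add: modes_def)

lemma K_nonneg: "K \<ge> 0" "Kb \<ge> 0"
  using modes_K[OF N] order_trans[OF norm_ge_zero b[of 0]] by (auto simp: bracket_0)

lemma tail_N_bound: "norm (backward 0 (backward 0 (N 0)) 0) \<le> K / rate\<^sup>2"
  using decays_bound[OF decays_backward[OF rate_pos decays_backward[OF rate_pos N_decays[of 0], of 0], of 0], of 0]
  by (simp add: bracket_0 power2_eq_square)

lemma omega_shift_bound: "norm (omega_shift b N) \<le> C_om * (Kb + K)"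
proof -
  have "norm (b 0 + backward 0 (backward 0 (N 0)) 0) \<le> Kb + K / rate\<^sup>2"
    using norm_triangle_ineq[of "b 0" "backward 0 (backward 0 (N 0)) 0"] b[of 0] tail_N_bound by (simp add: bracket_0)
  also have "\<dots> \<le> (1 + 1 / rate\<^sup>2) * (Kb + K)"
  proof -
    have "1 / rate\<^sup>2 * K \<le> 1 / rate\<^sup>2 * (Kb + K)" using K_nonneg by (intro mult_left_mono) auto
    then show ?thesis using K_nonneg by (simp add: ring_distribs)
  qed
  finally show ?thesis using \<nu>0 by (simp add: omega_shift_def C_om_def norm_divide divide_right_mono)
qed

lemma Q_mode_coeff_bound: "norm (b n - omega_shift b N * \<nu> n) \<le> (1 + C_om * B) * (Kb + K) / bracket n ^ 5"
proof -
  have "norm (omega_shift b N * \<nu> n) \<le> (C_om * (Kb + K)) * (B / bracket n ^ 5)"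
    unfolding norm_mult using K_nonneg C_nonneg by (intro mult_mono omega_shift_bound \<nu>_bound) auto
  then have "norm (b n - omega_shift b N * \<nu> n) \<le> Kb / bracket n ^ 5 + (C_om * (Kb + K)) * (B / bracket n ^ 5)"
    using b[of n] norm_triangle_ineq4[of "b n" "omega_shift b N * \<nu> n"] by linarith
  also have "\<dots> = (Kb + C_om * (Kb + K) * B) / bracket n ^ 5" by (simp add: add_divide_distrib)
  also have "\<dots> \<le> (1 + C_om * B) * (Kb + K) / bracket n ^ 5"
    using K_nonneg bracket_power_pos[of n 5] by (intro divide_right_mono) (auto simp: algebra_simps)
  finally show ?thesis .
qed

lemma Q_mode_deriv:
  assumes "y \<ge> 0"
  shows "(Q_mode b N n has_vector_derivative P_mode b N n y) (at y within {0..})"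
  unfolding Q_mode_def P_mode_def by (rule mode_deriv[OF rate_pos N_decays Re_mu_nonneg assms])

lemma P_mode_deriv:
  assumes "y \<ge> 0"
  shows "(P_mode b N n has_vector_derivative H_mode b N n y) (at y within {0..})"
  using mode_deriv2[OF rate_pos N_decays[of n] Re_mu_nonneg[of n] assms, of "b n - omega_shift b N * \<nu> n"]
  by (simp add: Q_mode_def[symmetric] P_mode_def[symmetric] H_mode_def mu_sq)

text \<open>For n \<noteq> 0 the fifth power comes from dividing by (Re mu)^2, which is proportional
  to |n|; for n = 0 the bracket equals 1.\<close>

lemma modes_Q_mode: "modes 5 rate (C_Q * (Kb + K)) (Q_mode b N)"
  unfolding modes_def
proof
  fix n
  have W: "bracket n > 0" by (rule bracket_pos)
  show "decays rate (C_Q * (Kb + K) / bracket n ^ 5) (Q_mode b N n)"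
  proof (cases "n = 0")
    case True
    have "K / rate\<^sup>2 \<le> C_Q * (Kb + K)"
    proof -
      have "1 / rate\<^sup>2 * K \<le> C_Q * (Kb + K)" using K_nonneg C_nonneg B l1 by (intro mult_mono) (auto simp: C_Q_def)
      then show ?thesis by simp
    qed
    then show ?thesis using decays_mono[OF decays_mode_0[OF rate_pos N_decays[of 0]]] True mu_eq_0[of 0] by (simp add: Q_mode_def bracket_0)
  next
    case False
    let ?b = "b n - omega_shift b N * \<nu> n"
    have n: "bracket n \<le> 2 * \<bar>real_of_int n\<bar>" "0 < \<bar>real_of_int n\<bar>" using False by (auto simp: bracket_def)
    have "4 / 3 * (K / bracket n ^ 4) / (Re (mu n))\<^sup>2 = K / bracket n ^ 4 * (8 / (3 * l1) * (1 / \<bar>real_of_int n\<bar>))"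
      using n l1 by (simp add: Re_mu_sq field_simps)
    also have "\<dots> \<le> K / bracket n ^ 4 * (8 / (3 * l1) * (2 / bracket n))"
    proof (intro mult_left_mono)
      show "1 / \<bar>real_of_int n\<bar> \<le> 2 / bracket n" using n W by (simp add: field_simps)
    qed (use K_nonneg l1 bracket_power_pos in \<open>auto simp: less_imp_le\<close>)
    also have "\<dots> = 16 / (3 * l1) * K / bracket n ^ 5" using W l1 by (simp add: field_simps eval_nat_numeral)
    finally have "norm ?b + 4 / 3 * (K / bracket n ^ 4) / (Re (mu n))\<^sup>2 \<le> (1 + C_om * B) * (Kb + K) / bracket n ^ 5 + 16 / (3 * l1) * K / bracket n ^ 5"
      using Q_mode_coeff_bound[of n] by linarith
    also have "\<dots> = ((1 + C_om * B) * (Kb + K) + 16 / (3 * l1) * K) / bracket n ^ 5" by (simp add: add_divide_distrib)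
    also have "\<dots> \<le> C_Q * (Kb + K) / bracket n ^ 5"
    proof (intro divide_right_mono)
      have "16 / (3 * l1) * K \<le> (16 / (3 * l1) + 1 / rate\<^sup>2) * (Kb + K)" using K_nonneg l1 by (intro mult_mono) auto
      then show "(1 + C_om * B) * (Kb + K) + 16 / (3 * l1) * K \<le> C_Q * (Kb + K)" unfolding C_Q_def by (simp only: ring_distribs)
    qed (use W in simp)
    finally show ?thesis unfolding Q_mode_def using decays_mono[OF decays_mode[OF rate_pos N_decays rate_le_mu[OF False]]] by blast
  qed
qed

text \<open>The multiplier i lam n spends the order gained by \<open>Q_mode\<close>, so the second
  derivative has the order 4 of \<open>N\<close>, and its product with \<rho> can be fed back as the
  new \<open>N\<close>.\<close>

lemma modes_H_mode: "modes 4 rate (C_H * (Kb + K)) (H_mode b N)"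
proof -
  have "norm (\<i> * of_real (lam n)) \<le> l1 * bracket n" for n
    using l1 by (simp add: norm_mult lam_def abs_mult bracket_def)
  from modes_diff[OF modes_multiplier[OF modes_Q_mode this] N]
  have "modes 4 rate (l1 * (C_Q * (Kb + K)) + K) (H_mode b N)" by (simp add: H_mode_def[abs_def])
  then show ?thesis by (rule modes_mono) (use K_nonneg in \<open>simp add: C_H_def algebra_simps\<close>)
qed

lemma modes_P_mode: "modes 4 rate (C_P * (Kb + K)) (P_mode b N)"
proof -
  have "modes 4 rate (K / rate) (\<lambda>n. backward (mu n) (N n))"
    unfolding modes_def
  proof
    fix n
    have "(K / bracket n ^ 4) / (Re (mu n) + rate) \<le> (K / bracket n ^ 4) / rate"
      using K_nonneg bracket_pos[of n] Re_mu_nonneg[of n] rate_pos by (intro divide_left_mono) auto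
    then show "decays rate (K / rate / bracket n ^ 4) (backward (mu n) (N n))"
      using decays_mono[OF decays_backward[OF rate_pos N_decays Re_mu_nonneg]] by (simp add: mult.commute)
  qed
  from modes_diff[OF this modes_multiplier[OF modes_Q_mode norm_mu]]
  have "modes 4 rate (K / rate + (1 + l1) * (C_Q * (Kb + K))) (P_mode b N)" by (simp add: P_mode_def[abs_def])
  then show ?thesis
  proof (rule modes_mono)
    have "1 / rate * K \<le> 1 / rate * (Kb + K)" using K_nonneg rate_pos by (intro mult_left_mono) auto
    then show "K / rate + (1 + l1) * (C_Q * (Kb + K)) \<le> C_P * (Kb + K)" unfolding C_P_def by (simp add: ring_distribs)
  qed
qed

lemma modes_alpha: "modes 4 0 B (\<lambda>n _. \<alpha> n)"
  using \<alpha>_bound by (simp add: modes_def decays_def)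

lemma modes_Z_mode: "modes 4 0 (C_Z * (Kb + K)) (Z_mode b N)"
proof -
  have "modes 4 0 (C_om * (Kb + K)) (\<lambda>n _. if n = 0 then omega_shift b N else 0)"
    unfolding modes_def decays_def using omega_shift_bound C_nonneg K_nonneg bracket_power_pos by (auto simp: bracket_0 less_imp_le)
  moreover have "modes 4 0 (32 * bracket_sum * (B * (C_Q * (Kb + K)))) (conv (\<lambda>n _. \<alpha> n) (Q_mode b N))"
  proof -
    have "modes 4 (0 + rate) (32 * bracket_sum * (B * (C_Q * (Kb + K)))) (conv (\<lambda>n _. \<alpha> n) (Q_mode b N))"
      using rate_pos by (intro modes_conv modes_alpha modes_order_mono[OF modes_Q_mode]) auto
    then show ?thesis by (rule modes_rate_mono) (use rate_pos in simp)
  qed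
  ultimately have "modes 4 0 (C_om * (Kb + K) + 32 * bracket_sum * (B * (C_Q * (Kb + K)))) (Z_mode b N)"
    unfolding Z_mode_def by (rule modes_add)
  moreover have "C_om * (Kb + K) + 32 * bracket_sum * (B * (C_Q * (Kb + K))) = C_Z * (Kb + K)"
    by (simp only: C_Z_def ring_distribs mult_ac)
  ultimately show ?thesis by (simp only:)
qed

context
  assumes b_cnj: "\<And>n. b (- n) = cnj (b n)" and N_cnj: "\<And>n \<psi>. \<psi> \<ge> 0 \<Longrightarrow> N (- n) \<psi> = cnj (N n \<psi>)"
begin

lemma omega_shift_cnj: "cnj (omega_shift b N) = omega_shift b N"
proof -
  have n: "cnj (N 0 y) = N 0 y" if "y \<ge> 0" for y using N_cnj[OF that, of 0] by simp
  have "cnj (backward 0 (N 0) y) = backward 0 (N 0) y" if "y \<ge> 0" for y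
    using backward_cnj[of 0 "N 0" y] backward_cong[where N = "\<lambda>y. cnj (N 0 y)" and N' = "N 0" and \<mu> = 0, OF n that] by (simp only: complex_cnj_zero)
  then have "cnj (backward 0 (backward 0 (N 0)) 0) = backward 0 (backward 0 (N 0)) 0"
    using backward_cnj[of 0 "backward 0 (N 0)" 0]
      backward_cong[where \<mu> = 0 and \<psi> = 0 and N = "\<lambda>y. cnj (backward 0 (N 0) y)" and N' = "backward 0 (N 0)"] by (simp only: complex_cnj_zero order.refl)
  then show ?thesis using b_cnj[of 0] by (simp add: omega_shift_def \<nu>0)
qed

lemma Q_mode_cnj: "y \<ge> 0 \<Longrightarrow> Q_mode b N (- n) y = cnj (Q_mode b N n y)"
  using mode_cnj[of "N (- n)" "N n" y "mu n" "b n - omega_shift b N * \<nu> n"]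
  by (simp add: Q_mode_def mu_cnj b_cnj \<nu>_cnj N_cnj omega_shift_cnj)

lemma H_mode_cnj: "y \<ge> 0 \<Longrightarrow> H_mode b N (- n) y = cnj (H_mode b N n y)"
  by (simp add: H_mode_def Q_mode_cnj N_cnj lam_def)

lemma Z_mode_cnj: "y \<ge> 0 \<Longrightarrow> Z_mode b N (- n) y = cnj (Z_mode b N n y)"
  using conv_cnj[OF modes_alpha modes_order_mono[OF modes_Q_mode], of y n]
  by (auto simp: Z_mode_def omega_shift_cnj \<alpha>_cnj Q_mode_cnj)

end

end

lemma omega_shift_diff:
  assumes "modes 4 rate K N" "modes 4 rate K' N'"
  shows "omega_shift (\<lambda>n. b n - b' n) (\<lambda>n y. N n y - N' n y) = omega_shift b N - omega_shift b' N'"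
proof -
  note d = assms(1)[unfolded modes_def, rule_format, of 0] assms(2)[unfolded modes_def, rule_format, of 0]
  note d' = decays_backward[OF rate_pos d(1), of 0] decays_backward[OF rate_pos d(2), of 0]
  have "backward 0 (backward 0 (\<lambda>y. N 0 y - N' 0 y)) 0 = backward 0 (\<lambda>y. backward 0 (N 0) y - backward 0 (N' 0) y) 0"
    by (rule backward_cong) (use backward_diff[OF rate_pos d] in auto)
  also have "\<dots> = backward 0 (backward 0 (N 0)) 0 - backward 0 (backward 0 (N' 0)) 0"
    by (rule backward_diff[OF rate_pos d']) auto
  finally show ?thesis by (simp add: omega_shift_def diff_divide_distrib add_divide_distrib)
qed

lemma Q_mode_diff:
  assumes "modes 4 rate K N" "modes 4 rate K' N'" "y \<ge> 0"
  shows "Q_mode (\<lambda>n. b n - b' n) (\<lambda>n y. N n y - N' n y) n y = Q_mode b N n y - Q_mode b' N' n y"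
proof -
  note d = assms(1)[unfolded modes_def, rule_format, of n] assms(2)[unfolded modes_def, rule_format, of n]
  show ?thesis
    unfolding Q_mode_def omega_shift_diff[OF assms(1,2)] mode_diff[OF rate_pos d Re_mu_nonneg assms(3), symmetric] by (simp add: algebra_simps)
qed

lemma H_mode_diff:
  assumes "modes 4 rate K N" "modes 4 rate K' N'" "y \<ge> 0"
  shows "H_mode (\<lambda>n. b n - b' n) (\<lambda>n y. N n y - N' n y) n y = H_mode b N n y - H_mode b' N' n y"
  by (simp add: H_mode_def Q_mode_diff[OF assms] algebra_simps)

end

section \<open>The fixed-point map and its contraction\<close>

context mode_problem
begin

text \<open>The construction is linear in the pair (b, N), so the boundary data cancel; the
  contraction estimate reuses the bounds on \<open>Z_mode\<close> with Kb = 0.\<close>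

lemma Z_mode_diff:
  assumes N: "modes 4 rate K N" "modes 4 rate K' N'" and b: "\<And>n. norm (b n) \<le> Kb / bracket n ^ 5" and y: "y \<ge> 0"
  shows "Z_mode b N n y - Z_mode b N' n y = Z_mode (\<lambda>_. 0) (\<lambda>n y. N n y - N' n y) n y"
proof -
  note Q = modes_order_mono[OF modes_Q_mode[OF b N(1)], of 4, simplified] modes_order_mono[OF modes_Q_mode[OF b N(2)], of 4, simplified]
  have "conv (\<lambda>n _. \<alpha> n) (Q_mode b N) n y - conv (\<lambda>n _. \<alpha> n) (Q_mode b N') n y
      = conv (\<lambda>n _. \<alpha> n) (\<lambda>n y. Q_mode b N n y - Q_mode b N' n y) n y"
    using conv_diff[OF modes_alpha[OF b N(1)] modes_alpha[OF b N(1)] Q y, of n] by (simp add: conv_def)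
  also have "\<dots> = conv (\<lambda>n _. \<alpha> n) (Q_mode (\<lambda>_. 0) (\<lambda>n y. N n y - N' n y)) n y"
    unfolding conv_def using Q_mode_diff[OF N y, of b b] by simp
  finally show ?thesis
    using omega_shift_diff[OF N, of b b] by (cases "n = 0") (simp_all add: Z_mode_def)
qed

lemma modes_cong:
  assumes "modes k c K f" "\<And>n y. y \<ge> 0 \<Longrightarrow> g n y = f n y"
  shows "modes k c K g"
  using assms continuous_on_cong[of "{0..}" "{0..}" "g _" "f _"] by (auto simp: modes_def decays_def)

definition C_fix :: real where "C_fix = C_Z + C_H"

text \<open>The ratio of the two weights. \<rho> depends linearly on the data and on
  \<open>N\<close>, with a constant at most \<open>C_fix\<close>; the ratio is so large that this
  contribution fits into half of it.\<close>

definition M_fix :: "real \<Rightarrow> real" where "M_fix b0 = 2 * C_fix * (b0 + 2)"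

text \<open>The two components of the fixed point are the modes of \<open>q / q\<^sub>e - 1\<close> and of \<open>(q / q\<^sub>e - 1) \<partial>\<^sub>\<psi>\<^sup>2 Q\<close>. The first
  carries the larger weight, as it is bounded by the second with a constant that is not small.\<close>

theorem fixed_point:
  assumes b0: "b0 \<ge> 0" and \<epsilon>: "\<epsilon> > 0" "64 * bracket_sum * (M_fix b0)\<^sup>2 * \<epsilon> \<le> 1"
    and b: "\<And>n. norm (b n) \<le> b0 * \<epsilon> / bracket n ^ 5" and b_cnj: "\<And>n. b (- n) = cnj (b n)"
  obtains r N where "modes 4 0 (M_fix b0 * \<epsilon>) r" "modes 4 rate \<epsilon> N"
    "\<And>n y. y \<ge> 0 \<Longrightarrow> r (- n) y = cnj (r n y)" "\<And>n y. y \<ge> 0 \<Longrightarrow> N (- n) y = cnj (N n y)"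
    "\<And>n y. y \<ge> 0 \<Longrightarrow> 2 * r n y + conv r r n y = Z_mode b N n y" "\<And>n y. y \<ge> 0 \<Longrightarrow> N n y = conv r (H_mode b N) n y"
proof -
  let ?M = "M_fix b0" and ?S = "32 * bracket_sum"
  \<comment> \<open>\<open>m\<close> is the size allowed for the modes of \<rho>, and
    \<open>h\<close> is the sum Kb + K of the sizes of the data and of \<open>N\<close>.\<close>
  define m h where "m = ?M * \<epsilon>" and "h = b0 * \<epsilon> + \<epsilon>"
  \<comment> \<open>The relation 2 r + conv r r = Z is solved for its linear term; the convolution
    is quadratically small.\<close>
  let ?F = "\<lambda>r N n y. 1 / 2 * (Z_mode b N n y - conv r r n y)" and ?T = "\<lambda>r N. conv r (H_mode b N)"
  \<comment> \<open>The Boolean index selects the component: \<open>False\<close> for the modes of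
    \<rho>, \<open>True\<close> for \<open>N\<close>.\<close>
  define \<Phi> where "\<Phi> u i = (case i of (p, n) \<Rightarrow> (if p then ?T else ?F) (\<lambda>n. u (False, n)) (\<lambda>n. u (True, n)) n)"
    for u :: "bool \<times> int \<Rightarrow> real \<Rightarrow> complex" and i
  define \<gamma> where "\<gamma> i = (if fst i then rate else 0)" for i :: "bool \<times> int"
  define w where "w i = (if fst i then \<epsilon> else m) / bracket (snd i) ^ 4" for i :: "bool \<times> int"
  define \<iota> where "\<iota> i = (fst i, - snd i)" for i :: "bool \<times> int"
  define adm where "adm u \<longleftrightarrow> (\<forall>i. decays (\<gamma> i) (w i) (u i)) \<and> (\<forall>i. \<forall>y\<ge>0. u (\<iota> i) y = cnj (u i y))" for u
  have C: "C_fix \<ge> 1" "C_Z \<le> C_fix" "C_H \<le> C_fix" using C_nonneg by (auto simp: C_fix_def)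
  have M: "?M \<ge> 1" "C_fix * (b0 + 1) \<le> ?M / 2" "C_fix * (b0 + 2) \<le> ?M / 2" "C_fix + 1 \<le> ?M"
  proof -
    have "C_fix * (b0 + 1) \<le> C_fix * (b0 + 2)" "C_fix * 2 \<le> C_fix * (b0 + 2)" using C b0 by (auto intro!: mult_left_mono)
    moreover have "?M = 2 * (C_fix * (b0 + 2))" by (simp add: M_fix_def)
    ultimately show "?M \<ge> 1" "C_fix * (b0 + 1) \<le> ?M / 2" "C_fix * (b0 + 2) \<le> ?M / 2" "C_fix + 1 \<le> ?M" using C(1) by linarith+
  qed
  have S: "?S * ?M\<^sup>2 * \<epsilon> \<le> 1 / 2" "?S \<ge> 0" using \<epsilon>(2) bracket_sum_nonneg by simp_all
  have adm_iff: "adm u \<longleftrightarrow> modes 4 0 m (\<lambda>n. u (False, n)) \<and> modes 4 rate \<epsilon> (\<lambda>n. u (True, n)) \<and>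
      (\<forall>n. \<forall>y\<ge>0. u (False, - n) y = cnj (u (False, n) y)) \<and> (\<forall>n. \<forall>y\<ge>0. u (True, - n) y = cnj (u (True, n) y))" for u
    unfolding adm_def modes_def by (auto simp: split_paired_All \<gamma>_def w_def \<iota>_def all_bool_eq)
  have maps: "adm (\<Phi> u)" if "adm u" for u
  proof -
    define r N where "r = (\<lambda>n. u (False, n))" and "N = (\<lambda>n. u (True, n))"
    have r: "modes 4 0 m r" "\<And>n y. y \<ge> 0 \<Longrightarrow> r (- n) y = cnj (r n y)"
      and N: "modes 4 rate \<epsilon> N" "\<And>n y. y \<ge> 0 \<Longrightarrow> N (- n) y = cnj (N n y)" using that unfolding adm_iff r_def N_def by blast+
    have "modes 4 (0 + 0) (?S * (m * m)) (conv r r)" by (rule modes_conv[OF r(1) r(1)]) auto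
    then have "modes 4 0 (norm (1 / 2 :: complex) * (C_Z * h + ?S * (m * m))) (?F r N)"
      using modes_Z_mode[OF b N(1)] unfolding h_def by (intro modes_scale modes_diff) auto
    then have F: "modes 4 0 m (?F r N)"
    proof (rule modes_mono)
      have "C_Z * (b0 + 1) \<le> C_fix * (b0 + 1)" using C b0 by (intro mult_right_mono) auto
      then have "C_Z * (b0 + 1) + ?S * ?M\<^sup>2 * \<epsilon> \<le> 2 * ?M" using M S by linarith
      then have "(C_Z * (b0 + 1) + ?S * ?M\<^sup>2 * \<epsilon>) * \<epsilon> \<le> 2 * ?M * \<epsilon>" using \<epsilon> by (intro mult_right_mono) auto
      then show "norm (1 / 2 :: complex) * (C_Z * h + ?S * (m * m)) \<le> m" by (simp add: m_def h_def algebra_simps power2_eq_square)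
    qed
    have "modes 4 (0 + rate) (?S * (m * (C_H * h))) (?T r N)" using rate_pos unfolding h_def by (intro modes_conv r(1) modes_H_mode[OF b N(1)]) auto
    then have T: "modes 4 rate \<epsilon> (?T r N)" unfolding add_0
    proof (rule modes_mono)
      have "C_H * (b0 + 1) \<le> C_fix * (b0 + 1)" using C b0 by (intro mult_right_mono) auto
      then have "C_H * (b0 + 1) \<le> ?M" using M by linarith
      then have "?S * ?M * \<epsilon> * (C_H * (b0 + 1)) \<le> ?S * ?M * \<epsilon> * ?M" using S M \<epsilon> by (intro mult_left_mono) auto
      also have "\<dots> \<le> 1" using S(1) by (simp add: power2_eq_square mult_ac)
      finally have "(?S * ?M * \<epsilon> * (C_H * (b0 + 1))) * \<epsilon> \<le> 1 * \<epsilon>" using \<epsilon> by (intro mult_right_mono) auto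
      then show "?S * (m * (C_H * h)) \<le> \<epsilon>" by (simp add: m_def h_def algebra_simps)
    qed
    show ?thesis unfolding adm_iff
    proof (intro conjI allI impI)
      show "modes 4 0 m (\<lambda>n. \<Phi> u (False, n))" "modes 4 rate \<epsilon> (\<lambda>n. \<Phi> u (True, n))" using F T by (simp_all add: \<Phi>_def r_def N_def)
      fix n and y :: real assume y: "y \<ge> 0"
      show "\<Phi> u (False, - n) y = cnj (\<Phi> u (False, n) y)" "\<Phi> u (True, - n) y = cnj (\<Phi> u (True, n) y)"
        using Z_mode_cnj[OF b N(1) b_cnj N(2) y, of n] conv_cnj[OF r(1) r(1), of y n] r(2)[OF y]
          conv_cnj[OF r(1) modes_H_mode[OF b N(1)], of y n] H_mode_cnj[OF b N(1) b_cnj N(2) y] by (simp_all add: \<Phi>_def r_def[symmetric] N_def[symmetric])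
    qed
  qed
  have contr: "decays (\<gamma> i) (c / 2 * w i) (\<lambda>y. \<Phi> u i y - \<Phi> v i y)"
    if "adm u" "adm v" and c: "0 \<le> c" and d: "\<And>i. decays (\<gamma> i) (c * w i) (\<lambda>y. u i y - v i y)" for u v c i
  proof -
    define r N r' N' where "r = (\<lambda>n. u (False, n))" and "N = (\<lambda>n. u (True, n))" and "r' = (\<lambda>n. v (False, n))" and "N' = (\<lambda>n. v (True, n))"
    have r: "modes 4 0 m r" "modes 4 0 m r'" and N: "modes 4 rate \<epsilon> N" "modes 4 rate \<epsilon> N'" using that(1,2) unfolding adm_iff r_def N_def r'_def N'_def by blast+
    have dr: "modes 4 0 (c * m) (\<lambda>n y. r n y - r' n y)" and dN: "modes 4 rate (c * \<epsilon>) (\<lambda>n y. N n y - N' n y)"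
      using d[of "(False, _)"] d[of "(True, _)"] by (auto simp: modes_def \<gamma>_def w_def r_def N_def r'_def N'_def)
    define d\<rho> d\<nu> where "d\<rho> = (\<lambda>n y. r n y - r' n y)" and "d\<nu> = (\<lambda>n y. N n y - N' n y)"
    note dr = dr[folded d\<rho>_def] and dN = dN[folded d\<nu>_def]
    have z: "norm (0 :: complex) \<le> 0 / bracket n ^ 5" for n by simp
    have H: "modes 4 rate (C_H * h) (H_mode b N)" "modes 4 rate (C_H * h) (H_mode b N')" unfolding h_def by (intro modes_H_mode[OF b] N)+
    have "modes 4 rate (C_H * (0 + c * \<epsilon>)) (H_mode (\<lambda>_. 0) d\<nu>)" by (rule modes_H_mode[OF z dN])
    then have dH: "modes 4 rate (C_H * (c * \<epsilon>)) (\<lambda>n y. H_mode b N n y - H_mode b N' n y)" (is "modes _ _ _ ?dH")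
      unfolding add_0 by (rule modes_cong) (use H_mode_diff[OF N, of _ b b] in \<open>simp add: d\<nu>_def\<close>)
    have T: "modes 4 rate (c / 2 * \<epsilon>) (\<lambda>n y. ?T r N n y - ?T r' N' n y)"
    proof (rule modes_cong)
      have "modes 4 (0 + rate) (?S * ((c * m) * (C_H * h)) + ?S * (m * (C_H * (c * \<epsilon>)))) (\<lambda>n y. conv d\<rho> (H_mode b N) n y + conv r' ?dH n y)"
        using rate_pos by (intro modes_add modes_conv dr r H dH) auto
      then show "modes 4 rate (c / 2 * \<epsilon>) (\<lambda>n y. conv d\<rho> (H_mode b N) n y + conv r' ?dH n y)" unfolding add_0
      proof (rule modes_mono)
        have "C_H * (b0 + 2) \<le> C_fix * (b0 + 2)" using C b0 by (intro mult_right_mono) auto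
        then have "C_H * (b0 + 2) \<le> ?M" using M by linarith
        then have "?S * ?M * \<epsilon> * (C_H * (b0 + 2)) \<le> ?S * ?M * \<epsilon> * ?M" using S M \<epsilon> by (intro mult_left_mono) auto
        also have "\<dots> \<le> 1 / 2" using S(1) by (simp add: power2_eq_square mult_ac)
        finally have "(?S * ?M * \<epsilon> * (C_H * (b0 + 2))) * (c * \<epsilon>) \<le> 1 / 2 * (c * \<epsilon>)" using \<epsilon> c by (intro mult_right_mono) auto
        then show "?S * ((c * m) * (C_H * h)) + ?S * (m * (C_H * (c * \<epsilon>))) \<le> c / 2 * \<epsilon>" by (simp add: m_def h_def algebra_simps)
      qed
    qed (simp add: conv_diff[OF r H] d\<rho>_def)
    have F: "modes 4 0 (c / 2 * m) (\<lambda>n y. ?F r N n y - ?F r' N' n y)"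
    proof (rule modes_cong)
      let ?D = "\<lambda>n y. 1 / 2 * (Z_mode (\<lambda>_. 0) d\<nu> n y - (conv d\<rho> r n y + conv r' d\<rho> n y))"
      have "modes 4 0 (C_Z * (0 + c * \<epsilon>)) (Z_mode (\<lambda>_. 0) d\<nu>)" by (rule modes_Z_mode[OF z dN])
      moreover have "modes 4 (0 + 0) (?S * ((c * m) * m)) (conv d\<rho> r)" "modes 4 (0 + 0) (?S * (m * (c * m))) (conv r' d\<rho>)" by (intro modes_conv dr r; simp)+
      ultimately have "modes 4 0 (norm (1 / 2 :: complex) * (C_Z * (0 + c * \<epsilon>) + (?S * ((c * m) * m) + ?S * (m * (c * m))))) ?D"
        unfolding add_0 by (intro modes_scale modes_diff modes_add)
      then show "modes 4 0 (c / 2 * m) ?D"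
      proof (rule modes_mono)
        \<comment> \<open>\<open>Z\<close> reacts to a change of \<open>N\<close> with a constant
          that is not small. Measured against the larger weight m = M \<epsilon>, a change of size c
          \<epsilon> counts only as c C_Z / M.\<close>
        have "C_Z + 2 * (?S * ?M\<^sup>2 * \<epsilon>) \<le> ?M" using C M S by linarith
        then have "(C_Z + 2 * (?S * ?M\<^sup>2 * \<epsilon>)) * (c * \<epsilon>) \<le> ?M * (c * \<epsilon>)" using \<epsilon> c by (intro mult_right_mono) auto
        then show "norm (1 / 2 :: complex) * (C_Z * (0 + c * \<epsilon>) + (?S * ((c * m) * m) + ?S * (m * (c * m)))) \<le> c / 2 * m"
          by (simp add: m_def algebra_simps power2_eq_square)
      qed
      fix n and y :: real assume "y \<ge> 0"
      then show "?F r N n y - ?F r' N' n y = ?D n y" using Z_mode_diff[OF N b, of y n] conv_diff[OF r r, of y n] by (simp add: d\<rho>_def d\<nu>_def field_simps)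
    qed
    obtain p n where "i = (p, n)" by (cases i)
    then show ?thesis using F T by (cases p) (simp_all add: modes_def \<gamma>_def w_def \<Phi>_def r_def N_def r'_def N'_def)
  qed
  have "\<exists>u. ((\<forall>i. decays (\<gamma> i) (w i) (u i)) \<and> (\<forall>i. \<forall>y\<ge>0. u (\<iota> i) y = cnj (u i y))) \<and> (\<forall>i. \<forall>y\<ge>0. \<Phi> u i y = u i y)"
  proof (rule weighted_contraction)
    show "\<gamma> i \<ge> 0" for i using rate_pos by (simp add: \<gamma>_def)
    show "w i \<ge> 0" for i using \<epsilon> M bracket_power_pos by (auto simp: w_def m_def less_imp_le)
    show "(\<forall>i. decays (\<gamma> i) (w i) (\<Phi> u i)) \<and> (\<forall>i. \<forall>y\<ge>0. \<Phi> u (\<iota> i) y = cnj (\<Phi> u i y))"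
      if "(\<forall>i. decays (\<gamma> i) (w i) (u i)) \<and> (\<forall>i. \<forall>y\<ge>0. u (\<iota> i) y = cnj (u i y))" for u using maps[unfolded adm_def, OF that] .
    show "decays (\<gamma> i) (c / 2 * w i) (\<lambda>y. \<Phi> u i y - \<Phi> v i y)"
      if "(\<forall>i. decays (\<gamma> i) (w i) (u i)) \<and> (\<forall>i. \<forall>y\<ge>0. u (\<iota> i) y = cnj (u i y))"
        "(\<forall>i. decays (\<gamma> i) (w i) (v i)) \<and> (\<forall>i. \<forall>y\<ge>0. v (\<iota> i) y = cnj (v i y))" "0 \<le> c"
        "\<And>i. decays (\<gamma> i) (c * w i) (\<lambda>y. u i y - v i y)" for u v c i by (rule contr[unfolded adm_def, OF that])
  qed
  then obtain u where u: "adm u" "\<And>i y. y \<ge> 0 \<Longrightarrow> \<Phi> u i y = u i y" unfolding adm_def by blast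
  show thesis
  proof (rule that[of "\<lambda>n. u (False, n)" "\<lambda>n. u (True, n)"])
    fix n and y :: real assume y: "y \<ge> 0"
    show "2 * u (False, n) y + conv (\<lambda>n. u (False, n)) (\<lambda>n. u (False, n)) n y = Z_mode b (\<lambda>n. u (True, n)) n y"
      using u(2)[OF y, of "(False, n)"] by (simp add: \<Phi>_def field_simps)
    show "u (True, n) y = conv (\<lambda>n. u (False, n)) (H_mode b (\<lambda>n. u (True, n))) n y" using u(2)[OF y, of "(True, n)"] by (simp add: \<Phi>_def)
  qed (use u(1) in \<open>simp_all add: adm_iff m_def\<close>)
qed

end

section \<open>Fourier series in the Euler angle\<close>

locale boundary_speed =
  fixes L :: real and q_e :: "real \<Rightarrow> real"
  assumes L: "L > 0" and qe_smooth: "smooth q_e" and qe_pos: "\<And>s. q_e s > 0" and qe_per: "\<And>s. q_e (s + L) = q_e s"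
begin

lemma qe_cont: "continuous_on A q_e"
  by (rule smooth_continuous[OF qe_smooth])

definition total :: real where "total = integral {0..L} q_e"

lemma total_pos: "total > 0"
proof -
  have "\<exists>x\<in>{0..L}. \<forall>y\<in>{0..L}. q_e x \<le> q_e y"
    by (rule continuous_attains_inf) (use L qe_cont in auto)
  then obtain x where x: "\<And>y. y \<in> {0..L} \<Longrightarrow> q_e x \<le> q_e y" by blast
  have "q_e x * L = integral {0..L} (\<lambda>_. q_e x)" using L by simp
  also have "\<dots> \<le> total" unfolding total_def by (intro integral_le x integrable_continuous_real qe_cont) auto
  finally show ?thesis using L qe_pos[of x] by (smt (verit) mult_pos_pos)
qed

definition phase :: "real \<Rightarrow> real" where
  "phase s = 2 * pi / total * (SOME F. \<forall>x. (F has_real_derivative q_e x) (at x)) s"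

lemma phase_deriv: "(phase has_real_derivative 2 * pi / total * q_e s) (at s)"
proof -
  have "\<exists>F. \<forall>x. (F has_real_derivative q_e x) (at x)" using smooth_antiderivative[OF qe_smooth] by metis
  from someI_ex[OF this] have "\<forall>x. ((SOME F. \<forall>x. (F has_real_derivative q_e x) (at x)) has_real_derivative q_e x) (at x)" .
  then show ?thesis unfolding phase_def by (intro DERIV_cmult) simp
qed

lemma phase_cont: "continuous_on A phase"
  using phase_deriv by (meson DERIV_isCont continuous_at_imp_continuous_on)

lemma phase_L: "phase L = phase 0 + 2 * pi"
proof -
  have "((\<lambda>s. 2 * pi / total * q_e s) has_integral phase L - phase 0) {0..L}"
    using L has_field_derivative_at_within[OF phase_deriv]
    by (intro fundamental_theorem_of_calculus) (simp_all only: has_real_derivative_iff_has_vector_derivative)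
  from integral_unique[OF this] have "2 * pi / total * total = phase L - phase 0"
    by (simp add: total_def)
  then show ?thesis using total_pos by simp
qed

lemma phase_per: "phase (s + L) = phase s + 2 * pi"
proof -
  define h where "h s = phase (1 * s + L) - phase s" for s
  have "(h has_real_derivative 0) (at s)" for s
  proof -
    have "((\<lambda>s. phase (1 * s + L)) has_real_derivative 2 * pi / total * q_e s) (at s)" using affine_deriv[OF phase_deriv[of "1 * s + L"]] by (simp add: qe_per)
    from DERIV_diff[OF this phase_deriv[of s]] show ?thesis unfolding h_def by simp
  qed
  then have "h s = h 0" using DERIV_isconst_all[of h s 0] by blast
  then show ?thesis using phase_L by (simp add: h_def)
qed

lemma phase_mono:
  assumes "s < t"
  shows "phase s < phase t"
  by (rule DERIV_pos_imp_increasing[OF assms])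
    (use phase_deriv total_pos qe_pos in \<open>meson divide_pos_pos mult_pos_pos pi_gt_zero zero_less_numeral\<close>)

section \<open>Exponentials in the angle and Fourier coefficients\<close>

definition l1 :: real where "l1 = 2 * pi / total"

lemma l1_pos: "l1 > 0"
  using total_pos by (simp add: l1_def)

definition expo :: "int \<Rightarrow> real \<Rightarrow> complex" where "expo n s = cis (real_of_int n * phase s)"

lemma expo_add: "expo (m + n) s = expo m s * expo n s"
  by (simp add: expo_def cis_mult ring_distribs)

lemma expo_0: "expo 0 s = 1"
  by (simp add: expo_def)

lemma norm_expo: "norm (expo n s) = 1"
  by (simp add: expo_def)

lemma expo_cnj: "cnj (expo n s) = expo (- n) s"
  by (simp add: expo_def cis_cnj)

lemma expo_per: "expo n (s + L) = expo n s"
proof -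
  have "expo n (s + L) = expo n s * cis (2 * pi * real_of_int n)"
    by (simp add: expo_def phase_per cis_mult ring_distribs mult_ac)
  then show ?thesis by simp
qed

lemma expo_cont: "continuous_on A (expo n)"
  unfolding expo_def by (intro continuous_intros phase_cont)

lemma expo_deriv: "(expo n has_vector_derivative \<i> * of_real (l1 * real_of_int n) * of_real (q_e s) * expo n s) (at s)"
proof -
  have "((\<lambda>s. real_of_int n * phase s) has_real_derivative real_of_int n * (l1 * q_e s)) (at s)"
    unfolding l1_def by (intro DERIV_cmult phase_deriv)
  then have "((\<lambda>s. real_of_int n * phase s) has_vector_derivative real_of_int n * (l1 * q_e s)) (at s)"
    by (simp only: has_real_derivative_iff_has_vector_derivative)
  from vector_diff_chain_at[OF this exp_deriv_within[of \<i>]]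
  have "((\<lambda>s. cis (real_of_int n * phase s)) has_vector_derivative (real_of_int n * (l1 * q_e s)) *\<^sub>R (\<i> * cis (real_of_int n * phase s))) (at s)"
    by (simp add: o_def cis_conv_exp)
  then show ?thesis unfolding expo_def by (simp add: scaleR_conv_of_real mult_ac)
qed

text \<open>The Fourier coefficient in the angle \<open>phase\<close>: q_e ds / total is the
  normalised angular measure.\<close>

definition coef :: "(real \<Rightarrow> real) \<Rightarrow> int \<Rightarrow> complex" where
  "coef F n = integral {0..L} (\<lambda>s. of_real (F s) * expo (- n) s * of_real (q_e s)) / of_real total"

lemma coef_cnj: "coef F (- n) = cnj (coef F n)"
  by (simp add: coef_def integral_cnj expo_cnj)

lemma coef_0: "coef F 0 = of_real (integral {0..L} (\<lambda>s. F s * q_e s) / total)" if "continuous_on {0..L} F"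
proof -
  have "((\<lambda>s. of_real (F s * q_e s) :: complex) has_integral of_real (integral {0..L} (\<lambda>s. F s * q_e s))) {0..L}"
    by (intro has_integral_of_real integrable_integral integrable_continuous_real continuous_intros that qe_cont)
  from integral_unique[OF this] show ?thesis by (simp add: coef_def expo_0)
qed

lemma coef_integrable: "continuous_on {0..L} F \<Longrightarrow> (\<lambda>s. of_real (F s) * expo n s * of_real (q_e s)) integrable_on {0..L}"
  by (intro integrable_continuous_real continuous_intros expo_cont qe_cont)

lemma coef_bounded:
  assumes "smooth F"
  shows "\<exists>C\<ge>0. \<forall>n. norm (coef F n) \<le> C"
proof -
  obtain C where C: "C \<ge> 0" "\<And>s. s \<in> {0..L} \<Longrightarrow> norm (F s) \<le> C"
    using continuous_on_interval_bounded[OF smooth_continuous[OF assms], of 0 L] by blast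
  have "norm (coef F n) \<le> C" for n
  proof -
    have "norm (integral {0..L} (\<lambda>s. of_real (F s) * expo (- n) s * of_real (q_e s))) \<le> integral {0..L} (\<lambda>s. C * q_e s)" by (rule integral_norm_bound_integral)
         (use C qe_pos in \<open>auto intro!: coef_integrable smooth_continuous[OF assms] integrable_continuous_real[of 0 L "\<lambda>s. C * q_e s"] continuous_on_mult[OF continuous_on_const qe_cont]
           mult_right_mono simp: norm_mult norm_expo abs_of_pos\<close>)
    also have "\<dots> = C * total" by (simp add: total_def)
    finally show ?thesis using total_pos by (simp add: coef_def norm_divide divide_le_eq)
  qed
  then show ?thesis using C by blast
qed

text \<open>The derivative with respect to the primitive of \<open>q_e\<close>, that is,
  \<open>l1\<close> times the derivative in the angle; it acts on \<open>coef\<close> as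
  multiplication by i l1 n.\<close>

definition along :: "(real \<Rightarrow> real) \<Rightarrow> real \<Rightarrow> real" where "along F s = deriv F s * inverse (q_e s)"

lemma smooth_along: "smooth F \<Longrightarrow> smooth (along F)"
  unfolding along_def using qe_pos by (intro smooth_mult smooth_deriv smooth_inverse qe_smooth) (auto simp: less_imp_neq[symmetric])

lemma along_per:
  assumes "smooth F" "\<And>s. F (s + L) = F s"
  shows "along F (s + L) = along F s"
proof -
  have "((\<lambda>s. F (1 * s + L)) has_real_derivative 1 * deriv F (1 * s + L)) (at s)"
    by (rule affine_deriv[OF smooth_has_deriv[OF assms(1)]])
  then have "(F has_real_derivative deriv F (s + L)) (at s)" using assms(2) by simp
  then have "deriv F (s + L) = deriv F s" using DERIV_unique smooth_has_deriv[OF assms(1)] by blast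
  then show ?thesis by (simp add: along_def qe_per)
qed

lemma coef_along:
  assumes "smooth F" "\<And>s. F (s + L) = F s"
  shows "coef (along F) n = \<i> * of_real (l1 * real_of_int n) * coef F n"
proof -
  let ?c = "\<i> * of_real (l1 * real_of_int n) :: complex"
  have "((\<lambda>s. of_real (deriv F s) * expo (- n) s + of_real (F s) * (\<i> * of_real (l1 * real_of_int (- n)) * of_real (q_e s) * expo (- n) s))
      has_integral (of_real (F L) * expo (- n) L - of_real (F 0) * expo (- n) 0)) {0..L}"
  proof (rule fundamental_theorem_of_calculus)
    fix s assume "s \<in> {0..L}"
    have "((\<lambda>s. of_real (F s) :: complex) has_vector_derivative of_real (deriv F s)) (at s)"
      using smooth_has_deriv[OF assms(1), of s] by (rule has_vector_derivative_of_real)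
    from has_vector_derivative_mult[OF this expo_deriv[of "- n" s]]
    show "((\<lambda>s. of_real (F s) * expo (- n) s) has_vector_derivative of_real (deriv F s) * expo (- n) s + of_real (F s) * (\<i> * of_real (l1 * real_of_int (- n)) * of_real (q_e s) * expo (- n) s)) (at s within {0..L})"
      by (simp add: add.commute has_vector_derivative_at_within)
  qed (use L in simp)
  moreover have "of_real (F L) * expo (- n) L - of_real (F 0) * expo (- n) 0 = 0"
    using assms(2)[of 0] expo_per[of "- n" 0] by simp
  ultimately have *: "((\<lambda>s. of_real (deriv F s) * expo (- n) s + of_real (F s) * (\<i> * of_real (l1 * real_of_int (- n)) * of_real (q_e s) * expo (- n) s)) has_integral 0) {0..L}"
    by simp
  have "integral {0..L} (\<lambda>s. of_real (along F s) * expo (- n) s * of_real (q_e s)) - ?c * integral {0..L} (\<lambda>s. of_real (F s) * expo (- n) s * of_real (q_e s))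
     = integral {0..L} (\<lambda>s. of_real (along F s) * expo (- n) s * of_real (q_e s) - ?c * (of_real (F s) * expo (- n) s * of_real (q_e s)))"
    by (subst integral_diff) (auto intro!: coef_integrable integrable_on_mult_right smooth_continuous assms smooth_along)
  also have "\<dots> = integral {0..L} (\<lambda>s. of_real (deriv F s) * expo (- n) s + of_real (F s) * (\<i> * of_real (l1 * real_of_int (- n)) * of_real (q_e s) * expo (- n) s))"
    using qe_pos by (intro integral_cong) (simp add: along_def less_imp_neq[symmetric])
  also have "\<dots> = 0" using * by (rule integral_unique)
  finally show ?thesis by (simp add: coef_def divide_simps)
qed

lemma coef_decay:
  assumes "smooth F" "\<And>s. F (s + L) = F s"
  shows "\<exists>C\<ge>0. \<forall>n. norm (coef F n) \<le> C / bracket n ^ k"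
  using assms
proof (induction k arbitrary: F)
  case 0
  then show ?case using coef_bounded by simp
next
  case (Suc k)
  obtain C where C: "C \<ge> 0" "\<And>n. norm (coef F n) \<le> C / bracket n ^ k" using Suc.IH[OF Suc.prems] by blast
  obtain C' where C': "C' \<ge> 0" "\<And>n. norm (coef (along F) n) \<le> C' / bracket n ^ k"
    using Suc.IH[OF smooth_along[OF Suc.prems(1)] along_per[OF Suc.prems]] by blast
  have "norm (coef F n) \<le> (C + C' / l1) / bracket n ^ Suc k" for n
  proof -
    have "l1 * (\<bar>real_of_int n\<bar> * norm (coef F n)) \<le> C' / bracket n ^ k"
      using C'(2)[of n] l1_pos unfolding coef_along[OF Suc.prems] by (simp add: norm_mult abs_mult)
    then have "\<bar>real_of_int n\<bar> * norm (coef F n) \<le> C' / l1 / bracket n ^ k" using l1_pos bracket_power_pos[of n k] by (simp add: field_simps)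
    then have "bracket n * norm (coef F n) \<le> (C + C' / l1) / bracket n ^ k" using C(2)[of n] by (simp add: bracket_def ring_distribs add_divide_distrib)
    then show ?thesis using bracket_pos[of n] by (simp add: field_simps)
  qed
  then show ?case using C(1) C'(1) l1_pos by (intro exI[of _ "C + C' / l1"]) simp
qed

lemma expo_integral: "integral {0..L} (\<lambda>s. expo n s * of_real (q_e s)) = (if n = 0 then of_real total else 0)"
proof (cases "n = 0")
  case True
  have "((\<lambda>s. of_real (q_e s) :: complex) has_integral of_real total) {0..L}"
    unfolding total_def by (intro has_integral_of_real integrable_integral integrable_continuous_real qe_cont)
  from integral_unique[OF this] True show ?thesis by (simp add: expo_0)
next
  case False
  let ?c = "\<i> * of_real (l1 * real_of_int n) :: complex"
  have "((\<lambda>s. ?c * of_real (q_e s) * expo n s) has_integral expo n L - expo n 0) {0..L}"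
    using L by (intro fundamental_theorem_of_calculus has_vector_derivative_at_within[OF expo_deriv]) simp
  then have "((\<lambda>s. ?c * (expo n s * of_real (q_e s))) has_integral 0) {0..L}" using expo_per[of n 0] by (simp add: mult_ac)
  from integral_unique[OF this] have "?c * integral {0..L} (\<lambda>s. expo n s * of_real (q_e s)) = 0" by simp
  then show ?thesis using False l1_pos by simp
qed

text \<open>The series converges uniformly to some \<open>G\<close>, term by term integration shows
  that F - G has no Fourier coefficients, and completeness gives F = G on one period.\<close>

theorem fourier_inversion:
  assumes "smooth F" "\<And>s. F (s + L) = F s"
  shows "of_real (F s) = (\<Sum>\<^sub>\<infinity>n. coef F n * expo n s)"
proof -
  obtain C where C: "C \<ge> 0" "\<And>n. norm (coef F n) \<le> C / bracket n ^ 2" using coef_decay[OF assms, of 2] by blast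
  define G where "G s = (\<Sum>\<^sub>\<infinity>n. coef F n * expo n s)" for s
  have ul: "uniform_limit UNIV (\<lambda>X s. \<Sum>n\<in>X. coef F n * expo n s) G (finite_subsets_at_top UNIV)"
    unfolding G_def by (rule Weierstrass_m_test_general[where M = "\<lambda>n. C * (1 / bracket n ^ 2)"])
       (use C summable_on_cmult_right[OF bracket_summable[of 2]] in \<open>simp_all add: norm_mult norm_expo\<close>)
  have Gc: "continuous_on UNIV G"
    by (rule uniform_limit_theorem[OF _ ul]) (auto intro!: always_eventually continuous_intros expo_cont)
  have orth: "integral {0..L} (\<lambda>s. (of_real (F s) - G s) * cis (real_of_int m * phase s) * of_real (q_e s)) = 0" for m :: int
  proof -
    have ul': "uniform_limit (cbox 0 L) (\<lambda>X s. (\<Sum>n\<in>X. coef F n * expo n s) * (expo m s * of_real (q_e s))) (\<lambda>s. G s * (expo m s * of_real (q_e s))) (finite_subsets_at_top UNIV)"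
    proof (rule uniform_lim_mult[OF _ uniform_limit_const])
      show "uniform_limit (cbox 0 L) (\<lambda>X s. \<Sum>n\<in>X. coef F n * expo n s) G (finite_subsets_at_top UNIV)" by (rule uniform_limit_on_subset[OF ul]) simp
      show "bounded (G ` cbox 0 L)" by (intro compact_imp_bounded compact_continuous_image continuous_on_subset[OF Gc]) auto
      show "bounded ((\<lambda>s. expo m s * of_real (q_e s)) ` cbox 0 L)"
        by (intro compact_imp_bounded compact_continuous_image continuous_intros expo_cont qe_cont) auto
    qed
    obtain I J where IJ: "\<And>X. ((\<lambda>s. (\<Sum>n\<in>X. coef F n * expo n s) * (expo m s * of_real (q_e s))) has_integral I X) (cbox 0 L)"
      "((\<lambda>s. G s * (expo m s * of_real (q_e s))) has_integral J) (cbox 0 L)" "(I \<longlongrightarrow> J) (finite_subsets_at_top UNIV)"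
      by (rule uniform_limit_integral_cbox[OF ul']) (auto intro!: continuous_intros expo_cont qe_cont)
    \<comment> \<open>Once the finite set \<open>X\<close> contains -m, orthogonality leaves this
      single term, so the integrals are eventually constant along the filter.\<close>
    have "I X = coef F (- m) * of_real total" if "finite X" "- m \<in> X" for X
    proof -
      have "I X = integral {0..L} (\<lambda>s. \<Sum>n\<in>X. coef F n * (expo (n + m) s * of_real (q_e s)))"
        using integral_unique[OF IJ(1)[of X]] by (simp add: sum_distrib_left sum_distrib_right expo_add mult_ac)
      also have "\<dots> = (\<Sum>n\<in>X. coef F n * integral {0..L} (\<lambda>s. expo (n + m) s * of_real (q_e s)))"
        using that by (subst integral_sum) (auto intro!: integrable_continuous_real continuous_intros expo_cont qe_cont)
      also have "\<dots> = (\<Sum>n\<in>X. if n = - m then coef F n * of_real total else 0)" unfolding expo_integral by (intro sum.cong) auto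
      finally show ?thesis using that by simp
    qed
    then have "\<forall>\<^sub>F X in finite_subsets_at_top UNIV. I X = coef F (- m) * of_real total"
      unfolding eventually_finite_subsets_at_top by (intro exI[of _ "{- m}"]) auto
    then have "(I \<longlongrightarrow> coef F (- m) * of_real total) (finite_subsets_at_top UNIV)" by (rule tendsto_eventually)
    with IJ(3) have J: "J = coef F (- m) * of_real total" using tendsto_unique finite_subsets_at_top_neq_bot by blast
    have "integral {0..L} (\<lambda>s. (of_real (F s) - G s) * cis (real_of_int m * phase s) * of_real (q_e s))
        = integral {0..L} (\<lambda>s. of_real (F s) * expo m s * of_real (q_e s) - G s * (expo m s * of_real (q_e s)))" by (simp add: expo_def algebra_simps)
    also have "\<dots> = integral {0..L} (\<lambda>s. of_real (F s) * expo m s * of_real (q_e s)) - J"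
      using IJ(2) by (subst integral_diff) (auto intro!: coef_integrable smooth_continuous assms simp: integrable_on_def integral_unique)
    also have "\<dots> = 0" using total_pos by (simp add: J coef_def)
    finally show ?thesis .
  qed
  have *: "of_real (F s) - G s = 0" if "s \<in> {0..L}" for s
  proof (rule circle_angle.cis_orthogonal_imp_zero[OF circle_angle.intro[OF L phase_cont phase_mono phase_L] _ qe_cont qe_pos orth that])
    show "continuous_on {0..L} (\<lambda>s. of_real (F s) - G s)" by (intro continuous_intros smooth_continuous assms continuous_on_subset[OF Gc]) auto
  qed
  have Gper: "G (s + L) = G s" for s by (simp add: G_def expo_per)
  obtain k where "s - of_int k * L \<in> {0<..L}" by (rule periodic_reduce[OF L])
  then have "of_real (F (s - of_int k * L)) = G (s - of_int k * L)" using *[of "s - of_int k * L"] by simp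
  then show ?thesis
    using periodic_int[of F L "s - of_int k * L" k] periodic_int[of G L "s - of_int k * L" k] assms(2) Gper unfolding G_def by simp
qed

end

section \<open>Existence\<close>

lemma polynomial_le_exp:
  assumes "c > 0"
  shows "\<exists>K\<ge>0. \<forall>y\<ge>0. (1 + y) ^ n \<le> K * exp (c * y :: real)"
proof (cases "n = 0")
  case False
  define d where "d = min 1 (c / n)"
  have d: "d > 0" using assms False by (simp add: d_def)
  have "(1 + y) ^ n \<le> (1 / d) ^ n * exp (c * y)" if "y \<ge> 0" for y
  proof -
    have "d * (1 + y) \<le> 1 + c / n * y"
    proof -
      have "d * y \<le> c / n * y" by (rule mult_right_mono) (use that in \<open>simp_all add: d_def\<close>)
      moreover have "d * 1 \<le> 1" by (simp add: d_def)
      ultimately show ?thesis by (simp add: ring_distribs)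
    qed
    also have "\<dots> \<le> exp (c / n * y)" by (rule exp_ge_add_one_self)
    finally have "(d * (1 + y)) ^ n \<le> exp (c / n * y) ^ n" using d that by (intro power_mono) auto
    also have "\<dots> = exp (c * y)" using False by (simp add: exp_of_nat_mult[symmetric])
    finally have "d ^ n * (1 + y) ^ n \<le> exp (c * y)" by (simp only: power_mult_distrib)
    then show ?thesis using d by (simp add: power_one_over pos_le_divide_eq mult.commute)
  qed
  then show ?thesis using d by (intro exI[of _ "(1 / d) ^ n"]) auto
qed (use assms in \<open>auto intro!: exI[of _ 1]\<close>)

text \<open>One constant \<open>J\<close> serves all \<open>g\<close> and \<open>A\<close>. The
  exponent 2 m + 2 exceeds that of the squared weight by two, which leaves the integrable factor (1
  + \<psi>)^(-2).\<close>

lemma weighted_square_decay: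
  fixes L \<delta> :: real
  assumes L: "L > 0" and \<delta>: "\<delta> > 0"
  shows "\<exists>J\<ge>0. \<forall>A g. A \<ge> 0 \<longrightarrow> (cyl_ext L g) \<in> borel_measurable lborel \<longrightarrow>
     (AE x in lborel. x \<in> cylinder L \<longrightarrow> \<bar>g x\<bar> \<le> A * exp (- (\<delta> * snd x))) \<longrightarrow>
     set_integrable lborel (cylinder L) (weighted_square m g) \<and> weighted_L2_sq L m g \<le> A\<^sup>2 * J"
proof -
  obtain K where K: "K \<ge> 0" "\<And>y. y \<ge> 0 \<Longrightarrow> (1 + y) ^ (2 * m + 2) \<le> K * exp (2 * \<delta> * y)"
    using polynomial_le_exp[of "2 * \<delta>" "2 * m + 2"] \<delta> by auto
  define D where "D = (\<lambda>(s, y). (indicator {0..L} s * 1 :: real) * (indicator {0..} y * (1 / (1 + y)\<^sup>2) :: real))"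
  have Di: "integrable lborel D"
  proof -
    have "integrable lborel (\<lambda>s. indicator {0..L} s * 1 :: real)" by (simp add: integrable_indicator_iff emeasure_lborel_Icc_eq)
    from integrable_pair_product[OF this integrable_inverse_square] show ?thesis by (simp add: D_def lborel_prod)
  qed
  have D0: "D x \<ge> 0" for x by (cases x) (simp add: D_def)
  define J where "J = K * integral\<^sup>L lborel D"
  have J: "J \<ge> 0" unfolding J_def using K D0 by (intro mult_nonneg_nonneg integral_nonneg_AE) auto
  have "set_integrable lborel (cylinder L) (weighted_square m g) \<and> weighted_L2_sq L m g \<le> A\<^sup>2 * J"
    if A: "A \<ge> 0" and g: "(cyl_ext L g) \<in> borel_measurable lborel"
      and b: "AE x in lborel. x \<in> cylinder L \<longrightarrow> \<bar>g x\<bar> \<le> A * exp (- (\<delta> * snd x))" for A g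
  proof -
    have "(\<lambda>x :: real \<times> real. (1 + snd x) ^ m) \<in> borel_measurable borel" by (intro borel_measurable_continuous_onI continuous_intros)
    then have "(\<lambda>x :: real \<times> real. (1 + snd x) ^ m) \<in> borel_measurable lborel" by simp
    from borel_measurable_power[OF borel_measurable_times[OF this g]]
    have "(\<lambda>x. ((1 + snd x) ^ m * (cyl_ext L g x))\<^sup>2) \<in> borel_measurable lborel" .
    moreover have "(\<lambda>x. ((1 + snd x) ^ m * (cyl_ext L g x))\<^sup>2) = (\<lambda>x. indicator (cylinder L) x *\<^sub>R weighted_square m g x)"
      by (auto simp: fun_eq_iff weighted_square_def indicator_def)
    ultimately have meas: "(\<lambda>x. indicator (cylinder L) x *\<^sub>R weighted_square m g x) \<in> borel_measurable lborel" by simp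
    have le: "AE x in lborel. indicator (cylinder L) x *\<^sub>R weighted_square m g x \<le> A\<^sup>2 * K * D x" using b
    proof eventually_elim
      case (elim x)
      obtain s y where x: "x = (s, y)" by (cases x)
      show ?case
      proof (cases "x \<in> cylinder L")
        case True
        then have y: "0 \<le> y" "0 \<le> s" "s \<le> L" by (auto simp: x cylinder_def)
        have "\<bar>g x\<bar> \<le> A * exp (- (\<delta> * y))" using elim True by (simp add: x)
        then have "(g x)\<^sup>2 \<le> (A * exp (- (\<delta> * y)))\<^sup>2" using A by (simp add: abs_le_square_iff[symmetric] abs_mult)
        also have "\<dots> = A\<^sup>2 * exp (- (2 * \<delta> * y))" by (simp add: power_mult_distrib exp_double[symmetric] mult.assoc)
        finally have gx: "(g x)\<^sup>2 \<le> A\<^sup>2 * exp (- (2 * \<delta> * y))" .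
        have "weighted_square m g x = (1 + y) ^ (2 * m) * (g x)\<^sup>2" by (simp add: weighted_square_def x power_mult_distrib power_mult[symmetric] mult.commute)
        also have "\<dots> \<le> (1 + y) ^ (2 * m) * (A\<^sup>2 * exp (- (2 * \<delta> * y)))" using gx y by (intro mult_left_mono) auto
        also have "\<dots> = (1 + y) ^ (2 * m + 2) * (A\<^sup>2 * exp (- (2 * \<delta> * y)) / (1 + y)\<^sup>2)"
        proof -
          have "p ^ (2 * m) * z = p ^ (2 * m + 2) * (z / p\<^sup>2)" if "p > 0" for p z :: real unfolding power_add using that by simp
          then show ?thesis using y by simp
        qed
        also have "\<dots> \<le> K * exp (2 * \<delta> * y) * (A\<^sup>2 * exp (- (2 * \<delta> * y)) / (1 + y)\<^sup>2)" using K(2)[OF y(1)] by (intro mult_right_mono) auto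
        also have "\<dots> = A\<^sup>2 * K * (1 / (1 + y)\<^sup>2)" by (simp add: exp_minus)
        finally show ?thesis using True y by (simp add: D_def x)
      next
        case False
        then show ?thesis using D0[of x] K by simp
      qed
    qed
    have pos: "indicator (cylinder L) x *\<^sub>R weighted_square m g x \<ge> 0" for x by (cases x) (simp add: weighted_square_def)
    have int: "integrable lborel (\<lambda>x. indicator (cylinder L) x *\<^sub>R weighted_square m g x)"
    proof (rule Bochner_Integration.integrable_bound[OF _ meas])
      show "integrable lborel (\<lambda>x. A\<^sup>2 * K * D x)" using Di by simp
      show "AE x in lborel. norm (indicator (cylinder L) x *\<^sub>R weighted_square m g x) \<le> norm (A\<^sup>2 * K * D x)" using le pos K D0 by (auto simp: abs_of_nonneg)
    qed
    have "weighted_L2_sq L m g \<le> integral\<^sup>L lborel (\<lambda>x. A\<^sup>2 * K * D x)" unfolding weighted_L2_sq_def set_lebesgue_integral_def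
      by (rule integral_mono_AE[OF int _ le]) (use Di in simp)
    then show ?thesis using int by (simp add: set_integrable_def J_def mult.assoc)
  qed
  then show ?thesis using J by blast
qed

lemma has_weak_partial_cong:
  assumes "has_weak_partial L a b h g" "\<And>x. x \<in> cylinder L \<Longrightarrow> h x = h' x"
  shows "has_weak_partial L a b h' g"
proof -
  have "set_integrable lborel ({0..<L} \<times> {c..d}) h' = set_integrable lborel ({0..<L} \<times> {c..d}) h" if "0 < c" for c d
    unfolding set_integrable_def by (rule arg_cong[where f = "integrable lborel"]) (use assms(2) that in \<open>auto simp: fun_eq_iff indicator_def cylinder_def\<close>)
  moreover have "set_lebesgue_integral lborel (cylinder L) (\<lambda>x. h' x * k x) = set_lebesgue_integral lborel (cylinder L) (\<lambda>x. h x * k x)" for k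
    using assms(2) by (intro set_lebesgue_integral_cong) auto
  ultimately show ?thesis using assms(1) unfolding has_weak_partial_def locally_integrable_def by simp
qed

lemma weak_partial_AE_eq:
  assumes "L > 0" "has_weak_partial L a b h g"
  shows "has_weak_partial L a b h (weak_partial L a b h)" "AE x in lborel. x \<in> cylinder L \<longrightarrow> weak_partial L a b h x = g x"
proof -
  show "has_weak_partial L a b h (weak_partial L a b h)"
    unfolding weak_partial_def using someI[of "has_weak_partial L a b h", OF assms(2)] by simp
  from weak_partial_unique[OF assms(1) this assms(2)]
  show "AE x in lborel. x \<in> cylinder L \<longrightarrow> weak_partial L a b h x = g x" .
qed

section \<open>Series and their derivatives in \<open>s\<close>\<close>

context boundary_speed
begin

text \<open>The first three derivatives of \<open>expo n\<close>, divided by \<open>expo n\<close>.\<close>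

definition symbol :: "nat \<Rightarrow> int \<Rightarrow> real \<Rightarrow> complex" where
  "symbol j n s = (let c = \<i> * of_real (l1 * real_of_int n); q = of_real (q_e s); q1 = of_real (deriv q_e s); q2 = of_real (deriv (deriv q_e) s)
     in if j = 0 then 1 else if j = 1 then c * q else if j = 2 then c * q1 + (c * q)\<^sup>2 else c * q2 + 3 * c\<^sup>2 * q * q1 + (c * q) ^ 3)"

definition dexpo :: "nat \<Rightarrow> int \<Rightarrow> real \<Rightarrow> complex" where "dexpo j n s = symbol j n s * expo n s"

lemma dexpo_0: "dexpo 0 n s = expo n s"
  and dexpo_1: "dexpo (Suc 0) n s = \<i> * of_real (l1 * real_of_int n) * of_real (q_e s) * expo n s"
  by (simp_all add: dexpo_def symbol_def Let_def)

lemma dexpo_deriv: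
  assumes "j < 3"
  shows "(dexpo j n has_vector_derivative dexpo (Suc j) n s) (at s)"
proof -
  let ?c = "\<i> * of_real (l1 * real_of_int n) :: complex"
  have q: "((\<lambda>s. of_real (q_e s) :: complex) has_vector_derivative of_real (deriv q_e s)) (at s)"
    "((\<lambda>s. of_real (deriv q_e s) :: complex) has_vector_derivative of_real (deriv (deriv q_e) s)) (at s)"
    by (intro has_vector_derivative_of_real smooth_has_deriv smooth_deriv qe_smooth)+
  have prod: "(dexpo j n has_vector_derivative dexpo (Suc j) n s) (at s)"
    if "(symbol j n has_vector_derivative d) (at s)" "d + ?c * of_real (q_e s) * symbol j n s = symbol (Suc j) n s" for d
  proof -
    have "(dexpo j n has_vector_derivative symbol j n s * (?c * of_real (q_e s) * expo n s) + d * expo n s) (at s)"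
      unfolding dexpo_def by (rule has_vector_derivative_mult[OF that(1) expo_deriv])
    moreover have "symbol j n s * (?c * of_real (q_e s) * expo n s) + d * expo n s = dexpo (Suc j) n s"
      unfolding dexpo_def that(2)[symmetric] by (simp only: ring_distribs ac_simps)
    ultimately show ?thesis by simp
  qed
  consider "j = 0" | "j = 1" | "j = 2" using assms by linarith
  then show ?thesis
  proof cases
    case 1
    show ?thesis by (rule prod[of 0]) (simp_all add: 1 symbol_def[abs_def] Let_def)
  next
    case 2
    have "((\<lambda>s. ?c * of_real (q_e s)) has_vector_derivative ?c * of_real (deriv q_e s)) (at s)" by (intro has_vector_derivative_mult_right q)
    then show ?thesis by (intro prod[of "?c * of_real (deriv q_e s)"]) (simp_all add: 2 symbol_def[abs_def] Let_def power2_eq_square)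
  next
    case 3
    have "((\<lambda>s. ?c * of_real (deriv q_e s) + (?c * of_real (q_e s)) * (?c * of_real (q_e s))) has_vector_derivative
        ?c * of_real (deriv (deriv q_e) s) + ((?c * of_real (q_e s)) * (?c * of_real (deriv q_e s)) + (?c * of_real (deriv q_e s)) * (?c * of_real (q_e s)))) (at s)"
      by (intro has_vector_derivative_add has_vector_derivative_mult has_vector_derivative_mult_right q)
    then show ?thesis by (intro prod) (auto simp: 3 symbol_def[abs_def] Let_def power2_eq_square power3_eq_cube algebra_simps eval_nat_numeral)
  qed
qed

lemma deriv_per:
  assumes "smooth F" "\<And>s. F (s + L) = F s"
  shows "deriv F (s + L) = deriv F s"
  using along_per[OF assms, of s] qe_pos[of s] by (simp add: along_def qe_per)

lemma dexpo_per: "dexpo j n (s + L) = dexpo j n s"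
  using deriv_per[OF qe_smooth qe_per] deriv_per[OF smooth_deriv[OF qe_smooth] deriv_per[OF qe_smooth qe_per]]
  by (simp add: dexpo_def symbol_def expo_per qe_per)

lemma dexpo_cont: "continuous_on A (dexpo j n)"
  unfolding dexpo_def symbol_def Let_def
  by (cases "j = 0"; cases "j = 1"; cases "j = 2") (auto intro!: continuous_intros expo_cont smooth_continuous smooth_deriv qe_smooth)

lemma dexpo_bound: "\<exists>C\<ge>1. \<forall>j\<le>3. \<forall>n. \<forall>s\<in>{0..L}. norm (dexpo j n s) \<le> C * bracket n ^ j"
proof -
  obtain M0 where M0: "M0 \<ge> 0" "\<And>s. s \<in> {0..L} \<Longrightarrow> norm (q_e s) \<le> M0"
    using continuous_on_interval_bounded[OF qe_cont] by blast
  obtain M1 where M1: "M1 \<ge> 0" "\<And>s. s \<in> {0..L} \<Longrightarrow> norm (deriv q_e s) \<le> M1"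
    using continuous_on_interval_bounded[OF smooth_continuous[OF smooth_deriv[OF qe_smooth]]] by blast
  obtain M2 where M2: "M2 \<ge> 0" "\<And>s. s \<in> {0..L} \<Longrightarrow> norm (deriv (deriv q_e) s) \<le> M2"
    using continuous_on_interval_bounded[OF smooth_continuous[OF smooth_deriv[OF smooth_deriv[OF qe_smooth]]]] by blast
  define M where "M = 1 + M0 + M1 + M2"
  define D where "D = (1 + l1) * M"
  have M: "M \<ge> 1" "M0 \<le> M" "M1 \<le> M" "M2 \<le> M" using M0 M1 M2 by (auto simp: M_def)
  have D: "D \<ge> 1" using M l1_pos mult_mono[of 1 "1 + l1" 1 M] by (simp add: D_def)
  \<comment> \<open>The 5 is the sum 1 + 3 + 1 of the coefficients in the third symbol; D^3 covers
    the bounds on \<open>l1\<close> and on \<open>q_e\<close> with its derivatives for all j \<le>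
    3.\<close>
  have "norm (dexpo j n s) \<le> 5 * D ^ 3 * bracket n ^ j" if j: "j \<le> 3" and s: "s \<in> {0..L}" for j n s
  proof -
    define c q q1 q2 where "c = \<i> * complex_of_real (l1 * real_of_int n)" and "q = complex_of_real (q_e s)"
      and "q1 = complex_of_real (deriv q_e s)" and "q2 = complex_of_real (deriv (deriv q_e) s)"
    define x where "x = D * bracket n"
    have nq: "norm q \<le> M" "norm q1 \<le> M" "norm q2 \<le> M" using M0(2)[OF s] M1(2)[OF s] M2(2)[OF s] M by (auto simp: q_def q1_def q2_def)
    have x1: "x \<ge> 1" using D bracket_ge_1[of n] mult_mono[of 1 D 1 "bracket n"] by (simp add: x_def)
    have cM: "norm c * M \<le> x"
    proof -
      have "norm c = l1 * \<bar>real_of_int n\<bar>" using l1_pos by (simp add: c_def norm_mult abs_mult)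
      also have "\<dots> \<le> (1 + l1) * bracket n" using l1_pos by (intro mult_mono) (auto simp: bracket_def)
      finally have "norm c * M \<le> (1 + l1) * bracket n * M" using M by (intro mult_right_mono) auto
      then show ?thesis by (simp add: x_def D_def mult_ac)
    qed
    have cq: "norm (c * q) \<le> x" "norm (c * q1) \<le> x" "norm (c * q2) \<le> x" using nq cM by (auto simp: norm_mult intro: order_trans[OF mult_left_mono])
    have pw: "x ^ i \<le> D ^ 3 * bracket n ^ i" if "i \<le> 3" for i
      unfolding x_def power_mult_distrib using D that bracket_pos[of n] by (intro mult_right_mono power_increasing) auto
    have sym: "norm (symbol j n s) \<le> 5 * x ^ j"
    proof -
      consider "j = 0" | "j = 1" | "j = 2" | "j = 3" using j by linarith
      then show ?thesis
      proof cases
        case 3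
        have "norm (c * q1 + (c * q)\<^sup>2) \<le> x + x\<^sup>2" using cq by (intro norm_triangle_mono) (auto simp: norm_power intro!: power_mono)
        also have "\<dots> \<le> 5 * x\<^sup>2" using x1 power_increasing[of 1 2 x] by simp
        finally show ?thesis using 3 by (simp add: symbol_def Let_def c_def q_def q1_def)
      next
        case 4
        have "norm (3 * c\<^sup>2 * q * q1) \<le> 3 * x\<^sup>2"
        proof -
          have "norm ((c * q) * (c * q1)) \<le> x * x" unfolding norm_mult[of "c * q"] using cq x1 by (intro mult_mono) auto
          then show ?thesis by (simp add: norm_mult power2_eq_square mult_ac)
        qed
        moreover have "norm ((c * q) ^ 3) \<le> x ^ 3" using cq by (auto simp: norm_power intro!: power_mono)
        ultimately have "norm (c * q2 + 3 * c\<^sup>2 * q * q1 + (c * q) ^ 3) \<le> x + 3 * x\<^sup>2 + x ^ 3" using cq by (intro norm_triangle_mono) auto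
        also have "\<dots> \<le> 5 * x ^ 3" using x1 power_increasing[of 1 3 x] power_increasing[of 2 3 x] by simp
        finally show ?thesis using 4 by (simp add: symbol_def Let_def c_def q_def q1_def q2_def)
      qed (use cq x1 in \<open>auto simp: symbol_def Let_def c_def q_def\<close>)
    qed
    then have "norm (dexpo j n s) \<le> 5 * x ^ j" by (simp add: dexpo_def norm_mult norm_expo)
    also have "\<dots> \<le> 5 * (D ^ 3 * bracket n ^ j)" using pw[OF j] by simp
    finally show ?thesis by simp
  qed
  moreover have "5 * D ^ 3 \<ge> 1" using one_le_power[OF D, of 3] by simp
  ultimately show ?thesis by blast
qed

text \<open>The series of \<open>u\<close> against \<open>expo\<close>, differentiated
  \<open>a\<close> times in \<open>s\<close> term by term. Taking the real part produces a real
  function even before the modes are known to come in conjugate pairs.\<close>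

definition series :: "nat \<Rightarrow> (int \<Rightarrow> real \<Rightarrow> complex) \<Rightarrow> real \<times> real \<Rightarrow> real" where
  "series a u x = Re (\<Sum>\<^sub>\<infinity>n. u n (snd x) * dexpo a n (fst x))"

definition part :: "int set \<Rightarrow> nat \<Rightarrow> (int \<Rightarrow> real \<Rightarrow> complex) \<Rightarrow> real \<times> real \<Rightarrow> real" where
  "part X a u x = Re (\<Sum>n\<in>X. u n (snd x) * dexpo a n (fst x))"

definition sq_sum :: real where "sq_sum = (\<Sum>\<^sub>\<infinity>n. 1 / bracket n ^ 2)"

lemma sq_sum_nonneg: "sq_sum \<ge> 0"
  unfolding sq_sum_def using bracket_power_pos by (intro infsum_nonneg) (simp add: less_imp_le)

context
  fixes k a :: nat and \<gamma> K C :: real and u :: "int \<Rightarrow> real \<Rightarrow> complex" and S :: "real set"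
  assumes u: "modes k \<gamma> K u" and k: "a + 2 \<le> k" and \<gamma>: "\<gamma> \<ge> 0" and C: "\<And>n s. s \<in> S \<Longrightarrow> norm (dexpo a n s) \<le> C * bracket n ^ a" "C \<ge> 0"
begin

text \<open>Of the \<open>k\<close> orders of decay, \<open>a\<close> pay for the s-derivatives of
  \<open>expo n\<close> and two for summability in \<open>n\<close>.\<close>

lemma series_term_bound:
  assumes "s \<in> S" "y \<ge> 0"
  shows "norm (u n y * dexpo a n s) \<le> C * K * exp (- (\<gamma> * y)) * (1 / bracket n ^ 2)"
proof -
  have W: "bracket n > 0" by (rule bracket_pos)
  have "norm (u n y * dexpo a n s) \<le> (K * exp (- (\<gamma> * y)) * (1 / bracket n ^ (a + 2))) * (C * bracket n ^ a)"
    unfolding norm_mult using W modes_K[OF u] by (intro mult_mono modes_bound[OF modes_order_mono[OF u k] assms(2)] C(1) assms(1)) auto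
  also have "\<dots> = C * K * exp (- (\<gamma> * y)) * (1 / bracket n ^ 2)" using W by (simp add: power_add power2_eq_square mult_ac)
  finally show ?thesis .
qed

lemma series_summable:
  assumes "s \<in> S" "y \<ge> 0"
  shows "(\<lambda>n. norm (u n y * dexpo a n s)) summable_on UNIV"
  by (rule Infinite_Sum.abs_summable_on_comparison_test'[OF summable_on_cmult_right[OF bracket_summable[of 2]] series_term_bound[OF assms]]) simp

lemma series_bound:
  assumes "s \<in> S" "y \<ge> 0"
  shows "\<bar>series a u (s, y)\<bar> \<le> C * K * sq_sum * exp (- (\<gamma> * y))"
proof -
  have "\<bar>series a u (s, y)\<bar> \<le> norm (\<Sum>\<^sub>\<infinity>n. u n y * dexpo a n s)" unfolding series_def by (simp add: abs_Re_le_cmod)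
  also have "\<dots> \<le> (\<Sum>\<^sub>\<infinity>n. norm (u n y * dexpo a n s))" by (rule norm_infsum_bound[OF series_summable[OF assms]])
  also have "\<dots> \<le> (\<Sum>\<^sub>\<infinity>n. C * K * exp (- (\<gamma> * y)) * (1 / bracket n ^ 2))"
    by (intro infsum_mono series_summable assms series_term_bound summable_on_cmult_right bracket_summable) auto
  also have "\<dots> = C * K * sq_sum * exp (- (\<gamma> * y))" unfolding infsum_cmult_right' sq_sum_def by simp
  finally show ?thesis .
qed

lemma series_uniform:
  "uniform_limit (S \<times> {0..}) (\<lambda>X. part X a u) (series a u) (finite_subsets_at_top UNIV)"
proof -
  have "uniform_limit (S \<times> {0..}) (\<lambda>X x. \<Sum>n\<in>X. u n (snd x) * dexpo a n (fst x)) (\<lambda>x. \<Sum>\<^sub>\<infinity>n. u n (snd x) * dexpo a n (fst x)) (finite_subsets_at_top UNIV)"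
  proof (rule Weierstrass_m_test_general[where M = "\<lambda>n. C * K * (1 / bracket n ^ 2)"])
    show "(\<lambda>n. C * K * (1 / bracket n ^ 2)) summable_on UNIV" by (intro summable_on_cmult_right bracket_summable) simp
    fix n and x :: "real \<times> real" assume x: "x \<in> S \<times> {0..}"
    have "norm (u n (snd x) * dexpo a n (fst x)) \<le> C * K * exp (- (\<gamma> * snd x)) * (1 / bracket n ^ 2)" using x by (intro series_term_bound) auto
    also have "\<dots> \<le> C * K * 1 * (1 / bracket n ^ 2)" using x \<gamma> C(2) modes_K[OF u] bracket_power_pos[of n 2] by (intro mult_right_mono mult_left_mono) auto
    finally show "norm (u n (snd x) * dexpo a n (fst x)) \<le> C * K * (1 / bracket n ^ 2)" by simp
  qed
  from bounded_linear.uniform_limit[OF bounded_linear_Re this] show ?thesis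
    by (simp add: part_def[abs_def] series_def[abs_def])
qed

lemma partial_series_cont:
  "continuous_on (S \<times> {0..}) (part X a u)"
  unfolding part_def[abs_def]
  by (intro continuous_on_Re continuous_on_sum continuous_on_mult continuous_on_fst continuous_on_snd continuous_on_id
      continuous_on_compose2[OF dexpo_cont[of UNIV]] continuous_on_compose2[OF u[unfolded modes_def, rule_format, THEN decays_cont]]) auto

lemma series_cont: "continuous_on (S \<times> {0..}) (series a u)"
  by (rule uniform_limit_theorem[OF _ series_uniform]) (intro always_eventually allI partial_series_cont, simp)

end

text \<open>Finite partial sums are classical, so integration by parts applies to them, and the weak
  identity passes to the uniform limit. Convergence is used for the function and for the derivative
  in question; the derivatives between them occur in finite sums only.\<close>

theorem series_weak_partial:
  assumes ab: "a \<le> 3" "b \<le> 2" and \<gamma>: "\<gamma> \<ge> 0" and u0: "modes k0 \<gamma> K0 (u 0)" "2 \<le> k0" and ub: "modes kb \<gamma> Kb (u b)" "a + 2 \<le> kb"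
    and du: "\<And>i n y. i < b \<Longrightarrow> y \<ge> 0 \<Longrightarrow> (u i n has_vector_derivative u (Suc i) n y) (at y within {0..})"
  shows "has_weak_partial L a b (series 0 (u 0)) (series a (u b))"
proof -
  obtain C where C: "C \<ge> 1" "\<And>j n s. j \<le> 3 \<Longrightarrow> s \<in> {0..L} \<Longrightarrow> norm (dexpo j n s) \<le> C * bracket n ^ j" using dexpo_bound by blast
  have sub: "{0..L} \<times> {0<..} \<subseteq> {0..L} \<times> {0 :: real..}" "cylinder L \<subseteq> {0..L} \<times> {0..}" by (auto simp: cylinder_def)
  have u_cont: "continuous_on {0..} (u i n)" if "i \<le> b" for i n
  proof (cases "i = b")
    case True
    then show ?thesis using ub(1) by (simp add: modes_def decays_def)
  next
    case False
    then show ?thesis using that unfolding continuous_on_eq_continuous_within by (intro ballI has_vector_derivative_continuous[OF du]) auto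
  qed
  have cont: "cyl_cont L (part X j (u i))" if "i \<le> b" for X i j
    unfolding part_def[abs_def] by (intro continuous_on_Re continuous_on_sum continuous_on_mult continuous_on_fst continuous_on_snd continuous_on_id
        continuous_on_compose2[OF dexpo_cont[of UNIV]] continuous_on_compose2[OF u_cont[OF that]]) auto
  have d0: "\<And>n s. s \<in> {0..L} \<Longrightarrow> norm (dexpo 0 n s) \<le> C * bracket n ^ 0" and da: "\<And>n s. s \<in> {0..L} \<Longrightarrow> norm (dexpo a n s) \<le> C * bracket n ^ a"
    using C(2)[of 0] C(2)[of a] ab by simp_all
  have C0: "C \<ge> 0" using C by simp
  have k0: "0 + 2 \<le> k0" using u0 by simp
  note s0 = u0(1) k0 \<gamma> d0 C0 and sa = ub(1,2) \<gamma> da C0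
  show ?thesis
  proof (rule weak_partial_uniform_limit[OF L finite_subsets_at_top_neq_bot[of "UNIV :: int set"],
        where hF = "\<lambda>X. part X 0 (u 0)" and gF = "\<lambda>X. part X a (u b)"])
    show "cyl_cont L (series 0 (u 0))" by (rule continuous_on_subset[OF series_cont[OF s0] sub(1)])
    show "cyl_cont L (series a (u b))" by (rule continuous_on_subset[OF series_cont[OF sa] sub(1)])
    show "uniform_limit (cylinder L) (\<lambda>X. part X 0 (u 0)) (series 0 (u 0)) (finite_subsets_at_top UNIV)"
      by (rule uniform_limit_on_subset[OF series_uniform[OF s0] sub(2)])
    show "uniform_limit (cylinder L) (\<lambda>X. part X a (u b)) (series a (u b)) (finite_subsets_at_top UNIV)"
      by (rule uniform_limit_on_subset[OF series_uniform[OF sa] sub(2)])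
    fix X
    show "cyl_cont L (part X 0 (u 0))"
      "cyl_cont L (part X a (u b))" by (intro cont; simp)+
    show "has_weak_partial L a b (part X 0 (u 0)) (part X a (u b))"
    proof (rule classical_imp_weak_partial[OF L, where h = "\<lambda>i. part X i (u 0)" and k = "\<lambda>i. part X a (u i)"])
      fix i assume i: "i < a"
      show "part X i (u 0) (0, y) = part X i (u 0) (L, y)" for y using dexpo_per[of i _ 0] by (simp add: part_def)
      fix s y :: real assume "s \<in> {0..L}" "y > 0"
      have "((\<lambda>t. \<Sum>n\<in>X. u 0 n y * dexpo i n t) has_vector_derivative (\<Sum>n\<in>X. u 0 n y * dexpo (Suc i) n s)) (at s within {0..L})"
        using i ab by (intro has_vector_derivative_sum has_vector_derivative_mult_right has_vector_derivative_at_within[OF dexpo_deriv]) simp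
      then show "((\<lambda>t. part X i (u 0) (t, y)) has_real_derivative part X (Suc i) (u 0) (s, y)) (at s within {0..L})"
        unfolding part_def fst_conv snd_conv has_real_derivative_iff_has_vector_derivative by (rule bounded_linear.has_vector_derivative[OF bounded_linear_Re])
    next
      fix i and s y :: real assume i: "i < b" and "y > 0"
      then have "at y within {0..} = at y" by (intro at_within_interior) simp
      then have "(u i n has_vector_derivative u (Suc i) n y) (at y)" for n using du[OF i, of y n] \<open>y > 0\<close> by simp
      then have "((\<lambda>t. \<Sum>n\<in>X. u i n t * dexpo a n s) has_vector_derivative (\<Sum>n\<in>X. u (Suc i) n y * dexpo a n s)) (at y)"
        by (intro has_vector_derivative_sum has_vector_derivative_mult_left)
      then show "((\<lambda>t. part X a (u i) (s, t)) has_real_derivative part X a (u (Suc i)) (s, y)) (at y)"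
        unfolding part_def fst_conv snd_conv has_real_derivative_iff_has_vector_derivative by (rule bounded_linear.has_vector_derivative[OF bounded_linear_Re])
    qed (intro cont refl; simp)+
  qed
qed

end

text \<open>The passage from pointwise exponential bounds on weak derivatives to the norm.
  \<open>J\<close> is independent of \<open>h\<close> and of the size \<open>A\<close>, so a bound
  of size \<epsilon> yields a norm of size \<epsilon>.\<close>

definition X_bound_const :: "real \<Rightarrow> real \<Rightarrow> nat \<Rightarrow> nat \<Rightarrow> real \<Rightarrow> bool" where
  "X_bound_const L \<delta> k m J \<longleftrightarrow> J \<ge> 0 \<and> (\<forall>A h. A \<ge> 0 \<longrightarrow>
    (\<forall>k'\<le>k. \<forall>(a, b) \<in> {(k', 0), (k' + 1, 0), (k', 1), (k', 2)}. \<exists>g. has_weak_partial L a b h g \<and>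
       (\<forall>x\<in>cylinder L. \<bar>g x\<bar> \<le> A * exp (- (\<delta> * snd x)))) \<longrightarrow>
    h \<in> X_space L k m \<and> X_norm L k m h \<le> A * J)"

text \<open>\<open>weak_partial\<close> is a choice, so a bound on some weak derivative carries over
  to it only almost everywhere, by uniqueness; that suffices for the integrals.\<close>

lemma X_space_of_exponential_decay:
  assumes L: "L > 0" and \<delta>: "\<delta> > 0"
  shows "\<exists>J. X_bound_const L \<delta> k m J"
proof -
  define W where "W n J \<longleftrightarrow> J \<ge> 0 \<and> (\<forall>A g. A \<ge> 0 \<longrightarrow> (cyl_ext L g) \<in> borel_measurable lborel \<longrightarrow>
     (AE x in lborel. x \<in> cylinder L \<longrightarrow> \<bar>g x\<bar> \<le> A * exp (- (\<delta> * snd x))) \<longrightarrow>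
     set_integrable lborel (cylinder L) (weighted_square n g) \<and> weighted_L2_sq L n g \<le> A\<^sup>2 * J)" for n J
  have "\<exists>J. \<forall>n. W n (J n)"
    unfolding W_def by (intro choice allI) (use weighted_square_decay[OF L \<delta>] in blast)
  then obtain J where J': "\<And>n. W n (J n)" by blast
  then have J: "J n \<ge> 0" for n by (simp add: W_def)
  define JJ where "JJ = (\<Sum>k'\<le>k. \<Sum>m'\<le>m. 4 * J m')"
  have JJ: "JJ \<ge> 0" unfolding JJ_def using J by (intro sum_nonneg) simp
  have "h \<in> X_space L k m \<and> X_norm L k m h \<le> A * sqrt JJ"
    if A: "A \<ge> 0" and w: "\<forall>k'\<le>k. \<forall>(a, b) \<in> {(k', 0), (k' + 1, 0), (k', 1), (k', 2)}. \<exists>g. has_weak_partial L a b h g \<and>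
       (\<forall>x\<in>cylinder L. \<bar>g x\<bar> \<le> A * exp (- (\<delta> * snd x)))" for A h
  proof -
    have ex: "\<exists>g. has_weak_partial L a b h g"
      and int: "set_integrable lborel (cylinder L) (weighted_square n (weak_partial L a b h))"
      and le: "weighted_L2_sq L n (weak_partial L a b h) \<le> A\<^sup>2 * J n"
      if "k' \<le> k" "(a, b) \<in> {(k', 0), (k' + 1, 0), (k', 1), (k', 2)}" for k' a b n
    proof -
      have "case (a, b) of (a, b) \<Rightarrow> \<exists>g. has_weak_partial L a b h g \<and> (\<forall>x\<in>cylinder L. \<bar>g x\<bar> \<le> A * exp (- (\<delta> * snd x)))" by (rule w[rule_format, OF that])
      then obtain g where g: "has_weak_partial L a b h g" "\<And>x. x \<in> cylinder L \<Longrightarrow> \<bar>g x\<bar> \<le> A * exp (- (\<delta> * snd x))" by auto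
      note wp = weak_partial_AE_eq[OF L g(1)]
      have "AE x in lborel. x \<in> cylinder L \<longrightarrow> \<bar>weak_partial L a b h x\<bar> \<le> A * exp (- (\<delta> * snd x))" using wp(2) by eventually_elim (use g(2) in auto)
      moreover have "(cyl_ext L (weak_partial L a b h)) \<in> borel_measurable lborel"
        using wp(1) by (intro cylinder_measurable_mult) (simp add: has_weak_partial_def)
      ultimately show "\<exists>g. has_weak_partial L a b h g" "set_integrable lborel (cylinder L) (weighted_square n (weak_partial L a b h))"
        "weighted_L2_sq L n (weak_partial L a b h) \<le> A\<^sup>2 * J n" using g(1) J'[of n] A unfolding W_def by blast+
    qed
    have "h \<in> X_space L k m" unfolding X_space_def using ex int by (auto 0 0)
    moreover have "X_norm L k m h \<le> sqrt (A\<^sup>2 * JJ)" unfolding X_norm_def JJ_def sum_distrib_left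
    proof (intro real_sqrt_le_mono sum_mono)
      fix k' m' assume "k' \<in> {..k}"
      then have k: "k' \<le> k" by simp
      have "weighted_L2_sq L m' (weak_partial L k' 0 h) \<le> A\<^sup>2 * J m'" "weighted_L2_sq L m' (weak_partial L (k' + 1) 0 h) \<le> A\<^sup>2 * J m'"
        "weighted_L2_sq L m' (weak_partial L k' 1 h) \<le> A\<^sup>2 * J m'" "weighted_L2_sq L m' (weak_partial L k' 2 h) \<le> A\<^sup>2 * J m'" by (rule le[OF k]; simp)+
      then show "weighted_L2_sq L m' (weak_partial L k' 0 h) + weighted_L2_sq L m' (weak_partial L (k' + 1) 0 h) +
          weighted_L2_sq L m' (weak_partial L k' 1 h) + weighted_L2_sq L m' (weak_partial L k' 2 h) \<le> A\<^sup>2 * (4 * J m')" by linarith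
    qed
    ultimately show ?thesis using A by (simp add: real_sqrt_mult)
  qed
  then show ?thesis using JJ unfolding X_bound_const_def by (intro exI[of _ "sqrt JJ"]) simp
qed

section \<open>Sums and products of series\<close>

context boundary_speed
begin

definition csum :: "(int \<Rightarrow> real \<Rightarrow> complex) \<Rightarrow> real \<Rightarrow> real \<Rightarrow> complex" where
  "csum u s y = (\<Sum>\<^sub>\<infinity>n. u n y * expo n s)"

lemma series_csum: "series 0 u (s, y) = Re (csum u s y)"
  by (simp add: series_def csum_def dexpo_0)

lemma csum_summable:
  assumes "modes k \<gamma> K u" "2 \<le> k" "y \<ge> 0"
  shows "(\<lambda>n. norm (u n y * expo n s)) summable_on UNIV" "(\<lambda>n. u n y * expo n s) summable_on UNIV"
proof -
  show 1: "(\<lambda>n. norm (u n y * expo n s)) summable_on UNIV"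
    using modes_abs_summable[OF assms] by (simp add: norm_mult norm_expo)
  show "(\<lambda>n. u n y * expo n s) summable_on UNIV" by (rule abs_summable_summable[OF 1])
qed

lemma csum_real:
  assumes "\<And>n. u (- n) y = cnj (u n y)"
  shows "csum u s y = of_real (series 0 u (s, y))"
proof -
  have "cnj (csum u s y) = (\<Sum>\<^sub>\<infinity>n. u (0 - n) y * expo (0 - n) s)"
    by (simp add: csum_def infsum_cnj[symmetric] assms expo_cnj)
  also have "\<dots> = csum u s y"
    unfolding csum_def by (rule infsum_reindex_bij_betw[OF bij_minus_shift[of 0], of "\<lambda>n. u n y * expo n s"])
  finally show ?thesis by (simp add: series_csum complex_eq_iff)
qed

lemma csum_conv:
  assumes "modes 4 \<gamma> K u" "modes 4 \<gamma>' K' v" "y \<ge> 0"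
  shows "csum (conv u v) s y = csum u s y * csum v s y"
proof -
  have "csum (conv u v) s y = (\<Sum>\<^sub>\<infinity>n. \<Sum>\<^sub>\<infinity>m. (u m y * expo m s) * (v (n - m) y * expo (n - m) s))"
    unfolding csum_def conv_def
  proof (rule infsum_cong)
    fix n
    have "expo m s * expo (n - m) s = expo n s" for m using expo_add[of m "n - m" s] by simp
    then have "(u m y * expo m s) * (v (n - m) y * expo (n - m) s) = u m y * v (n - m) y * expo n s" for m by (metis mult.assoc mult.left_commute)
    then show "(\<Sum>\<^sub>\<infinity>m. u m y * v (n - m) y) * expo n s = (\<Sum>\<^sub>\<infinity>m. (u m y * expo m s) * (v (n - m) y * expo (n - m) s))" by (simp only: infsum_cmult_left')
  qed
  also have "\<dots> = csum u s y * csum v s y"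
    unfolding csum_def using assms by (intro infsum_convolution csum_summable(1)) auto
  finally show ?thesis .
qed

lemma csum_add:
  assumes "modes k \<gamma> K u" "modes k' \<gamma>' K' v" "2 \<le> k" "2 \<le> k'" "y \<ge> 0"
  shows "csum (\<lambda>n y. u n y + v n y) s y = csum u s y + csum v s y"
  using infsum_add[OF csum_summable(2)[OF assms(1,3,5)] csum_summable(2)[OF assms(2,4,5)], of s s]
  by (simp add: csum_def ring_distribs)

lemma csum_scale: "csum (\<lambda>n y. c * u n y) s y = c * csum u s y"
  by (simp add: csum_def infsum_cmult_right' mult.assoc)

lemma csum_cong: "(\<And>n. u n y = v n y) \<Longrightarrow> csum u s y = csum v s y"
  by (simp add: csum_def)

lemma csum_zero_mode: "csum (\<lambda>n _. if n = 0 then c else 0) s y = c"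
proof -
  have "csum (\<lambda>n _. if n = 0 then c else 0) s y = (\<Sum>\<^sub>\<infinity>n\<in>{0}. (if n = 0 then c else 0) * expo n s)"
    unfolding csum_def by (intro infsum_cong_neutral) auto
  then show ?thesis by (simp add: expo_0)
qed

end

section \<open>Construction of the solution\<close>

locale speed_modes = boundary_speed +
  fixes B Cd :: real
  assumes B: "B \<ge> 0" "\<And>n. norm (coef (\<lambda>s. (q_e s)\<^sup>2) n) \<le> B / bracket n ^ 5"
      "\<And>n. norm (coef (\<lambda>s. (inverse (q_e s))\<^sup>2) n) \<le> B / bracket n ^ 4"
    and Cd: "Cd \<ge> 1" "\<And>j n s. j \<le> 3 \<Longrightarrow> s \<in> {0..L} \<Longrightarrow> norm (dexpo j n s) \<le> Cd * bracket n ^ j"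
begin

lemma smooth_data: "smooth (\<lambda>s. (q_e s)\<^sup>2)" "smooth (\<lambda>s. (inverse (q_e s))\<^sup>2)"
  unfolding power2_eq_square using qe_pos by (intro smooth_mult smooth_inverse qe_smooth; simp add: less_imp_neq[symmetric])+

lemma cube_integral_pos: "integral {0..L} (\<lambda>s. (q_e s) ^ 3) > 0"
proof -
  have "\<exists>x\<in>{0..L}. \<forall>y\<in>{0..L}. q_e x \<le> q_e y"
    by (rule continuous_attains_inf) (use L qe_cont in auto)
  then obtain x where x: "\<And>y. y \<in> {0..L} \<Longrightarrow> q_e x \<le> q_e y" by blast
  have "q_e x ^ 3 * L = integral {0..L} (\<lambda>_. q_e x ^ 3)" using L by simp
  also have "\<dots> \<le> integral {0..L} (\<lambda>s. (q_e s) ^ 3)"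
    using x qe_pos[of x] by (intro integral_le integrable_continuous_real continuous_intros qe_cont power_mono) auto
  finally show ?thesis using L qe_pos[of x] by (smt (verit) mult_pos_pos zero_less_power)
qed

text \<open>The zeroth coefficient of q_e^2 carries the integral of q_e^3 because
  \<open>coef\<close> integrates against q_e ds; this is the denominator in the formula for
  \<omega>^2.\<close>

sublocale mode_problem l1 "integral {0..L} (\<lambda>s. (q_e s) ^ 3) / total" B "coef (\<lambda>s. (q_e s)\<^sup>2)" "coef (\<lambda>s. (inverse (q_e s))\<^sup>2)"
proof
  show "coef (\<lambda>s. (q_e s)\<^sup>2) 0 = of_real (integral {0..L} (\<lambda>s. (q_e s) ^ 3) / total)"
    using coef_0[OF smooth_continuous[OF smooth_data(1)]] by (simp add: power2_eq_square power3_eq_cube)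
qed (use l1_pos cube_integral_pos total_pos B in \<open>auto simp: coef_cnj\<close>)

definition C_sum :: real where "C_sum = Cd * (C_Q + C_P + C_H) * sq_sum"

text \<open>The size of \<open>N\<close> as a product of \<rho> and the second derivative, divided
  by rate^2 for the double tail integral and by \<nu> 0 for solving the condition on
  \<omega>^2.\<close>

definition C_err :: "real \<Rightarrow> real" where
  "C_err b0 = 32 * bracket_sum * M_fix b0 * C_H * (b0 + 1) / rate\<^sup>2 * total / integral {0..L} (\<lambda>s. (q_e s) ^ 3)"

text \<open>The representative \<open>h\<close> of the second \<psi>-derivative and its exponential
  bound are exported for the uniqueness argument. All bounds are explicit in \<epsilon>, so that a
  single threshold can meet every smallness condition.\<close>

theorem solution_exists:
  fixes f :: "real \<Rightarrow> real" and b0 \<epsilon> :: real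
  defines "b \<equiv> coef (\<lambda>s. (f s)\<^sup>2 - (q_e s)\<^sup>2)"
  assumes f: "smooth f" "\<And>s. f (s + L) = f s" and b0: "b0 \<ge> 0" and \<epsilon>: "\<epsilon> > 0" and b: "\<And>n. norm (b n) \<le> b0 * \<epsilon> / bracket n ^ 5"
    and small: "64 * bracket_sum * (M_fix b0)\<^sup>2 * \<epsilon> \<le> 1" "C_om * (b0 + 1) * \<epsilon> \<le> 1 / 2" "M_fix b0 * sq_sum * \<epsilon> \<le> 1 / 2"
    and J: "X_bound_const L rate 2 50 J"
  shows "\<exists>\<omega> q h. prandtl_solution L q_e f \<omega> q \<and> X_norm L 2 50 (Q_of q_e \<omega> q) \<le> C_sum * (b0 + 1) * \<epsilon> * J \<and>
    has_weak_partial L 0 2 (Q_of q_e \<omega> q) h \<and> (\<forall>x\<in>cylinder L. \<bar>h x\<bar> \<le> C_sum * (b0 + 1) * \<epsilon> * exp (- (rate * snd x))) \<and>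
    \<bar>\<omega>\<^sup>2 - integral {0..L} (\<lambda>s. q_e s * (f s)\<^sup>2) / integral {0..L} (\<lambda>s. (q_e s) ^ 3)\<bar> \<le> C_err b0 * \<epsilon>\<^sup>2"
proof -
  have b_cnj: "b (- n) = cnj (b n)" for n by (simp add: b_def coef_cnj)
  obtain r N where rN: "modes 4 0 (M_fix b0 * \<epsilon>) r" "modes 4 rate \<epsilon> N"
      "\<And>n \<psi>. \<psi> \<ge> 0 \<Longrightarrow> r (- n) \<psi> = cnj (r n \<psi>)" "\<And>n \<psi>. \<psi> \<ge> 0 \<Longrightarrow> N (- n) \<psi> = cnj (N n \<psi>)"
    and fix_r: "\<And>n \<psi>. \<psi> \<ge> 0 \<Longrightarrow> 2 * r n \<psi> + conv r r n \<psi> = Z_mode b N n \<psi>"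
    and fix_N: "\<And>n \<psi>. \<psi> \<ge> 0 \<Longrightarrow> N n \<psi> = conv r (H_mode b N) n \<psi>" by (rule fixed_point[OF b0 \<epsilon> small(1) b b_cnj], rule that)
  note r = rN(1,3) and N = rN(2,4)
  note Q = modes_Q_mode[OF b N(1)] and P = modes_P_mode[OF b N(1)] and H = modes_H_mode[OF b N(1)]
  have Q4: "modes 4 rate (C_Q * (b0 * \<epsilon> + \<epsilon>)) (Q_mode b N)" by (rule modes_order_mono[OF Q]) simp
  have rate0: "rate \<ge> 0" using rate_pos by simp
  define \<sigma> where "\<sigma> = Re (omega_shift b N)"
  have \<sigma>: "omega_shift b N = of_real \<sigma>"
    using omega_shift_cnj[OF b N(1) b_cnj N(2)] by (simp add: \<sigma>_def complex_eq_iff)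
  have \<sigma>_small: "\<bar>\<sigma>\<bar> \<le> 1 / 2"
  proof -
    have "\<bar>\<sigma>\<bar> \<le> C_om * (b0 * \<epsilon> + \<epsilon>)" using omega_shift_bound[OF b N(1)] by (simp add: \<sigma>)
    then show ?thesis using small(2) by (simp add: algebra_simps)
  qed
  define R Qf Hf where "R = series 0 r" and "Qf = series 0 (Q_mode b N)" and "Hf = series 0 (H_mode b N)"
  have sR: "csum r s \<psi> = of_real (R (s, \<psi>))" and sQ: "csum (Q_mode b N) s \<psi> = of_real (Qf (s, \<psi>))"
    and sH: "csum (H_mode b N) s \<psi> = of_real (Hf (s, \<psi>))" if "\<psi> \<ge> 0" for s \<psi> unfolding R_def Qf_def Hf_def
    using r(2)[OF that] Q_mode_cnj[OF b N(1) b_cnj N(2) that] H_mode_cnj[OF b N(1) b_cnj N(2) that] by (intro csum_real; simp)+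
  \<comment> \<open>Multiplied by q_e^2, this is q^2 = \<omega>^2 q_e^2 + Q with q = q_e (1 +
    R).\<close>
  have eq_R: "2 * R (s, \<psi>) + (R (s, \<psi>))\<^sup>2 = \<sigma> + (inverse (q_e s))\<^sup>2 * Qf (s, \<psi>)" if \<psi>: "\<psi> \<ge> 0" for s \<psi>
  proof -
    let ?\<alpha> = "\<lambda>n (_ :: real). coef (\<lambda>s. (inverse (q_e s))\<^sup>2) n"
    have "modes 4 (0 + 0) (32 * bracket_sum * ((M_fix b0 * \<epsilon>) * (M_fix b0 * \<epsilon>))) (conv r r)" by (rule modes_conv[OF r(1) r(1)]) auto
    from csum_add[OF modes_scale[OF r(1), of 2] this _ _ \<psi>, of s]
    have "csum (\<lambda>n \<psi>. 2 * r n \<psi> + conv r r n \<psi>) s \<psi> = 2 * csum r s \<psi> + (csum r s \<psi>)\<^sup>2"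
      using csum_conv[OF r(1) r(1) \<psi>, of s] by (simp add: csum_scale power2_eq_square)
    moreover have "csum (\<lambda>n \<psi>. 2 * r n \<psi> + conv r r n \<psi>) s \<psi> = csum (\<lambda>n \<psi>. (if n = 0 then omega_shift b N else 0) + conv ?\<alpha> (Q_mode b N) n \<psi>) s \<psi>"
      using fix_r[OF \<psi>] by (intro csum_cong) (simp add: Z_mode_def)
    moreover have "csum (\<lambda>n \<psi>. (if n = 0 then omega_shift b N else 0) + conv ?\<alpha> (Q_mode b N) n \<psi>) s \<psi>
        = csum (\<lambda>n _. if n = 0 then omega_shift b N else 0) s \<psi> + csum (conv ?\<alpha> (Q_mode b N)) s \<psi>"
    proof (rule csum_add[OF _ modes_conv[OF modes_alpha[OF b N(1)] Q4] _ _ \<psi>])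
      show "modes 4 0 (norm (omega_shift b N)) (\<lambda>n _. if n = 0 then omega_shift b N else 0)"
        using bracket_power_pos by (auto simp: modes_def decays_def bracket_0 less_imp_le)
    qed (use rate_pos in auto)
    moreover have "csum (conv ?\<alpha> (Q_mode b N)) s \<psi> = csum ?\<alpha> s \<psi> * csum (Q_mode b N) s \<psi>" by (rule csum_conv[OF modes_alpha[OF b N(1)] Q4 \<psi>])
    moreover have "csum ?\<alpha> s \<psi> = of_real ((inverse (q_e s))\<^sup>2)" unfolding csum_def by (rule fourier_inversion[symmetric]) (auto simp: smooth_data qe_per)
    ultimately have "complex_of_real (2 * R (s, \<psi>) + (R (s, \<psi>))\<^sup>2) = of_real (\<sigma> + (inverse (q_e s))\<^sup>2 * Qf (s, \<psi>))"
      by (simp add: csum_zero_mode sR[OF \<psi>] sQ[OF \<psi>] \<sigma>)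
    then show ?thesis by (simp only: of_real_eq_iff)
  qed
  define \<omega> where "\<omega> = sqrt (1 + \<sigma>)"
  have \<omega>: "\<omega> > 0" "\<omega>\<^sup>2 = 1 + \<sigma>" using \<sigma>_small by (auto simp: \<omega>_def abs_le_iff)
  define q where "q x = q_e (fst x) * (1 + R x)" for x
  have q_sq: "(q (s, \<psi>))\<^sup>2 = \<omega>\<^sup>2 * (q_e s)\<^sup>2 + Qf (s, \<psi>)" if "\<psi> \<ge> 0" for s \<psi>
  proof -
    have "(q (s, \<psi>))\<^sup>2 = (q_e s)\<^sup>2 * (1 + (2 * R (s, \<psi>) + (R (s, \<psi>))\<^sup>2))" by (simp add: q_def power_mult_distrib power2_eq_square algebra_simps)
    also have "\<dots> = (q_e s)\<^sup>2 * (1 + \<sigma>) + ((q_e s)\<^sup>2 * (inverse (q_e s))\<^sup>2) * Qf (s, \<psi>)" unfolding eq_R[OF that] by (simp add: algebra_simps)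
    also have "(q_e s)\<^sup>2 * (inverse (q_e s))\<^sup>2 = 1" using qe_pos[of s] by (simp add: power_mult_distrib[symmetric])
    finally show ?thesis by (simp add: \<omega>(2) mult.commute)
  qed
  have Q_of: "Q_of q_e \<omega> q (s, \<psi>) = Qf (s, \<psi>)" if "\<psi> \<ge> 0" for s \<psi>
    using q_sq[OF that, of s] by (simp add: Q_of_def)
  have d0: "norm (dexpo 0 n s) \<le> 1 * bracket n ^ 0" for n s by (simp add: dexpo_0 norm_expo)
  have R_bound: "\<bar>R (s, \<psi>)\<bar> \<le> 1 / 2" if "\<psi> \<ge> 0" for s \<psi>
    using series_bound[OF r(1) _ _ d0 _ UNIV_I that, of s] small(3) by (simp add: R_def mult_ac)
  have q_nonneg: "q (s, \<psi>) \<ge> 0" if "\<psi> \<ge> 0" for s \<psi>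
    using R_bound[OF that, of s] qe_pos[of s] by (simp add: q_def abs_le_iff)
  have Q_bound: "\<bar>Qf (s, \<psi>)\<bar> \<le> 1 * (C_Q * (b0 * \<epsilon> + \<epsilon>)) * sq_sum * exp (- (rate * \<psi>))" if "\<psi> \<ge> 0" for s \<psi>
    unfolding Qf_def by (rule series_bound[OF Q _ rate0 d0 _ UNIV_I that]) auto
  define u where "u i = (if i = 0 then Q_mode b N else if i = 1 then P_mode b N else H_mode b N)" for i :: nat
  \<comment> \<open>Three s-derivatives occur only without a \<psi>-derivative, where the order 5 =
    3 + 2 is available; in all other cases order 4 = 2 + 2 suffices.\<close>
  have weak: "has_weak_partial L i j (Q_of q_e \<omega> q) (series i (u j))"
    and weak_bound: "\<And>x. x \<in> cylinder L \<Longrightarrow> \<bar>series i (u j) x\<bar> \<le> C_sum * (b0 + 1) * \<epsilon> * exp (- (rate * snd x))"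
    if ij: "(i \<le> 3 \<and> j = 0) \<or> (i \<le> 2 \<and> j \<le> 2)" for i j
  proof -
    define Cu where "Cu = (if j = 0 then C_Q else if j = 1 then C_P else C_H)"
    define k :: nat where "k = (if j = 0 then 5 else 4)"
    have uj: "modes k rate (Cu * (b0 * \<epsilon> + \<epsilon>)) (u j)" using Q P H by (auto simp: u_def Cu_def k_def)
    have k: "i + 2 \<le> k" using ij by (auto simp: k_def)
    have i3: "i \<le> 3" "j \<le> 2" using ij by auto
    have "has_weak_partial L i j (series 0 (u 0)) (series i (u j))"
    proof (rule series_weak_partial[where u = u, OF i3 rate0 _ _ uj k])
      show "modes 5 rate (C_Q * (b0 * \<epsilon> + \<epsilon>)) (u 0)" using Q by (simp add: u_def)
      show "(u l n has_vector_derivative u (Suc l) n \<psi>) (at \<psi> within {0..})" if l: "l < j" and \<psi>: "\<psi> \<ge> 0" for l n \<psi>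
      proof -
        consider "l = 0" | "l = 1" using l i3 by linarith
        then show ?thesis by cases (simp_all add: u_def Q_mode_deriv[OF b N(1) \<psi>] P_mode_deriv[OF b N(1) \<psi>])
      qed
    qed simp
    then show "has_weak_partial L i j (Q_of q_e \<omega> q) (series i (u j))" by (rule has_weak_partial_cong) (auto simp: u_def cylinder_def Qf_def[symmetric] Q_of)
    fix x assume "x \<in> cylinder L"
    then obtain s \<psi> where x: "x = (s, \<psi>)" "s \<in> {0..L}" "\<psi> \<ge> 0" by (cases x) (auto simp: cylinder_def)
    have "\<bar>series i (u j) (s, \<psi>)\<bar> \<le> Cd * (Cu * (b0 * \<epsilon> + \<epsilon>)) * sq_sum * exp (- (rate * \<psi>))"
      by (rule series_bound[OF uj k rate0 Cd(2)[OF i3(1)] _ x(2,3)]) (use Cd(1) in auto)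
    also have "\<dots> = Cd * Cu * sq_sum * ((b0 + 1) * \<epsilon> * exp (- (rate * \<psi>)))" by (simp add: algebra_simps)
    also have "\<dots> \<le> C_sum * ((b0 + 1) * \<epsilon> * exp (- (rate * \<psi>)))"
    proof (intro mult_right_mono)
      have "Cu \<le> C_Q + C_P + C_H" using C_nonneg by (auto simp: Cu_def)
      then show "Cd * Cu * sq_sum \<le> C_sum" unfolding C_sum_def using Cd(1) sq_sum_nonneg by (intro mult_right_mono mult_left_mono) auto
    qed (use b0 \<epsilon> in auto)
    finally show "\<bar>series i (u j) x\<bar> \<le> C_sum * (b0 + 1) * \<epsilon> * exp (- (rate * snd x))" by (simp add: x mult.assoc)
  qed
  \<comment> \<open>By the definition of \<open>H_mode\<close> and the fixed point, i lam n Q n = H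
    n + N n = H n + conv r H n, the n-th mode of (1 + \<rho>) times the second derivative. The
    remaining factor q_e comes from differentiating \<open>expo n\<close>.\<close>
  have equation: "series 1 (u 0) (s, \<psi>) = q (s, \<psi>) * series 0 (u 2) (s, \<psi>)" if \<psi>: "\<psi> \<ge> 0" for s \<psi>
  proof -
    have "(\<Sum>\<^sub>\<infinity>n. u 0 n \<psi> * dexpo 1 n s) = (\<Sum>\<^sub>\<infinity>n. of_real (q_e s) * ((H_mode b N n \<psi> + conv r (H_mode b N) n \<psi>) * expo n s))"
    proof (rule infsum_cong)
      fix n
      have "\<i> * of_real (lam n) * Q_mode b N n \<psi> = H_mode b N n \<psi> + conv r (H_mode b N) n \<psi>" using fix_N[OF \<psi>, of n] by (simp add: H_mode_def)
      moreover have "u 0 n \<psi> * dexpo 1 n s = of_real (q_e s) * ((\<i> * of_real (lam n) * Q_mode b N n \<psi>) * expo n s)" by (simp add: u_def dexpo_1 lam_def mult_ac)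
      ultimately show "u 0 n \<psi> * dexpo 1 n s = of_real (q_e s) * ((H_mode b N n \<psi> + conv r (H_mode b N) n \<psi>) * expo n s)" by simp
    qed
    also have "\<dots> = of_real (q_e s) * csum (\<lambda>n \<psi>. H_mode b N n \<psi> + conv r (H_mode b N) n \<psi>) s \<psi>" by (simp only: infsum_cmult_right' csum_def)
    also have "csum (\<lambda>n \<psi>. H_mode b N n \<psi> + conv r (H_mode b N) n \<psi>) s \<psi> = csum (H_mode b N) s \<psi> + csum (conv r (H_mode b N)) s \<psi>"
      using rate_pos by (intro csum_add[OF H modes_conv[OF r(1) H] _ _ \<psi>]) auto
    also have "\<dots> = of_real ((1 + R (s, \<psi>)) * Hf (s, \<psi>))" by (simp add: csum_conv[OF r(1) H \<psi>] sR[OF \<psi>] sH[OF \<psi>] ring_distribs)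
    finally have "(\<Sum>\<^sub>\<infinity>n. u 0 n \<psi> * dexpo 1 n s) = of_real (q_e s * ((1 + R (s, \<psi>)) * Hf (s, \<psi>)))" by simp
    then have "series 1 (u 0) (s, \<psi>) = q_e s * ((1 + R (s, \<psi>)) * Hf (s, \<psi>))" by (simp add: series_def)
    then show ?thesis by (simp add: q_def Hf_def u_def mult.assoc)
  qed
  \<comment> \<open>The one boundary value that cannot be prescribed, that of n = 0, agrees with the
    data by the choice of \<open>omega_shift\<close>.\<close>
  have tail: "omega_shift b N * coef (\<lambda>s. (q_e s)\<^sup>2) 0 = b 0 + backward 0 (backward 0 (N 0)) 0"
  proof -
    have "coef (\<lambda>s. (q_e s)\<^sup>2) 0 \<noteq> 0" using \<nu>0 by (metis less_irrefl of_real_eq_0_iff)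
    then show ?thesis by (simp add: omega_shift_def)
  qed
  have bdry: "Qf (s, 0) = (f s)\<^sup>2 - \<omega>\<^sup>2 * (q_e s)\<^sup>2" for s
  proof -
    let ?\<nu> = "\<lambda>n (_ :: real). coef (\<lambda>s. (q_e s)\<^sup>2) n" and ?b = "\<lambda>n (_ :: real). b n"
    have mb: "modes 5 0 (b0 * \<epsilon>) ?b" and mn: "modes 5 0 B ?\<nu>" using b \<nu>_bound by (auto simp: modes_def decays_def)
    have "Q_mode b N n 0 = b n + - of_real \<sigma> * coef (\<lambda>s. (q_e s)\<^sup>2) n" for n
    proof (cases "n = 0")
      case True
      have "Q_mode b N 0 0 = - backward 0 (backward 0 (N 0)) 0" using mode_boundary(2) mu_eq_0[of 0] by (simp add: Q_mode_def)
      then show ?thesis using tail True by (simp add: \<sigma>)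
    next
      case False
      then show ?thesis using mode_boundary(1)[of "mu n"] mu_eq_0[of n] by (simp add: Q_mode_def \<sigma>)
    qed
    then have "csum (Q_mode b N) s 0 = csum (\<lambda>n \<psi>. ?b n \<psi> + - of_real \<sigma> * ?\<nu> n \<psi>) s 0" by (intro csum_cong) simp
    also have "\<dots> = csum ?b s 0 + - of_real \<sigma> * csum ?\<nu> s 0" using csum_add[OF mb modes_scale[OF mn, of "- of_real \<sigma>"], of 0 s] unfolding csum_scale by simp
    also have "csum ?b s 0 = of_real ((f s)\<^sup>2 - (q_e s)\<^sup>2)" unfolding csum_def b_def using f qe_per
      by (intro fourier_inversion[symmetric] smooth_diff smooth_data) (auto simp: power2_eq_square intro: smooth_mult)
    also have "csum ?\<nu> s 0 = of_real ((q_e s)\<^sup>2)" unfolding csum_def by (rule fourier_inversion[symmetric]) (auto simp: smooth_data qe_per)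
    also have "of_real ((f s)\<^sup>2 - (q_e s)\<^sup>2) + - of_real \<sigma> * of_real ((q_e s)\<^sup>2) = complex_of_real ((f s)\<^sup>2 - \<omega>\<^sup>2 * (q_e s)\<^sup>2)"
      by (simp add: \<omega>(2) algebra_simps)
    finally show ?thesis using sQ[of 0 s] by (simp only: order.refl of_real_eq_iff)
  qed
  have X: "Q_of q_e \<omega> q \<in> X_space L 2 50 \<and> X_norm L 2 50 (Q_of q_e \<omega> q) \<le> C_sum * (b0 + 1) * \<epsilon> * J"
  proof (rule J[unfolded X_bound_const_def, THEN conjunct2, rule_format])
    show "C_sum * (b0 + 1) * \<epsilon> \<ge> 0" using C_nonneg sq_sum_nonneg Cd(1) b0 \<epsilon> by (simp add: C_sum_def)
    fix k' :: nat and ij assume "k' \<le> 2" "ij \<in> {(k', 0), (k' + 1, 0), (k', 1 :: nat), (k', 2)}"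
    then have "(fst ij \<le> 3 \<and> snd ij = 0) \<or> (fst ij \<le> 2 \<and> snd ij \<le> 2)" by auto
    from weak[OF this] weak_bound[OF this]
    show "case ij of (i, j) \<Rightarrow> \<exists>g. has_weak_partial L i j (Q_of q_e \<omega> q) g \<and> (\<forall>x\<in>cylinder L. \<bar>g x\<bar> \<le> C_sum * (b0 + 1) * \<epsilon> * exp (- (rate * snd x)))"
      by (auto simp: case_prod_beta)
  qed
  have sol: "prandtl_solution L q_e f \<omega> q"
    unfolding prandtl_solution_def Let_def L_periodic_def
  proof (intro conjI allI impI)
    show "\<omega> > 0" by (rule \<omega>)
    show "q (s + L, \<psi>) = q (s, \<psi>)" for s \<psi> by (simp add: q_def R_def series_def dexpo_per qe_per)
    have "continuous_on (UNIV \<times> {0..}) R" unfolding R_def by (rule series_cont[OF r(1) _ _ d0]) auto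
    then show "continuous_on (UNIV \<times> {0..}) q" unfolding q_def by (intro continuous_intros continuous_on_compose2[OF qe_cont[of UNIV]]) auto
    show "Q_of q_e \<omega> q \<in> X_space L 2 50" using X ..
    show "q (s, \<psi>) = sqrt (\<omega>\<^sup>2 * (q_e s)\<^sup>2 + Q_of q_e \<omega> q (s, \<psi>))" if "\<psi> \<ge> 0" for s \<psi>
      using q_nonneg[OF that, of s] by (simp add: Q_of[OF that] q_sq[OF that, symmetric])
    have "AE x in lborel. x \<in> cylinder L \<longrightarrow> weak_partial L 1 0 (Q_of q_e \<omega> q) x = series 1 (u 0) x"
      "AE x in lborel. x \<in> cylinder L \<longrightarrow> weak_partial L 0 2 (Q_of q_e \<omega> q) x = series 0 (u 2) x" by (rule weak_partial_AE_eq[OF L weak]; simp)+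
    then show "AE x in lborel. x \<in> cylinder L \<longrightarrow> weak_partial L 1 0 (Q_of q_e \<omega> q) x - q x * weak_partial L 0 2 (Q_of q_e \<omega> q) x = 0"
    proof eventually_elim
      case (elim x)
      show ?case
      proof
        assume "x \<in> cylinder L"
        moreover from this obtain s \<psi> where "x = (s, \<psi>)" "\<psi> \<ge> 0" by (cases x) (auto simp: cylinder_def)
        ultimately show "weak_partial L 1 0 (Q_of q_e \<omega> q) x - q x * weak_partial L 0 2 (Q_of q_e \<omega> q) x = 0" using elim equation[of \<psi> s] by simp
      qed
    qed
    show "Q_of q_e \<omega> q (s, 0) = (f s)\<^sup>2 - \<omega>\<^sup>2 * (q_e s)\<^sup>2" for s using bdry[of s] Q_of[of 0 s] by simp
    show "((\<lambda>\<psi>. Q_of q_e \<omega> q (s, \<psi>)) \<longlongrightarrow> 0) at_top" for s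
    proof (rule Lim_null_comparison)
      show "\<forall>\<^sub>F \<psi> in at_top. norm (Q_of q_e \<omega> q (s, \<psi>)) \<le> 1 * (C_Q * (b0 * \<epsilon> + \<epsilon>)) * sq_sum * exp (- (rate * \<psi>))"
        using eventually_ge_at_top[of 0] by eventually_elim (use Q_bound[of _ s] in \<open>simp add: Q_of\<close>)
      have "((\<lambda>\<psi>. exp (- (rate * \<psi>))) \<longlongrightarrow> 0) at_top"
        using rate_pos by (intro filterlim_compose[OF exp_at_bot] filterlim_uminus_at_bot[THEN iffD1] filterlim_tendsto_pos_mult_at_top[OF tendsto_const _ filterlim_ident])
           (auto simp: filterlim_uminus_at_bot intro!: filterlim_tendsto_pos_mult_at_top[OF tendsto_const _ filterlim_ident])
      then show "((\<lambda>\<psi>. 1 * (C_Q * (b0 * \<epsilon> + \<epsilon>)) * sq_sum * exp (- (rate * \<psi>))) \<longlongrightarrow> 0) at_top" by (rule tendsto_mult_right_zero)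
    qed
  qed
  let ?I = "integral {0..L} (\<lambda>s. (q_e s) ^ 3)" and ?J = "integral {0..L} (\<lambda>s. q_e s * (f s)\<^sup>2)"
  let ?t = "backward 0 (backward 0 (N 0)) 0"
  have "integral {0..L} (\<lambda>s. ((f s)\<^sup>2 - (q_e s)\<^sup>2) * q_e s) = ?J - ?I"
  proof -
    have "integral {0..L} (\<lambda>s. ((f s)\<^sup>2 - (q_e s)\<^sup>2) * q_e s) = integral {0..L} (\<lambda>s. q_e s * (f s)\<^sup>2 - (q_e s) ^ 3)"
      by (simp add: algebra_simps power2_eq_square power3_eq_cube)
    also have "\<dots> = ?J - ?I" by (intro integral_diff integrable_continuous_real continuous_intros qe_cont smooth_continuous[OF f(1)])
    finally show ?thesis .
  qed
  moreover have "continuous_on {0..L} (\<lambda>s. (f s)\<^sup>2 - (q_e s)\<^sup>2)"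
    by (intro continuous_intros qe_cont smooth_continuous[OF f(1)])
  ultimately have "b 0 = of_real ((?J - ?I) / total)" unfolding b_def by (subst coef_0) simp_all
  moreover have I: "?I > 0" by (rule cube_integral_pos)
  moreover have "(x / T + y) / (I / T) = x / I + y * T / I" if "T > 0" for x y T I :: real
    using that by (simp add: add_divide_distrib ring_distribs)
  ultimately have "\<sigma> = (?J - ?I) / ?I + Re ?t * total / ?I"
    using total_pos unfolding \<sigma>_def omega_shift_def \<nu>0(1) Re_divide_of_real by simp
  then have "\<omega>\<^sup>2 - ?J / ?I = Re ?t * total / ?I" using I by (simp add: \<omega>(2) diff_divide_distrib)
  then have "\<bar>\<omega>\<^sup>2 - ?J / ?I\<bar> = \<bar>Re ?t\<bar> * total / ?I" using I total_pos by (simp add: abs_mult)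
  also have "\<dots> \<le> (32 * bracket_sum * ((M_fix b0 * \<epsilon>) * (C_H * (b0 * \<epsilon> + \<epsilon>)))) / rate\<^sup>2 * total / ?I"
  proof (intro divide_right_mono mult_right_mono)
    have "modes 4 (0 + rate) (32 * bracket_sum * ((M_fix b0 * \<epsilon>) * (C_H * (b0 * \<epsilon> + \<epsilon>)))) (conv r (H_mode b N))"
      by (rule modes_conv[OF r(1) H]) (use rate_pos in auto)
    \<comment> \<open>The fixed point gave \<open>N\<close> the size \<epsilon>. As N = conv r H
      with both factors of size \<epsilon>, its size is in fact \<epsilon>^2, whence the quadratic
      error.\<close>
    then have "modes 4 rate (32 * bracket_sum * ((M_fix b0 * \<epsilon>) * (C_H * (b0 * \<epsilon> + \<epsilon>)))) N" using N(1) fix_N by (auto simp: modes_def decays_def)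
    from order_trans[OF abs_Re_le_cmod tail_N_bound[OF b this]]
    show "\<bar>Re ?t\<bar> \<le> (32 * bracket_sum * ((M_fix b0 * \<epsilon>) * (C_H * (b0 * \<epsilon> + \<epsilon>)))) / rate\<^sup>2" .
  qed (use total_pos I in auto)
  also have "\<dots> = C_err b0 * \<epsilon>\<^sup>2"
    by (simp add: C_err_def power2_eq_square algebra_simps)
  finally have err: "\<bar>\<omega>\<^sup>2 - ?J / ?I\<bar> \<le> C_err b0 * \<epsilon>\<^sup>2" .
  show ?thesis
    using sol X weak[of 0 2] weak_bound[of 0 2] err by (intro exI[of _ \<omega>] exI[of _ q] exI[of _ "series 0 (u 2)"]) simp
qed

end

section \<open>Choice of constants and application of uniqueness\<close>

lemma prandtl_solution_perturbed:
  assumes L: "L > 0" and qe: "continuous_on UNIV q_e" "\<And>s. q_e (s + L) = q_e s"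
    and bounds: "\<And>s. a \<le> q_e s" "\<And>s. q_e s \<le> M" "a > 0" "\<exists>s. q_e s = a"
    and e: "\<And>s. \<bar>(f s)\<^sup>2 - (q_e s)\<^sup>2\<bar> \<le> e * (q_e s)\<^sup>2" "0 \<le> e" "4 * e * M\<^sup>2 \<le> a\<^sup>2"
    and sol: "prandtl_solution L q_e f \<omega> q"
  obtains V where "perturbed_solution L (Q_of q_e \<omega> q) q V (cyl_ext L (weak_partial L 0 2 (Q_of q_e \<omega> q))) q_e f \<omega> a M e"
proof -
  obtain V where V: "regular_solution L (Q_of q_e \<omega> q) q V (cyl_ext L (weak_partial L 0 2 (Q_of q_e \<omega> q)))"
    using prandtl_solution_regular[OF L qe sol] by blast
  have w: "\<omega> > 0" "\<And>s. Q_of q_e \<omega> q (s, 0) = (f s)\<^sup>2 - \<omega>\<^sup>2 * (q_e s)\<^sup>2"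
    using sol by (simp_all add: prandtl_solution_def Let_def)
  have q: "(q (s, y))\<^sup>2 = \<omega>\<^sup>2 * (q_e s)\<^sup>2 + Q_of q_e \<omega> q (s, y)" for s y by (simp add: Q_of_def)
  have "perturbed_solution_axioms (Q_of q_e \<omega> q) q q_e f \<omega> a M e"
    by (rule perturbed_solution_axioms.intro; rule bounds e w q)
  then show thesis using V by (intro that perturbed_solution.intro)
qed

lemma eventually_small: "\<forall>\<^sub>F \<epsilon> in at_right 0. X * \<epsilon> < Y" if "Y > 0" for X Y :: real
proof -
  have "((\<lambda>\<epsilon>. X * \<epsilon>) \<longlongrightarrow> X * 0) (at_right 0)" by (intro tendsto_intros)
  from order_tendstoD(2)[OF this, of Y] that show ?thesis by simp
qed

lemma (in boundary_speed) coef_linear: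
  assumes "continuous_on {0..L} F" "continuous_on {0..L} G"
  shows "coef (\<lambda>s. x * F s + y * G s) n = of_real x * coef F n + of_real y * coef G n"
proof -
  have "integral {0..L} (\<lambda>s. of_real (x * F s + y * G s) * expo (- n) s * of_real (q_e s)) =
     integral {0..L} (\<lambda>s. of_real x * (of_real (F s) * expo (- n) s * of_real (q_e s)) + of_real y * (of_real (G s) * expo (- n) s * of_real (q_e s)))"
    by (simp add: algebra_simps)
  also have "\<dots> = of_real x * integral {0..L} (\<lambda>s. of_real (F s) * expo (- n) s * of_real (q_e s)) +
      of_real y * integral {0..L} (\<lambda>s. of_real (G s) * expo (- n) s * of_real (q_e s))"
    by (subst integral_add) (auto intro!: coef_integrable integrable_on_mult_right assms)
  finally show ?thesis by (simp add: coef_def add_divide_distrib)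
qed

lemma periodic_continuous_attains:
  fixes h :: "real \<Rightarrow> real"
  assumes "L > 0" "continuous_on UNIV h" "\<And>s. h (s + L) = h s"
  shows "\<exists>s0. \<forall>s. h s0 \<le> h s" "\<exists>s0. \<forall>s. h s \<le> h s0"
proof -
  have red: "\<exists>t\<in>{0..L}. h s = h t" for s
  proof -
    obtain k where k: "s - of_int k * L \<in> {0<..L}" by (rule periodic_reduce[OF assms(1)])
    then show ?thesis using periodic_int[of h L "s - of_int k * L" k] assms(3) by (intro bexI[of _ "s - of_int k * L"]) auto
  qed
  have c: "continuous_on {0..L} h" by (rule continuous_on_subset[OF assms(2)]) simp
  have "\<exists>x\<in>{0..L}. \<forall>y\<in>{0..L}. h x \<le> h y" by (rule continuous_attains_inf[OF _ _ c]) (use assms in auto)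
  then show "\<exists>s0. \<forall>s. h s0 \<le> h s" using red by metis
  have "\<exists>x\<in>{0..L}. \<forall>y\<in>{0..L}. h y \<le> h x" by (rule continuous_attains_sup[OF _ _ c]) (use assms in auto)
  then show "\<exists>s0. \<forall>s. h s \<le> h s0" using red by metis
qed

theorem theorem3:
  fixes M :: "(real ^ 2) set" and \<gamma> :: "real \<Rightarrow> real ^ 2" and L :: real
    and q_e g :: "real \<Rightarrow> real"
  assumes "open M" and "connected M" and "M \<noteq> {}"
    and "bounded M" and "simply_connected M"
    and "arc_length_param \<gamma> L (frontier M)"
    and "L_periodic L q_e" and "smooth q_e" and "\<forall>s. q_e s > 0"
    and "L_periodic L g" and "smooth g"
  shows "\<exists>eps_star>0. \<exists>C>0. \<forall>\<epsilon>. 0 < \<epsilon> \<and> \<epsilon> < eps_star \<longrightarrow>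
    (let f = (\<lambda>s. q_e s + \<epsilon> * g s) in
      \<exists>\<omega>\<^sub>0 q.
        prandtl_solution L q_e f \<omega>\<^sub>0 q \<and>
        (\<forall>\<omega>' q'. prandtl_solution L q_e f \<omega>' q' \<longrightarrow>
           \<omega>' = \<omega>\<^sub>0 \<and> (\<forall>s. \<forall>\<psi>\<ge>0. q' (s, \<psi>) = q (s, \<psi>))) \<and>
        X_norm L 2 50 (Q_of q_e \<omega>\<^sub>0 q) \<le> C * \<epsilon> \<and>
        (\<exists>\<omega>_Err. \<omega>\<^sub>0\<^sup>2 = integral {0..L} (\<lambda>s. q_e s * (f s)\<^sup>2) / integral {0..L} (\<lambda>s. (q_e s) ^ 3) + \<omega>_Err
           \<and> \<bar>\<omega>_Err\<bar> \<le> C * \<epsilon>\<^sup>2))"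
    (is "\<exists>eps_star>0. \<exists>C>0. \<forall>\<epsilon>. _ \<longrightarrow> ?P C \<epsilon>")
proof -
  have L: "L > 0" using assms(6) by (simp add: arc_length_param_def)
  have qe: "smooth q_e" "\<And>s. q_e s > 0" "\<And>s. q_e (s + L) = q_e s" and g: "smooth g" "\<And>s. g (s + L) = g s"
    using assms(7-11) by (simp_all add: L_periodic_def)
  interpret boundary_speed L q_e by unfold_locales (use L qe in auto)
  have s_data: "smooth (\<lambda>s. (q_e s)\<^sup>2)" "smooth (\<lambda>s. (inverse (q_e s))\<^sup>2)" "smooth (\<lambda>s. 2 * (q_e s * g s))" "smooth (\<lambda>s. (g s)\<^sup>2)"
    unfolding power2_eq_square using qe(2) by (intro smooth_mult smooth_const smooth_inverse qe g; simp add: less_imp_neq[symmetric])+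
  obtain B1 where B1: "B1 \<ge> 0" "\<And>n. norm (coef (\<lambda>s. (q_e s)\<^sup>2) n) \<le> B1 / bracket n ^ 5"
    using coef_decay[OF s_data(1), of 5] by (auto simp: qe)
  obtain B2 where B2: "B2 \<ge> 0" "\<And>n. norm (coef (\<lambda>s. (inverse (q_e s))\<^sup>2) n) \<le> B2 / bracket n ^ 4"
    using coef_decay[OF s_data(2), of 4] by (auto simp: qe)
  obtain b1 where b1: "b1 \<ge> 0" "\<And>n. norm (coef (\<lambda>s. 2 * (q_e s * g s)) n) \<le> b1 / bracket n ^ 5"
    using coef_decay[OF s_data(3), of 5] by (auto simp: qe g)
  obtain b2 where b2: "b2 \<ge> 0" "\<And>n. norm (coef (\<lambda>s. (g s)\<^sup>2) n) \<le> b2 / bracket n ^ 5"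
    using coef_decay[OF s_data(4), of 5] by (auto simp: g)
  obtain Cd where Cd: "Cd \<ge> 1" "\<And>j n s. j \<le> 3 \<Longrightarrow> s \<in> {0..L} \<Longrightarrow> norm (dexpo j n s) \<le> Cd * bracket n ^ j"
    using dexpo_bound by blast
  interpret speed_modes L q_e "B1 + B2" Cd
  proof unfold_locales
    fix n
    have "B1 / bracket n ^ 5 \<le> (B1 + B2) / bracket n ^ 5" "B2 / bracket n ^ 4 \<le> (B1 + B2) / bracket n ^ 4"
      using B1(1) B2(1) bracket_pos[of n] by (intro divide_right_mono; simp)+
    then show "norm (coef (\<lambda>s. (q_e s)\<^sup>2) n) \<le> (B1 + B2) / bracket n ^ 5" "norm (coef (\<lambda>s. (inverse (q_e s))\<^sup>2) n) \<le> (B1 + B2) / bracket n ^ 4"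
      using B1(2)[of n] B2(2)[of n] by linarith+
  qed (use B1 B2 Cd in auto)
  define b0 where "b0 = b1 + b2"
  have b0: "b0 \<ge> 0" using b1 b2 by (simp add: b0_def)
  obtain J where J: "X_bound_const L rate 2 50 J" using X_space_of_exponential_decay[OF L rate_pos] by blast
  then have J0: "J \<ge> 0" by (simp add: X_bound_const_def)
  have g_cont: "continuous_on UNIV g" and qe_cont': "continuous_on UNIV q_e" by (intro smooth_continuous g qe)+
  obtain sa where sa: "\<And>s. q_e sa \<le> q_e s" using periodic_continuous_attains(1)[OF L qe_cont' qe(3)] by blast
  obtain sM where sM: "\<And>s. q_e s \<le> q_e sM" using periodic_continuous_attains(2)[OF L qe_cont' qe(3)] by blast
  obtain sg where sg: "\<And>s. \<bar>g s\<bar> \<le> \<bar>g sg\<bar>"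
    using periodic_continuous_attains(2)[OF L continuous_on_rabs[OF g_cont]] g(2) by auto
  \<comment> \<open>\<open>G\<close> bounds |f^2 - q_e^2| / \<epsilon> for \<epsilon> \<le>
    1.\<close>
  define a M G where "a = q_e sa" and "M = q_e sM" and "G = 2 * (q_e sM * \<bar>g sg\<bar>) + \<bar>g sg\<bar>\<^sup>2"
  have a: "a > 0" "\<And>s. a \<le> q_e s" "\<And>s. q_e s \<le> M" using qe(2) sa sM by (auto simp: a_def M_def)
  have G: "G \<ge> 0" using qe(2)[of sM] by (simp add: G_def)
  define A0 where "A0 = C_sum * (b0 + 1)"
  have A0: "A0 \<ge> 0" using C_nonneg sq_sum_nonneg Cd(1) b0 by (simp add: A0_def C_sum_def)
  define Ce where "Ce = C_err b0"
  let ?C = "A0 * J + \<bar>Ce\<bar> + 1"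
  have "\<forall>\<^sub>F \<epsilon> in at_right 0. 1 * \<epsilon> < 1 \<and> 64 * bracket_sum * (M_fix b0)\<^sup>2 * \<epsilon> < 1 \<and> C_om * (b0 + 1) * \<epsilon> < 1 / 2 \<and>
      M_fix b0 * sq_sum * \<epsilon> < 1 / 2 \<and> 4 * (G / a\<^sup>2) * M\<^sup>2 * \<epsilon> < a\<^sup>2 \<and> 2 * A0 * (2 + 12 * M\<^sup>2 / a\<^sup>2) * \<epsilon> < rate\<^sup>2 * a\<^sup>2"
    by (intro eventually_conj eventually_small) (use a rate_pos in auto)
  \<comment> \<open>In this order the conditions give \<epsilon>^2 \<le> \<epsilon>, the
    contraction, 1 + \<sigma> > 0 so that \<omega> exists, |\<rho>| \<le> 1/2 so that q > 0, the
    smallness of \<open>e\<close> in the a priori bounds, and the absorption condition of the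
    uniqueness argument with \<kappa> = A0 \<epsilon>.\<close>
  then obtain eps_star where eps: "eps_star > 0" "\<And>\<epsilon>. 0 < \<epsilon> \<Longrightarrow> \<epsilon> < eps_star \<Longrightarrow> 1 * \<epsilon> < 1 \<and> 64 * bracket_sum * (M_fix b0)\<^sup>2 * \<epsilon> < 1 \<and>
      C_om * (b0 + 1) * \<epsilon> < 1 / 2 \<and> M_fix b0 * sq_sum * \<epsilon> < 1 / 2 \<and> 4 * (G / a\<^sup>2) * M\<^sup>2 * \<epsilon> < a\<^sup>2 \<and> 2 * A0 * (2 + 12 * M\<^sup>2 / a\<^sup>2) * \<epsilon> < rate\<^sup>2 * a\<^sup>2"
    unfolding eventually_at_right_field by blast
  show ?thesis
  proof (rule exI[of _ eps_star], rule conjI[OF eps(1)], rule exI[of _ "?C"], intro conjI allI impI)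
    show "?C > 0" using A0 J0 by (simp add: add_nonneg_pos)
    fix \<epsilon> :: real assume "0 < \<epsilon> \<and> \<epsilon> < eps_star"
    then have \<epsilon>: "0 < \<epsilon>" "\<epsilon> < eps_star" by simp_all
    note small = eps(2)[OF \<epsilon>]
    define f where "f s = q_e s + \<epsilon> * g s" for s
    have f: "smooth f" "\<And>s. f (s + L) = f s" unfolding f_def by (intro smooth_add smooth_mult smooth_const qe g) (simp add: qe g)
    have f_sq: "(f s)\<^sup>2 - (q_e s)\<^sup>2 = \<epsilon> * (2 * (q_e s * g s)) + \<epsilon>\<^sup>2 * (g s)\<^sup>2" for s by (simp add: f_def power2_eq_square algebra_simps)
    have b: "norm (coef (\<lambda>s. (f s)\<^sup>2 - (q_e s)\<^sup>2) n) \<le> b0 * \<epsilon> / bracket n ^ 5" for n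
    proof -
      have e2: "\<epsilon>\<^sup>2 \<le> \<epsilon>" using small \<epsilon> by (simp add: power2_eq_square mult_left_le)
      have "norm (coef (\<lambda>s. (f s)\<^sup>2 - (q_e s)\<^sup>2) n) \<le> \<epsilon> * norm (coef (\<lambda>s. 2 * (q_e s * g s)) n) + \<epsilon>\<^sup>2 * norm (coef (\<lambda>s. (g s)\<^sup>2) n)"
        unfolding f_sq coef_linear[OF smooth_continuous[OF s_data(3)] smooth_continuous[OF s_data(4)]]
        using \<epsilon>(1) by (intro norm_triangle_le) (simp add: norm_mult norm_power)
      also have "\<dots> \<le> \<epsilon> * (b1 / bracket n ^ 5) + \<epsilon> * (b2 / bracket n ^ 5)" using e2 \<epsilon>(1) b1 b2 by (intro add_mono mult_mono) auto
      finally show ?thesis by (simp add: b0_def algebra_simps add_divide_distrib)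
    qed
    \<comment> \<open>The absolute perturbation G \<epsilon> relative to a^2, the minimum of
      q_e^2.\<close>
    define e where "e = G / a\<^sup>2 * \<epsilon>"
    have e: "\<bar>(f s)\<^sup>2 - (q_e s)\<^sup>2\<bar> \<le> e * (q_e s)\<^sup>2" "0 \<le> e" "4 * e * M\<^sup>2 \<le> a\<^sup>2" for s
    proof -
      have "\<bar>\<epsilon> * (2 * (q_e s * g s)) + \<epsilon>\<^sup>2 * (g s)\<^sup>2\<bar> \<le> \<epsilon> * (2 * (q_e sM * \<bar>g sg\<bar>)) + \<epsilon> * \<bar>g sg\<bar>\<^sup>2"
      proof (rule order_trans[OF abs_triangle_ineq add_mono])
        have "\<bar>q_e s * g s\<bar> \<le> q_e sM * \<bar>g sg\<bar>" using qe(2)[of s] sM[of s] sg[of s] by (simp add: abs_mult mult_mono)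
        then show "\<bar>\<epsilon> * (2 * (q_e s * g s))\<bar> \<le> \<epsilon> * (2 * (q_e sM * \<bar>g sg\<bar>))" using \<epsilon>(1) by (simp add: abs_mult)
        have "\<epsilon>\<^sup>2 \<le> \<epsilon>" using small \<epsilon> by (simp add: power2_eq_square mult_left_le)
        moreover have "(g s)\<^sup>2 \<le> \<bar>g sg\<bar>\<^sup>2" using sg[of s] by (simp add: abs_le_square_iff)
        ultimately show "\<bar>\<epsilon>\<^sup>2 * (g s)\<^sup>2\<bar> \<le> \<epsilon> * \<bar>g sg\<bar>\<^sup>2" using \<epsilon>(1) by (simp add: abs_mult mult_mono)
      qed
      then have "\<bar>(f s)\<^sup>2 - (q_e s)\<^sup>2\<bar> \<le> \<epsilon> * G" unfolding f_sq G_def by (simp add: algebra_simps)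
      also have "\<dots> = e * a\<^sup>2" using a(1) by (simp add: e_def)
      also have "\<dots> \<le> e * (q_e s)\<^sup>2" using a G \<epsilon>(1) by (intro mult_left_mono power_mono) (auto simp: e_def)
      finally show "\<bar>(f s)\<^sup>2 - (q_e s)\<^sup>2\<bar> \<le> e * (q_e s)\<^sup>2" .
      show "0 \<le> e" using G \<epsilon>(1) by (simp add: e_def)
      have "4 * (G / a\<^sup>2) * M\<^sup>2 * \<epsilon> \<le> a\<^sup>2" using small by simp
      then show "4 * e * M\<^sup>2 \<le> a\<^sup>2" by (simp add: e_def mult_ac)
    qed
    obtain \<omega> q h where sol: "prandtl_solution L q_e f \<omega> q" and X: "X_norm L 2 50 (Q_of q_e \<omega> q) \<le> A0 * \<epsilon> * J"
      and h: "has_weak_partial L 0 2 (Q_of q_e \<omega> q) h" "\<forall>x\<in>cylinder L. \<bar>h x\<bar> \<le> A0 * \<epsilon> * exp (- (rate * snd x))"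
      and err: "\<bar>\<omega>\<^sup>2 - integral {0..L} (\<lambda>s. q_e s * (f s)\<^sup>2) / integral {0..L} (\<lambda>s. (q_e s) ^ 3)\<bar> \<le> Ce * \<epsilon>\<^sup>2"
      using solution_exists[OF f b0 \<epsilon>(1) b _ _ _ J] small unfolding A0_def Ce_def by (auto simp: less_imp_le)
    have unique: "\<omega>' = \<omega> \<and> (\<forall>s. \<forall>\<psi>\<ge>0. q' (s, \<psi>) = q (s, \<psi>))" if sol': "prandtl_solution L q_e f \<omega>' q'" for \<omega>' q'
    proof -
      have att: "\<exists>s. q_e s = a" by (auto simp: a_def)
      note pert = prandtl_solution_perturbed[OF L qe_cont' qe(3) a(2,3,1) att e]
      obtain V where V: "perturbed_solution L (Q_of q_e \<omega> q) q V (cyl_ext L (weak_partial L 0 2 (Q_of q_e \<omega> q))) q_e f \<omega> a M e" by (rule pert[OF sol])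
      obtain V' where V': "perturbed_solution L (Q_of q_e \<omega>' q') q' V' (cyl_ext L (weak_partial L 0 2 (Q_of q_e \<omega>' q'))) q_e f \<omega>' a M e" by (rule pert[OF sol'])
      have H: "AE x in lborel. x \<in> cylinder L \<longrightarrow> \<bar>cyl_ext L (weak_partial L 0 2 (Q_of q_e \<omega> q)) x\<bar> \<le> A0 * \<epsilon> * exp (- (rate * snd x))"
        using weak_partial_AE_eq(2)[OF L h(1)] by eventually_elim (use h(2) in auto)
      have \<kappa>: "0 \<le> A0 * \<epsilon>" "2 * (A0 * \<epsilon>) * (2 + 12 * M\<^sup>2 / a\<^sup>2) < rate\<^sup>2 * a\<^sup>2" using A0 \<epsilon>(1) small by (simp_all add: mult_ac)
      \<comment> \<open>The constructed solution takes the second place, where exponential decay of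
        the second derivative is required; the competitor takes the first.\<close>
      show ?thesis using perturbed_solutions_unique[OF V' V rate_pos H \<kappa>] by blast
    qed
    have "A0 * \<epsilon> * J \<le> (?C) * \<epsilon>" using \<epsilon>(1) by (simp add: algebra_simps)
    moreover have "Ce * \<epsilon>\<^sup>2 \<le> (?C) * \<epsilon>\<^sup>2" using mult_nonneg_nonneg[OF A0 J0] abs_ge_self[of Ce] by (intro mult_right_mono) (linarith, simp)
    ultimately have fin: "X_norm L 2 50 (Q_of q_e \<omega> q) \<le> (?C) * \<epsilon>"
      "\<bar>\<omega>\<^sup>2 - integral {0..L} (\<lambda>s. q_e s * (f s)\<^sup>2) / integral {0..L} (\<lambda>s. (q_e s) ^ 3)\<bar> \<le> (?C) * \<epsilon>\<^sup>2" using X err by linarith+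
    have err': "\<exists>\<omega>_Err. \<omega>\<^sup>2 = integral {0..L} (\<lambda>s. q_e s * (f s)\<^sup>2) / integral {0..L} (\<lambda>s. (q_e s) ^ 3) + \<omega>_Err
        \<and> \<bar>\<omega>_Err\<bar> \<le> ?C * \<epsilon>\<^sup>2" by (rule exI, rule conjI[OF _ fin(2)]) simp
    have f_eq: "(\<lambda>s. q_e s + \<epsilon> * g s) = f" by (simp add: f_def fun_eq_iff)
    show "?P ?C \<epsilon>" unfolding Let_def f_eq by (rule exI[of _ \<omega>], rule exI[of _ q], intro conjI sol fin(1) err', intro allI impI, rule unique)
  qed
qed

end
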